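(* Let $n\ge1$ and $p\in(1,\infty)$, with $p'=\frac{p}{p-1}$. There is a constant $C$ depending only on $n$ and $p$ such that for all $f,\varphi\in C_c^\infty(\mathbb{R}^n)$, $$\big\|[(-\Delta)^{\frac12},\varphi](f)\big\|_{L^p(\mathbb{R}^n)}\le C\,[\varphi]_{C^{0,1}}\,\|f\|_{L^p(\mathbb{R}^n)};$$ equivalently, for all $f,g,\varphi\in C_c^\infty(\mathbb{R}^n)$, $$\int_{\mathbb{R}^n}\big(f\,(-\Delta)^{\frac12}g-(-\Delta)^{\frac12}f\;g\big)\,\varphi\,dx\le C\,[\varphi]_{C^{0,1}}\,\|f\|_{L^p(\mathbb{R}^n)}\,\|g\|_{L^{p'}(\mathbb{R}^n)}.$$
   Context: All functions are real-valued. $(-\Delta)^{\frac12}$ is the half-Laplacian (Fourier multiplier $|\xi|$, up to normalization). The commutator is $[(-\Delta)^{\frac12},\varphi](f)=(-\Delta)^{\frac12}(\varphi f)-\varphi\,(-\Delta)^{\frac12}f$. $[\varphi]_{C^{0,1}}=\sup_{x\ne y}\frac{|\varphi(x)-\varphi(y)|}{|x-y|}$ is the Lipschitz seminorm. *)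

theory Defs
  imports "HOL-Analysis.Analysis"
begin

text \<open>\<open>k\<close> times continuously differentiable on the whole space: all iterated directional
  derivatives of order at most \<open>k\<close> exist (as Frechet derivatives) and are continuous.\<close>

fun C_diff :: "nat \<Rightarrow> ('a::euclidean_space \<Rightarrow> real) \<Rightarrow> bool" where
  "C_diff 0 f \<longleftrightarrow> continuous_on UNIV f"
| "C_diff (Suc k) f \<longleftrightarrow>
     (\<forall>x. f differentiable (at x)) \<and> (\<forall>v. C_diff k (\<lambda>x. frechet_derivative f (at x) v))"

definition test_function :: "('a::euclidean_space \<Rightarrow> real) \<Rightarrow> bool" where
  "test_function f \<longleftrightarrow> (\<forall>k. C_diff k f) \<and> compact (closure {x. f x \<noteq> 0})"

definition fourier :: "('a::euclidean_space \<Rightarrow> real) \<Rightarrow> 'a \<Rightarrow> complex" where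
  "fourier f \<xi> = (LINT x|lborel. complex_of_real (f x) * cis (- (x \<bullet> \<xi>)))"

text \<open>The Fourier multiplier with symbol \<open>norm \<xi>\<close>, in the normalisation of \<^const>\<open>fourier\<close>, whose
  inverse carries the factor \<open>1 / (2 * pi) ^ n\<close>. For a real-valued test function the Fourier
  inversion integral converges absolutely and its value is real, so \<^const>\<open>Re\<close> only adjusts the
  type.\<close>

definition half_laplacian :: "('a::euclidean_space \<Rightarrow> real) \<Rightarrow> 'a \<Rightarrow> real" where
  "half_laplacian f x =
     Re (LINT \<xi>|lborel. complex_of_real (norm \<xi>) * fourier f \<xi> * cis (x \<bullet> \<xi>)) / (2 * pi) ^ DIM('a)"

definition half_laplacian_commutator ::
    "('a::euclidean_space \<Rightarrow> real) \<Rightarrow> ('a \<Rightarrow> real) \<Rightarrow> 'a \<Rightarrow> real" where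
  "half_laplacian_commutator \<phi> f x =
     half_laplacian (\<lambda>y. \<phi> y * f y) x - \<phi> x * half_laplacian f x"

text \<open>The supremum is taken in the reals, so it is meaningful only for Lipschitz functions; test
  functions are Lipschitz.\<close>

definition lipschitz_seminorm :: "('a::euclidean_space \<Rightarrow> real) \<Rightarrow> real" where
  "lipschitz_seminorm \<phi> = (SUP (x, y)\<in>{(x, y). x \<noteq> y}. \<bar>\<phi> x - \<phi> y\<bar> / dist x y)"

definition in_Lp :: "real \<Rightarrow> ('a::euclidean_space \<Rightarrow> real) \<Rightarrow> bool" where
  "in_Lp p f \<longleftrightarrow> f \<in> borel_measurable lborel \<and> integrable lborel (\<lambda>x. \<bar>f x\<bar> powr p)"

text \<open>Because of the default value of the Bochner integral, \<open>Lp_norm p f\<close> is \<open>0\<close> rather than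
  infinite when the integral diverges; a norm bound is therefore to be read together with
  \<^const>\<open>in_Lp\<close>.\<close>

definition Lp_norm :: "real \<Rightarrow> ('a::euclidean_space \<Rightarrow> real) \<Rightarrow> real" where
  "Lp_norm p f = (LINT x|lborel. \<bar>f x\<bar> powr p) powr (1 / p)"

end

theory Submission
  imports Defs "HOL-Probability.Probability"
begin

text \<open>The form \<open>\<integral> (f \<Lambda>g - g \<Lambda>f) \<psi>\<close>, \<open>\<Lambda>\<close> the half-Laplacian, is studied through the Poisson
  extensions \<open>F\<close>, \<open>G\<close>, \<open>\<Psi>\<close> of \<open>f\<close>, \<open>g\<close>, \<open>\<psi>\<close> to the upper half-space. By subordination the Poisson
  kernel has Fourier transform \<open>exp (- t * norm \<xi>)\<close>, so \<open>\<partial>\<^sub>t F\<close> tends to a multiple of \<open>- \<Lambda>f\<close> as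
  \<open>t \<rightarrow> 0\<close>. Put \<open>V = F \<nabla>G - G \<nabla>F\<close>, which is divergence free, and \<open>b(t) = \<integral> V\<^sub>t \<Psi> dx\<close>; the form is a
  multiple of \<open>b(0)\<close>. Since \<open>b' = \<integral> V \<cdot> \<nabla>\<Psi> dx\<close> and \<open>\<Psi>\<close> is harmonic, \<open>b''\<close> is the integral of a
  density in which every term contains two first derivatives, among those of \<open>F\<close>, \<open>G\<close> and the \<open>H\<^sub>i\<close>,
  where \<open>H\<^sub>i = \<partial>\<^sub>i \<Psi>\<close> is the Poisson extension of \<open>\<partial>\<^sub>i \<psi>\<close> and hence bounded by the Lipschitz constant
  of \<open>\<psi>\<close>. Integrating twice by parts in \<open>t\<close> expresses \<open>b(0)\<close> as the integral of \<open>t\<close> times this density.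

  The density is controlled with a Bellman function. Let \<open>q \<le> 2\<close> be the exponent of \<open>g\<close>. If
  \<open>0 \<le> f \<le> g powr (q - 1)\<close>, then by Jensen \<open>F \<le> G powr (q - 1)\<close>, and for a large constant \<open>K\<close> the Laplacian
  of \<open>G\<^sup>q (K + H\<^sub>i\<^sup>2) + F\<^sup>2 G\<^bsup>2 - q\<^esup>\<close> dominates \<open>G\<^bsup>q - 2\<^esup> |\<nabla>G|\<^sup>2 + G\<^sup>q |\<nabla>H\<^sub>i|\<^sup>2 + G\<^bsup>2 - q\<^esup> |\<nabla>F|\<^sup>2\<close>, which
  dominates the density. By Green's formula the integral of \<open>t\<close> times this Laplacian is at most a constant
  times \<open>\<integral> g\<^sup>q\<close>. Arbitrary \<open>f\<close>, \<open>g\<close> reduce to this case by trilinearity, the exponent is unrestricted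
  because the form is antisymmetric in \<open>f\<close> and \<open>g\<close>, and the norm estimate follows by duality and the
  self-adjointness of \<open>\<Lambda>\<close>.\<close>

subsection \<open>Integration over slices and strips\<close>

text \<open>Square functions and maximal functions are replaced by pointwise calculus and a Green
  formula. Two obstacles shape the details. The positive data to which the Bellman function is
  applied are built from absolute values and powers, hence merely continuous, and derivatives of
  their extensions may blow up at the boundary. All integrations therefore run over strips
  \<epsilon> \<le> t \<le> T with the weight t - \<epsilon>, which vanishes at the lower end; the
  bounds do not depend on \<epsilon> and T, the terms at height T decay, and only the original test
  functions are followed down to t = 0. The Bellman function is shaped by scaling. Under F \<le>
  G^(q-1) the product F G and the term F^2 G^(2-q) are both at most G^q. Dividing out G^q turns
  everything into polynomials in F / G^(q-1), H and normalised derivatives of size O(1/t), and the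
  required inequality becomes the positivity of one quadratic form, in which a large K absorbs the
  mixed terms. The bound obtained is additive, a sum of p-th and p'-th power integrals; rescaling
  makes it a product of norms.\<close>

lemma lborel_integral_affine:
  fixes f :: "'a::euclidean_space \<Rightarrow> 'b::{banach, second_countable_topology}"
  assumes c: "c \<noteq> 0" and f [measurable]: "f \<in> borel_measurable borel"
  shows "integrable lborel (\<lambda>x. f (a + c *\<^sub>R x)) \<longleftrightarrow> integrable lborel f"
    and "(LINT x|lborel. f x) = \<bar>c\<bar> ^ DIM('a) *\<^sub>R (LINT x|lborel. f (a + c *\<^sub>R x))"
proof -
  have E: "lborel = density (distr lborel borel (\<lambda>x. a + c *\<^sub>R x)) (\<lambda>x::'a. ennreal (\<bar>c\<bar> ^ DIM('a)))"
    by (rule lborel_affine[OF c])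
  have "integrable lborel f \<longleftrightarrow> integrable (density (distr lborel borel (\<lambda>x. a + c *\<^sub>R x)) (\<lambda>x::'a. ennreal (\<bar>c\<bar> ^ DIM('a)))) f"
    using E by simp
  also have "\<dots> \<longleftrightarrow> integrable lborel (\<lambda>x. f (a + c *\<^sub>R x))"
    using c integrable_scaleR_right[of "\<bar>c\<bar> ^ DIM('a)" lborel "\<lambda>x. f (a + c *\<^sub>R x)"]
      integrable_scaleR_right[of "inverse (\<bar>c\<bar> ^ DIM('a))" lborel "\<lambda>x. (\<bar>c\<bar> ^ DIM('a)) *\<^sub>R f (a + c *\<^sub>R x)"]
    by (auto simp add: integrable_density integrable_distr_eq)
  finally show "integrable lborel (\<lambda>x. f (a + c *\<^sub>R x)) \<longleftrightarrow> integrable lborel f" by simp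
  have "(LINT x|lborel. f x) = (LINT x|density (distr lborel borel (\<lambda>x. a + c *\<^sub>R x)) (\<lambda>x::'a. ennreal (\<bar>c\<bar> ^ DIM('a))). f x)"
    using E by simp
  also have "\<dots> = \<bar>c\<bar> ^ DIM('a) *\<^sub>R (LINT x|lborel. f (a + c *\<^sub>R x))"
    by (simp add: integral_density integral_distr)
  finally show "(LINT x|lborel. f x) = \<bar>c\<bar> ^ DIM('a) *\<^sub>R (LINT x|lborel. f (a + c *\<^sub>R x))" .
qed

lemma lborel_integral_translate:
  fixes f :: "'a::euclidean_space \<Rightarrow> 'b::{banach, second_countable_topology}"
  assumes "f \<in> borel_measurable borel"
  shows "integrable lborel (\<lambda>x. f (x + a)) \<longleftrightarrow> integrable lborel f"
    and "(LINT x|lborel. f (x + a)) = (LINT x|lborel. f x)"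
  using lborel_integral_affine[of 1 f a] assms by (simp_all add: add.commute)

lemma lborel_integral_reflect:
  fixes f :: "'a::euclidean_space \<Rightarrow> 'b::{banach, second_countable_topology}"
  assumes "f \<in> borel_measurable borel"
  shows "integrable lborel (\<lambda>x. f (a - x)) \<longleftrightarrow> integrable lborel f"
    and "(LINT x|lborel. f (a - x)) = (LINT x|lborel. f x)"
  using lborel_integral_affine[of "-1" f a] assms by simp_all

text \<open>Derivatives along lines are stated throughout at parameter 0 with a free base point.
  Calculus on an interval needs them at every parameter, which is the same statement at a shifted
  base point.\<close>

lemma DERIV_line_shift:
  fixes u :: "'a::real_normed_vector \<Rightarrow> real"
  assumes "((\<lambda>s. u (x + r *\<^sub>R v + s *\<^sub>R v)) has_real_derivative D) (at 0)"
  shows "((\<lambda>s. u (x + s *\<^sub>R v)) has_real_derivative D) (at r)"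
  using DERIV_shift[of "\<lambda>s. u (x + s *\<^sub>R v)" D 0 r] assms
  by (simp add: algebra_simps)

text \<open>By translation invariance the integral of u (x + v) - u x vanishes. The fundamental
  theorem and Fubini turn it into an average over the segment of integrals of translates of
  \<open>u'\<close>, all of which have the same value. Integrability of \<open>u\<close> and
  \<open>u'\<close> thus takes the place of decay or compact support in the integrations by parts
  over space.\<close>

lemma integral_line_derivative_eq_0:
  fixes u u' :: "'a::euclidean_space \<Rightarrow> real"
  assumes d: "\<And>x. ((\<lambda>s. u (x + s *\<^sub>R v)) has_real_derivative u' x) (at 0)"
    and c: "continuous_on UNIV u'" and iu: "integrable lborel u" and iu': "integrable lborel u'"
  shows "integral\<^sup>L lborel u' = 0"
proof -
  have [measurable]: "u' \<in> borel_measurable borel" "u \<in> borel_measurable borel"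
    using iu iu' by auto
  have D: "((\<lambda>s. u (x + s *\<^sub>R v)) has_real_derivative u' (x + r *\<^sub>R v)) (at r)" for x r
    by (rule DERIV_line_shift) (rule d)
  have ic: "isCont (\<lambda>s. u' (x + s *\<^sub>R v)) r" for x r
    by (intro continuous_at_compose[of r "\<lambda>s. x + s *\<^sub>R v" u', unfolded o_def] continuous_intros)
       (use c in \<open>simp add: continuous_on_eq_continuous_at\<close>)
  have F: "(LINT s|lborel. u' (x + s *\<^sub>R v) * indicator {0..1} s) = u (x + v) - u x" for x
    using integral_FTC_Icc_real[of 0 1 "\<lambda>s. u (x + s *\<^sub>R v)" "\<lambda>s. u' (x + s *\<^sub>R v)"] D ic by simp
  have I: "integrable (lborel \<Otimes>\<^sub>M lborel) (\<lambda>(s::real, x). u' (x + s *\<^sub>R v) * indicator {0..1} s)"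
  proof (rule lborel_pair.Fubini_integrable)
    show "(\<lambda>(s::real, x). u' (x + s *\<^sub>R v) * indicator {0..1} s) \<in> borel_measurable (lborel \<Otimes>\<^sub>M lborel)"
      by measurable
    have "(LINT x|lborel. norm (case (s::real, x) of (s, x) \<Rightarrow> u' (x + s *\<^sub>R v) * indicator {0..1} s)) =
       (LINT x|lborel. \<bar>u' x\<bar>) * indicator {0..1} s" for s
    proof -
      have "(LINT x|lborel. norm (case (s::real, x) of (s, x) \<Rightarrow> u' (x + s *\<^sub>R v) * indicator {0..1} s))
         = (LINT x|lborel. \<bar>u' (x + s *\<^sub>R v)\<bar> * indicator {0..1} s)"
        by (simp add: abs_mult)
      also have "\<dots> = (LINT x|lborel. \<bar>u' (x + s *\<^sub>R v)\<bar>) * indicator {0..1} s" by simp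
      finally show ?thesis using lborel_integral_translate(2)[of "\<lambda>x. \<bar>u' x\<bar>" "s *\<^sub>R v"] by simp
    qed
    thus "integrable lborel (\<lambda>s::real. LINT x|lborel. norm (case (s, x) of (s, x) \<Rightarrow> u' (x + s *\<^sub>R v) * indicator {0..1} s))"
      by (simp add: integrable_mult_right)
    show "AE s in lborel. integrable lborel (\<lambda>x. case (s::real, x) of (s, x) \<Rightarrow> u' (x + s *\<^sub>R v) * indicator {0..1} s)"
      using lborel_integral_translate(1)[of u'] iu' by simp
  qed
  have "0 = (LINT x|lborel. u (x + v) - u x)"
    using lborel_integral_translate[of u v] iu by simp
  also have "\<dots> = (LINT x|lborel. LINT s|lborel. u' (x + s *\<^sub>R v) * indicator {0..1} s)"
    by (simp add: F)
  also have "\<dots> = (LINT s|lborel. LINT x|lborel. u' (x + s *\<^sub>R v) * indicator {0..1} s)"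
    by (rule lborel_pair.Fubini_integral[OF I])
  also have "\<dots> = (LINT s|lborel. (LINT x|lborel. u' x) * indicator {0..1::real} s)"
    using lborel_integral_translate(2)[of u'] by simp
  also have "\<dots> = (LINT x|lborel. u' x)" by simp
  finally show ?thesis by simp
qed

lemma DERIV_line_fst:
  fixes Y :: "'a::real_normed_vector \<times> real \<Rightarrow> real"
  assumes "((\<lambda>s. Y ((x, r) + s *\<^sub>R (0, 1))) has_real_derivative D) (at 0)"
  shows "((\<lambda>t. Y (x, t)) has_real_derivative D) (at r)"
  using DERIV_shift[of "\<lambda>t. Y (x, t)" D 0 r] assms by (simp add: add.commute)

text \<open>The majorant depends on \<open>x\<close> alone and the strip has finite height, so it is
  integrable over the whole strip. Since \<open>0 < \<epsilon>\<close>, the strip is a closed set on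
  which \<open>Z\<close> is continuous, which gives joint measurability.\<close>

lemma strip_integrable:
  fixes Z :: "'a::euclidean_space \<times> real \<Rightarrow> real"
  assumes e: "0 < \<epsilon>" and c: "continuous_on {z. 0 < snd z} Z"
    and M: "integrable lborel M" "\<And>x t. \<epsilon> \<le> t \<Longrightarrow> t \<le> T \<Longrightarrow> \<bar>Z (x, t)\<bar> \<le> M x"
  shows "integrable lborel (\<lambda>t. (LINT x|lborel. Z (x, t)) * indicator {\<epsilon>..T} t)"
    and "\<And>t. \<epsilon> \<le> t \<Longrightarrow> t \<le> T \<Longrightarrow> integrable lborel (\<lambda>x. Z (x, t))"
    and "integrable (lborel \<Otimes>\<^sub>M lborel) (\<lambda>(t, x). Z (x, t) * indicator {\<epsilon>..T} t)"
proof -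
  have [measurable]: "M \<in> borel_measurable borel" using M by auto
  have m: "(\<lambda>z. indicator (UNIV \<times> {\<epsilon>..T}) z *\<^sub>R Z z) \<in> borel_measurable borel"
    by (rule borel_measurable_continuous_on_indicator)
      (use e in \<open>auto intro!: borel_closed closed_Times continuous_on_subset[OF c]\<close>)
  have m': "(\<lambda>(t, x). Z (x, t) * indicator {\<epsilon>..T} t) \<in> borel_measurable (lborel \<Otimes>\<^sub>M lborel)"
  proof -
    have "(\<lambda>p. (snd p, fst p)) \<in> (borel \<Otimes>\<^sub>M borel) \<rightarrow>\<^sub>M (borel :: ('a \<times> real) measure)"
      unfolding borel_prod[symmetric] by measurable
    from measurable_compose[OF this m]
    have "(\<lambda>(t, x). Z (x, t) * indicator {\<epsilon>..T} t) \<in> borel_measurable (borel \<Otimes>\<^sub>M borel)"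
      by (simp add: split_beta' indicator_times mult.commute)
    thus ?thesis
      unfolding measurable_cong_sets[OF sets_pair_measure_cong[OF sets_lborel sets_lborel] refl] .
  qed
  show "integrable lborel (\<lambda>x. Z (x, t))" if t: "\<epsilon> \<le> t" "t \<le> T" for t
  proof (rule Bochner_Integration.integrable_bound[OF M(1)])
    have "continuous_on UNIV (\<lambda>x. Z (x, t))"
      by (rule continuous_on_compose2[OF c]) (use t e in \<open>auto intro!: continuous_intros\<close>)
    thus "(\<lambda>x. Z (x, t)) \<in> borel_measurable lborel"
      by (simp add: borel_measurable_continuous_onI)
    show "AE x in lborel. norm (Z (x, t)) \<le> norm (M x)"
      using M(2)[OF t] by (auto intro: order_trans[OF _ abs_ge_self])
  qed
  show I: "integrable (lborel \<Otimes>\<^sub>M lborel) (\<lambda>(t, x). Z (x, t) * indicator {\<epsilon>..T} t)"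
  proof (rule Bochner_Integration.integrable_bound[OF _ m'])
    show "integrable (lborel \<Otimes>\<^sub>M lborel) (\<lambda>(t::real, x). M x * indicator {\<epsilon>..T} t)"
    proof (rule lborel_pair.Fubini_integrable)
      show "integrable lborel (\<lambda>t::real. LINT x|lborel. norm (case (t, x) of (t, x) \<Rightarrow> M x * indicator {\<epsilon>..T} t))"
        by (cases "\<epsilon> \<le> T") (simp_all add: abs_mult integrable_mult_right)
      show "AE t in lborel. integrable lborel (\<lambda>x. case (t::real, x) of (t, x) \<Rightarrow> M x * indicator {\<epsilon>..T} t)"
        using M(1) by simp
    qed measurable
    have "\<bar>Z (x, t) * indicator {\<epsilon>..T} t\<bar> \<le> \<bar>M x * indicator {\<epsilon>..T} t\<bar>" for x t
      using M(2)[of t x] by (auto simp: indicator_def)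
    thus "AE p in lborel \<Otimes>\<^sub>M lborel. norm (case p of (t, x) \<Rightarrow> Z (x, t) * indicator {\<epsilon>..T} t)
        \<le> norm (case p of (t, x) \<Rightarrow> M x * indicator {\<epsilon>..T} t)"
      by (auto simp: split_beta)
  qed
  from lborel_pair.integrable_fst[OF I]
  show "integrable lborel (\<lambda>t. (LINT x|lborel. Z (x, t)) * indicator {\<epsilon>..T} t)" by simp
qed

text \<open>The fundamental theorem in \<open>t\<close> is applied for fixed \<open>x\<close> and
  then integrated over \<open>x\<close>; the majorant of \<open>Y'\<close> justifies the exchange.
  In this integrated form the slice integrals never have to be differentiated in
  \<open>t\<close>.\<close>

lemma strip_integral:
  fixes Y Y' :: "'a::euclidean_space \<times> real \<Rightarrow> real"
  assumes eT: "0 < \<epsilon>" "\<epsilon> \<le> T"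
    and d: "\<And>z. 0 < snd z \<Longrightarrow> ((\<lambda>s. Y (z + s *\<^sub>R (0, 1))) has_real_derivative Y' z) (at 0)"
    and c: "continuous_on {z. 0 < snd z} Y" "continuous_on {z. 0 < snd z} Y'"
    and M: "integrable lborel M"
      "\<And>x t. \<epsilon> \<le> t \<Longrightarrow> t \<le> T \<Longrightarrow> \<bar>Y (x, t)\<bar> \<le> M x"
      "\<And>x t. \<epsilon> \<le> t \<Longrightarrow> t \<le> T \<Longrightarrow> \<bar>Y' (x, t)\<bar> \<le> M x"
  shows "integrable lborel (\<lambda>t. (LINT x|lborel. Y' (x, t)) * indicator {\<epsilon>..T} t)"
    and "(LINT t|lborel. (LINT x|lborel. Y' (x, t)) * indicator {\<epsilon>..T} t)
       = (LINT x|lborel. Y (x, T)) - (LINT x|lborel. Y (x, \<epsilon>))"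
    and "\<And>t. \<epsilon> \<le> t \<Longrightarrow> t \<le> T \<Longrightarrow> integrable lborel (\<lambda>x. Y (x, t))"
    and "\<And>t. \<epsilon> \<le> t \<Longrightarrow> t \<le> T \<Longrightarrow> integrable lborel (\<lambda>x. Y' (x, t))"
proof -
  note s = strip_integrable[OF eT(1) c(2) M(1,3)]
  show "integrable lborel (\<lambda>t. (LINT x|lborel. Y' (x, t)) * indicator {\<epsilon>..T} t)"
    by (rule s(1))
  show "\<And>t. \<epsilon> \<le> t \<Longrightarrow> t \<le> T \<Longrightarrow> integrable lborel (\<lambda>x. Y' (x, t))"
    by (rule s(2))
  show sY: "\<And>t. \<epsilon> \<le> t \<Longrightarrow> t \<le> T \<Longrightarrow> integrable lborel (\<lambda>x. Y (x, t))"
    by (rule strip_integrable(2)[OF eT(1) c(1) M(1,2)])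
  have I: "integrable (lborel \<Otimes>\<^sub>M lborel) (\<lambda>(t, x). Y' (x, t) * indicator {\<epsilon>..T} t)"
    by (rule s(3))
  have F: "(LINT t|lborel. Y' (x, t) * indicator {\<epsilon>..T} t) = Y (x, T) - Y (x, \<epsilon>)" for x
  proof (rule integral_FTC_Icc_real[OF eT(2)])
    fix t assume t: "\<epsilon> \<le> t" "t \<le> T"
    show "((\<lambda>t. Y (x, t)) has_real_derivative Y' (x, t)) (at t)"
      by (rule DERIV_line_fst, rule d) (use t eT in auto)
    have "open {z::'a\<times>real. 0 < snd z}"
      by (rule open_Collect_less) (auto intro: continuous_intros)
    hence "isCont Y' (x, t)" using c(2) t eT by (simp add: continuous_on_eq_continuous_at)
    thus "isCont (\<lambda>t. Y' (x, t)) t"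
      by (intro continuous_at_compose[of t "\<lambda>t. (x, t)" Y', unfolded o_def] continuous_intros)
  qed
  have "(LINT t|lborel. (LINT x|lborel. Y' (x, t)) * indicator {\<epsilon>..T} t)
     = (LINT t|lborel. (LINT x|lborel. Y' (x, t) * indicator {\<epsilon>..T} t))" by simp
  also have "\<dots> = (LINT x|lborel. (LINT t|lborel. Y' (x, t) * indicator {\<epsilon>..T} t))"
    by (rule lborel_pair.Fubini_integral[OF I, symmetric])
  also have "\<dots> = (LINT x|lborel. Y (x, T)) - (LINT x|lborel. Y (x, \<epsilon>))"
    unfolding F using eT by (intro Bochner_Integration.integral_diff sY) auto
  finally show "(LINT t|lborel. (LINT x|lborel. Y' (x, t)) * indicator {\<epsilon>..T} t)
       = (LINT x|lborel. Y (x, T)) - (LINT x|lborel. Y (x, \<epsilon>))" .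
qed

lemma lborel_integral_prod_Basis:
  fixes f :: "'a::euclidean_space \<Rightarrow> real \<Rightarrow> complex"
  assumes i: "\<And>b. b \<in> Basis \<Longrightarrow> integrable lborel (f b)"
  shows "integrable lborel (\<lambda>x. (\<Prod>b\<in>Basis. f b (x \<bullet> b)))"
    and "(LINT x|lborel. (\<Prod>b\<in>Basis. f b (x \<bullet> b))) = (\<Prod>b\<in>Basis. integral\<^sup>L lborel (f b))"
proof -
  interpret product_sigma_finite "\<lambda>b::'a. lborel :: real measure" by standard
  have [measurable]: "f b \<in> borel_measurable borel" if "b \<in> Basis" for b using i[OF that] by auto
  have sel: "(\<Prod>b\<in>Basis. f b ((\<Sum>c\<in>Basis. y c *\<^sub>R c) \<bullet> b)) = (\<Prod>b\<in>Basis. f b (y b))" for y :: "'a \<Rightarrow> real"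
    by (intro prod.cong refl) (simp add: inner_sum_left inner_Basis if_distrib sum.If_cases cong: if_cong)
  have "integrable (Pi\<^sub>M Basis (\<lambda>b. lborel)) (\<lambda>x. \<Prod>b\<in>Basis. f b (x b))"
    by (rule product_integrable_prod) (use i in auto)
  thus "integrable lborel (\<lambda>x. (\<Prod>b\<in>Basis. f b (x \<bullet> b)))"
    by (subst lborel_eq, subst integrable_distr_eq) (auto simp: sel)
  have "(LINT x|lborel. (\<Prod>b\<in>Basis. f b (x \<bullet> b))) = (LINT x|Pi\<^sub>M Basis (\<lambda>b. lborel). (\<Prod>b\<in>Basis. f b (x b)))"
    by (subst lborel_eq, subst integral_distr) (auto simp: sel)
  also have "\<dots> = (\<Prod>b\<in>Basis. integral\<^sup>L lborel (f b))"
    by (rule product_integral_prod) (use i in auto)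
  finally show "(LINT x|lborel. (\<Prod>b\<in>Basis. f b (x \<bullet> b))) = (\<Prod>b\<in>Basis. integral\<^sup>L lborel (f b))" .
qed

subsection \<open>Fourier transforms of Gaussians and subordination\<close>

text \<open>A rescaled characteristic function of the standard normal distribution: c = sqrt (2 s)
  turns exp (- (c x)^2 / 2) into exp (- s x^2).\<close>

lemma gaussian_fourier_real:
  fixes \<xi> s :: real
  assumes s: "0 < s"
  shows "integrable lborel (\<lambda>x. complex_of_real (exp (- s * x\<^sup>2)) * cis (x * \<xi>))"
    and "(LINT x|lborel. complex_of_real (exp (- s * x\<^sup>2)) * cis (x * \<xi>))
       = complex_of_real (sqrt (pi / s) * exp (- (\<xi>\<^sup>2) / (4 * s)))"
proof -
  define c where "c = sqrt (2 * s)"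
  have c: "0 < c" "c * c = 2 * s" using s by (auto simp: c_def)
  define t where "t = \<xi> / c"
  define g where "g = (\<lambda>x. complex_of_real (std_normal_density x) * cis (t * x))"
  have gm [measurable]: "g \<in> borel_measurable borel"
    unfolding g_def cis_conv_exp by measurable
  have gi: "integrable lborel g"
    by (rule Bochner_Integration.integrable_bound[OF integrable_normal_density[where \<mu>=0 and \<sigma>=1]])
       (auto simp: g_def norm_mult cis_conv_exp)
  have "complex_of_real (exp (- t\<^sup>2 / 2)) = char std_normal_distribution t"
    by (simp add: char_std_normal_distribution)
  also have "\<dots> = (LINT x|lborel. g x)"
    unfolding char_def
    by (subst integral_density) (auto simp: g_def scaleR_conv_of_real cis_conv_exp mult_ac)
  finally have G: "(LINT x|lborel. g x) = complex_of_real (exp (- t\<^sup>2 / 2))" ..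
  have gc: "g (0 + c * x) = complex_of_real (1 / sqrt (2 * pi)) * (complex_of_real (exp (- s * x\<^sup>2)) * cis (x * \<xi>))" for x
  proof -
    have "- (c * x)\<^sup>2 / 2 = - s * x\<^sup>2" using c by (simp add: power2_eq_square algebra_simps)
    moreover have "t * (c * x) = x * \<xi>" using c by (simp add: t_def)
    ultimately show ?thesis unfolding g_def std_normal_density_def by (simp only: add_0 of_real_mult mult.assoc)
  qed
  have "integrable lborel (\<lambda>x. g (0 + c * x))"
    using lborel_integrable_real_affine[OF gi, of c 0] c by simp
  hence "integrable lborel (\<lambda>x. complex_of_real (sqrt (2 * pi)) * g (0 + c * x))"
    by (rule integrable_mult_right)
  moreover have "complex_of_real (sqrt (2 * pi)) * g (0 + c * x) = complex_of_real (exp (- s * x\<^sup>2)) * cis (x * \<xi>)" for x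
    unfolding gc by simp
  ultimately show I: "integrable lborel (\<lambda>x. complex_of_real (exp (- s * x\<^sup>2)) * cis (x * \<xi>))" by simp
  have "complex_of_real (exp (- t\<^sup>2 / 2)) = c *\<^sub>R (LINT x|lborel. g (0 + c * x))"
    using G lborel_integral_real_affine[of c g 0] c by simp
  also have "\<dots> = complex_of_real (c / sqrt (2 * pi)) * (LINT x|lborel. complex_of_real (exp (- s * x\<^sup>2)) * cis (x * \<xi>))"
    unfolding gc by (simp add: scaleR_conv_of_real)
  finally have A: "complex_of_real (sqrt (2 * pi) / c) * complex_of_real (exp (- t\<^sup>2 / 2))
     = complex_of_real (sqrt (2 * pi) / c) * complex_of_real (c / sqrt (2 * pi)) * (LINT x|lborel. complex_of_real (exp (- s * x\<^sup>2)) * cis (x * \<xi>))"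
    by (simp only: mult.assoc)
  have B: "complex_of_real (sqrt (2 * pi) / c) * complex_of_real (c / sqrt (2 * pi)) = 1"
    using c by simp
  have C: "sqrt (2 * pi) / c = sqrt (pi / s)"
    unfolding c_def using s by (simp add: real_sqrt_divide[symmetric] real_sqrt_mult)
  have D: "- t\<^sup>2 / 2 = - (\<xi>\<^sup>2) / (4 * s)"
    using c s by (simp add: t_def power2_eq_square field_simps)
  show "(LINT x|lborel. complex_of_real (exp (- s * x\<^sup>2)) * cis (x * \<xi>))
       = complex_of_real (sqrt (pi / s) * exp (- (\<xi>\<^sup>2) / (4 * s)))"
    using A[unfolded B mult_1_left, unfolded C D] by (simp only: of_real_mult)
qed

lemma gaussian_fourier:
  fixes \<xi> :: "'a::euclidean_space"
  assumes s: "0 < s"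
  shows "integrable lborel (\<lambda>x. complex_of_real (exp (- s * (x \<bullet> x))) * cis (x \<bullet> \<xi>))"
    and "(LINT x|lborel. complex_of_real (exp (- s * (x \<bullet> x))) * cis (x \<bullet> \<xi>))
       = complex_of_real ((pi / s) powr (real DIM('a) / 2) * exp (- (\<xi> \<bullet> \<xi>) / (4 * s)))"
proof -
  define f where "f = (\<lambda>b::'a. \<lambda>x. complex_of_real (exp (- s * x\<^sup>2)) * cis (x * (\<xi> \<bullet> b)))"
  have P: "complex_of_real (exp (- s * (x \<bullet> x))) * cis (x \<bullet> \<xi>) = (\<Prod>b\<in>Basis. f b (x \<bullet> b))" for x :: 'a
  proof -
    have "complex_of_real (exp (- s * (x \<bullet> x))) * cis (x \<bullet> \<xi>)
        = exp (complex_of_real (- s * (x \<bullet> x)) + \<i> * complex_of_real (x \<bullet> \<xi>))"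
      by (simp only: exp_add cis_conv_exp exp_of_real)
    also have "complex_of_real (- s * (x \<bullet> x)) + \<i> * complex_of_real (x \<bullet> \<xi>)
       = (\<Sum>b\<in>Basis. complex_of_real (- s * (x \<bullet> b)\<^sup>2) + \<i> * complex_of_real ((x \<bullet> b) * (\<xi> \<bullet> b)))"
      by (simp add: euclidean_inner[of x x] euclidean_inner[of x \<xi>] sum.distrib sum_distrib_left power2_eq_square sum_negf sum_subtractf)
    also have "exp \<dots> = (\<Prod>b\<in>Basis. f b (x \<bullet> b))"
      unfolding exp_sum[OF finite_Basis]
      by (intro prod.cong refl) (simp only: f_def exp_add cis_conv_exp exp_of_real)
    finally show ?thesis .
  qed
  have i: "integrable lborel (f b)" for b
    unfolding f_def by (rule gaussian_fourier_real(1)[OF s])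
  show "integrable lborel (\<lambda>x. complex_of_real (exp (- s * (x \<bullet> x))) * cis (x \<bullet> \<xi>))"
    unfolding P by (rule lborel_integral_prod_Basis) (rule i)
  have "(LINT x|lborel. complex_of_real (exp (- s * (x \<bullet> x))) * cis (x \<bullet> \<xi>))
     = (\<Prod>b\<in>Basis. integral\<^sup>L lborel (f b))"
    unfolding P by (rule lborel_integral_prod_Basis) (rule i)
  also have "\<dots> = (\<Prod>b\<in>Basis. complex_of_real (sqrt (pi / s) * exp (- ((\<xi> \<bullet> b)\<^sup>2) / (4 * s))))"
    unfolding f_def by (intro prod.cong refl gaussian_fourier_real(2)[OF s])
  also have "\<dots> = complex_of_real (\<Prod>b\<in>(Basis::'a set). sqrt (pi / s) * exp (- ((\<xi> \<bullet> b)\<^sup>2) / (4 * s)))"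
    by (rule of_real_prod[symmetric])
  also have "(\<Prod>b\<in>(Basis::'a set). sqrt (pi / s) * exp (- ((\<xi> \<bullet> b)\<^sup>2) / (4 * s)))
     = sqrt (pi / s) ^ DIM('a) * exp (\<Sum>b\<in>Basis. - ((\<xi> \<bullet> b)\<^sup>2) / (4 * s))"
    by (simp add: prod.distrib exp_sum)
  also have "(\<Sum>b\<in>Basis. - ((\<xi> \<bullet> b)\<^sup>2) / (4 * s)) = - (\<xi> \<bullet> \<xi>) / (4 * s)"
    by (simp add: euclidean_inner[of \<xi> \<xi>] power2_eq_square sum_negf sum_divide_distrib)
  also have "sqrt (pi / s) ^ DIM('a) = (pi / s) powr (real DIM('a) / 2)"
    using s by (simp add: powr_half_sqrt[symmetric] powr_powr[symmetric] powr_realpow[symmetric] powr_powr)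
  finally show "(LINT x|lborel. complex_of_real (exp (- s * (x \<bullet> x))) * cis (x \<bullet> \<xi>))
       = complex_of_real ((pi / s) powr (real DIM('a) / 2) * exp (- (\<xi> \<bullet> \<xi>) / (4 * s)))" .
qed

text \<open>A rescaled error function, needed for the closed antiderivative in the subordination
  formula. The limit at plus infinity is the Gaussian integral over a half-line; the one at minus
  infinity follows from oddness.\<close>

lemma gaussian_antiderivative:
  obtains E :: "real \<Rightarrow> real" where "\<And>x. (E has_real_derivative exp (- x\<^sup>2)) (at x)" "E 0 = 0"
    "(E \<longlongrightarrow> sqrt pi / 2) at_top" "(E \<longlongrightarrow> - (sqrt pi / 2)) at_bot"
proof -
  obtain E0 :: "real \<Rightarrow> real" where E0: "\<And>x. (E0 has_vector_derivative exp (- x\<^sup>2)) (at x)"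
    using einterval_antiderivative[of "-\<infinity>" \<infinity> "\<lambda>x. exp (- x\<^sup>2) :: real"] by auto
  define E where "E x = E0 x - E0 0" for x
  have D: "(E has_real_derivative exp (- x\<^sup>2)) (at x)" for x
    using E0[of x] unfolding E_def has_real_derivative_iff_has_vector_derivative[symmetric]
    by (auto intro!: derivative_eq_intros)
  have odd: "E (- x) = - E x" for x
  proof -
    have "((\<lambda>x. E x + E (- x)) has_real_derivative 0) (at x)" for x
    proof -
      have "((\<lambda>x. E (- x)) has_real_derivative exp (- (- x)\<^sup>2) * (- 1)) (at x)"
        by (rule DERIV_chain2[where f = E and g = uminus, OF D]) (auto intro!: derivative_eq_intros)
      from DERIV_add[OF D[of x] this] show ?thesis by simp
    qed
    from DERIV_isconst_all[OF allI[OF this], of x 0]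
    show ?thesis by (simp add: E_def)
  qed
  have T: "(E \<longlongrightarrow> sqrt pi / 2) at_top"
  proof -
    have I: "integrable lborel (\<lambda>x::real. indicator {0..} x *\<^sub>R exp (- x\<^sup>2))"
      "(LINT x|lborel. indicator {0..} x *\<^sub>R exp (- x\<^sup>2)) = sqrt pi / 2"
      using gaussian_moment_0 by (auto simp: has_bochner_integral_iff)
    have "((\<lambda>y. LINT x|lborel. indicator {..y} x *\<^sub>R (indicator {0..} x *\<^sub>R exp (- x\<^sup>2))) \<longlongrightarrow> sqrt pi / 2) at_top"
      using tendsto_integral_at_top[OF _ I(1)] unfolding I(2) by simp
    moreover have "eventually (\<lambda>y. (LINT x|lborel. indicator {..y} x *\<^sub>R (indicator {0..} x *\<^sub>R exp (- x\<^sup>2))) = E y) at_top"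
      using eventually_ge_at_top[of 0]
    proof eventually_elim
      case (elim y)
      have "(LINT x|lborel. exp (- x\<^sup>2) * indicator {0..y} x) = E y - E 0"
        by (rule integral_FTC_Icc_real[OF elim]) (auto intro!: D continuous_intros)
      moreover have "(LINT x|lborel. exp (- x\<^sup>2) * indicator {0..y} x)
        = (LINT x|lborel. indicator {..y} x *\<^sub>R (indicator {0..} x *\<^sub>R exp (- x\<^sup>2)))"
        by (intro Bochner_Integration.integral_cong refl) (auto simp: indicator_def)
      ultimately show ?case by (simp add: E_def)
    qed
    ultimately show ?thesis by (simp add: tendsto_cong)
  qed
  have "((\<lambda>x. - E (- x)) \<longlongrightarrow> - (sqrt pi / 2)) at_bot"
    by (intro tendsto_minus filterlim_compose[OF T] filterlim_uminus_at_top_at_bot)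
  hence "(E \<longlongrightarrow> - (sqrt pi / 2)) at_bot" by (simp add: odd)
  with D T show ?thesis by (intro that[of E]) (auto simp: E_def)
qed

text \<open>The integrand has an explicit antiderivative \<open>F\<close>. Since (t sqrt s +- r / (2
  sqrt s))^2 = s t^2 + r^2 / (4 s) +- t r, the prefactors exp (t r) and exp (- t r) turn both
  Gaussians into the exponential of the integrand; the derivatives of the two inner functions then
  add up to t / sqrt s, the terms with \<open>r\<close> cancelling.\<close>

lemma exp_subordination:
  fixes t r :: real
  assumes t: "0 < t" and r: "0 \<le> r"
  shows "has_bochner_integral lborel
     (\<lambda>s. indicator {0<..} s * (exp (- s * t\<^sup>2 - r\<^sup>2 / (4 * s)) / sqrt s)) (sqrt pi * exp (- t * r) / t)"
proof -
  obtain E where E: "\<And>x. (E has_real_derivative exp (- x\<^sup>2)) (at x)" "E 0 = 0"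
    "(E \<longlongrightarrow> sqrt pi / 2) at_top" "(E \<longlongrightarrow> - (sqrt pi / 2)) at_bot"
    using gaussian_antiderivative by blast
  define F where "F s = (exp (t * r) * E (t * sqrt s + r / (2 * sqrt s)) + exp (- t * r) * E (t * sqrt s - r / (2 * sqrt s))) / t" for s
  have Ecomp: "((\<lambda>x. E (h x)) has_real_derivative exp (- (h x)\<^sup>2) * h') (at x)"
    if "(h has_real_derivative h') (at x)" for h h' x
    by (rule DERIV_chain2[OF E(1) that])
  have D: "(F has_real_derivative exp (- s * t\<^sup>2 - r\<^sup>2 / (4 * s)) / sqrt s) (at s)" if s: "0 < s" for s
  proof -
    have sq: "(sqrt s)\<^sup>2 = s" "0 < sqrt s" using s by auto
    have e1: "exp (t * r) * exp (- (t * sqrt s + r / (2 * sqrt s))\<^sup>2) = exp (- s * t\<^sup>2 - r\<^sup>2 / (4 * s))"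
      unfolding exp_add[symmetric] using sq s
      by (intro arg_cong[of _ _ exp]) (simp add: power2_sum power_mult_distrib power_divide field_simps)
    have e2: "exp (- t * r) * exp (- (t * sqrt s - r / (2 * sqrt s))\<^sup>2) = exp (- s * t\<^sup>2 - r\<^sup>2 / (4 * s))"
      unfolding exp_add[symmetric] using sq s
      by (intro arg_cong[of _ _ exp]) (simp add: power2_diff power_mult_distrib power_divide field_simps)
    define q where "q = inverse (sqrt s) / 2"
    have dq: "(sqrt has_real_derivative q) (at s)"
      using DERIV_real_sqrt[OF s] by (simp add: q_def)
    define v where "v = - r * q / (2 * (sqrt s)\<^sup>2)"
    have dv: "((\<lambda>s. r / (2 * sqrt s)) has_real_derivative v) (at s)"
    proof -
      have "((\<lambda>s. r / (2 * sqrt s)) has_real_derivative (0 * (2 * sqrt s) - r * (2 * q)) / ((2 * sqrt s) * (2 * sqrt s))) (at s)"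
        by (rule DERIV_divide) (use sq in \<open>auto intro!: DERIV_cmult dq\<close>)
      also have "(0 * (2 * sqrt s) - r * (2 * q)) / ((2 * sqrt s) * (2 * sqrt s)) = v"
        using sq by (simp add: v_def power2_eq_square)
      finally show ?thesis .
    qed
    have d1: "((\<lambda>s. t * sqrt s + r / (2 * sqrt s)) has_real_derivative t * q + v) (at s)"
     and d2: "((\<lambda>s. t * sqrt s - r / (2 * sqrt s)) has_real_derivative t * q - v) (at s)"
      by (rule DERIV_add[OF DERIV_cmult[OF dq] dv] DERIV_diff[OF DERIV_cmult[OF dq] dv])+
    have "(F has_real_derivative (exp (t * r) * (exp (- (t * sqrt s + r / (2 * sqrt s))\<^sup>2) * (t * q + v))
        + exp (- t * r) * (exp (- (t * sqrt s - r / (2 * sqrt s))\<^sup>2) * (t * q - v))) / t) (at s)"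
      unfolding F_def
      by (intro DERIV_cdivide DERIV_add DERIV_cmult Ecomp d1 d2)
    also have "(exp (t * r) * (exp (- (t * sqrt s + r / (2 * sqrt s))\<^sup>2) * (t * q + v))
        + exp (- t * r) * (exp (- (t * sqrt s - r / (2 * sqrt s))\<^sup>2) * (t * q - v))) / t
       = exp (- s * t\<^sup>2 - r\<^sup>2 / (4 * s)) * ((t * q + v) + (t * q - v)) / t"
      unfolding mult.assoc[symmetric] e1 e2 by (simp add: algebra_simps)
    also have "\<dots> = exp (- s * t\<^sup>2 - r\<^sup>2 / (4 * s)) / sqrt s"
      using t sq by (simp add: q_def field_simps)
    finally show ?thesis .
  qed
  have top: "(F \<longlongrightarrow> (exp (t * r) * (sqrt pi / 2) + exp (- t * r) * (sqrt pi / 2)) / t) at_top"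
  proof -
    have "filterlim (\<lambda>s. t * sqrt s + r / (2 * sqrt s)) at_top at_top"
      "filterlim (\<lambda>s. t * sqrt s - r / (2 * sqrt s)) at_top at_top"
      using t by real_asymp+
    thus ?thesis unfolding F_def
      by (intro tendsto_intros filterlim_compose[OF E(3)]) (use t in auto)
  qed
  \<comment> \<open>As s tends to 0 the two arguments tend to plus and minus infinity when r > 0, so
    the two terms of \<open>F\<close> get limits of opposite sign; for r = 0 both arguments tend to
    0. The limit is written as the limit at infinity minus the claimed value, so that the difference
    of the two limits is immediate.\<close>
  have bot: "(F \<longlongrightarrow> (exp (t * r) * (sqrt pi / 2) + exp (- t * r) * (sqrt pi / 2)) / t - sqrt pi * exp (- t * r) / t) (at_right 0)"
  proof (cases "r = 0")
    case True
    have "isCont E 0" using E(1) DERIV_isCont by blast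
    moreover have "((\<lambda>s. t * sqrt s) \<longlongrightarrow> 0) (at_right 0)" by real_asymp
    ultimately have "((\<lambda>s. E (t * sqrt s)) \<longlongrightarrow> E 0) (at_right 0)"
      by (rule isCont_tendsto_compose)
    hence "((\<lambda>s. (1 * E (t * sqrt s) + 1 * E (t * sqrt s)) / t) \<longlongrightarrow> (1 * 0 + 1 * 0) / t) (at_right 0)"
      unfolding E(2) by (intro tendsto_intros) (use t in auto)
    thus ?thesis unfolding F_def using True t by (simp add: diff_divide_distrib[symmetric])
  next
    case False
    with r have "0 < r" by simp
    have "filterlim (\<lambda>s. t * sqrt s + r / (2 * sqrt s)) at_top (at_right 0)"
      "filterlim (\<lambda>s. t * sqrt s - r / (2 * sqrt s)) at_bot (at_right 0)"
      using t \<open>0 < r\<close> by real_asymp+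
    hence "(F \<longlongrightarrow> (exp (t * r) * (sqrt pi / 2) + exp (- t * r) * (- (sqrt pi / 2))) / t) (at_right 0)"
      unfolding F_def
      by (intro tendsto_intros filterlim_compose[OF E(3)] filterlim_compose[OF E(4)]) (use t in auto)
    moreover have "(exp (t * r) * (sqrt pi / 2) + exp (- t * r) * (- (sqrt pi / 2))) / t
      = (exp (t * r) * (sqrt pi / 2) + exp (- t * r) * (sqrt pi / 2)) / t - sqrt pi * exp (- t * r) / t"
      using t by (simp add: field_simps)
    ultimately show ?thesis by simp
  qed
  let ?f = "\<lambda>s. exp (- s * t\<^sup>2 - r\<^sup>2 / (4 * s)) / sqrt s"
  have cont: "isCont ?f s" if "0 < s" for s
    using that by (intro continuous_intros) auto
  have A: "((F \<circ> real_of_ereal) \<longlongrightarrow> (exp (t * r) * (sqrt pi / 2) + exp (- t * r) * (sqrt pi / 2)) / t - sqrt pi * exp (- t * r) / t) (at_right (0::ereal))"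
    using bot by (simp add: zero_ereal_def ereal_tendsto_simps1)
  have B: "((F \<circ> real_of_ereal) \<longlongrightarrow> (exp (t * r) * (sqrt pi / 2) + exp (- t * r) * (sqrt pi / 2)) / t) (at_left \<infinity>)"
    using top by (simp add: ereal_tendsto_simps1)
  have FTC: "set_integrable lborel (einterval 0 \<infinity>) ?f"
    "(LBINT x=0..\<infinity>. ?f x) = (exp (t * r) * (sqrt pi / 2) + exp (- t * r) * (sqrt pi / 2)) / t
       - ((exp (t * r) * (sqrt pi / 2) + exp (- t * r) * (sqrt pi / 2)) / t - sqrt pi * exp (- t * r) / t)"
    by (rule interval_integral_FTC_nonneg[OF _ _ _ _ A B]; use D cont in \<open>auto simp: zero_ereal_def\<close>)+
  have "einterval 0 \<infinity> = {0<..}" by (auto simp: einterval_def zero_ereal_def)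
  thus ?thesis using FTC
    by (simp add: has_bochner_integral_iff set_integrable_def interval_lebesgue_integral_def set_lebesgue_integral_def)
qed

section \<open>Negative powers as Gamma mixtures, and the transform of exp (- t |\<xi>|)\<close>

lemma gamma_mixture:
  fixes a \<rho> :: real
  assumes a: "0 < a" and \<rho>: "0 < \<rho>"
  shows "has_bochner_integral lborel (\<lambda>s. indicator {0<..} s * (s powr (a - 1) * exp (- s * \<rho>))) (Gamma a * \<rho> powr (- a))"
proof -
  define f where "f = (\<lambda>t::real. indicator {0..} t * t powr (a - 1) / exp t)"
  have f: "has_bochner_integral lborel f (Gamma a)"
    by (rule has_bochner_integral_nn_integral)
       (use a Gamma_conv_nn_integral_real[OF a] Gamma_real_pos[OF a] in \<open>auto simp: f_def\<close>)
  have "has_bochner_integral lborel (\<lambda>s. f (0 + \<rho> * s)) (Gamma a /\<^sub>R \<bar>\<rho>\<bar>)"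
    using lborel_has_bochner_integral_real_affine_iff[of \<rho> f "Gamma a" 0] \<rho> f by simp
  hence A: "has_bochner_integral lborel (\<lambda>s. f (0 + \<rho> * s) * \<rho> powr (1 - a)) (Gamma a /\<^sub>R \<bar>\<rho>\<bar> * \<rho> powr (1 - a))"
    by (intro has_bochner_integral_mult_left) auto
  have B: "Gamma a /\<^sub>R \<bar>\<rho>\<bar> * \<rho> powr (1 - a) = Gamma a * \<rho> powr (- a)"
    using \<rho> by (simp add: powr_diff powr_minus field_simps)
  note * = A[unfolded B]
  have eq: "f (0 + \<rho> * s) * \<rho> powr (1 - a) = indicator {0<..} s * (s powr (a - 1) * exp (- s * \<rho>))" if "s \<noteq> 0" for s
  proof (cases "0 < s")
    case True
    hence "(\<rho> * s) powr (a - 1) * \<rho> powr (1 - a) = s powr (a - 1)"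
      using \<rho> by (simp add: powr_mult powr_add[symmetric] mult_ac)
    thus ?thesis using True \<rho> by (simp add: f_def exp_minus field_simps)
  next
    case False
    hence "\<rho> * s < 0" using that \<rho> by (simp add: mult_less_0_iff)
    thus ?thesis using False by (simp add: f_def)
  qed
  show ?thesis
    using * by (subst (asm) has_bochner_integral_cong_AE[where g = "\<lambda>s. indicator {0<..} s * (s powr (a - 1) * exp (- s * \<rho>))"])
      (use eq in \<open>auto simp: f_def intro: AE_mp[OF AE_lborel_singleton[of 0]]\<close>)
qed

lemma gaussian_integral:
  assumes s: "0 < s"
  shows "has_bochner_integral lborel (\<lambda>x::'a::euclidean_space. exp (- s * (x \<bullet> x))) ((pi / s) powr (real DIM('a) / 2))"
proof -
  have "has_bochner_integral lborel (\<lambda>x::'a. complex_of_real (exp (- s * (x \<bullet> x)))) (complex_of_real ((pi / s) powr (real DIM('a) / 2)))"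
    using gaussian_fourier[OF s, of "0::'a"] by (simp add: has_bochner_integral_iff)
  from has_bochner_integral_Re[OF this] show ?thesis by simp
qed

text \<open>With the power written as a Gamma mixture of Gaussians, integration over
  \<open>x\<close> first lowers the exponent of \<open>s\<close> from a - 1 to a - n/2 - 1, and n/2
  < a is the condition for the remaining Gamma integral to converge. It serves for the mass of the
  Poisson kernel and for the integrability of Fourier transforms.\<close>

lemma bessel_integral:
  fixes a \<rho> :: real
  defines "n \<equiv> real DIM('a::euclidean_space)"
  assumes a: "n / 2 < a" and \<rho>: "0 < \<rho>"
  shows "has_bochner_integral lborel (\<lambda>x::'a. (\<rho> + x \<bullet> x) powr (- a))
     (pi powr (n / 2) * Gamma (a - n / 2) / Gamma a * \<rho> powr (n / 2 - a))"
proof -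
  have a0: "0 < a" "0 < a - n / 2" using a by (auto simp: n_def intro: le_less_trans[rotated])
  define h where "h = (\<lambda>(s, x::'a). indicator {0<..} s * (s powr (a - 1) * exp (- s * (\<rho> + x \<bullet> x))))"
  have hs: "(\<lambda>x::'a. h (s, x)) = (\<lambda>x. (indicator {0<..} s * (s powr (a - 1) * exp (- s * \<rho>))) * exp (- s * (x \<bullet> x)))" for s
    by (auto simp: h_def fun_eq_iff exp_add[symmetric] algebra_simps)
  have inner: "has_bochner_integral lborel (\<lambda>x::'a. h (s, x))
      (pi powr (n / 2) * (indicator {0<..} s * (s powr (a - n / 2 - 1) * exp (- s * \<rho>))))" for s
  proof (cases "0 < s")
    case True
    have "has_bochner_integral lborel (\<lambda>x::'a. h (s, x)) ((indicator {0<..} s * (s powr (a - 1) * exp (- s * \<rho>))) * (pi / s) powr (n / 2))"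
      unfolding hs n_def by (intro has_bochner_integral_mult_right gaussian_integral True)
    also have "(indicator {0<..} s * (s powr (a - 1) * exp (- s * \<rho>))) * (pi / s) powr (n / 2)
       = pi powr (n / 2) * (indicator {0<..} s * (s powr (a - n / 2 - 1) * exp (- s * \<rho>)))"
    proof -
      have A: "s powr (a - 1) / s powr (n / 2) = s powr (a - n / 2 - 1)"
        unfolding powr_diff[symmetric] by (simp add: algebra_simps)
      have B: "(pi / s) powr (n / 2) = pi powr (n / 2) / s powr (n / 2)"
        using True by (simp add: powr_divide)
      have "i * (P * R) * (X / S) = X * (i * ((P / S) * R))" for i P R X S :: real
        by simp
      thus ?thesis unfolding B A[symmetric] by blast
    qed
    finally show ?thesis .
  qed (simp add: hs has_bochner_integral_zero)
  have outer: "has_bochner_integral lborel (\<lambda>s. pi powr (n / 2) * (indicator {0<..} s * (s powr (a - n / 2 - 1) * exp (- s * \<rho>))))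
     (pi powr (n / 2) * (Gamma (a - n / 2) * \<rho> powr (- (a - n / 2))))"
    by (intro has_bochner_integral_mult_right gamma_mixture a0 \<rho>)
  have hpos: "0 \<le> h p" for p by (auto simp: h_def split: prod.split)
  have m: "h \<in> borel_measurable (lborel \<Otimes>\<^sub>M lborel)" unfolding h_def by measurable
  have I: "integrable (lborel \<Otimes>\<^sub>M lborel) h"
  proof (rule lborel_pair.Fubini_integrable[OF m])
    have "(\<lambda>s. LINT x|lborel. norm (h (s, x))) = (\<lambda>s. pi powr (n / 2) * (indicator {0<..} s * (s powr (a - n / 2 - 1) * exp (- s * \<rho>))))"
      using has_bochner_integral_integral_eq[OF inner] hpos by auto
    thus "integrable lborel (\<lambda>s. LINT x|lborel. norm (h (s, x)))"
      using integrable.intros[OF outer] by simp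
    show "AE s in lborel. integrable lborel (\<lambda>x. h (s, x))"
      using integrable.intros[OF inner] by simp
  qed
  hence I': "integrable (lborel \<Otimes>\<^sub>M lborel) (\<lambda>(s, x). h (s, x))" by simp
  have G: "(LINT s|lborel. h (s, x)) = Gamma a * (\<rho> + x \<bullet> x) powr (- a)" for x
    unfolding h_def using gamma_mixture[OF a0(1), of "\<rho> + x \<bullet> x"] \<rho>
    by (simp add: has_bochner_integral_iff add_pos_nonneg)
  have Ga: "0 < Gamma a" using a0 by (simp add: Gamma_real_pos)
  have "has_bochner_integral lborel (\<lambda>x::'a. LINT s|lborel. h (s, x)) (pi powr (n / 2) * (Gamma (a - n / 2) * \<rho> powr (- (a - n / 2))))"
  proof -
    have "(LINT x|lborel. LINT s|lborel. h (s, x)) = (LINT s|lborel. LINT x|lborel. h (s, x))"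
      by (rule lborel_pair.Fubini_integral[OF I'])
    also have "\<dots> = pi powr (n / 2) * (Gamma (a - n / 2) * \<rho> powr (- (a - n / 2)))"
      unfolding has_bochner_integral_integral_eq[OF inner] by (rule has_bochner_integral_integral_eq[OF outer])
    finally show ?thesis
      using lborel_pair.integrable_snd[OF I'] by (simp add: has_bochner_integral_iff)
  qed
  hence R: "has_bochner_integral lborel (\<lambda>x::'a. (Gamma a * (\<rho> + x \<bullet> x) powr (- a)) * inverse (Gamma a)) (pi powr (n / 2) * (Gamma (a - n / 2) * \<rho> powr (- (a - n / 2))) * inverse (Gamma a))"
    unfolding G by (intro has_bochner_integral_mult_left) auto
  have E': "(g * P) * inverse g = P" if "0 < g" for g P :: real
    using that by simp
  note E = E'[OF Ga]
  have V: "pi powr (n / 2) * (Gamma (a - n / 2) * \<rho> powr (- (a - n / 2))) * inverse (Gamma a)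
     = pi powr (n / 2) * Gamma (a - n / 2) / Gamma a * \<rho> powr (n / 2 - a)"
  proof -
    have "p * (G * r) * inverse g = p * G / g * r" for p G r g :: real
      by (simp add: divide_inverse)
    thus ?thesis unfolding minus_diff_eq by blast
  qed
  show ?thesis using R unfolding E V .
qed

text \<open>Subordination makes exp (- t |\<xi>|) a mixture of Gaussians in \<xi> with parameter 1 /
  (4 s). Transforming each Gaussian produces exp (- s |x|^2), and the integral over \<open>s\<close>
  that is left is a Gamma integral whose value is a multiple of the Poisson kernel.\<close>

lemma exp_norm_fourier:
  fixes x :: "'a::euclidean_space"
  defines "k \<equiv> (real DIM('a) + 1) / 2"
  assumes t: "0 < t"
  shows "has_bochner_integral lborel (\<lambda>\<xi>. complex_of_real (exp (- t * norm \<xi>)) * cis (x \<bullet> \<xi>))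
     (complex_of_real (((4 * pi) powr (real DIM('a) / 2) * Gamma k / sqrt pi) * (t * (t\<^sup>2 + x \<bullet> x) powr (- k))))"
proof -
  define n where "n = real DIM('a)"
  define w where "w s = indicator {0<..} s * (exp (- s * t\<^sup>2) / sqrt s)" for s
  define h where "h p = complex_of_real (w (fst p) * exp (- (snd p \<bullet> snd p) / (4 * fst p))) * cis (snd p \<bullet> x)" for p :: "real \<times> 'a"
  have k: "0 < k" "k - 1 = n / 2 - 1 / 2" by (auto simp: k_def n_def field_simps)
  have wpos: "0 \<le> w s" for s by (auto simp: w_def indicator_def)
  have [measurable]: "w \<in> borel_measurable borel" unfolding w_def by measurable
  have G: "w s * (pi / (1 / (4 * s))) powr (n / 2) * exp (- (y \<bullet> y) / (4 * (1 / (4 * s))))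
      = (4 * pi) powr (n / 2) * (indicator {0<..} s * (s powr (k - 1) * exp (- s * (t\<^sup>2 + y \<bullet> y))))" for s and y :: 'a
  proof (cases "0 < s")
    case True
    have A: "(pi / (1 / (4 * s))) powr (n / 2) = (4 * pi) powr (n / 2) * s powr (n / 2)"
      using True by (simp add: powr_mult[symmetric] mult_ac)
    have B: "s powr (n / 2) / sqrt s = s powr (k - 1)"
      using True unfolding k(2) by (simp add: powr_diff powr_half_sqrt)
    have C: "exp (- s * t\<^sup>2) * exp (- (y \<bullet> y) / (4 * (1 / (4 * s)))) = exp (- s * (t\<^sup>2 + y \<bullet> y))"
      using True by (simp add: exp_add[symmetric] algebra_simps)
    have "w s * (P * Q) * R = P * (Q / sqrt s) * (exp (- s * t\<^sup>2) * R)" for P Q R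
      using True by (simp add: w_def)
    hence "w s * (pi / (1 / (4 * s))) powr (n / 2) * exp (- (y \<bullet> y) / (4 * (1 / (4 * s))))
       = (4 * pi) powr (n / 2) * (s powr (n / 2) / sqrt s) * (exp (- s * t\<^sup>2) * exp (- (y \<bullet> y) / (4 * (1 / (4 * s)))))"
      unfolding A by blast
    thus ?thesis using True unfolding B C by simp
  qed (simp add: w_def)
  have inner: "integrable lborel (\<lambda>\<xi>. h (s, \<xi>))"
    "(LINT \<xi>|lborel. h (s, \<xi>)) = complex_of_real ((4 * pi) powr (n / 2) * (indicator {0<..} s * (s powr (k - 1) * exp (- s * (t\<^sup>2 + x \<bullet> x)))))"
    "(LINT \<xi>|lborel. norm (h (s, \<xi>))) = (4 * pi) powr (n / 2) * (indicator {0<..} s * (s powr (k - 1) * exp (- s * t\<^sup>2)))" for s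
  proof -
    have hs: "(\<lambda>\<xi>. h (s, \<xi>)) = (\<lambda>\<xi>. complex_of_real (w s) * (complex_of_real (exp (- (1 / (4 * s)) * (\<xi> \<bullet> \<xi>))) * cis (\<xi> \<bullet> x)))"
      by (auto simp: h_def)
    have hn: "(\<lambda>\<xi>. norm (h (s, \<xi>))) = (\<lambda>\<xi>. w s * exp (- (1 / (4 * s)) * (\<xi> \<bullet> \<xi>)))"
      using wpos by (auto simp: h_def norm_mult)
    have G0: "w s * (pi / (1 / (4 * s))) powr (n / 2) = (4 * pi) powr (n / 2) * (indicator {0<..} s * (s powr (k - 1) * exp (- s * t\<^sup>2)))"
      using G[of s 0] by simp
    have X: "integrable lborel (\<lambda>\<xi>. h (s, \<xi>)) \<and>
      (LINT \<xi>|lborel. h (s, \<xi>)) = complex_of_real (w s * (pi / (1 / (4 * s))) powr (n / 2) * exp (- (x \<bullet> x) / (4 * (1 / (4 * s)))))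
      \<and> (LINT \<xi>|lborel. norm (h (s, \<xi>))) = w s * (pi / (1 / (4 * s))) powr (n / 2)"
    proof (cases "0 < s")
      case True
      hence s: "0 < 1 / (4 * s)" by simp
      show ?thesis unfolding hs hn
        using gaussian_fourier[OF s, of x] has_bochner_integral_integral_eq[OF gaussian_integral[OF s, where 'a='a]]
        by (simp add: n_def)
    qed (simp add: hs hn w_def)
    show "integrable lborel (\<lambda>\<xi>. h (s, \<xi>))"
      "(LINT \<xi>|lborel. h (s, \<xi>)) = complex_of_real ((4 * pi) powr (n / 2) * (indicator {0<..} s * (s powr (k - 1) * exp (- s * (t\<^sup>2 + x \<bullet> x)))))"
      "(LINT \<xi>|lborel. norm (h (s, \<xi>))) = (4 * pi) powr (n / 2) * (indicator {0<..} s * (s powr (k - 1) * exp (- s * t\<^sup>2)))"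
      by (rule X[THEN conjunct1] X[THEN conjunct2, THEN conjunct1, unfolded G] X[THEN conjunct2, THEN conjunct2, unfolded G0])+
  qed
  have m: "h \<in> borel_measurable (lborel \<Otimes>\<^sub>M lborel)"
    unfolding h_def cis_conv_exp by measurable
  have I: "integrable (lborel \<Otimes>\<^sub>M lborel) h"
  proof (rule lborel_pair.Fubini_integrable[OF m])
    have "has_bochner_integral lborel (\<lambda>s. (4 * pi) powr (n / 2) * (indicator {0<..} s * (s powr (k - 1) * exp (- s * t\<^sup>2))))
      ((4 * pi) powr (n / 2) * (Gamma k * (t\<^sup>2) powr (- k)))"
      by (intro has_bochner_integral_mult_right gamma_mixture k) (use t in auto)
    thus "integrable lborel (\<lambda>s. LINT \<xi>|lborel. norm (h (s, \<xi>)))"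
      unfolding inner(3) by (rule integrable.intros)
    show "AE s in lborel. integrable lborel (\<lambda>\<xi>. h (s, \<xi>))"
      using inner(1) by simp
  qed
  hence I': "integrable (lborel \<Otimes>\<^sub>M lborel) (\<lambda>(s, x). h (s, x))" by simp
  have S: "(LINT s|lborel. h (s, \<xi>)) = complex_of_real (sqrt pi / t) * (complex_of_real (exp (- t * norm \<xi>)) * cis (x \<bullet> \<xi>))" for \<xi>
  proof -
    have "has_bochner_integral lborel (\<lambda>s. complex_of_real (indicator {0<..} s * (exp (- s * t\<^sup>2 - (norm \<xi>)\<^sup>2 / (4 * s)) / sqrt s)) * cis (\<xi> \<bullet> x))
        (complex_of_real (sqrt pi * exp (- t * norm \<xi>) / t) * cis (\<xi> \<bullet> x))"
      by (intro has_bochner_integral_mult_left has_bochner_integral_of_real exp_subordination t) auto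
    moreover have "complex_of_real (indicator {0<..} s * (exp (- s * t\<^sup>2 - (norm \<xi>)\<^sup>2 / (4 * s)) / sqrt s)) * cis (\<xi> \<bullet> x) = h (s, \<xi>)" for s
    proof -
      have "exp (- s * t\<^sup>2 - (norm \<xi>)\<^sup>2 / (4 * s)) = exp (- s * t\<^sup>2) * exp (- (\<xi> \<bullet> \<xi>) / (4 * s))"
        unfolding exp_add[symmetric] by (simp add: power2_norm_eq_inner)
      thus ?thesis by (simp add: h_def w_def)
    qed
    ultimately show ?thesis
      by (simp add: has_bochner_integral_iff inner_commute mult_ac)
  qed
  have "(LINT \<xi>|lborel. LINT s|lborel. h (s, \<xi>)) = (LINT s|lborel. LINT \<xi>|lborel. h (s, \<xi>))"
    by (rule lborel_pair.Fubini_integral[OF I'])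
  also have "\<dots> = complex_of_real ((4 * pi) powr (n / 2) * (Gamma k * (t\<^sup>2 + x \<bullet> x) powr (- k)))"
    unfolding inner(2)
    by (intro has_bochner_integral_integral_eq has_bochner_integral_of_real has_bochner_integral_mult_right gamma_mixture k)
       (use t in \<open>auto intro: add_pos_nonneg\<close>)
  finally have B: "has_bochner_integral lborel (\<lambda>\<xi>. complex_of_real (sqrt pi / t) * (complex_of_real (exp (- t * norm \<xi>)) * cis (x \<bullet> \<xi>)))
       (complex_of_real ((4 * pi) powr (n / 2) * (Gamma k * (t\<^sup>2 + x \<bullet> x) powr (- k))))"
    using lborel_pair.integrable_snd[OF I'] unfolding S by (simp add: has_bochner_integral_iff)
  have R: "has_bochner_integral lborel (\<lambda>\<xi>. complex_of_real (t / sqrt pi) * (complex_of_real (sqrt pi / t) * (complex_of_real (exp (- t * norm \<xi>)) * cis (x \<bullet> \<xi>))))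
       (complex_of_real (t / sqrt pi) * complex_of_real ((4 * pi) powr (n / 2) * (Gamma k * (t\<^sup>2 + x \<bullet> x) powr (- k))))"
    by (intro has_bochner_integral_mult_right B)
  have S1: "complex_of_real (t / sqrt pi) * (complex_of_real (sqrt pi / t) * X) = X" for X
  proof -
    have "complex_of_real (t / sqrt pi) * complex_of_real (sqrt pi / t) = 1"
      unfolding of_real_mult[symmetric] using t by simp
    thus ?thesis by (metis mult.assoc mult_1_left)
  qed
  have S2: "complex_of_real (t / sqrt pi) * complex_of_real ((4 * pi) powr (n / 2) * (Gamma k * (t\<^sup>2 + x \<bullet> x) powr (- k)))
     = complex_of_real (((4 * pi) powr (n / 2) * Gamma k / sqrt pi) * (t * (t\<^sup>2 + x \<bullet> x) powr (- k)))"
    unfolding of_real_mult[symmetric] by (rule arg_cong[of _ _ complex_of_real]) simp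
  show ?thesis using R unfolding S1 S2 unfolding n_def .
qed

subsection \<open>Test functions\<close>

lemma frechet_derivative_of: "(f has_derivative D) (at x) \<Longrightarrow> frechet_derivative f (at x) = D"
  by (rule frechet_derivative_at[symmetric])

lemma frechet_derivative_mult:
  fixes f g :: "'a::real_normed_vector \<Rightarrow> real"
  assumes "f differentiable (at x)" "g differentiable (at x)"
  shows "frechet_derivative (\<lambda>x. f x * g x) (at x) v =
    f x * frechet_derivative g (at x) v + frechet_derivative f (at x) v * g x"
  using frechet_derivative_of[OF has_derivative_mult[OF assms[unfolded frechet_derivative_works]]] by simp

lemma frechet_derivative_plus':
  fixes f g :: "'a::real_normed_vector \<Rightarrow> real"
  assumes "f differentiable (at x)" "g differentiable (at x)"
  shows "frechet_derivative (\<lambda>x. f x + g x) (at x) v =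
    frechet_derivative f (at x) v + frechet_derivative g (at x) v"
  using frechet_derivative_of[OF has_derivative_add[OF assms[unfolded frechet_derivative_works]]] by simp

lemma C_diff_imp_continuous: "C_diff k f \<Longrightarrow> continuous_on UNIV f"
  by (cases k) (auto simp: continuous_on_eq_continuous_at intro: differentiable_imp_continuous_within)

lemma C_diff_Suc: "C_diff (Suc k) f \<Longrightarrow> C_diff k f"
proof (induction k arbitrary: f)
  case 0
  thus ?case using C_diff_imp_continuous[of "Suc 0" f] by simp
next
  case (Suc k)
  from Suc.prems have d: "\<forall>x. f differentiable (at x)"
    and c: "\<And>v. C_diff (Suc k) (\<lambda>x. frechet_derivative f (at x) v)" by simp_all
  show ?case using d Suc.IH[OF c] by simp
qed

lemma C_diff_const: "C_diff k (\<lambda>x::'a::euclidean_space. c)"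
  by (induction k arbitrary: c) auto

lemma C_diff_add: "C_diff k f \<Longrightarrow> C_diff k g \<Longrightarrow> C_diff k (\<lambda>x. f x + g x)"
proof (induction k arbitrary: f g)
  case 0 thus ?case by (auto intro: continuous_intros)
next
  case (Suc k)
  have "C_diff k (\<lambda>x. frechet_derivative (\<lambda>x. f x + g x) (at x) v)" for v
    using Suc by (simp add: frechet_derivative_plus')
  thus ?case using Suc.prems by auto
qed

lemma C_diff_mult: "C_diff k f \<Longrightarrow> C_diff k g \<Longrightarrow> C_diff k (\<lambda>x. f x * g x)"
proof (induction k arbitrary: f g)
  case 0 thus ?case by (auto intro: continuous_intros)
next
  case (Suc k)
  have "C_diff k (\<lambda>x. frechet_derivative (\<lambda>x. f x * g x) (at x) v)" for v
    using Suc.prems by (simp add: frechet_derivative_mult)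
      (intro C_diff_add Suc.IH, auto intro: C_diff_Suc)
  thus ?case using Suc.prems by (auto intro: differentiable_mult)
qed

lemma C_diff_linear: 
  fixes f :: "'a::euclidean_space \<Rightarrow> real"
  assumes "bounded_linear f" shows "C_diff k f"
proof (cases k)
  case 0 thus ?thesis using assms by (simp add: linear_continuous_on)
next
  case (Suc j)
  have "(f has_derivative f) (at x)" for x
    using assms by (rule bounded_linear_imp_has_derivative)
  thus ?thesis using Suc frechet_derivative_of[of f f]
    by (auto simp: differentiable_def C_diff_const)
qed

lemma C_diff_polynomial:
  fixes f :: "'a::euclidean_space \<Rightarrow> real"
  shows "real_polynomial_function f \<Longrightarrow> C_diff k f"
  by (induction rule: real_polynomial_function.induct) (auto intro: C_diff_linear C_diff_const C_diff_add C_diff_mult)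

text \<open>The index j makes the family closed under differentiation up to linear combinations, so
  smoothness follows by one induction over the order for all j together.\<close>

definition flat_exp :: "nat \<Rightarrow> real \<Rightarrow> real" where
  "flat_exp j x = (if 0 < x then exp (- inverse x) * inverse x ^ j else 0)"

lemma DERIV_flat_exp:
  "(flat_exp j has_real_derivative (flat_exp (j + 2) x - j * flat_exp (j + 1) x)) (at x)"
proof -
  consider "0 < x" | "x < 0" | "x = 0" by linarith
  thus ?thesis
  proof cases
    case 1
    have "((\<lambda>x. exp (- inverse x) * inverse x ^ j) has_real_derivative
       exp (- inverse x) * (inverse x * inverse x) * inverse x ^ j
       + exp (- inverse x) * (real j * (- (inverse x * inverse x) * inverse x ^ (j - 1)))) (at x)"
      using 1 by (auto intro!: derivative_eq_intros)
    also have "exp (- inverse x) * (inverse x * inverse x) * inverse x ^ j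
       + exp (- inverse x) * (real j * (- (inverse x * inverse x) * inverse x ^ (j - 1)))
       = flat_exp (j + 2) x - j * flat_exp (j + 1) x"
      using 1 by (cases j) (simp_all add: flat_exp_def algebra_simps)
    finally have d: "((\<lambda>x. exp (- inverse x) * inverse x ^ j) has_real_derivative (flat_exp (j + 2) x - j * flat_exp (j + 1) x)) (at x)" .
    have ev: "eventually (\<lambda>y. exp (- inverse y) * inverse y ^ j = flat_exp j y) (nhds x)"
      using eventually_nhds_in_open[of "{0<..}" x] 1 by (auto elim!: eventually_mono simp: flat_exp_def)
    from DERIV_cong_ev[OF refl ev refl, THEN iffD1, OF d] show ?thesis .
  next
    case 2
    have ev: "eventually (\<lambda>y. 0 = flat_exp j y) (nhds x)"
      using eventually_nhds_in_open[of "{..<0}" x] 2 by (auto elim!: eventually_mono simp: flat_exp_def)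
    have d: "((\<lambda>x. 0) has_real_derivative (flat_exp (j + 2) x - j * flat_exp (j + 1) x)) (at x)"
      using 2 by (simp add: flat_exp_def)
    from DERIV_cong_ev[OF refl ev refl, THEN iffD1, OF d] show ?thesis .
  next
    case 3
    have "((\<lambda>h. flat_exp j h / h) \<longlongrightarrow> 0) (at_right 0)"
    proof -
      \<comment> \<open>With y = 1 / h the right difference quotient at the origin is y^(j+1) / exp
        y, and y tends to infinity.\<close>
      have "((\<lambda>h::real. exp (- inverse h) * inverse h ^ Suc j) \<longlongrightarrow> 0) (at_right 0)"
        using filterlim_compose[OF tendsto_power_div_exp_0[of "Suc j"] filterlim_inverse_at_top_right]
        by (simp add: exp_minus field_simps)
      moreover have "eventually (\<lambda>h. exp (- inverse h) * inverse h ^ Suc j = flat_exp j h / h) (at_right (0::real))"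
        using eventually_at_right_less by (rule eventually_mono) (auto simp: flat_exp_def field_simps)
      ultimately show ?thesis by (rule Lim_transform_eventually)
    qed
    moreover have "((\<lambda>h. flat_exp j h / h) \<longlongrightarrow> 0) (at_left 0)"
    proof (rule Lim_transform_eventually[of "\<lambda>_. 0"])
      show "eventually (\<lambda>h. 0 = flat_exp j h / h) (at_left (0::real))"
        unfolding eventually_at_filter by (rule always_eventually) (auto simp: flat_exp_def)
    qed simp
    ultimately have "((\<lambda>h. flat_exp j h / h) \<longlongrightarrow> 0) (at 0)"
      by (simp add: filterlim_split_at)
    thus ?thesis using 3 by (simp add: DERIV_def flat_exp_def[of _ 0])
  qed
qed

lemma C_diff_flat_exp:
  fixes u :: "'a::euclidean_space \<Rightarrow> real"
  assumes u: "\<And>m. C_diff m u"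
  shows "C_diff k (\<lambda>x. flat_exp j (u x))"
proof (induction k arbitrary: j)
  case 0
  have "isCont (flat_exp j) x" for x using DERIV_flat_exp DERIV_isCont by blast
  hence "continuous_on UNIV (flat_exp j)" by (simp add: continuous_at_imp_continuous_on)
  thus ?case using C_diff_imp_continuous[OF u[of 0]]
    by (auto intro: continuous_on_compose2[of UNIV "flat_exp j"])
next
  case (Suc k)
  have du: "u differentiable (at x)" for x using u[of "Suc 0"] by simp
  have D: "((\<lambda>x. flat_exp j (u x)) has_derivative
     (\<lambda>v. (flat_exp (j + 2) (u x) - j * flat_exp (j + 1) (u x)) * frechet_derivative u (at x) v)) (at x)" for x
    using has_derivative_compose[OF du[unfolded frechet_derivative_works] DERIV_flat_exp[unfolded has_field_derivative_def]]
    by simp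
  have "C_diff k (\<lambda>x. (flat_exp (j + 2) (u x) + (- real j) * flat_exp (j + 1) (u x)) * frechet_derivative u (at x) v)" for v
    using u[of "Suc k"] by (intro C_diff_mult C_diff_add Suc.IH C_diff_const) auto
  thus ?case using D frechet_derivative_of[OF D] by (auto simp: differentiable_def)
qed

lemma test_functionD:
  assumes "test_function f"
  shows "C_diff k f" "continuous_on UNIV f" "\<And>x. f differentiable (at x)"
  using assms C_diff_imp_continuous[of 0 f] unfolding test_function_def
  by (auto dest: spec[of _ "Suc 0"])

lemma compact_support_subset:
  fixes f g :: "'a::euclidean_space \<Rightarrow> real"
  assumes "compact (closure {x. f x \<noteq> 0})" "\<And>x. f x = 0 \<Longrightarrow> g x = 0"
  shows "compact (closure {x. g x \<noteq> 0})"
  using assms bounded_subset[of "{x. f x \<noteq> 0}" "{x. g x \<noteq> 0}"] by (auto simp: compact_closure)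

lemma test_function_add: 
  assumes "test_function f" "test_function g" shows "test_function (\<lambda>x. f x + g x)"
proof -
  have "bounded ({x. f x \<noteq> 0} \<union> {x. g x \<noteq> 0})"
    using assms by (simp add: test_function_def compact_closure)
  hence "bounded {x. f x + g x \<noteq> 0}" by (rule bounded_subset) auto
  thus ?thesis using assms by (auto simp: test_function_def compact_closure intro: C_diff_add)
qed

lemma test_function_mult_left: 
  assumes "\<And>k. C_diff k f" "test_function g" shows "test_function (\<lambda>x. f x * g x)"
  using assms compact_support_subset[of g "\<lambda>x. f x * g x"] by (auto simp: test_function_def intro: C_diff_mult)

lemma test_function_mult: 
  assumes "test_function f" "test_function g" shows "test_function (\<lambda>x. f x * g x)"
  using assms test_function_mult_left by (auto simp: test_function_def)

lemma test_function_cmult: 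
  assumes "test_function g" shows "test_function (\<lambda>x. c * g x)"
  using test_function_mult_left[OF C_diff_const assms] .

lemma test_function_deriv:
  assumes "test_function f" shows "test_function (\<lambda>x. frechet_derivative f (at x) v)"
proof -
  have "C_diff k (\<lambda>x. frechet_derivative f (at x) v)" for k
    using assms unfolding test_function_def by (auto dest: spec[of _ "Suc k"])
  moreover have "compact (closure {x. frechet_derivative f (at x) v \<noteq> 0})"
  proof -
    let ?K = "closure {x. f x \<noteq> 0}"
    have "{x. frechet_derivative f (at x) v \<noteq> 0} \<subseteq> ?K"
    proof (rule ccontr)
      assume "\<not> ?thesis"
      then obtain x where x: "frechet_derivative f (at x) v \<noteq> 0" "x \<notin> ?K" by auto
      have "open (- ?K)" by auto
      moreover have "\<And>y. y \<in> - ?K \<Longrightarrow> 0 = f y" using closure_subset[of "{x. f x \<noteq> 0}"] by auto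
      moreover have "((\<lambda>_. 0::real) has_derivative (\<lambda>v. 0)) (at x)" by simp
      ultimately have "(f has_derivative (\<lambda>v. 0)) (at x)"
        using x(2) has_derivative_transform_within_open by (metis (no_types, lifting) Compl_iff)
      from frechet_derivative_of[OF this] x show False by simp
    qed
    thus ?thesis using assms bounded_subset[of ?K] unfolding test_function_def
      by (auto simp: compact_closure)
  qed
  ultimately show ?thesis by (simp add: test_function_def)
qed

lemma test_function_line_deriv:
  assumes "test_function f"
  shows "((\<lambda>s. f (x + s *\<^sub>R v)) has_real_derivative frechet_derivative f (at x) v) (at 0)"
proof -
  have "(f has_derivative frechet_derivative f (at x)) (at (x + 0 *\<^sub>R v))"
    using frechet_derivative_works[THEN iffD1, OF test_functionD(3)[OF assms]] by simp
  moreover have "((\<lambda>s. x + s *\<^sub>R v) has_derivative (\<lambda>s. s *\<^sub>R v)) (at 0)"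
    by (auto intro!: derivative_eq_intros)
  ultimately have "((\<lambda>s. f (x + s *\<^sub>R v)) has_derivative (\<lambda>s. frechet_derivative f (at x) (s *\<^sub>R v))) (at 0)"
    using has_derivative_compose[of "\<lambda>s. x + s *\<^sub>R v" "\<lambda>s. s *\<^sub>R v" 0 UNIV f "frechet_derivative f (at x)"] by simp
  moreover have "frechet_derivative f (at x) (s *\<^sub>R v) = s * frechet_derivative f (at x) v" for s
    using linear_frechet_derivative[OF test_functionD(3)[OF assms]] by (simp add: linear_cmul)
  ultimately show ?thesis by (simp add: has_field_derivative_def mult.commute[of _ "frechet_derivative f (at x) v"])
qed

subsection \<open>Fourier transforms of test functions and the half-laplacian\<close>

text \<open>Continuous with bounded support. Absolute values and powers of test functions leave the
  smooth class but not this one, and it suffices for Poisson extensions because their derivatives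
  fall on the kernel.\<close>

definition ccs :: "('a::euclidean_space \<Rightarrow> real) \<Rightarrow> bool" where
  "ccs f \<longleftrightarrow> continuous_on UNIV f \<and> bounded {x. f x \<noteq> 0}"

lemma test_function_ccs: "test_function f \<Longrightarrow> ccs f"
  using test_functionD(2)[of f] by (simp add: ccs_def test_function_def compact_closure)

lemma ccs_mult: "ccs f \<Longrightarrow> continuous_on UNIV g \<Longrightarrow> ccs (\<lambda>x. f x * g x)"
  unfolding ccs_def by (auto intro: continuous_intros elim: bounded_subset)

lemma ccs_cmult: "ccs f \<Longrightarrow> ccs (\<lambda>x. c * f x)"
  unfolding ccs_def by (auto intro: continuous_intros elim: bounded_subset)

lemma ccs_add: "ccs f \<Longrightarrow> ccs g \<Longrightarrow> ccs (\<lambda>x. f x + g x)"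
  unfolding ccs_def
  by (auto intro!: continuous_intros bounded_subset[of "{x. f x \<noteq> 0} \<union> {x. g x \<noteq> 0}" "{x. f x + g x \<noteq> 0}"])

lemma ccs_diff: "ccs f \<Longrightarrow> ccs g \<Longrightarrow> ccs (\<lambda>x. f x - g x)"
  using ccs_add[of f "\<lambda>x. (-1) * g x"] ccs_cmult[of g "-1"] by simp

lemma ccs_abs_powr: "ccs f \<Longrightarrow> 0 < r \<Longrightarrow> ccs (\<lambda>x. \<bar>f x\<bar> powr r)"
  unfolding ccs_def by (auto intro!: continuous_intros continuous_on_powr' elim: bounded_subset)

lemma ccs_abs: "ccs f \<Longrightarrow> ccs (\<lambda>x. \<bar>f x\<bar>)"
  unfolding ccs_def by (auto intro!: continuous_intros elim: bounded_subset)

lemma ccs_measurable: "ccs f \<Longrightarrow> f \<in> borel_measurable borel"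
  by (auto simp: ccs_def intro: borel_measurable_continuous_onI)

lemma ccs_box:
  assumes "ccs f" obtains a where "\<And>x. x \<notin> cbox (-a) a \<Longrightarrow> f x = 0"
proof -
  have "bounded {x. f x \<noteq> 0}" using assms by (simp add: ccs_def)
  then obtain a where "{x. f x \<noteq> 0} \<subseteq> cbox (-a) a" using bounded_subset_cbox_symmetric by blast
  thus ?thesis by (intro that[of a]) auto
qed

lemma ccs_bounded:
  fixes f :: "'a::euclidean_space \<Rightarrow> real"
  assumes "ccs f" obtains B where "0 < B" "\<And>x. \<bar>f x\<bar> \<le> B"
proof -
  obtain a where a: "\<And>x. x \<notin> cbox (-a) a \<Longrightarrow> f x = 0" using ccs_box[OF assms] by blast
  have "continuous_on (cbox (-a) a) f" using assms by (auto simp: ccs_def intro: continuous_on_subset)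
  hence "bounded (f ` cbox (-a) a)" by (intro compact_imp_bounded compact_continuous_image compact_cbox)
  then obtain B where B: "0 < B" "\<And>x. x \<in> cbox (-a) a \<Longrightarrow> \<bar>f x\<bar> \<le> B"
    unfolding bounded_pos by auto
  have "\<bar>f x\<bar> \<le> B" for x using a[of x] B by (cases "x \<in> cbox (-a) a") auto
  with B(1) show ?thesis by (rule that)
qed

lemma ccs_integrable:
  assumes "ccs f" shows "integrable lborel f"
proof -
  obtain a where a: "\<And>x. x \<notin> cbox (-a) a \<Longrightarrow> f x = 0" using ccs_box[OF assms] by blast
  have "continuous_on (cbox (-a) a) f" using assms by (auto simp: ccs_def intro: continuous_on_subset)
  hence "set_integrable lborel (cbox (-a) a) f" using borel_integrable_compact[of "cbox (-a) a" f]
    by (simp add: set_integrable_def compact_cbox)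
  moreover have "(\<lambda>x. indicator (cbox (-a) a) x *\<^sub>R f x) = f"
    using a by (auto simp: indicator_def fun_eq_iff)
  ultimately show ?thesis by (simp add: set_integrable_def)
qed

text \<open>If the integral were 0, the zero set of \<open>f\<close> would be closed and of full
  measure, hence the whole space.\<close>

lemma ccs_integral_pos:
  fixes f :: "'a::euclidean_space \<Rightarrow> real"
  assumes f: "ccs f" and p: "\<And>x. 0 \<le> f x" "0 < f x0"
  shows "0 < integral\<^sup>L lborel f"
proof (rule ccontr)
  assume "\<not> ?thesis"
  moreover have "0 \<le> integral\<^sup>L lborel f" using p(1) by (intro integral_nonneg_AE AE_I2) auto
  ultimately have "integral\<^sup>L lborel f = 0" by linarith
  hence "AE y in lborel. f y = 0"
    using integral_nonneg_eq_0_iff_AE[OF ccs_integrable[OF f]] p by simp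
  hence "AE y in lebesgue. y \<in> {y. f y = 0}" by (auto intro: AE_completion)
  moreover have "closed {y. f y = 0}"
    using f by (intro closed_Collect_eq) (auto simp: ccs_def intro: continuous_intros)
  ultimately have "f x0 = 0" using mem_closed_if_AE_lebesgue by blast
  thus False using p by simp
qed

lemma ccs_mult_integrable:
  fixes f :: "'a::euclidean_space \<Rightarrow> real"
  shows "ccs f \<Longrightarrow> continuous_on UNIV g \<Longrightarrow> integrable lborel (\<lambda>x. f x * g x)"
  by (intro ccs_integrable ccs_mult)

lemma cis_borel_measurable [measurable]: "cis \<in> borel_measurable borel"
  unfolding cis_conv_exp by (intro borel_measurable_continuous_onI continuous_intros)

lemma pair_integrable_mult_bounded:
  fixes f :: "'a::euclidean_space \<Rightarrow> complex" and g :: "'b::euclidean_space \<Rightarrow> complex" and e :: "'a \<times> 'b \<Rightarrow> complex"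
  assumes f: "integrable lborel f" and g: "integrable lborel g"
    and e: "e \<in> borel_measurable (lborel \<Otimes>\<^sub>M lborel)" "\<And>p. norm (e p) \<le> 1"
  shows "integrable (lborel \<Otimes>\<^sub>M lborel) (\<lambda>(x, y). f x * g y * e (x, y))"
proof (rule Bochner_Integration.integrable_bound[where f = "\<lambda>(x, y). f x * g y"])
  have [measurable]: "f \<in> borel_measurable borel" "g \<in> borel_measurable borel" using f g by auto
  have [measurable]: "e \<in> borel_measurable (borel \<Otimes>\<^sub>M borel)"
    using e(1) unfolding measurable_cong_sets[OF sets_pair_measure_cong[OF sets_lborel sets_lborel] refl] .
  show "integrable (lborel \<Otimes>\<^sub>M lborel) (\<lambda>(x, y). f x * g y)"
  proof (rule lborel_pair.Fubini_integrable)
    show "integrable lborel (\<lambda>x. LINT y|lborel. norm (case (x, y) of (x, y) \<Rightarrow> f x * g y))"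
      using f by (simp add: norm_mult integrable_mult_left)
    show "AE x in lborel. integrable lborel (\<lambda>y. case (x, y) of (x, y) \<Rightarrow> f x * g y)"
      using g by simp
  qed measurable
  show "(\<lambda>(x, y). f x * g y * e (x, y)) \<in> borel_measurable (lborel \<Otimes>\<^sub>M lborel)" by measurable
  have "norm (f x * g y * e (x, y)) \<le> norm (f x * g y)" for x y
    using mult_left_mono[OF e(2)[of "(x, y)"], of "norm (f x * g y)"] by (simp add: norm_mult)
  thus "AE p in lborel \<Otimes>\<^sub>M lborel. norm (case p of (x, y) \<Rightarrow> f x * g y * e (x, y)) \<le> norm (case p of (x, y) \<Rightarrow> f x * g y)"
    by (auto simp: split_beta)
qed

text \<open>\<open>integral_line_derivative_eq_0\<close> concerns real-valued functions, so the
  transform is handled through its cosine and sine parts, each of which differentiates into the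
  other.\<close>

lemma cos_sin_deriv_integrals:
  fixes f :: "'a::euclidean_space \<Rightarrow> real"
  assumes f: "test_function f"
  shows "(LINT x|lborel. frechet_derivative f (at x) v * cos (x \<bullet> \<xi>)) = (v \<bullet> \<xi>) * (LINT x|lborel. f x * sin (x \<bullet> \<xi>))"
    and "(LINT x|lborel. frechet_derivative f (at x) v * sin (x \<bullet> \<xi>)) = - (v \<bullet> \<xi>) * (LINT x|lborel. f x * cos (x \<bullet> \<xi>))"
proof -
  note fv = test_function_deriv[OF f, of v]
  note c = test_functionD(2)[OF f] test_functionD(2)[OF fv]
  note i = ccs_mult_integrable[OF test_function_ccs[OF f]] ccs_mult_integrable[OF test_function_ccs[OF fv]]
  have lin: "((\<lambda>s. (x + s *\<^sub>R v) \<bullet> \<xi>) has_real_derivative v \<bullet> \<xi>) (at 0)" for x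
    by (auto simp: inner_add_left intro!: derivative_eq_intros)
  have "(LINT x|lborel. frechet_derivative f (at x) v * cos (x \<bullet> \<xi>) - (v \<bullet> \<xi>) * (f x * sin (x \<bullet> \<xi>))) = 0"
    by (rule integral_line_derivative_eq_0[where u = "\<lambda>x. f x * cos (x \<bullet> \<xi>)" and v = v])
      (auto intro!: derivative_eq_intros test_function_line_deriv[OF f] lin i continuous_intros c)
  thus "(LINT x|lborel. frechet_derivative f (at x) v * cos (x \<bullet> \<xi>)) = (v \<bullet> \<xi>) * (LINT x|lborel. f x * sin (x \<bullet> \<xi>))"
    by (subst (asm) Bochner_Integration.integral_diff) (auto intro!: i continuous_intros)
  have "(LINT x|lborel. frechet_derivative f (at x) v * sin (x \<bullet> \<xi>) + (v \<bullet> \<xi>) * (f x * cos (x \<bullet> \<xi>))) = 0"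
    by (rule integral_line_derivative_eq_0[where u = "\<lambda>x. f x * sin (x \<bullet> \<xi>)" and v = v])
      (auto intro!: derivative_eq_intros test_function_line_deriv[OF f] lin i continuous_intros c)
  thus "(LINT x|lborel. frechet_derivative f (at x) v * sin (x \<bullet> \<xi>)) = - (v \<bullet> \<xi>) * (LINT x|lborel. f x * cos (x \<bullet> \<xi>))"
    by (subst (asm) Bochner_Integration.integral_add) (auto intro!: i continuous_intros)
qed

lemma fourier_integrable:
  fixes f :: "'a::euclidean_space \<Rightarrow> real"
  assumes "ccs f" shows "integrable lborel (\<lambda>x. complex_of_real (f x) * cis (- (x \<bullet> \<xi>)))"
proof (rule Bochner_Integration.integrable_bound[OF ccs_integrable[OF assms]])
  have [measurable]: "f \<in> borel_measurable borel" by (rule ccs_measurable[OF assms])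
  show "(\<lambda>x. complex_of_real (f x) * cis (- (x \<bullet> \<xi>))) \<in> borel_measurable lborel" by measurable
qed (auto simp: norm_mult)

lemma fourier_Complex:
  fixes f :: "'a::euclidean_space \<Rightarrow> real"
  assumes "ccs f"
  shows "fourier f \<xi> = Complex (LINT x|lborel. f x * cos (x \<bullet> \<xi>)) (- (LINT x|lborel. f x * sin (x \<bullet> \<xi>)))"
  unfolding fourier_def using fourier_integrable[OF assms, of \<xi>]
  by (intro complex_eqI) (simp_all flip: integral_Re integral_Im)

lemma fourier_norm_le:
  fixes f :: "'a::euclidean_space \<Rightarrow> real"
  assumes "ccs f" shows "norm (fourier f \<xi>) \<le> (LINT x|lborel. \<bar>f x\<bar>)"
  unfolding fourier_def using integral_norm_bound[of lborel "\<lambda>x. complex_of_real (f x) * cis (- (x \<bullet> \<xi>))"]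
  by (simp add: norm_mult)

lemma fourier_deriv:
  fixes f :: "'a::euclidean_space \<Rightarrow> real"
  assumes f: "test_function f"
  shows "fourier (\<lambda>x. frechet_derivative f (at x) v) \<xi> = \<i> * complex_of_real (v \<bullet> \<xi>) * fourier f \<xi>"
  unfolding fourier_Complex[OF test_function_ccs[OF f]] fourier_Complex[OF test_function_ccs[OF test_function_deriv[OF f]]]
    cos_sin_deriv_integrals[OF f]
  by (simp add: complex_eq_iff)

lemma fourier_add:
  assumes "ccs f" "ccs g"
  shows "fourier (\<lambda>x. f x + g x) \<xi> = fourier f \<xi> + fourier g \<xi>"
  unfolding fourier_def using fourier_integrable[OF assms(1), of \<xi>] fourier_integrable[OF assms(2), of \<xi>]
  by (simp add: distrib_right)

lemma fourier_cmult: "fourier (\<lambda>x. c * f x) \<xi> = complex_of_real c * fourier f \<xi>"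
  unfolding fourier_def by (simp add: mult.assoc)

lemma test_function_sum:
  "finite A \<Longrightarrow> (\<And>i. i \<in> A \<Longrightarrow> test_function (f i)) \<Longrightarrow> test_function (\<lambda>x. \<Sum>i\<in>A. f i x)"
proof (induction rule: finite_induct)
  case empty show ?case by (simp add: test_function_def C_diff_const)
qed (simp add: test_function_add)

lemma fourier_sum:
  "finite A \<Longrightarrow> (\<And>i. i \<in> A \<Longrightarrow> test_function (f i)) \<Longrightarrow> fourier (\<lambda>x. \<Sum>i\<in>A. f i x) \<xi> = (\<Sum>i\<in>A. fourier (f i) \<xi>)"
proof (induction rule: finite_induct)
  case empty show ?case by (simp add: fourier_def)
next
  case (insert x A)
  thus ?case using test_function_sum[of A f]
    by (simp add: fourier_add test_function_ccs)
qed

text \<open>Passing from f to f - \<Delta>f multiplies the transform by 1 + |\<xi>|^2 and stays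
  within test functions. Each induction step thus gains one power, starting from the trivial bound
  by the integral of |f|.\<close>

lemma fourier_decay:
  fixes f :: "'a::euclidean_space \<Rightarrow> real"
  assumes "test_function f"
  shows "\<exists>C. \<forall>\<xi>. (1 + \<xi> \<bullet> \<xi>) ^ m * norm (fourier f \<xi>) \<le> C"
  using assms
proof (induction m arbitrary: f)
  case 0 thus ?case using fourier_norm_le[OF test_function_ccs] by auto
next
  case (Suc m)
  define D where "D b g x = frechet_derivative g (at x) b" for b :: 'a and g :: "'a \<Rightarrow> real" and x
  define h where "h x = f x + (\<Sum>b\<in>Basis. (-1) * D b (D b f) x)" for x
  have tD: "test_function (D b g)" if "test_function g" for b g
    using test_function_deriv[OF that, of b] by (simp add: D_def[abs_def])
  have tb: "test_function (\<lambda>x. (-1) * D b (D b f) x)" for b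
    by (intro test_function_cmult tD Suc.prems)
  have ts: "test_function (\<lambda>x. \<Sum>b\<in>Basis. (-1) * D b (D b f) x)"
    by (intro test_function_sum tb finite_Basis)
  have h: "test_function h" unfolding h_def by (intro test_function_add ts Suc.prems)
  have fD: "fourier (D b g) \<xi> = \<i> * complex_of_real (b \<bullet> \<xi>) * fourier g \<xi>" if "test_function g" for b g \<xi>
    using fourier_deriv[OF that, of b \<xi>] by (simp add: D_def[abs_def])
  have "fourier h \<xi> = complex_of_real (1 + \<xi> \<bullet> \<xi>) * fourier f \<xi>" for \<xi>
  proof -
    have ii: "\<i> * a * (\<i> * a * F) = - (a * a * F)" for a F :: complex
    proof -
      have "\<i> * a * (\<i> * a * F) = (\<i> * \<i>) * (a * a * F)" by (simp only: mult_ac)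
      thus ?thesis by simp
    qed
    have fD2: "fourier (\<lambda>x. (-1) * D b (D b f) x) \<xi> = complex_of_real ((\<xi> \<bullet> b) * (\<xi> \<bullet> b)) * fourier f \<xi>" for b
      using fourier_cmult[of "-1" "D b (D b f)" \<xi>] fD[OF tD[OF Suc.prems], of b b \<xi>] fD[OF Suc.prems, of b \<xi>]
      by (simp add: inner_commute[of b] ii)
    have "fourier h \<xi> = fourier f \<xi> + (\<Sum>b\<in>Basis. fourier (\<lambda>x. (-1) * D b (D b f) x) \<xi>)"
      unfolding h_def using fourier_add[OF test_function_ccs[OF Suc.prems] test_function_ccs[OF ts]]
        fourier_sum[OF finite_Basis tb] by simp
    also have "\<dots> = fourier f \<xi> + (\<Sum>b\<in>Basis. complex_of_real ((\<xi> \<bullet> b) * (\<xi> \<bullet> b)) * fourier f \<xi>)"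
      unfolding fD2 ..
    also have "(\<Sum>b\<in>Basis. complex_of_real ((\<xi> \<bullet> b) * (\<xi> \<bullet> b)) * fourier f \<xi>) = complex_of_real (\<xi> \<bullet> \<xi>) * fourier f \<xi>"
      by (simp add: euclidean_inner[of \<xi> \<xi>] sum_distrib_right)
    finally show ?thesis by (simp add: algebra_simps)
  qed
  hence "norm (fourier h \<xi>) = (1 + \<xi> \<bullet> \<xi>) * norm (fourier f \<xi>)" for \<xi>
    by (simp only: norm_mult norm_of_real) (simp add: add_nonneg_nonneg)
  thus ?case using Suc.IH[OF h] by (simp add: algebra_simps)
qed

lemma fourier_measurable:
  fixes f :: "'a::euclidean_space \<Rightarrow> real"
  assumes [measurable]: "f \<in> borel_measurable borel"
  shows "fourier f \<in> borel_measurable borel"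
proof -
  have "(\<lambda>\<xi>. LINT x|lborel. complex_of_real (f x) * cis (- (x \<bullet> \<xi>))) \<in> borel_measurable (borel :: 'a measure)"
    by (rule lborel.borel_measurable_lebesgue_integral) measurable
  thus ?thesis by (simp add: fourier_def[abs_def])
qed

lemma fourier_moment_integrable:
  fixes f :: "'a::euclidean_space \<Rightarrow> real"
  assumes f: "test_function f"
  shows "integrable lborel (\<lambda>\<xi>. complex_of_real (norm \<xi>) * fourier f \<xi>)"
    and "integrable lborel (fourier f)"
proof -
  have [measurable]: "fourier f \<in> borel_measurable borel"
    by (rule fourier_measurable) (rule ccs_measurable[OF test_function_ccs[OF f]])
  \<comment> \<open>The exponent is n + 1: one factor 1 + |\<xi>|^2 pays for the moment 1 + |\<xi>|,
    and the other n leave (1 + |\<xi>|^2)^(-n), integrable by \<open>bessel_integral\<close> because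
    n > n/2.\<close>
  obtain C where C: "\<And>\<xi>. (1 + \<xi> \<bullet> \<xi>) ^ (Suc DIM('a)) * norm (fourier f \<xi>) \<le> C"
    using fourier_decay[OF f] by blast
  have B: "integrable lborel (\<lambda>\<xi>::'a. C * (1 + \<xi> \<bullet> \<xi>) powr (- real DIM('a)))"
    by (intro integrable_mult_right integrable.intros[OF bessel_integral]) auto
  have bd: "(1 + norm \<xi>) * norm (fourier f \<xi>) \<le> 2 * (C * (1 + \<xi> \<bullet> \<xi>) powr (- real DIM('a)))" for \<xi>
  proof -
    have p: "1 \<le> 1 + \<xi> \<bullet> \<xi>" by simp
    have n: "norm \<xi> \<le> 1 + \<xi> \<bullet> \<xi>"
      using zero_le_power2[of "norm \<xi> - 1"] by (simp add: power2_norm_eq_inner[symmetric] power2_diff) (smt (verit) norm_ge_zero)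
    have "(1 + norm \<xi>) * norm (fourier f \<xi>) \<le> (2 * (1 + \<xi> \<bullet> \<xi>)) * norm (fourier f \<xi>)"
    proof (intro mult_right_mono norm_ge_zero)
      have "1 + a \<le> 2 * (1 + b)" if "a \<le> 1 + b" "0 \<le> b" for a b :: real using that by argo
      from this[OF n inner_ge_zero] show "1 + norm \<xi> \<le> 2 * (1 + \<xi> \<bullet> \<xi>)" .
    qed
    also have "\<dots> = 2 * ((1 + \<xi> \<bullet> \<xi>) ^ (Suc DIM('a)) * norm (fourier f \<xi>)) * (1 + \<xi> \<bullet> \<xi>) powr (- real DIM('a))"
    proof -
      have p0: "0 < 1 + \<xi> \<bullet> \<xi>" by (rule add_pos_nonneg) simp_all
      have E: "(1 + \<xi> \<bullet> \<xi>) ^ DIM('a) * (1 + \<xi> \<bullet> \<xi>) powr (- real DIM('a)) = 1"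
        unfolding powr_minus powr_realpow[OF p0] by (rule right_inverse) (use p0 in simp)
      have "2 * (q ^ Suc d * N) * Q = (2 * q * N) * (q ^ d * Q)" for q N Q :: real and d :: nat
        by simp
      from this[of "1 + \<xi> \<bullet> \<xi>" "DIM('a)" "norm (fourier f \<xi>)" "(1 + \<xi> \<bullet> \<xi>) powr (- real DIM('a))"]
      show ?thesis unfolding E by (simp only: mult_1_right)
    qed
    also have "\<dots> \<le> 2 * C * (1 + \<xi> \<bullet> \<xi>) powr (- real DIM('a))"
      by (intro mult_right_mono mult_left_mono C) auto
    finally show ?thesis by simp
  qed
  have bd1: "norm \<xi> * norm (fourier f \<xi>) \<le> \<bar>2 * (C * (1 + \<xi> \<bullet> \<xi>) powr (- real DIM('a)))\<bar>"
    and bd2: "norm (fourier f \<xi>) \<le> \<bar>2 * (C * (1 + \<xi> \<bullet> \<xi>) powr (- real DIM('a)))\<bar>" for \<xi>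
  proof -
    have e: "(1 + norm \<xi>) * norm (fourier f \<xi>) = norm (fourier f \<xi>) + norm \<xi> * norm (fourier f \<xi>)"
      by (simp add: algebra_simps)
    have "0 \<le> norm \<xi> * norm (fourier f \<xi>)" "0 \<le> norm (fourier f \<xi>)" by auto
    with bd[of \<xi>] e show "norm \<xi> * norm (fourier f \<xi>) \<le> \<bar>2 * (C * (1 + \<xi> \<bullet> \<xi>) powr (- real DIM('a)))\<bar>"
      and "norm (fourier f \<xi>) \<le> \<bar>2 * (C * (1 + \<xi> \<bullet> \<xi>) powr (- real DIM('a)))\<bar>" by linarith+
  qed
  show "integrable lborel (\<lambda>\<xi>. complex_of_real (norm \<xi>) * fourier f \<xi>)"
    by (rule Bochner_Integration.integrable_bound[OF integrable_mult_right[OF B, of 2]])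
      (use bd1 in \<open>auto simp: norm_mult\<close>)
  show "integrable lborel (fourier f)"
    by (rule Bochner_Integration.integrable_bound[OF integrable_mult_right[OF B, of 2]]) (use bd2 in auto)
qed

lemma half_laplacian_integrable:
  fixes f :: "'a::euclidean_space \<Rightarrow> real"
  assumes f: "test_function f"
  shows "integrable lborel (\<lambda>\<xi>. complex_of_real (norm \<xi>) * fourier f \<xi> * cis (x \<bullet> \<xi>))"
proof (rule Bochner_Integration.integrable_bound[OF fourier_moment_integrable(1)[OF f]])
  have [measurable]: "fourier f \<in> borel_measurable borel"
    by (rule fourier_measurable) (rule ccs_measurable[OF test_function_ccs[OF f]])
  show "(\<lambda>\<xi>. complex_of_real (norm \<xi>) * fourier f \<xi> * cis (x \<bullet> \<xi>)) \<in> borel_measurable lborel" by measurable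
qed (auto simp: norm_mult)

lemma half_laplacian_cmult:
  fixes f :: "'a::euclidean_space \<Rightarrow> real"
  shows "half_laplacian (\<lambda>x. c * f x) x = c * half_laplacian f x"
proof -
  have "(LINT \<xi>|lborel. complex_of_real (norm \<xi>) * fourier (\<lambda>x. c * f x) \<xi> * cis (x \<bullet> \<xi>))
    = (LINT \<xi>|lborel. complex_of_real c * (complex_of_real (norm \<xi>) * fourier f \<xi> * cis (x \<bullet> \<xi>)))"
    unfolding fourier_cmult by (intro Bochner_Integration.integral_cong refl) (simp add: mult_ac)
  thus ?thesis unfolding half_laplacian_def by simp
qed

lemma half_laplacian_continuous:
  fixes f :: "'a::euclidean_space \<Rightarrow> real"
  assumes f: "test_function f"
  shows "continuous_on UNIV (half_laplacian f)"
proof -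
  have [measurable]: "fourier f \<in> borel_measurable borel"
    by (rule fourier_measurable) (rule ccs_measurable[OF test_function_ccs[OF f]])
  have "isCont (\<lambda>x. LINT \<xi>|lborel. complex_of_real (norm \<xi>) * fourier f \<xi> * cis (x \<bullet> \<xi>)) x" for x
  proof (rule continuous_at_sequentiallyI)
    fix u :: "nat \<Rightarrow> 'a" assume u: "u \<longlonglongrightarrow> x"
    show "(\<lambda>n. LINT \<xi>|lborel. complex_of_real (norm \<xi>) * fourier f \<xi> * cis (u n \<bullet> \<xi>))
      \<longlonglongrightarrow> (LINT \<xi>|lborel. complex_of_real (norm \<xi>) * fourier f \<xi> * cis (x \<bullet> \<xi>))"
    proof (rule integral_dominated_convergence[OF _ _ integrable_norm[OF fourier_moment_integrable(1)[OF f]]])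
      show "AE \<xi> in lborel. (\<lambda>n. complex_of_real (norm \<xi>) * fourier f \<xi> * cis (u n \<bullet> \<xi>))
         \<longlonglongrightarrow> complex_of_real (norm \<xi>) * fourier f \<xi> * cis (x \<bullet> \<xi>)"
        unfolding cis_conv_exp by (intro always_eventually allI tendsto_intros u)
    qed (auto simp: norm_mult)
  qed
  thus ?thesis unfolding half_laplacian_def
    by (auto intro!: continuous_at_imp_continuous_on continuous_intros)
qed

text \<open>By Fubini either pairing is the real part of the integral of |\<xi>| times one transform
  times the conjugate of the other, and conjugation exchanges the two functions without changing the
  real part.\<close>

lemma half_laplacian_selfadjoint:
  fixes f g :: "'a::euclidean_space \<Rightarrow> real"
  assumes f: "test_function f" and g: "test_function g"
  shows "(LINT x|lborel. half_laplacian f x * g x) = (LINT x|lborel. f x * half_laplacian g x)"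
proof -
  have *: "(LINT x|lborel. g x * half_laplacian f x)
     = Re (LINT \<xi>|lborel. complex_of_real (norm \<xi>) * fourier f \<xi> * cnj (fourier g \<xi>)) / (2 * pi) ^ DIM('a)"
    if f: "test_function f" and g: "test_function g" for f g :: "'a \<Rightarrow> real"
  proof -
    have [measurable]: "g \<in> borel_measurable borel" by (rule ccs_measurable[OF test_function_ccs[OF g]])
    have [measurable]: "fourier f \<in> borel_measurable borel"
      by (rule fourier_measurable) (rule ccs_measurable[OF test_function_ccs[OF f]])
    have I: "integrable (lborel \<Otimes>\<^sub>M lborel) (\<lambda>(x, \<xi>). complex_of_real (g x) * (complex_of_real (norm \<xi>) * fourier f \<xi>) * cis (x \<bullet> \<xi>))"
      using pair_integrable_mult_bounded[of "\<lambda>x. complex_of_real (g x)" "\<lambda>\<xi>. complex_of_real (norm \<xi>) * fourier f \<xi>" "\<lambda>p. cis (fst p \<bullet> snd p)"]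
        fourier_moment_integrable(1)[OF f] ccs_integrable[OF test_function_ccs[OF g]] by simp
    have "complex_of_real (g x) * (complex_of_real (norm \<xi>) * fourier f \<xi>) * cis (x \<bullet> \<xi>)
       = complex_of_real (norm \<xi>) * fourier f \<xi> * cnj (complex_of_real (g x) * cis (- (x \<bullet> \<xi>)))" for x \<xi>
      by (simp add: cis_cnj)
    hence e0: "(LINT x|lborel. complex_of_real (g x) * (complex_of_real (norm \<xi>) * fourier f \<xi>) * cis (x \<bullet> \<xi>))
       = (LINT x|lborel. complex_of_real (norm \<xi>) * fourier f \<xi> * cnj (complex_of_real (g x) * cis (- (x \<bullet> \<xi>))))" for \<xi>
      by presburger
    have e1: "(LINT x|lborel. complex_of_real (g x) * (complex_of_real (norm \<xi>) * fourier f \<xi>) * cis (x \<bullet> \<xi>))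
       = complex_of_real (norm \<xi>) * fourier f \<xi> * cnj (fourier g \<xi>)" for \<xi>
      unfolding e0 fourier_def[of g] by (simp only: integral_mult_right_zero Bochner_Integration.integral_cnj)
    have e2: "(LINT \<xi>|lborel. complex_of_real (g x) * (complex_of_real (norm \<xi>) * fourier f \<xi>) * cis (x \<bullet> \<xi>))
       = complex_of_real (g x) * (LINT \<xi>|lborel. complex_of_real (norm \<xi>) * fourier f \<xi> * cis (x \<bullet> \<xi>))" for x
      by (simp add: mult.assoc)
    have "(LINT x|lborel. g x * half_laplacian f x) = (LINT x|lborel. Re (LINT \<xi>|lborel. complex_of_real (g x) * (complex_of_real (norm \<xi>) * fourier f \<xi>) * cis (x \<bullet> \<xi>)) / (2 * pi) ^ DIM('a))"
      unfolding e2 half_laplacian_def by simp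
    also have "\<dots> = Re (LINT x|lborel. (LINT \<xi>|lborel. complex_of_real (g x) * (complex_of_real (norm \<xi>) * fourier f \<xi>) * cis (x \<bullet> \<xi>))) / (2 * pi) ^ DIM('a)"
      using lborel_pair.integrable_fst[OF I] by simp
    also have "(LINT x|lborel. (LINT \<xi>|lborel. complex_of_real (g x) * (complex_of_real (norm \<xi>) * fourier f \<xi>) * cis (x \<bullet> \<xi>)))
      = (LINT \<xi>|lborel. (LINT x|lborel. complex_of_real (g x) * (complex_of_real (norm \<xi>) * fourier f \<xi>) * cis (x \<bullet> \<xi>)))"
      by (rule lborel_pair.Fubini_integral[OF I, symmetric])
    finally show ?thesis unfolding e1 .
  qed
  have "Re (LINT \<xi>|lborel. complex_of_real (norm \<xi>) * fourier f \<xi> * cnj (fourier g \<xi>))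
      = Re (cnj (LINT \<xi>|lborel. complex_of_real (norm \<xi>) * fourier f \<xi> * cnj (fourier g \<xi>)))" by simp
  also have "cnj (LINT \<xi>|lborel. complex_of_real (norm \<xi>) * fourier f \<xi> * cnj (fourier g \<xi>))
     = (LINT \<xi>|lborel. complex_of_real (norm \<xi>) * fourier g \<xi> * cnj (fourier f \<xi>))"
    unfolding Bochner_Integration.integral_cnj[symmetric] by (intro Bochner_Integration.integral_cong refl) simp
  finally show ?thesis using *[OF f g] *[OF g f] by (simp add: mult.commute)
qed

subsection \<open>Poisson extensions\<close>

abbreviation halfspace :: "('a::euclidean_space \<times> real) set" where
  "halfspace \<equiv> {z. 0 < snd z}"

definition poisson_mass :: "'a::euclidean_space itself \<Rightarrow> real" where
  "poisson_mass _ = (LINT x::'a|lborel. (1 + x \<bullet> x) powr (- (real DIM('a) + 1) / 2))"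

definition pk :: "'a::euclidean_space \<times> real \<Rightarrow> real" where
  "pk z = snd z * (z \<bullet> z) powr (- (real DIM('a) + 1) / 2) / poisson_mass TYPE('a)"

text \<open>\<open>pk1 v\<close> is the derivative of the Poisson kernel in direction
  \<open>v\<close> of the half-space, and \<open>pk2 v w\<close> below is the further derivative in
  direction \<open>w\<close>; \<open>pk_line_deriv\<close> confirms this. Closed formulas make
  continuity, symmetry, harmonicity and size estimates computations.\<close>

definition pk1 :: "'a::euclidean_space \<times> real \<Rightarrow> 'a \<times> real \<Rightarrow> real" where
  "pk1 v z = (let k = (real DIM('a) + 1) / 2 in
     snd v * (z \<bullet> z) powr (- k) - 2 * k * (snd z * (z \<bullet> v)) * (z \<bullet> z) powr (- k - 1)) / poisson_mass TYPE('a)"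

definition pk2 :: "'a::euclidean_space \<times> real \<Rightarrow> 'a \<times> real \<Rightarrow> 'a \<times> real \<Rightarrow> real" where
  "pk2 v w z = (let k = (real DIM('a) + 1) / 2 in
     4 * k * (k + 1) * (snd z * (z \<bullet> v) * (z \<bullet> w)) * (z \<bullet> z) powr (- k - 2)
     - 2 * k * (snd v * (z \<bullet> w) + snd w * (z \<bullet> v) + snd z * (v \<bullet> w)) * (z \<bullet> z) powr (- k - 1)) / poisson_mass TYPE('a)"

lemma inner_pos_halfspace: "0 < snd z \<Longrightarrow> 0 < z \<bullet> z" for z :: "'a::euclidean_space \<times> real"
  by (metis inner_gt_zero_iff less_irrefl snd_zero)

lemma poisson_kernel_integral:
  assumes t: "0 < t"
  shows "integrable lborel (\<lambda>x::'a::euclidean_space. (t\<^sup>2 + x \<bullet> x) powr (- (real DIM('a) + 1) / 2))"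
    and "(LINT x::'a|lborel. t * (t\<^sup>2 + x \<bullet> x) powr (- (real DIM('a) + 1) / 2)) = poisson_mass TYPE('a)"
    and "0 < poisson_mass TYPE('a)"
proof -
  define k where "k = (real DIM('a) + 1) / 2"
  define A where "A = pi powr (real DIM('a) / 2) * Gamma (k - real DIM('a) / 2) / Gamma k"
  have k: "real DIM('a) / 2 < k" "real DIM('a) / 2 - k = - 1 / 2" "- (real DIM('a) + 1) / 2 = - k"
    by (auto simp: k_def field_simps)
  have k0: "0 < k" "0 < k - real DIM('a) / 2" using k by (auto simp: k_def)
  have G: "0 < Gamma k" "0 < Gamma (k - real DIM('a) / 2)" by (rule Gamma_real_pos[OF k0(1)] Gamma_real_pos[OF k0(2)])+
  have A0: "0 < A" unfolding A_def by (rule divide_pos_pos mult_pos_pos G)+ (rule G | simp)+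
  have B: "has_bochner_integral lborel (\<lambda>x::'a. (\<rho> + x \<bullet> x) powr (- k)) (A * \<rho> powr (- 1 / 2))" if "0 < \<rho>" for \<rho>
    using bessel_integral[OF k(1) that] unfolding A_def k(2) .
  have s: "(t\<^sup>2) powr (- 1 / 2) = inverse t"
    using t by (simp add: powr_minus powr_half_sqrt)
  have 1: "poisson_mass TYPE('a) = A"
    unfolding poisson_mass_def k(3) using has_bochner_integral_integral_eq[OF B[of 1]] by simp
  show "0 < poisson_mass TYPE('a)" unfolding 1 by (rule A0)
  show "integrable lborel (\<lambda>x::'a. (t\<^sup>2 + x \<bullet> x) powr (- (real DIM('a) + 1) / 2))"
    unfolding k(3) by (rule integrable.intros[OF B]) (use t in simp)
  have "(LINT x::'a|lborel. (t\<^sup>2 + x \<bullet> x) powr (- k)) = A * inverse t"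
    using has_bochner_integral_integral_eq[OF B[of "t\<^sup>2"]] t unfolding s by simp
  thus "(LINT x::'a|lborel. t * (t\<^sup>2 + x \<bullet> x) powr (- (real DIM('a) + 1) / 2)) = poisson_mass TYPE('a)"
    unfolding k(3) 1 using t by simp
qed

lemmas poisson_mass_pos = poisson_kernel_integral(3)[OF zero_less_one]

lemma pk_Pair: "pk (x, t) = t * (t\<^sup>2 + x \<bullet> x) powr (- (real DIM('a) + 1) / 2) / poisson_mass TYPE('a)"
  for x :: "'a::euclidean_space"
  by (simp add: pk_def power2_eq_square add.commute)

lemma pk_pos: "0 < snd z \<Longrightarrow> 0 < pk z" for z :: "'a::euclidean_space \<times> real"
  using inner_pos_halfspace[of z] poisson_mass_pos[where 'a='a] by (simp add: pk_def)

lemma pk_integral: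
  assumes t: "0 < t"
  shows "integrable lborel (\<lambda>x::'a::euclidean_space. pk (x, t))" "(LINT x::'a|lborel. pk (x, t)) = 1"
proof -
  show "integrable lborel (\<lambda>x::'a. pk (x, t))"
    unfolding pk_Pair using poisson_kernel_integral(1)[OF t, where 'a='a] by simp
  show "(LINT x::'a|lborel. pk (x, t)) = 1"
    unfolding pk_Pair using poisson_kernel_integral(2,3)[OF t, where 'a='a] by simp
qed

lemma pk_line_deriv:
  fixes z :: "'a::euclidean_space \<times> real"
  assumes z: "0 < snd z"
  shows "((\<lambda>s. pk (z + s *\<^sub>R v)) has_real_derivative pk1 v z) (at 0)"
    and "((\<lambda>s. pk1 v (z + s *\<^sub>R w)) has_real_derivative pk2 v w z) (at 0)"
proof -
  define k where "k = (real DIM('a) + 1) / 2"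
  define \<rho> where "\<rho> = z \<bullet> z"
  have \<rho>: "0 < \<rho>" unfolding \<rho>_def by (rule inner_pos_halfspace[OF z])
  have dz: "((\<lambda>s. (z + s *\<^sub>R v) \<bullet> (z + s *\<^sub>R v)) has_real_derivative 2 * (z \<bullet> v)) (at 0)" for v
    by (auto intro!: derivative_eq_intros simp: inner_add_left inner_add_right inner_commute)
  have dp: "((\<lambda>s. ((z + s *\<^sub>R v) \<bullet> (z + s *\<^sub>R v)) powr a) has_real_derivative a * \<rho> powr (a - 1) * (2 * (z \<bullet> v))) (at 0)" for v a
    using DERIV_fun_powr[OF dz, of v a] \<rho> by (simp add: \<rho>_def)
  have ds: "((\<lambda>s. snd (z + s *\<^sub>R v)) has_real_derivative snd v) (at 0)" for v
    by (auto intro!: derivative_eq_intros)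
  have di: "((\<lambda>s. (z + s *\<^sub>R w) \<bullet> v) has_real_derivative w \<bullet> v) (at 0)" for v w
    by (auto intro!: derivative_eq_intros simp: inner_add_left)
  have e: "- (real DIM('a) + 1) / 2 = - k" unfolding k_def by (rule minus_divide_left[symmetric])
  have "((\<lambda>s. pk (z + s *\<^sub>R v)) has_real_derivative
     (snd z * (- k * \<rho> powr (- k - 1) * (2 * (z \<bullet> v))) + snd v * \<rho> powr (- k)) / poisson_mass TYPE('a)) (at 0)"
    unfolding pk_def e using DERIV_mult'[OF ds[of v] dp[of v "- k"]]
    by (intro DERIV_cdivide) (simp add: \<rho>_def)
  moreover have "(snd z * (- k * \<rho> powr (- k - 1) * (2 * (z \<bullet> v))) + snd v * \<rho> powr (- k)) / poisson_mass TYPE('a) = pk1 v z"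
    unfolding pk1_def Let_def k_def[symmetric] \<rho>_def[symmetric] by (simp add: algebra_simps)
  ultimately show "((\<lambda>s. pk (z + s *\<^sub>R v)) has_real_derivative pk1 v z) (at 0)" by simp
  have "((\<lambda>s. pk1 v (z + s *\<^sub>R w)) has_real_derivative
     (snd v * (- k * \<rho> powr (- k - 1) * (2 * (z \<bullet> w)))
      - ((2 * k * (snd z * (z \<bullet> v))) * ((- k - 1) * \<rho> powr (- k - 1 - 1) * (2 * (z \<bullet> w)))
         + (2 * k * (snd z * (w \<bullet> v) + snd w * (z \<bullet> v))) * \<rho> powr (- k - 1))) / poisson_mass TYPE('a)) (at 0)"
    unfolding pk1_def Let_def k_def[symmetric]
    using DERIV_diff[OF DERIV_cmult[OF dp[of w "- k"], of "snd v"]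
       DERIV_mult'[OF DERIV_cmult[OF DERIV_mult'[OF ds[of w] di[of w v]], of "2 * k"] dp[of w "- k - 1"]]]
    by (intro DERIV_cdivide) (simp add: \<rho>_def)
  moreover have "(snd v * (- k * \<rho> powr (- k - 1) * (2 * (z \<bullet> w)))
      - ((2 * k * (snd z * (z \<bullet> v))) * ((- k - 1) * \<rho> powr (- k - 1 - 1) * (2 * (z \<bullet> w)))
         + (2 * k * (snd z * (w \<bullet> v) + snd w * (z \<bullet> v))) * \<rho> powr (- k - 1))) / poisson_mass TYPE('a) = pk2 v w z"
    unfolding pk2_def Let_def k_def[symmetric] \<rho>_def[symmetric] inner_commute[of w v]
    by (simp add: algebra_simps)
  ultimately show "((\<lambda>s. pk1 v (z + s *\<^sub>R w)) has_real_derivative pk2 v w z) (at 0)" by simp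
qed

lemma pk_continuous:
  "continuous_on halfspace (pk :: 'a::euclidean_space \<times> real \<Rightarrow> real)"
  "continuous_on halfspace (pk1 v :: 'a \<times> real \<Rightarrow> real)"
  "continuous_on halfspace (pk2 v w :: 'a \<times> real \<Rightarrow> real)"
  unfolding pk_def pk1_def pk2_def Let_def
  by (intro continuous_intros; use inner_pos_halfspace poisson_mass_pos[where 'a='a] in fastforce)+

lemma pk2_commute: "pk2 v w z = pk2 w v z"
  by (simp add: pk2_def inner_commute algebra_simps)

text \<open>Writing t for the height and \<rho> for |z|^2, the trace of the first part is 4 k (k +
  1) t \<rho>^(-k-1) and that of the second 2 k (2 + 2 k) t \<rho>^(-k-1). They cancel because the
  half-space has dimension n + 1 = 2 k, the value of the sum of b \<bullet> b over the
  basis.\<close>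

lemma pk_harmonic:
  fixes z :: "'a::euclidean_space \<times> real"
  assumes z: "0 < snd z"
  shows "(\<Sum>b\<in>Basis. pk2 b b z) = 0"
proof -
  define k where "k = (real DIM('a) + 1) / 2"
  define \<rho> where "\<rho> = z \<bullet> z"
  define c where "c = poisson_mass TYPE('a)"
  have \<rho>: "0 < \<rho>" unfolding \<rho>_def by (rule inner_pos_halfspace[OF z])
  have s1: "(\<Sum>b\<in>Basis. (z \<bullet> b) * (z \<bullet> b)) = \<rho>" unfolding \<rho>_def by (rule euclidean_inner[symmetric])
  have s2: "(\<Sum>b\<in>Basis. snd b * (z \<bullet> b)) = snd z"
  proof -
    have "snd z = z \<bullet> (0, 1)" by (cases z) simp
    also have "\<dots> = (\<Sum>b\<in>Basis. (z \<bullet> b) * ((0, 1) \<bullet> b))" by (rule euclidean_inner)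
    also have "\<dots> = (\<Sum>b\<in>Basis. snd b * (z \<bullet> b))" by (intro sum.cong refl) (auto simp: inner_prod_def)
    finally show ?thesis ..
  qed
  have s3: "(\<Sum>b\<in>(Basis :: ('a \<times> real) set). b \<bullet> b) = 2 * k"
    by (simp add: k_def inner_same_Basis)
  have pw: "\<rho> powr (- k - 1) = \<rho> * \<rho> powr (- k - 2)"
  proof -
    have "- k - 1 = 1 + (- k - 2)" by simp
    thus ?thesis using powr_add[of \<rho> 1 "- k - 2"] \<rho> by (simp only: powr_one order_less_imp_le)
  qed
  have "(\<Sum>b\<in>Basis. pk2 b b z) = (\<Sum>b\<in>Basis. (4 * k * (k + 1) * snd z * \<rho> powr (- k - 2) / c) * ((z \<bullet> b) * (z \<bullet> b))
      - (2 * k * \<rho> powr (- k - 1) / c) * (2 * (snd b * (z \<bullet> b)) + snd z * (b \<bullet> b)))"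
    unfolding pk2_def Let_def k_def[symmetric] \<rho>_def[symmetric] c_def[symmetric]
    by (intro sum.cong refl) (simp add: diff_divide_distrib algebra_simps)
  also have "\<dots> = (4 * k * (k + 1) * snd z * \<rho> powr (- k - 2) / c) * \<rho> - (2 * k * \<rho> powr (- k - 1) / c) * (2 * snd z + snd z * (2 * k))"
    by (simp only: sum_subtractf sum_distrib_left[symmetric] sum.distrib s1 s2 s3)
  also have "\<dots> = 0" unfolding pw by (simp add: algebra_simps)
  finally show ?thesis .
qed

text \<open>Since t \<le> |z|, every derivative costs at most a factor of order 1 / t relative to
  the kernel itself. The bounds by \<open>pk\<close> give Harnack-type estimates for positive data;
  the bounds by a pure power of t give the decay at large heights.\<close>

lemma pk_bounds:
  fixes z :: "'a::euclidean_space \<times> real"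
  defines "k \<equiv> (real DIM('a) + 1) / 2"
  assumes z: "0 < snd z"
  shows "\<bar>pk1 v z\<bar> \<le> (1 + 2 * k) * norm v / snd z * pk z"
    and "\<bar>pk2 v w z\<bar> \<le> (4 * k * (k + 1) + 6 * k) * norm v * norm w / (snd z)\<^sup>2 * pk z"
    and "pk z \<le> (snd z) powr (- real DIM('a)) / poisson_mass TYPE('a)"
    and "\<bar>pk1 v z\<bar> \<le> (1 + 2 * k) * norm v * (snd z) powr (- real DIM('a) - 1) / poisson_mass TYPE('a)"
proof -
  define \<rho> where "\<rho> = z \<bullet> z"
  define c where "c = poisson_mass TYPE('a)"
  define t where "t = snd z"
  define R where "R = \<rho> powr (- k)"
  have c: "0 < c" unfolding c_def by (rule poisson_mass_pos)
  have \<rho>: "0 < \<rho>" unfolding \<rho>_def by (rule inner_pos_halfspace[OF z])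
  have t: "0 < t" using z by (simp add: t_def)
  have k: "0 < k" by (simp add: k_def)
  have R: "0 < R" unfolding R_def using \<rho> by simp
  have nz: "norm z * norm z = \<rho>" by (simp add: \<rho>_def dot_square_norm power2_eq_square)
  have tz: "t \<le> norm z" unfolding t_def using norm_snd_le[of "snd z" "fst z"] by simp
  have nz0: "0 < norm z" using t tz by linarith
  have p1: "\<rho> powr (- k - 1) = R / \<rho>" unfolding R_def using \<rho> by (simp add: powr_diff)
  have p2: "\<rho> powr (- k - 2) = R / (\<rho> * \<rho>)" unfolding R_def using \<rho> by (simp add: powr_diff power2_eq_square powr_numeral)
  have pkz: "pk z = t * R / c"
  proof -
    have "- (real DIM('a) + 1) / 2 = - k" unfolding k_def by (rule minus_divide_left[symmetric])
    thus ?thesis unfolding pk_def R_def t_def \<rho>_def c_def by simp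
  qed
  have sv: "\<bar>snd v\<bar> \<le> norm v" for v :: "'a \<times> real" using norm_snd_le[of "snd v" "fst v"] by simp
  have zv: "\<bar>z \<bullet> v\<bar> \<le> norm z * norm v" for v by (rule Cauchy_Schwarz_ineq2)
  have A: "\<bar>pk1 v z\<bar> \<le> (1 + 2 * k) * norm v * R / c"
  proof -
    have "\<bar>t * (z \<bullet> v)\<bar> \<le> norm z * (norm z * norm v)"
      unfolding abs_mult using t tz zv[of v] by (intro mult_mono) auto
    hence "\<bar>t * (z \<bullet> v)\<bar> \<le> \<rho> * norm v" using nz by (simp add: mult.assoc[symmetric])
    hence "\<bar>t * (z \<bullet> v)\<bar> / \<rho> \<le> norm v" using \<rho> by (simp add: divide_le_eq mult.commute)
    hence "2 * k * R * (\<bar>t * (z \<bullet> v)\<bar> / \<rho>) \<le> 2 * k * R * norm v"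
      using k R by (intro mult_left_mono) auto
    moreover have "\<bar>snd v\<bar> * R \<le> norm v * R" using sv R by (intro mult_right_mono) auto
    ultimately have "\<bar>snd v\<bar> * R + 2 * k * R * (\<bar>t * (z \<bullet> v)\<bar> / \<rho>) \<le> (1 + 2 * k) * norm v * R"
      by (simp add: algebra_simps)
    moreover have "\<bar>snd v * R - 2 * k * (t * (z \<bullet> v)) * (R / \<rho>)\<bar> \<le> \<bar>snd v\<bar> * R + 2 * k * R * (\<bar>t * (z \<bullet> v)\<bar> / \<rho>)"
      using k R \<rho> by (intro order_trans[OF abs_triangle_ineq4]) (simp add: abs_mult mult_ac)
    ultimately have "\<bar>snd v * R - 2 * k * (t * (z \<bullet> v)) * (R / \<rho>)\<bar> \<le> (1 + 2 * k) * norm v * R" by linarith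
    hence "\<bar>snd v * R - 2 * k * (t * (z \<bullet> v)) * (R / \<rho>)\<bar> / c \<le> (1 + 2 * k) * norm v * R / c"
      using c by (intro divide_right_mono) auto
    moreover have "pk1 v z = (snd v * R - 2 * k * (t * (z \<bullet> v)) * (R / \<rho>)) / c"
      unfolding pk1_def Let_def k_def[symmetric] \<rho>_def[symmetric] c_def[symmetric] t_def[symmetric] p1 R_def ..
    ultimately show ?thesis using c by simp
  qed
  show "\<bar>pk1 v z\<bar> \<le> (1 + 2 * k) * norm v / snd z * pk z"
    using A t unfolding pkz t_def[symmetric] by simp
  have Rle: "R \<le> t powr (- real DIM('a) - 1)"
  proof -
    have "R \<le> (t * t) powr (- k)"
      unfolding R_def by (rule powr_mono2') (use k t tz in \<open>auto simp: nz[symmetric] intro: mult_mono\<close>)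
    also have "(t * t) powr (- k) = t powr (- real DIM('a) - 1)"
    proof -
      have "- real DIM('a) - 1 = - k + - k" by (simp add: k_def field_simps)
      thus ?thesis using t by (simp only: powr_add) (simp add: powr_mult)
    qed
    finally show ?thesis .
  qed
  have "(1 + 2 * k) * norm v * R / c \<le> (1 + 2 * k) * norm v * t powr (- real DIM('a) - 1) / c"
    using Rle k c by (intro divide_right_mono mult_left_mono) auto
  with A show "\<bar>pk1 v z\<bar> \<le> (1 + 2 * k) * norm v * (snd z) powr (- real DIM('a) - 1) / poisson_mass TYPE('a)"
    unfolding c_def[symmetric] t_def[symmetric] by linarith
  have "t * R \<le> t * t powr (- real DIM('a) - 1)" using Rle t by simp
  also have "\<dots> = t powr (- real DIM('a))" using t powr_add[of t 1 "- real DIM('a) - 1"] by simp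
  finally show "pk z \<le> (snd z) powr (- real DIM('a)) / poisson_mass TYPE('a)"
    unfolding pkz c_def[symmetric] t_def[symmetric] using c by (intro divide_right_mono) auto
  have B1: "\<bar>t * (z \<bullet> v) * (z \<bullet> w)\<bar> / (\<rho> * \<rho>) \<le> norm v * norm w / t"
  proof -
    have "\<bar>z \<bullet> v\<bar> * \<bar>z \<bullet> w\<bar> \<le> (norm z * norm v) * (norm z * norm w)"
      using zv by (intro mult_mono) auto
    also have "\<dots> = \<rho> * (norm v * norm w)" using nz by (simp add: mult_ac)
    finally have 1: "\<bar>z \<bullet> v\<bar> * \<bar>z \<bullet> w\<bar> \<le> \<rho> * (norm v * norm w)" .
    have "t * t \<le> \<rho>" unfolding nz[symmetric] using t tz by (intro mult_mono) auto
    have "(t * t) * (\<bar>z \<bullet> v\<bar> * \<bar>z \<bullet> w\<bar>) \<le> \<rho> * (\<rho> * (norm v * norm w))"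
      by (rule mult_mono[OF \<open>t * t \<le> \<rho>\<close> 1]) (use \<rho> in auto)
    thus ?thesis using t \<rho> by (simp add: field_simps abs_mult)
  qed
  have B2: "\<bar>snd v * (z \<bullet> w) + snd w * (z \<bullet> v) + t * (v \<bullet> w)\<bar> / \<rho> \<le> 3 * (norm v * norm w) / t"
  proof -
    have "\<bar>snd v * (z \<bullet> w)\<bar> \<le> norm v * (norm z * norm w)" "\<bar>snd w * (z \<bullet> v)\<bar> \<le> norm w * (norm z * norm v)"
      unfolding abs_mult by (intro mult_mono sv zv abs_ge_zero norm_ge_zero mult_nonneg_nonneg)+
    moreover have "\<bar>t\<bar> * \<bar>v \<bullet> w\<bar> \<le> norm z * (norm v * norm w)"
      by (rule mult_mono[OF _ Cauchy_Schwarz_ineq2]) (use t tz in auto)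
    ultimately have "\<bar>snd v * (z \<bullet> w)\<bar> + \<bar>snd w * (z \<bullet> v)\<bar> + \<bar>t * (v \<bullet> w)\<bar> \<le> norm z * (3 * (norm v * norm w))"
      by (simp add: abs_mult algebra_simps)
    hence "\<bar>snd v * (z \<bullet> w) + snd w * (z \<bullet> v) + t * (v \<bullet> w)\<bar> \<le> norm z * (3 * (norm v * norm w))"
      by linarith
    hence "\<bar>snd v * (z \<bullet> w) + snd w * (z \<bullet> v) + t * (v \<bullet> w)\<bar> / \<rho> \<le> norm z * (3 * (norm v * norm w)) / (norm z * norm z)"
      unfolding nz using \<rho> by (intro divide_right_mono) auto
    also have "\<dots> = 3 * (norm v * norm w) / norm z" using nz0 by simp
    also have "\<dots> \<le> 3 * (norm v * norm w) / t" using tz t nz0 by (intro divide_left_mono mult_pos_pos) auto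
    finally show ?thesis .
  qed
  have pk2_eq: "pk2 v w z = (4 * k * (k + 1) * (t * (z \<bullet> v) * (z \<bullet> w)) * (R / (\<rho> * \<rho>))
     - 2 * k * (snd v * (z \<bullet> w) + snd w * (z \<bullet> v) + t * (v \<bullet> w)) * (R / \<rho>)) / c"
    unfolding pk2_def Let_def k_def[symmetric] \<rho>_def[symmetric] c_def[symmetric] t_def[symmetric] p1 p2 ..
  have "\<bar>pk2 v w z\<bar> \<le> (4 * k * (k + 1) * R * (\<bar>t * (z \<bullet> v) * (z \<bullet> w)\<bar> / (\<rho> * \<rho>))
     + 2 * k * R * (\<bar>snd v * (z \<bullet> w) + snd w * (z \<bullet> v) + t * (v \<bullet> w)\<bar> / \<rho>)) / c"
  proof -
    have "\<bar>(4 * k * (k + 1) * X * (R / (\<rho> * \<rho>)) - 2 * k * Y * (R / \<rho>)) / c\<bar>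
      \<le> (4 * k * (k + 1) * R * (\<bar>X\<bar> / (\<rho> * \<rho>)) + 2 * k * R * (\<bar>Y\<bar> / \<rho>)) / c" for X Y
    proof -
      have "\<bar>4 * k * (k + 1) * X * (R / (\<rho> * \<rho>)) - 2 * k * Y * (R / \<rho>)\<bar>
        \<le> \<bar>4 * k * (k + 1) * X * (R / (\<rho> * \<rho>))\<bar> + \<bar>2 * k * Y * (R / \<rho>)\<bar>"
        by (rule abs_triangle_ineq4)
      also have "\<dots> = 4 * k * (k + 1) * R * (\<bar>X\<bar> / (\<rho> * \<rho>)) + 2 * k * R * (\<bar>Y\<bar> / \<rho>)"
        using k R \<rho> by (simp add: abs_mult mult_ac)
      finally show ?thesis using c by (simp add: divide_right_mono)
    qed
    thus ?thesis unfolding pk2_eq .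
  qed
  also have "\<dots> \<le> (4 * k * (k + 1) * R * (norm v * norm w / t) + 2 * k * R * (3 * (norm v * norm w) / t)) / c"
    using c k R by (intro divide_right_mono add_mono mult_left_mono B1 B2) auto
  also have "\<dots> = (4 * k * (k + 1) + 6 * k) * norm v * norm w / t\<^sup>2 * (t * R / c)"
    using t c by (simp add: field_simps power2_eq_square)
  finally show "\<bar>pk2 v w z\<bar> \<le> (4 * k * (k + 1) + 6 * k) * norm v * norm w / (snd z)\<^sup>2 * pk z"
    unfolding pkz t_def[symmetric] .
qed

text \<open>Going up from \<epsilon> to t multiplies the factor t by at most T / \<epsilon> and
  decreases the negative power. The slice at the bottom of a strip, times T / \<epsilon>, thus
  dominates all slices.\<close>

lemma pk_strip:
  fixes x :: "'a::euclidean_space"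
  assumes "0 < \<epsilon>" "\<epsilon> \<le> t" "t \<le> T"
  shows "pk (x, t) \<le> T / \<epsilon> * pk (x, \<epsilon>)"
proof -
  define e where "e = - (real DIM('a) + 1) / 2"
  have "(t\<^sup>2 + x \<bullet> x) powr e \<le> (\<epsilon>\<^sup>2 + x \<bullet> x) powr e"
    using assms by (intro powr_mono2') (auto simp: e_def intro!: add_pos_nonneg power_mono)
  hence "t * (t\<^sup>2 + x \<bullet> x) powr e \<le> T * (\<epsilon>\<^sup>2 + x \<bullet> x) powr e"
    using assms by (intro mult_mono) auto
  also have "\<dots> = T / \<epsilon> * (\<epsilon> * (\<epsilon>\<^sup>2 + x \<bullet> x) powr e)" using assms by simp
  finally show ?thesis
    using divide_right_mono[OF _ less_imp_le[OF poisson_mass_pos[where 'a='a]]]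
    unfolding pk_Pair e_def[symmetric] times_divide_eq_right by blast
qed

section \<open>Convolution of half-space kernels with boundary data\<close>

text \<open>The boundary point y is embedded as (y, 0), so the convolution is in the space variable
  only. With \<open>pk\<close> this is the Poisson extension, with \<open>pk1\<close> and
  \<open>pk2\<close> its derivatives; \<open>f\<close> itself is never differentiated.\<close>

definition hconv :: "('a::euclidean_space \<times> real \<Rightarrow> real) \<Rightarrow> ('a \<Rightarrow> real) \<Rightarrow> 'a \<times> real \<Rightarrow> real" where
  "hconv k f z = (LINT y|lborel. k (z - (y, 0)) * f y)"

lemma ccs_lborel_integral:
  fixes g :: "'a::euclidean_space \<Rightarrow> real"
  assumes g: "ccs g" and 0: "\<And>x. x \<notin> cbox a b \<Longrightarrow> g x = 0"
  shows "integral\<^sup>L lborel g = integral (cbox a b) g"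
proof -
  have "integral\<^sup>L lborel g = integral UNIV g"
    by (rule integral_lborel[OF ccs_integrable[OF g], symmetric])
  also have "\<dots> = integral UNIV (\<lambda>x. if x \<in> cbox a b then g x else 0)"
    by (rule arg_cong[of _ _ "integral UNIV"]) (use 0 in auto)
  also have "\<dots> = integral (cbox a b) g" by (rule integral_restrict_UNIV)
  finally show ?thesis .
qed

context
  fixes k :: "'a::euclidean_space \<times> real \<Rightarrow> real"
  assumes k: "continuous_on halfspace k"
begin

lemma hconv_slice_continuous:
  assumes "0 < snd z" shows "continuous_on UNIV (\<lambda>y. k (z - (y, 0)))"
  by (rule continuous_on_compose2[OF k]) (use assms in \<open>auto intro!: continuous_intros\<close>)

lemma hconv_ccs:
  assumes "0 < snd z" "ccs f" shows "ccs (\<lambda>y. k (z - (y, 0)) * f y)"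
  using ccs_mult[OF assms(2) hconv_slice_continuous[OF assms(1)]] by (simp add: mult.commute)

lemma hconv_integrable:
  assumes "0 < snd z" "ccs f" shows "integrable lborel (\<lambda>y. k (z - (y, 0)) * f y)"
  by (rule ccs_integrable[OF hconv_ccs[OF assms]])

lemma hconv_diff:
  assumes "0 < snd z" "ccs f" "ccs g" shows "hconv k (\<lambda>x. f x - g x) z = hconv k f z - hconv k g z"
  unfolding hconv_def using hconv_integrable assms by (simp add: right_diff_distrib)

lemma hconv_continuous:
  assumes f: "ccs f" shows "continuous_on halfspace (hconv k f)"
proof -
  obtain a where a: "\<And>x. x \<notin> cbox (-a) a \<Longrightarrow> f x = 0" using ccs_box[OF f] by blast
  have cf: "continuous_on UNIV f" using f by (simp add: ccs_def)
  have "continuous_on (halfspace \<times> cbox (-a) a) (\<lambda>(z, y). k (z - (y, 0)) * f y)"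
    unfolding split_beta
    by (intro continuous_on_mult continuous_on_compose2[OF k] continuous_on_compose2[OF cf] continuous_intros) auto
  hence A: "continuous_on halfspace (\<lambda>z. integral (cbox (-a) a) (\<lambda>y. k (z - (y, 0)) * f y))"
    by (rule integral_continuous_on_param)
  have B: "hconv k f z = integral (cbox (-a) a) (\<lambda>y. k (z - (y, 0)) * f y)" if "0 < snd z" for z
    unfolding hconv_def by (rule ccs_lborel_integral[OF hconv_ccs[OF that f]]) (simp add: a)
  show ?thesis by (rule continuous_on_eq[OF A]) (use B in auto)
qed

lemma hconv_line_deriv:
  assumes f: "ccs f" and z: "0 < snd z"
    and k': "continuous_on halfspace k'"
    and d: "\<And>z. 0 < snd z \<Longrightarrow> ((\<lambda>s. k (z + s *\<^sub>R v)) has_real_derivative k' z) (at 0)"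
  shows "((\<lambda>s. hconv k f (z + s *\<^sub>R v)) has_real_derivative hconv k' f z) (at 0)"
proof -
  obtain a where a: "\<And>x. x \<notin> cbox (-a) a \<Longrightarrow> f x = 0" using ccs_box[OF f] by blast
  have cf: "continuous_on UNIV f" using f by (simp add: ccs_def)
  \<comment> \<open>For |s| below this radius the point z + s v has positive height, also when
    \<open>v\<close> points downwards.\<close>
  define e where "e = snd z / (1 + \<bar>snd v\<bar>)"
  have e0: "0 < e" unfolding e_def using z by (intro divide_pos_pos) auto
  have e1: "0 < snd (z + s *\<^sub>R v)" if "s \<in> ball (0::real) e" for s
  proof -
    have "\<bar>s\<bar> * (1 + \<bar>snd v\<bar>) < snd z" using that by (simp add: e_def pos_less_divide_eq)
    moreover have "\<bar>s * snd v\<bar> \<le> \<bar>s\<bar> * (1 + \<bar>snd v\<bar>)" by (simp add: abs_mult mult_left_mono)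
    ultimately show ?thesis by simp
  qed
  note e = e0 e1
  let ?I = "\<lambda>k z. integral (cbox (-a) a) (\<lambda>y. k (z - (y, 0)) * f y)"
  have UI: "hconv k f z = ?I k z" if "0 < snd z" for z
    unfolding hconv_def by (rule ccs_lborel_integral[OF hconv_ccs[OF that f]]) (simp add: a)
  have "((\<lambda>s. ?I k (z + s *\<^sub>R v)) has_real_derivative ?I k' (z + 0 *\<^sub>R v)) (at 0 within ball 0 e)"
  proof (rule leibniz_rule_field_derivative[where f = "\<lambda>s y. k (z + s *\<^sub>R v - (y, 0)) * f y" and fx = "\<lambda>s y. k' (z + s *\<^sub>R v - (y, 0)) * f y"])
    fix s y assume s: "s \<in> ball (0::real) e"
    have "((\<lambda>s. k ((z - (y, 0)) + s *\<^sub>R v)) has_real_derivative k' (z - (y, 0) + s *\<^sub>R v)) (at s)"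
      by (rule DERIV_line_shift) (rule d, use e(2)[OF s] in simp)
    hence "((\<lambda>s. k (z + s *\<^sub>R v - (y, 0))) has_real_derivative k' (z + s *\<^sub>R v - (y, 0))) (at s)"
      by (simp add: algebra_simps)
    from DERIV_cmult_right[OF this]
    show "((\<lambda>s. k (z + s *\<^sub>R v - (y, 0)) * f y) has_real_derivative k' (z + s *\<^sub>R v - (y, 0)) * f y) (at s within ball 0 e)"
      by (rule has_field_derivative_at_within)
  next
    fix s assume s: "s \<in> ball (0::real) e"
    have "continuous_on (cbox (-a) a) (\<lambda>y. k (z + s *\<^sub>R v - (y, 0)) * f y)"
      using hconv_ccs[OF e(2)[OF s] f] by (auto simp: ccs_def intro: continuous_on_subset)
    thus "(\<lambda>y. k (z + s *\<^sub>R v - (y, 0)) * f y) integrable_on cbox (-a) a"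
      by (rule integrable_continuous)
  next
    show "continuous_on (ball 0 e \<times> cbox (-a) a) (\<lambda>(s, y). k' (z + s *\<^sub>R v - (y, 0)) * f y)"
      unfolding split_beta
      by (intro continuous_on_mult continuous_on_compose2[OF k'] continuous_on_compose2[OF cf] continuous_intros)
        (use e(2) in auto)
  qed (use e in auto)
  hence A: "((\<lambda>s. ?I k (z + s *\<^sub>R v)) has_real_derivative ?I k' z) (at 0)"
    using e(1) by (simp add: at_within_open[OF _ open_ball])
  have ev: "eventually (\<lambda>s. ?I k (z + s *\<^sub>R v) = hconv k f (z + s *\<^sub>R v)) (nhds 0)"
  proof (rule eventually_mono)
    show "eventually (\<lambda>s. s \<in> ball 0 e) (nhds (0::real))"
      using eventually_nhds_in_open[of "ball 0 e" "0::real"] e(1) by simp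
  qed (rule UI[OF e(2), symmetric])
  have V: "hconv k' f z = ?I k' z"
    unfolding hconv_def
  proof (rule ccs_lborel_integral)
    have "continuous_on UNIV (\<lambda>y. k' (z - (y, 0)))"
      by (rule continuous_on_compose2[OF k']) (use z in \<open>auto intro!: continuous_intros\<close>)
    from ccs_mult[OF f this] show "ccs (\<lambda>y. k' (z - (y, 0)) * f y)" by (simp add: mult.commute)
  qed (simp add: a)
  show ?thesis unfolding V using DERIV_cong_ev[OF refl ev refl, THEN iffD1, OF A] .
qed

text \<open>For a horizontal direction the derivative of the kernel in z is minus its derivative in
  y, so integration by parts moves it onto \<open>f\<close>. In this way a horizontal derivative of
  an extension is itself the extension of a derivative.\<close>

lemma hconv_deriv_swap:
  assumes f: "test_function f" and z: "0 < snd z"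
    and k': "continuous_on halfspace k'"
    and d: "\<And>z. 0 < snd z \<Longrightarrow> ((\<lambda>s. k (z + s *\<^sub>R (v, 0))) has_real_derivative k' z) (at 0)"
  shows "hconv k' f z = hconv k (\<lambda>x. frechet_derivative f (at x) v) z"
proof -
  note fc = test_function_ccs[OF f] and fc' = test_function_ccs[OF test_function_deriv[OF f, of v]]
  have c': "continuous_on UNIV (\<lambda>y. k' (z - (y, 0)))"
    by (rule continuous_on_compose2[OF k']) (use z in \<open>auto intro!: continuous_intros\<close>)
  have i': "integrable lborel (\<lambda>y. k' (z - (y, 0)) * f y)"
    using ccs_mult_integrable[OF fc c'] by (simp add: mult.commute)
  have "(LINT y|lborel. k (z - (y, 0)) * frechet_derivative f (at y) v - k' (z - (y, 0)) * f y) = 0"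
  proof (rule integral_line_derivative_eq_0[where u = "\<lambda>y. k (z - (y, 0)) * f y" and v = v])
    fix y
    have "((\<lambda>s. k ((z - (y, 0)) + s *\<^sub>R (v, 0))) has_real_derivative k' (z - (y, 0))) (at (- 0))"
      using d[of "z - (y, 0)"] z by simp
    from DERIV_chain2[where f = "\<lambda>s. k ((z - (y, 0)) + s *\<^sub>R (v, 0))" and g = uminus and Db = "- 1", OF this]
    have X: "((\<lambda>s. k ((z - (y, 0)) + (- s) *\<^sub>R (v, 0))) has_real_derivative k' (z - (y, 0)) * (- 1)) (at 0)"
      by (rule meta_mp) (auto intro!: derivative_eq_intros)
    have eq: "(z - (y, 0)) + (- s) *\<^sub>R (v, 0) = z - (y + s *\<^sub>R v, 0)" for s
      by (simp add: prod_eq_iff)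
    have dk: "((\<lambda>s. k (z - (y + s *\<^sub>R v, 0))) has_real_derivative - k' (z - (y, 0))) (at 0)"
      using X unfolding eq by simp
    from DERIV_mult'[OF dk test_function_line_deriv[OF f, of y v]]
    show "((\<lambda>s. k (z - (y + s *\<^sub>R v, 0)) * f (y + s *\<^sub>R v)) has_real_derivative
       k (z - (y, 0)) * frechet_derivative f (at y) v - k' (z - (y, 0)) * f y) (at 0)" by simp
  next
    show "continuous_on UNIV (\<lambda>y. k (z - (y, 0)) * frechet_derivative f (at y) v - k' (z - (y, 0)) * f y)"
      using fc fc' by (intro continuous_on_mult continuous_on_diff c' hconv_slice_continuous[OF z]) (auto simp: ccs_def)
  qed (use hconv_integrable[OF z fc] hconv_integrable[OF z fc'] i' in auto)
  thus ?thesis unfolding hconv_def using hconv_integrable[OF z fc'] i' by simp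
qed

end

lemma hconv_le:
  assumes k: "continuous_on halfspace k" and f: "ccs f" and z: "0 < snd z"
    and b: "\<And>w. snd w = snd z \<Longrightarrow> \<bar>k w\<bar> \<le> C * pk w"
  shows "\<bar>hconv k f z\<bar> \<le> C * hconv pk (\<lambda>y. \<bar>f y\<bar>) z"
proof -
  have i: "integrable lborel (\<lambda>y. pk (z - (y, 0)) * \<bar>f y\<bar>)"
    by (rule hconv_integrable[OF pk_continuous(1) z ccs_abs[OF f]])
  have "\<bar>hconv k f z\<bar> \<le> (LINT y|lborel. \<bar>k (z - (y, 0)) * f y\<bar>)"
    unfolding hconv_def by (rule integral_abs_bound)
  also have "\<dots> \<le> (LINT y|lborel. C * (pk (z - (y, 0)) * \<bar>f y\<bar>))"
  proof (rule integral_mono)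
    show "integrable lborel (\<lambda>y. \<bar>k (z - (y, 0)) * f y\<bar>)" using hconv_integrable[OF k z f] by simp
    show "\<bar>k (z - (y, 0)) * f y\<bar> \<le> C * (pk (z - (y, 0)) * \<bar>f y\<bar>)" for y
      using mult_right_mono[OF b[of "z - (y, 0)"], of "\<bar>f y\<bar>"] by (simp add: abs_mult mult.assoc)
  qed (use i in simp)
  also have "\<dots> = C * hconv pk (\<lambda>y. \<bar>f y\<bar>) z" unfolding hconv_def by simp
  finally show ?thesis .
qed

lemma hconv_le_sup:
  assumes k: "continuous_on halfspace k" and f: "ccs f" and z: "0 < snd z"
    and b: "\<And>w. snd w = snd z \<Longrightarrow> \<bar>k w\<bar> \<le> C"
  shows "\<bar>hconv k f z\<bar> \<le> C * (LINT y|lborel. \<bar>f y\<bar>)"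
proof -
  have "\<bar>hconv k f z\<bar> \<le> (LINT y|lborel. \<bar>k (z - (y, 0)) * f y\<bar>)"
    unfolding hconv_def by (rule integral_abs_bound)
  also have "\<dots> \<le> (LINT y|lborel. C * \<bar>f y\<bar>)"
  proof (rule integral_mono)
    show "integrable lborel (\<lambda>y. \<bar>k (z - (y, 0)) * f y\<bar>)" using hconv_integrable[OF k z f] by simp
    show "\<bar>k (z - (y, 0)) * f y\<bar> \<le> C * \<bar>f y\<bar>" for y
      using mult_right_mono[OF b[of "z - (y, 0)"], of "\<bar>f y\<bar>"] by (simp add: abs_mult)
  qed (use ccs_integrable[OF f] in simp)
  finally show ?thesis by simp
qed

lemmas pk_U = hconv_line_deriv[OF pk_continuous(1) _ _ pk_continuous(2) pk_line_deriv(1)]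
  hconv_line_deriv[OF pk_continuous(2) _ _ pk_continuous(3) pk_line_deriv(2)]

lemma hconv_harmonic:
  assumes f: "ccs f" and z: "0 < snd z"
  shows "(\<Sum>b\<in>Basis. hconv (pk2 b b) f z) = 0"
proof -
  have "(\<Sum>b\<in>Basis. hconv (pk2 b b) f z) = (LINT y|lborel. (\<Sum>b\<in>Basis. pk2 b b (z - (y, 0)) * f y))"
    unfolding hconv_def by (rule Bochner_Integration.integral_sum[symmetric]) (rule hconv_integrable[OF pk_continuous(3) z f])
  also have "(\<lambda>y. \<Sum>b\<in>Basis. pk2 b b (z - (y, 0)) * f y) = (\<lambda>y. 0)"
    unfolding sum_distrib_right[symmetric] using z by (simp add: pk_harmonic)
  finally show ?thesis by simp
qed

section \<open>Monotonicity, Jensen inequalities and mass of Poisson extensions\<close>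

lemma hconv_mono:
  assumes "ccs f" "ccs g" "0 < snd z" "\<And>x. f x \<le> g x"
  shows "hconv pk f z \<le> hconv pk g z"
  unfolding hconv_def using assms
  by (intro integral_mono hconv_integrable[OF pk_continuous(1)] mult_left_mono less_imp_le[OF pk_pos]) auto

lemma hconv_nonneg:
  assumes "0 < snd z" "\<And>x. 0 \<le> f x"
  shows "0 \<le> hconv pk f z"
  unfolding hconv_def using assms
  by (intro integral_nonneg_AE AE_I2 mult_nonneg_nonneg less_imp_le[OF pk_pos]) auto

lemma hconv_pos:
  assumes f: "ccs f" and z: "0 < snd z" and p: "\<And>x. 0 \<le> f x" "0 < f x0"
  shows "0 < hconv pk f z"
  unfolding hconv_def
proof (rule ccs_integral_pos[OF hconv_ccs[OF pk_continuous(1) z f], of x0])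
  have k: "0 < pk (z - (y, 0))" for y using z by (intro pk_pos) simp
  show "0 \<le> pk (z - (y, 0)) * f y" "0 < pk (z - (x0, 0)) * f x0" for y
    using k[of y] k[of x0] p by simp_all
qed

lemma pk_slice_integral:
  fixes z :: "'a::euclidean_space \<times> real"
  assumes z: "0 < snd z"
  shows "integrable lborel (\<lambda>y. pk (z - (y, 0)))" "(LINT y|lborel. pk (z - (y, 0))) = 1"
proof -
  have m: "(\<lambda>x::'a. pk (x, snd z)) \<in> borel_measurable borel" unfolding pk_Pair by measurable
  have e: "pk (z - (y, 0)) = pk (fst z - y, snd z)" for y by (simp add: minus_prod_def)
  show "integrable lborel (\<lambda>y. pk (z - (y, 0)))" "(LINT y|lborel. pk (z - (y, 0))) = 1"
    unfolding e using lborel_integral_reflect[OF m, of "fst z"] pk_integral[OF z, where 'a='a] by simp_all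
qed

lemma hconv_abs_le:
  fixes f :: "'a::euclidean_space \<Rightarrow> real"
  assumes f: "ccs f" and z: "0 < snd z" and B: "\<And>x. \<bar>f x\<bar> \<le> B"
  shows "\<bar>hconv pk f z\<bar> \<le> B"
proof -
  have "\<bar>hconv pk f z\<bar> \<le> (LINT y|lborel. \<bar>pk (z - (y, 0)) * f y\<bar>)"
    unfolding hconv_def by (rule integral_abs_bound)
  also have "\<dots> \<le> (LINT y|lborel. pk (z - (y, 0)) * B)"
  proof (rule integral_mono)
    show "integrable lborel (\<lambda>y. \<bar>pk (z - (y, 0)) * f y\<bar>)" using hconv_integrable[OF pk_continuous(1) z f] by simp
    show "\<bar>pk (z - (y, 0)) * f y\<bar> \<le> pk (z - (y, 0)) * B" for y
      using pk_pos[of "z - (y, 0)"] z B[of y] by (simp add: abs_mult)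
  qed (use pk_slice_integral(1)[OF z] in simp)
  also have "\<dots> = B" using pk_slice_integral(2)[OF z] by simp
  finally show ?thesis .
qed

text \<open>Jensen's inequality through Young's: with \<open>G\<close> the value of the extension at
  \<open>z\<close>, f^r G^(1-r) \<le> r f + (1 - r) G holds pointwise. Averaging against the kernel,
  which has mass 1, makes the right-hand side exactly G.\<close>

lemma hconv_powr_concave:
  fixes f :: "'a::euclidean_space \<Rightarrow> real"
  assumes f: "ccs f" and z: "0 < snd z" and p: "\<And>x. 0 \<le> f x" "0 < f x0" and r: "0 < r" "r \<le> 1"
  shows "hconv pk (\<lambda>x. f x powr r) z \<le> hconv pk f z powr r"
proof -
  define G where "G = hconv pk f z"
  have G: "0 < G" unfolding G_def by (rule hconv_pos[OF f z p])
  have cr: "ccs (\<lambda>x. f x powr r)" using ccs_abs_powr[OF f r(1)] p by simp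
  have pt: "f y powr r \<le> (r * f y + (1 - r) * G) * G powr (r - 1)" for y
  proof (cases "f y = 0")
    case True
    thus ?thesis using r G by simp
  next
    case False
    hence "0 < f y" using p(1)[of y] by simp
    hence "f y powr r * G powr (1 - r) \<le> r * f y + (1 - r) * G"
      using Youngs_inequality_0[of r "1 - r" "f y" G] r G by simp
    hence "(f y powr r * G powr (1 - r)) * G powr (r - 1) \<le> (r * f y + (1 - r) * G) * G powr (r - 1)"
      by (rule mult_right_mono) simp
    moreover have "G powr (1 - r) * G powr (r - 1) = 1" using G by (simp add: powr_add[symmetric])
    ultimately show ?thesis by (simp add: mult.assoc)
  qed
  have i: "integrable lborel (\<lambda>y. pk (z - (y, 0)) * f y)" by (rule hconv_integrable[OF pk_continuous(1) z f])
  have "hconv pk (\<lambda>x. f x powr r) z \<le> (LINT y|lborel. (r * (pk (z - (y, 0)) * f y) + (1 - r) * G * pk (z - (y, 0))) * G powr (r - 1))"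
    unfolding hconv_def
  proof (rule integral_mono)
    show "integrable lborel (\<lambda>y. pk (z - (y, 0)) * f y powr r)" by (rule hconv_integrable[OF pk_continuous(1) z cr])
    show "integrable lborel (\<lambda>y. (r * (pk (z - (y, 0)) * f y) + (1 - r) * G * pk (z - (y, 0))) * G powr (r - 1))"
      using i pk_slice_integral(1)[OF z] by simp
    show "pk (z - (y, 0)) * f y powr r \<le> (r * (pk (z - (y, 0)) * f y) + (1 - r) * G * pk (z - (y, 0))) * G powr (r - 1)" for y
      using mult_left_mono[OF pt[of y] less_imp_le[OF pk_pos[of "z - (y, 0)"]]] z by (simp add: algebra_simps)
  qed
  also have "\<dots> = (r * G + (1 - r) * G) * G powr (r - 1)"
    using i pk_slice_integral[OF z] by (simp add: G_def hconv_def)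
  also have "\<dots> = G powr r" using G powr_add[of G 1 "r - 1"] by (simp add: algebra_simps)
  finally show ?thesis unfolding G_def .
qed

text \<open>The concave case for the function f^r and the exponent 1 / r.\<close>

lemma hconv_powr_convex:
  fixes f :: "'a::euclidean_space \<Rightarrow> real"
  assumes f: "ccs f" and z: "0 < snd z" and p: "\<And>x. 0 \<le> f x" "0 < f x0" and r: "1 \<le> r"
  shows "hconv pk f z powr r \<le> hconv pk (\<lambda>x. f x powr r) z"
proof -
  have cr: "ccs (\<lambda>x. f x powr r)" using ccs_abs_powr[OF f, of r] p r by simp
  have "hconv pk (\<lambda>x. (f x powr r) powr (1 / r)) z \<le> hconv pk (\<lambda>x. f x powr r) z powr (1 / r)"
    by (rule hconv_powr_concave[OF cr z, of x0]) (use p r in auto)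
  moreover have "(\<lambda>x. (f x powr r) powr (1 / r)) = f" using p r by (auto simp: powr_powr)
  ultimately have "hconv pk f z \<le> hconv pk (\<lambda>x. f x powr r) z powr (1 / r)" by simp
  hence "hconv pk f z powr r \<le> (hconv pk (\<lambda>x. f x powr r) z powr (1 / r)) powr r"
    using hconv_nonneg[OF z p(1)] r by (intro powr_mono2) auto
  thus ?thesis using hconv_nonneg[OF z, of "\<lambda>x. f x powr r"] r by (simp add: powr_powr)
qed

lemma hconv_slice_integral:
  fixes f :: "'a::euclidean_space \<Rightarrow> real"
  assumes f: "ccs f" and t: "0 < t"
  shows "integrable lborel (\<lambda>x. hconv pk f (x, t))" "(LINT x|lborel. hconv pk f (x, t)) = (LINT x|lborel. f x)"
proof -
  have [measurable]: "f \<in> borel_measurable borel" by (rule ccs_measurable[OF f])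
  have [measurable]: "(\<lambda>x::'a. pk (x, t)) \<in> borel_measurable borel" unfolding pk_Pair by measurable
  have pn: "0 \<le> pk (x, t)" for x :: 'a using pk_pos[of "(x, t)"] t by simp
  have sh: "integrable lborel (\<lambda>x::'a. pk (x - y, t))" "(LINT x::'a|lborel. pk (x - y, t)) = 1" for y
    using lborel_integral_translate[of "\<lambda>x::'a. pk (x, t)" "- y"] pk_integral[OF t, where 'a='a] by simp_all
  have I: "integrable (lborel \<Otimes>\<^sub>M lborel) (\<lambda>(y, x). pk (x - y, t) * f y)"
  proof (rule lborel_pair.Fubini_integrable)
    have "(LINT x|lborel. norm (case (y, x) of (y, x) \<Rightarrow> pk (x - y, t) * f y)) = \<bar>f y\<bar>" for y
      using sh[of y] pn by (simp add: abs_mult)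
    thus "integrable lborel (\<lambda>y. LINT x|lborel. norm (case (y, x) of (y, x) \<Rightarrow> pk (x - y, t) * f y))"
      using ccs_integrable[OF f] by simp
    show "AE y in lborel. integrable lborel (\<lambda>x. case (y, x) of (y, x) \<Rightarrow> pk (x - y, t) * f y)"
      using sh by simp
    have "(\<lambda>(y::'a, x). pk (x - y, t)) \<in> borel_measurable (borel \<Otimes>\<^sub>M borel)"
      unfolding pk_Pair by measurable
    thus "(\<lambda>(y, x). pk (x - y, t) * f y) \<in> borel_measurable (lborel \<Otimes>\<^sub>M lborel)" by measurable
  qed
  have e: "hconv pk f (x, t) = (LINT y|lborel. pk (x - y, t) * f y)" for x by (simp add: hconv_def)
  show "integrable lborel (\<lambda>x. hconv pk f (x, t))"
    unfolding e using lborel_pair.integrable_snd[OF I] .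
  have "(LINT x|lborel. hconv pk f (x, t)) = (LINT y|lborel. LINT x|lborel. pk (x - y, t) * f y)"
    unfolding e by (rule lborel_pair.Fubini_integral[OF I])
  also have "\<dots> = (LINT y|lborel. f y)" using sh by simp
  finally show "(LINT x|lborel. hconv pk f (x, t)) = (LINT x|lborel. f x)" .
qed

lemma hconv_strip:
  fixes f :: "'a::euclidean_space \<Rightarrow> real"
  assumes f: "ccs f" "\<And>x. 0 \<le> f x" and t: "0 < \<epsilon>" "\<epsilon> \<le> t" "t \<le> T"
  shows "hconv pk f (x, t) \<le> T / \<epsilon> * hconv pk f (x, \<epsilon>)"
proof -
  have "hconv pk f (x, t) \<le> (LINT y|lborel. T / \<epsilon> * (pk ((x, \<epsilon>) - (y, 0)) * f y))"
    unfolding hconv_def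
  proof (rule integral_mono)
    show "integrable lborel (\<lambda>y. pk ((x, t) - (y, 0)) * f y)"
      by (rule hconv_integrable[OF pk_continuous(1) _ f(1)]) (use t in simp)
    show "integrable lborel (\<lambda>y. T / \<epsilon> * (pk ((x, \<epsilon>) - (y, 0)) * f y))"
      by (intro integrable_mult_right hconv_integrable[OF pk_continuous(1) _ f(1)]) (use t in simp)
    show "pk ((x, t) - (y, 0)) * f y \<le> T / \<epsilon> * (pk ((x, \<epsilon>) - (y, 0)) * f y)" for y
      using mult_right_mono[OF pk_strip[OF t, of "x - y"] f(2)[of y]] by (simp add: mult.assoc)
  qed
  thus ?thesis by (simp add: hconv_def)
qed

subsection \<open>Boundary behaviour of Poisson extensions\<close>

text \<open>The kernel is replaced by its Fourier representation and the order of integration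
  exchanged. The constant is left unevaluated, since it only rescales the final bound and its
  positivity is all that enters.\<close>

lemma poisson_fourier:
  obtains c where "0 < c"
    "\<And>(f :: 'a::euclidean_space \<Rightarrow> real) x t. ccs f \<Longrightarrow> 0 < t \<Longrightarrow>
      hconv pk f (x, t) = c * Re (LINT \<xi>|lborel. complex_of_real (exp (- t * norm \<xi>)) * fourier f \<xi> * cis (x \<bullet> \<xi>))"
proof -
  define k where "k = (real DIM('a) + 1) / 2"
  define K where "K = (4 * pi) powr (real DIM('a) / 2) * Gamma k / sqrt pi"
  define m where "m = poisson_mass TYPE('a)"
  have m: "0 < m" unfolding m_def by (rule poisson_mass_pos)
  have "0 < Gamma k" by (rule Gamma_real_pos) (simp add: k_def)
  hence K: "0 < K" unfolding K_def by (intro divide_pos_pos mult_pos_pos) simp_all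
  have e: "- (real DIM('a) + 1) / 2 = - k" unfolding k_def by (rule minus_divide_left[symmetric])
  show ?thesis
  proof (rule that[of "1 / (K * m)"])
    show "0 < 1 / (K * m)" using K m by simp
    fix f :: "'a \<Rightarrow> real" and x :: 'a and t :: real
    assume f: "ccs f" and t: "0 < t"
    have B: "has_bochner_integral lborel (\<lambda>\<xi>. complex_of_real (exp (- t * norm \<xi>)) * cis (y \<bullet> \<xi>))
        (complex_of_real (K * m * pk (y, t)))" for y :: 'a
      using exp_norm_fourier[OF t, of y] m unfolding pk_Pair m_def[symmetric] e k_def[symmetric] K_def[symmetric] by simp
    have ie: "integrable lborel (\<lambda>\<xi>::'a. complex_of_real (exp (- t * norm \<xi>)))"
      using integrable.intros[OF B[of 0]] by simp
    have I: "integrable (lborel \<Otimes>\<^sub>M lborel) (\<lambda>(y, \<xi>). complex_of_real (f y) * complex_of_real (exp (- t * norm \<xi>)) * cis ((x - y) \<bullet> \<xi>))"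
      using pair_integrable_mult_bounded[of "\<lambda>y. complex_of_real (f y)" "\<lambda>\<xi>. complex_of_real (exp (- t * norm \<xi>))" "\<lambda>p. cis ((x - fst p) \<bullet> snd p)"]
        ie ccs_integrable[OF f] by simp
    have e1: "(LINT \<xi>|lborel. complex_of_real (f y) * complex_of_real (exp (- t * norm \<xi>)) * cis ((x - y) \<bullet> \<xi>))
       = complex_of_real (K * m * (pk ((x, t) - (y, 0)) * f y))" for y
    proof -
      have "(LINT \<xi>|lborel. complex_of_real (f y) * (complex_of_real (exp (- t * norm \<xi>)) * cis ((x - y) \<bullet> \<xi>)))
        = complex_of_real (f y) * complex_of_real (K * m * pk (x - y, t))"
        unfolding integral_mult_right_zero has_bochner_integral_integral_eq[OF B] ..
      thus ?thesis by (simp add: mult.assoc)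
    qed
    have e2: "(LINT y|lborel. complex_of_real (f y) * complex_of_real (exp (- t * norm \<xi>)) * cis ((x - y) \<bullet> \<xi>))
       = complex_of_real (exp (- t * norm \<xi>)) * fourier f \<xi> * cis (x \<bullet> \<xi>)" for \<xi>
    proof -
      have "cis ((x - y) \<bullet> \<xi>) = cis (- (y \<bullet> \<xi>)) * cis (x \<bullet> \<xi>)" for y
        by (simp add: cis_mult inner_diff_left)
      hence "complex_of_real (f y) * complex_of_real (exp (- t * norm \<xi>)) * cis ((x - y) \<bullet> \<xi>)
        = complex_of_real (exp (- t * norm \<xi>)) * (complex_of_real (f y) * cis (- (y \<bullet> \<xi>))) * cis (x \<bullet> \<xi>)" for y
        by (simp only: mult_ac)
      thus ?thesis unfolding fourier_def by (simp only: integral_mult_right_zero integral_mult_left_zero)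
    qed
    have "(LINT \<xi>|lborel. complex_of_real (exp (- t * norm \<xi>)) * fourier f \<xi> * cis (x \<bullet> \<xi>))
       = (LINT y|lborel. complex_of_real (K * m * (pk ((x, t) - (y, 0)) * f y)))"
      unfolding e1[symmetric] e2[symmetric] by (rule lborel_pair.Fubini_integral[OF I])
    also have "\<dots> = complex_of_real (K * m * hconv pk f (x, t))"
      unfolding hconv_def integral_complex_of_real by simp
    finally show "hconv pk f (x, t) = 1 / (K * m) * Re (LINT \<xi>|lborel. complex_of_real (exp (- t * norm \<xi>)) * fourier f \<xi> * cis (x \<bullet> \<xi>))"
      using K m by simp
  qed
qed

lemma exp_minus_lipschitz:
  fixes a b :: real
  assumes "0 \<le> a" "0 \<le> b"
  shows "\<bar>exp (- b) - exp (- a)\<bar> \<le> \<bar>b - a\<bar>"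
proof -
  have *: "\<bar>exp (- b) - exp (- a)\<bar> \<le> b - a" if "0 \<le> a" "a \<le> b" for a b :: real
  proof -
    have "exp (- b) = exp (- a) * exp (- (b - a))" by (simp add: exp_add[symmetric])
    moreover have "1 - exp (- (b - a)) \<le> b - a" using exp_ge_add_one_self[of "- (b - a)"] by linarith
    moreover have "exp (- a) * (1 - exp (- (b - a))) \<le> 1 * (1 - exp (- (b - a)))"
      using that by (intro mult_right_mono) auto
    moreover have "exp (- b) \<le> exp (- a)" using that by simp
    ultimately show ?thesis by (simp add: algebra_simps)
  qed
  show ?thesis using *[of a b] *[of b a] assms by (cases "a \<le> b") (auto simp: abs_minus_commute)
qed

text \<open>The Fourier formula is differentiated in t under the integral, with |\<xi>| times the
  modulus of the transform as majorant of the difference quotients. The same derivative is known in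
  kernel form, and derivatives are unique.\<close>

lemma hconv_pk1_fourier:
  fixes f :: "'a::euclidean_space \<Rightarrow> real"
  assumes f: "test_function f" and t: "0 < t"
    and c: "\<And>x t. 0 < t \<Longrightarrow>
      hconv pk f (x, t) = c * Re (LINT \<xi>|lborel. complex_of_real (exp (- t * norm \<xi>)) * fourier f \<xi> * cis (x \<bullet> \<xi>))"
  shows "hconv (pk1 (0, 1)) f (x, t) = - c * Re (LINT \<xi>|lborel. complex_of_real (norm \<xi> * exp (- t * norm \<xi>)) * fourier f \<xi> * cis (x \<bullet> \<xi>))"
proof -
  have [measurable]: "fourier f \<in> borel_measurable borel"
    by (rule fourier_measurable) (rule ccs_measurable[OF test_function_ccs[OF f]])
  define E where "E s \<xi> = complex_of_real (exp (- (t + s) * norm \<xi>)) * fourier f \<xi> * cis (x \<bullet> \<xi>)" for s \<xi>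
  define E' where "E' \<xi> = complex_of_real (norm \<xi> * exp (- t * norm \<xi>)) * fourier f \<xi> * cis (x \<bullet> \<xi>)" for \<xi>
  have [measurable]: "E s \<in> borel_measurable borel" "E' \<in> borel_measurable borel" for s
    unfolding E_def E'_def by measurable
  have iE: "integrable lborel (E s)" if "- t < s" for s
  proof (rule Bochner_Integration.integrable_bound[OF fourier_moment_integrable(2)[OF f]])
    have "exp (- (t + s) * norm \<xi>) * norm (fourier f \<xi>) \<le> 1 * norm (fourier f \<xi>)" for \<xi>
      using that by (intro mult_right_mono) (auto intro: mult_nonpos_nonneg)
    thus "AE \<xi> in lborel. norm (E s \<xi>) \<le> norm (fourier f \<xi>)" by (simp add: E_def norm_mult)
  qed measurable
  \<comment> \<open>Differentiating within the half-line s > - t keeps the perturbed height t + s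
    positive, as the Lipschitz bound for the exponential and the integrability of \<open>E s\<close>
    require.\<close>
  have "((\<lambda>s. c * Re (LINT \<xi>|lborel. E s \<xi>)) has_real_derivative c * Re (- (LINT \<xi>|lborel. E' \<xi>))) (at 0 within {-t<..})"
    unfolding has_field_derivative_iff
  proof (subst tendsto_at_iff_sequentially, intro allI impI)
    fix X :: "nat \<Rightarrow> real" assume X: "\<forall>i. X i \<in> {- t<..} - {0}" "X \<longlonglongrightarrow> 0"
    have "(\<lambda>i. LINT \<xi>|lborel. (E (X i) \<xi> - E 0 \<xi>) / complex_of_real (X i)) \<longlonglongrightarrow> (LINT \<xi>|lborel. - E' \<xi>)"
    proof (rule integral_dominated_convergence[OF _ _ integrable_norm[OF fourier_moment_integrable(1)[OF f]]])
      show "AE \<xi> in lborel. (\<lambda>i. (E (X i) \<xi> - E 0 \<xi>) / complex_of_real (X i)) \<longlonglongrightarrow> - E' \<xi>"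
      proof (rule AE_I2)
        fix \<xi> :: 'a
        have "((\<lambda>s. exp (- (t + s) * norm \<xi>)) has_real_derivative - (norm \<xi> * exp (- t * norm \<xi>))) (at 0)"
          by (auto intro!: derivative_eq_intros)
        hence "(\<lambda>i. (exp (- (t + X i) * norm \<xi>) - exp (- t * norm \<xi>)) / X i) \<longlonglongrightarrow> - (norm \<xi> * exp (- t * norm \<xi>))"
          unfolding has_field_derivative_iff using X
          by (subst (asm) tendsto_at_iff_sequentially) (auto simp: o_def)
        hence "(\<lambda>i. complex_of_real ((exp (- (t + X i) * norm \<xi>) - exp (- t * norm \<xi>)) / X i) * (fourier f \<xi> * cis (x \<bullet> \<xi>)))
           \<longlonglongrightarrow> complex_of_real (- (norm \<xi> * exp (- t * norm \<xi>))) * (fourier f \<xi> * cis (x \<bullet> \<xi>))"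
          by (intro tendsto_intros)
        thus "(\<lambda>i. (E (X i) \<xi> - E 0 \<xi>) / complex_of_real (X i)) \<longlonglongrightarrow> - E' \<xi>"
          by (simp add: E_def E'_def algebra_simps diff_divide_distrib)
      qed
      show "AE \<xi> in lborel. norm ((E (X i) \<xi> - E 0 \<xi>) / complex_of_real (X i)) \<le> norm (complex_of_real (norm \<xi>) * fourier f \<xi>)" for i
      proof (rule AE_I2)
        fix \<xi> :: 'a
        have Xi: "- t < X i" "X i \<noteq> 0" using X by auto
        have "E (X i) \<xi> - E 0 \<xi> = complex_of_real (exp (- ((t + X i) * norm \<xi>)) - exp (- (t * norm \<xi>))) * (fourier f \<xi> * cis (x \<bullet> \<xi>))"
          by (simp add: E_def algebra_simps)
        hence "norm (E (X i) \<xi> - E 0 \<xi>) = \<bar>exp (- ((t + X i) * norm \<xi>)) - exp (- (t * norm \<xi>))\<bar> * norm (fourier f \<xi>)"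
          by (simp only: norm_mult norm_of_real norm_cis mult_1_right)
        also have "\<dots> \<le> \<bar>(t + X i) * norm \<xi> - t * norm \<xi>\<bar> * norm (fourier f \<xi>)"
          by (intro mult_right_mono exp_minus_lipschitz) (use t Xi in auto)
        also have "\<dots> = \<bar>X i\<bar> * (norm \<xi> * norm (fourier f \<xi>))" by (simp add: algebra_simps abs_mult)
        finally show "norm ((E (X i) \<xi> - E 0 \<xi>) / complex_of_real (X i)) \<le> norm (complex_of_real (norm \<xi>) * fourier f \<xi>)"
          using Xi by (simp add: norm_divide norm_mult divide_le_eq mult.commute)
      qed
    qed measurable
    hence "(\<lambda>i. c * Re (LINT \<xi>|lborel. (E (X i) \<xi> - E 0 \<xi>) / complex_of_real (X i))) \<longlonglongrightarrow> c * Re (LINT \<xi>|lborel. - E' \<xi>)"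
      by (intro tendsto_intros)
    moreover have "c * Re (LINT \<xi>|lborel. (E (X i) \<xi> - E 0 \<xi>) / complex_of_real (X i))
      = (c * Re (LINT \<xi>|lborel. E (X i) \<xi>) - c * Re (LINT \<xi>|lborel. E 0 \<xi>)) / (X i - 0)" for i
    proof -
      have eq: "(LINT \<xi>|lborel. (E (X i) \<xi> - E 0 \<xi>) / complex_of_real (X i)) = ((LINT \<xi>|lborel. E (X i) \<xi>) - (LINT \<xi>|lborel. E 0 \<xi>)) / complex_of_real (X i)"
        using iE[of "X i"] iE[of 0] X t by simp
      show ?thesis unfolding eq by (simp add: right_diff_distrib)
    qed
    ultimately show "((\<lambda>y. (c * Re (LINT \<xi>|lborel. E y \<xi>) - c * Re (LINT \<xi>|lborel. E 0 \<xi>)) / (y - 0)) \<circ> X) \<longlonglongrightarrow> c * Re (- (LINT \<xi>|lborel. E' \<xi>))"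
      by (simp only: o_def Bochner_Integration.integral_minus)
  qed
  moreover have "(0::real) \<in> {-t<..}" using t by simp
  ultimately have "((\<lambda>s. c * Re (LINT \<xi>|lborel. E s \<xi>)) has_real_derivative c * Re (- (LINT \<xi>|lborel. E' \<xi>))) (at 0)"
    by (simp add: at_within_open[OF _ open_greaterThan])
  moreover have ev: "eventually (\<lambda>s. c * Re (LINT \<xi>|lborel. E s \<xi>) = hconv pk f ((x, t) + s *\<^sub>R (0, 1))) (nhds 0)"
  proof (rule eventually_mono)
    show "eventually (\<lambda>s. s \<in> {-t<..}) (nhds 0)"
      using eventually_nhds_in_open[of "{-t<..}" "0::real"] t by simp
    show "c * Re (LINT \<xi>|lborel. E s \<xi>) = hconv pk f ((x, t) + s *\<^sub>R (0, 1))" if "s \<in> {-t<..}" for s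
      using c[of "t + s" x] that by (simp add: E_def)
  qed
  ultimately have "((\<lambda>s. hconv pk f ((x, t) + s *\<^sub>R (0, 1))) has_real_derivative c * Re (- (LINT \<xi>|lborel. E' \<xi>))) (at 0)"
    using DERIV_cong_ev[OF refl ev refl, THEN iffD1] by blast
  moreover have "((\<lambda>s. hconv pk f ((x, t) + s *\<^sub>R (0, 1))) has_real_derivative hconv (pk1 (0, 1)) f (x, t)) (at 0)"
    by (rule pk_U(1)[OF test_function_ccs[OF f]]) (use t in simp)
  ultimately have "hconv (pk1 (0, 1)) f (x, t) = c * Re (- (LINT \<xi>|lborel. E' \<xi>))"
    using DERIV_unique by blast
  thus ?thesis by (simp add: E'_def)
qed

text \<open>The constant absorbs the factor (2 pi)^n of \<open>half_laplacian\<close>. Limits are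
  taken along sequences to suit dominated convergence, and the bound uniform in x and t supplies
  part of the majorant when the trilinear identity is taken to the boundary.\<close>

lemma hconv_normal_derivative_boundary:
  obtains c where "0 < c"
    "\<And>(f :: 'a::euclidean_space \<Rightarrow> real) x X. test_function f \<Longrightarrow> (\<And>i. 0 < X i) \<Longrightarrow> X \<longlonglongrightarrow> 0 \<Longrightarrow>
      (\<lambda>i. hconv (pk1 (0, 1)) f (x, X i)) \<longlonglongrightarrow> - c * half_laplacian f x"
    "\<And>f :: 'a \<Rightarrow> real. test_function f \<Longrightarrow> \<exists>B. \<forall>x t. 0 < t \<longrightarrow> \<bar>hconv (pk1 (0, 1)) f (x, t)\<bar> \<le> B"
proof -
  obtain c where c: "0 < c"
    "\<And>(f :: 'a \<Rightarrow> real) x t. ccs f \<Longrightarrow> 0 < t \<Longrightarrow>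
      hconv pk f (x, t) = c * Re (LINT \<xi>|lborel. complex_of_real (exp (- t * norm \<xi>)) * fourier f \<xi> * cis (x \<bullet> \<xi>))"
    using poisson_fourier[where 'a='a] by blast
  have meas: "(\<lambda>\<xi>. complex_of_real (norm \<xi> * exp (- t * norm \<xi>)) * fourier f \<xi> * cis (x \<bullet> \<xi>)) \<in> borel_measurable lborel"
    if "test_function f" for f :: "'a \<Rightarrow> real" and t x
  proof -
    have [measurable]: "fourier f \<in> borel_measurable borel"
      by (rule fourier_measurable) (rule ccs_measurable[OF test_function_ccs[OF that]])
    show ?thesis by measurable
  qed
  have bound: "norm (complex_of_real (norm \<xi> * exp (- t * norm \<xi>)) * fourier f \<xi> * cis (x \<bullet> \<xi>)) \<le> norm (complex_of_real (norm \<xi>) * fourier f \<xi>)"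
    if "0 < t" for t and x \<xi> :: 'a and f
    using that mult_right_mono[of "norm \<xi> * exp (- t * norm \<xi>)" "norm \<xi>" "norm (fourier f \<xi>)"]
    by (simp add: norm_mult mult_left_le)
  show ?thesis
  proof (rule that[of "c * (2 * pi) ^ DIM('a)"])
    show "0 < c * (2 * pi) ^ DIM('a)" using c(1) by simp
  next
    fix f :: "'a \<Rightarrow> real" and x and X :: "nat \<Rightarrow> real"
    assume f: "test_function f" and X: "\<And>i. 0 < X i" "X \<longlonglongrightarrow> 0"
    have "(\<lambda>i. LINT \<xi>|lborel. complex_of_real (norm \<xi> * exp (- X i * norm \<xi>)) * fourier f \<xi> * cis (x \<bullet> \<xi>))
      \<longlonglongrightarrow> (LINT \<xi>|lborel. complex_of_real (norm \<xi>) * fourier f \<xi> * cis (x \<bullet> \<xi>))"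
    proof (rule integral_dominated_convergence[OF _ meas[OF f] integrable_norm[OF fourier_moment_integrable(1)[OF f]]])
      show "(\<lambda>\<xi>. complex_of_real (norm \<xi>) * fourier f \<xi> * cis (x \<bullet> \<xi>)) \<in> borel_measurable lborel"
        using half_laplacian_integrable[OF f] by auto
      show "AE \<xi> in lborel. (\<lambda>i. complex_of_real (norm \<xi> * exp (- X i * norm \<xi>)) * fourier f \<xi> * cis (x \<bullet> \<xi>))
         \<longlonglongrightarrow> complex_of_real (norm \<xi>) * fourier f \<xi> * cis (x \<bullet> \<xi>)"
      proof (rule AE_I2)
        fix \<xi> :: 'a
        have "(\<lambda>i. complex_of_real (norm \<xi> * exp (- X i * norm \<xi>)) * fourier f \<xi> * cis (x \<bullet> \<xi>))
         \<longlonglongrightarrow> complex_of_real (norm \<xi> * exp (- 0 * norm \<xi>)) * fourier f \<xi> * cis (x \<bullet> \<xi>)"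
          by (intro tendsto_intros X)
        thus "(\<lambda>i. complex_of_real (norm \<xi> * exp (- X i * norm \<xi>)) * fourier f \<xi> * cis (x \<bullet> \<xi>))
         \<longlonglongrightarrow> complex_of_real (norm \<xi>) * fourier f \<xi> * cis (x \<bullet> \<xi>)" by simp
      qed
      show "AE \<xi> in lborel. norm (complex_of_real (norm \<xi> * exp (- X i * norm \<xi>)) * fourier f \<xi> * cis (x \<bullet> \<xi>)) \<le> norm (complex_of_real (norm \<xi>) * fourier f \<xi>)" for i
        using bound[OF X(1)] by simp
    qed
    hence A: "(\<lambda>i. - c * Re (LINT \<xi>|lborel. complex_of_real (norm \<xi> * exp (- X i * norm \<xi>)) * fourier f \<xi> * cis (x \<bullet> \<xi>)))
      \<longlonglongrightarrow> - c * Re (LINT \<xi>|lborel. complex_of_real (norm \<xi>) * fourier f \<xi> * cis (x \<bullet> \<xi>))"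
      by (intro tendsto_intros)
    have B: "- c * Re (LINT \<xi>|lborel. complex_of_real (norm \<xi>) * fourier f \<xi> * cis (x \<bullet> \<xi>)) = - (c * (2 * pi) ^ DIM('a)) * half_laplacian f x"
      by (simp add: half_laplacian_def)
    show "(\<lambda>i. hconv (pk1 (0, 1)) f (x, X i)) \<longlonglongrightarrow> - (c * (2 * pi) ^ DIM('a)) * half_laplacian f x"
    proof -
      have "hconv (pk1 (0, 1)) f (x, X i) = - c * Re (LINT \<xi>|lborel. complex_of_real (norm \<xi> * exp (- X i * norm \<xi>)) * fourier f \<xi> * cis (x \<bullet> \<xi>))" for i
        by (rule hconv_pk1_fourier[OF f X(1)]) (rule c(2)[OF test_function_ccs[OF f]])
      thus ?thesis using A unfolding B by simp
    qed
  next
    fix f :: "'a \<Rightarrow> real" assume f: "test_function f"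
    have "\<bar>hconv (pk1 (0, 1)) f (x, t)\<bar> \<le> c * (LINT \<xi>|lborel. norm (complex_of_real (norm \<xi>) * fourier f \<xi>))" if t: "0 < t" for x t
    proof -
      let ?E = "\<lambda>\<xi>. complex_of_real (norm \<xi> * exp (- t * norm \<xi>)) * fourier f \<xi> * cis (x \<bullet> \<xi>)"
      have iE: "integrable lborel ?E"
        by (rule Bochner_Integration.integrable_bound[OF fourier_moment_integrable(1)[OF f] meas[OF f]]) (use bound[OF t] in simp)
      have "\<bar>Re (LINT \<xi>|lborel. ?E \<xi>)\<bar> \<le> norm (LINT \<xi>|lborel. ?E \<xi>)" by (rule abs_Re_le_cmod)
      also have "\<dots> \<le> (LINT \<xi>|lborel. norm (?E \<xi>))" by (rule integral_norm_bound)
      also have "\<dots> \<le> (LINT \<xi>|lborel. norm (complex_of_real (norm \<xi>) * fourier f \<xi>))"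
        by (intro integral_mono integrable_norm iE fourier_moment_integrable(1)[OF f] bound t)
      finally have A: "\<bar>Re (LINT \<xi>|lborel. ?E \<xi>)\<bar> \<le> (LINT \<xi>|lborel. norm (complex_of_real (norm \<xi>) * fourier f \<xi>))" .
      have eq: "hconv (pk1 (0, 1)) f (x, t) = - c * Re (LINT \<xi>|lborel. ?E \<xi>)"
        by (rule hconv_pk1_fourier[OF f t]) (rule c(2)[OF test_function_ccs[OF f]])
      show ?thesis unfolding eq abs_mult using c(1) mult_left_mono[OF A, of c] by simp
    qed
    thus "\<exists>B. \<forall>x t. 0 < t \<longrightarrow> \<bar>hconv (pk1 (0, 1)) f (x, t)\<bar> \<le> B" by blast
  qed
qed

text \<open>Substituting x - t y for y freezes the kernel at height 1 and moves the dependence on t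
  into the argument of the bounded continuous function \<open>f\<close>, where dominated convergence
  applies.\<close>

lemma hconv_boundary_limit:
  fixes f :: "'a::euclidean_space \<Rightarrow> real"
  assumes f: "ccs f" and X: "\<And>i. 0 < X i" "X \<longlonglongrightarrow> 0"
  shows "(\<lambda>i. hconv pk f (x, X i)) \<longlonglongrightarrow> f x"
proof -
  obtain B where B: "0 < B" "\<And>x. \<bar>f x\<bar> \<le> B" using ccs_bounded[OF f] by blast
  have cf: "continuous_on UNIV f" using f by (simp add: ccs_def)
  have [measurable]: "f \<in> borel_measurable borel" by (rule ccs_measurable[OF f])
  have [measurable]: "(\<lambda>x::'a. pk (x, t)) \<in> borel_measurable borel" for t unfolding pk_Pair by measurable
  \<comment> \<open>The kernel is homogeneous of degree - n, which matches the Jacobian of the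
    dilation.\<close>
  have scale: "t ^ DIM('a) * pk (t *\<^sub>R y, t) = pk (y, 1)" if t: "0 < t" for t and y :: 'a
  proof -
    define e where "e = - (real DIM('a) + 1) / 2"
    have "(t\<^sup>2 + (t *\<^sub>R y) \<bullet> (t *\<^sub>R y)) powr e = (t\<^sup>2 * (1 + y \<bullet> y)) powr e"
      by (simp add: power2_eq_square algebra_simps)
    also have "\<dots> = (t\<^sup>2) powr e * (1 + y \<bullet> y) powr e" by (simp add: powr_mult)
    also have "(t\<^sup>2) powr e = t powr (- (real DIM('a) + 1))"
    proof -
      have "- (real DIM('a) + 1) = 2 * e" by (simp add: e_def)
      moreover have "t\<^sup>2 = t powr 2" using t by (simp add: powr_numeral)
      ultimately show ?thesis by (simp only: powr_powr)
    qed
    finally have "t ^ DIM('a) * (t * (t\<^sup>2 + (t *\<^sub>R y) \<bullet> (t *\<^sub>R y)) powr e) = (t powr real DIM('a) * t powr 1 * t powr (- (real DIM('a) + 1))) * (1 + y \<bullet> y) powr e"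
      using t by (simp add: powr_realpow)
    also have "t powr real DIM('a) * t powr 1 * t powr (- (real DIM('a) + 1)) = 1"
    proof -
      have "t powr real DIM('a) * t powr 1 * t powr (- (real DIM('a) + 1)) = t powr (real DIM('a) + 1 + (- (real DIM('a) + 1)))"
        by (simp only: powr_add)
      thus ?thesis using t by simp
    qed
    finally show ?thesis unfolding pk_Pair e_def[symmetric] by simp
  qed
  have eq: "hconv pk f (x, t) = (LINT y|lborel. pk (y, 1) * f (x - t *\<^sub>R y))" if t: "0 < t" for t
  proof -
    have "hconv pk f (x, t) = (LINT y|lborel. (\<lambda>u. pk (u, t) * f (x - u)) (x - y))" by (simp add: hconv_def)
    also have "\<dots> = (LINT u|lborel. pk (u, t) * f (x - u))"
      by (rule lborel_integral_reflect(2)) measurable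
    also have "\<dots> = \<bar>t\<bar> ^ DIM('a) *\<^sub>R (LINT y|lborel. pk (0 + t *\<^sub>R y, t) * f (x - (0 + t *\<^sub>R y)))"
      by (rule lborel_integral_affine(2)) (use t in auto)
    also have "\<dots> = (LINT y|lborel. t ^ DIM('a) * pk (t *\<^sub>R y, t) * f (x - t *\<^sub>R y))"
      using t by (simp add: mult.assoc)
    finally show ?thesis unfolding scale[OF t] .
  qed
  have pn: "0 \<le> pk (y, 1)" for y :: 'a using pk_pos[of "(y, 1)"] by simp
  have "(\<lambda>i. LINT y|lborel. pk (y, 1) * f (x - X i *\<^sub>R y)) \<longlonglongrightarrow> (LINT y::'a|lborel. pk (y, 1) * f x)"
  proof (rule integral_dominated_convergence[where w = "\<lambda>y::'a. pk (y, 1) * B"])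
    show "AE y in lborel. (\<lambda>i. pk (y, 1) * f (x - X i *\<^sub>R y)) \<longlonglongrightarrow> pk (y, 1) * f x"
    proof (rule AE_I2)
      fix y :: 'a
      have "(\<lambda>i. x - X i *\<^sub>R y) \<longlonglongrightarrow> x - 0 *\<^sub>R y" by (intro tendsto_intros X)
      hence "(\<lambda>i. f (x - X i *\<^sub>R y)) \<longlonglongrightarrow> f (x - 0 *\<^sub>R y)"
        using continuous_on_tendsto_compose[OF cf] by simp
      thus "(\<lambda>i. pk (y, 1) * f (x - X i *\<^sub>R y)) \<longlonglongrightarrow> pk (y, 1) * f x"
        by (intro tendsto_intros) simp
    qed
    show "AE y in lborel. norm (pk (y, 1) * f (x - X i *\<^sub>R y)) \<le> pk (y, 1) * B" for i
      using pn B by (simp add: abs_mult mult_left_mono)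
    show "integrable lborel (\<lambda>y::'a. pk (y, 1) * B)" using pk_integral(1)[of 1, where 'a='a] by simp
  qed measurable
  thus ?thesis using eq[OF X(1)] pk_integral(2)[of 1, where 'a='a] by simp
qed

text \<open>The majorant is a multiple of (1 + |x|^2)^(-(n+1)/2): near the support the extension is
  bounded by the supremum of |f|, and far away the kernel itself decays like this, uniformly for t
  \<le> 1. The comparison with a bottom slice in \<open>hconv_strip\<close> would be useless here,
  its factor T / \<epsilon> being unbounded as \<epsilon> tends to 0.\<close>

lemma hconv_boundary_dominated:
  fixes f :: "'a::euclidean_space \<Rightarrow> real"
  assumes f: "ccs f"
  obtains M where "integrable lborel M" "\<And>x t. 0 < t \<Longrightarrow> t \<le> 1 \<Longrightarrow> \<bar>hconv pk f (x, t)\<bar> \<le> M x"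
proof -
  define k where "k = (real DIM('a) + 1) / 2"
  define m where "m = poisson_mass TYPE('a)"
  have m: "0 < m" unfolding m_def by (rule poisson_mass_pos)
  have k: "0 < k" by (simp add: k_def)
  have e: "- (real DIM('a) + 1) / 2 = - k" unfolding k_def by (rule minus_divide_left[symmetric])
  obtain B where B: "0 < B" "\<And>x. \<bar>f x\<bar> \<le> B" using ccs_bounded[OF f] by blast
  have "bounded {x. f x \<noteq> 0}" using f by (simp add: ccs_def)
  then obtain R0 where R0: "\<And>x. f x \<noteq> 0 \<Longrightarrow> norm x \<le> R0" unfolding bounded_iff by auto
  define R where "R = max 1 R0"
  have R: "1 \<le> R" "\<And>x. f x \<noteq> 0 \<Longrightarrow> norm x \<le> R" using R0 by (force simp: R_def)+
  define I where "I = (LINT y|lborel. \<bar>f y\<bar>)"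
  have I: "0 \<le> I" by (simp add: I_def)
  \<comment> \<open>The first summand covers |x| < 2 R, where 1 + |x|^2 \<le> 1 + 4 R^2. The second
    covers |x| \<ge> 2 R: for y in the support |x - y| \<ge> |x| / 2, and |x|^2 \<ge> 4 makes |x|^2
    / 4 at least (1 + |x|^2) / 8, whence the 8.\<close>
  define C where "C = B * (1 + 4 * R\<^sup>2) powr k + 8 powr k * I / m"
  have C12: "B * (1 + 4 * R\<^sup>2) powr k \<le> C" "8 powr k * I / m \<le> C"
    using B I m by (simp_all add: C_def)
  have int: "integrable lborel (\<lambda>x::'a. C * (1\<^sup>2 + x \<bullet> x) powr (- k))"
    using poisson_kernel_integral(1)[of 1, where 'a='a] unfolding e by simp
  have "\<bar>hconv pk f (x, t)\<bar> \<le> C * (1\<^sup>2 + x \<bullet> x) powr (- k)" if t: "0 < t" "t \<le> 1" for x t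
  proof (cases "norm x < 2 * R")
    case True
    have "x \<bullet> x \<le> 4 * R\<^sup>2"
      using True power_mono[of "norm x" "2 * R" 2] by (simp add: power2_norm_eq_inner power_mult_distrib)
    hence "(1 + x \<bullet> x) powr k \<le> (1 + 4 * R\<^sup>2) powr k"
      using k by (intro powr_mono2) auto
    hence "1 \<le> (1 + 4 * R\<^sup>2) powr k * (1 + x \<bullet> x) powr (- k)"
    proof -
      have "0 < 1 + x \<bullet> x" by (rule add_pos_nonneg) simp_all
      hence "0 < (1 + x \<bullet> x) powr k" by simp
      moreover assume "(1 + x \<bullet> x) powr k \<le> (1 + 4 * R\<^sup>2) powr k"
      ultimately show ?thesis unfolding powr_minus divide_inverse[symmetric] by simp
    qed
    hence "B * 1 \<le> B * ((1 + 4 * R\<^sup>2) powr k * (1 + x \<bullet> x) powr (- k))"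
      using B(1) by (intro mult_left_mono) auto
    also have "\<dots> \<le> C * (1 + x \<bullet> x) powr (- k)"
      using mult_right_mono[OF C12(1), of "(1 + x \<bullet> x) powr (- k)"] by (simp add: mult.assoc)
    finally show ?thesis using hconv_abs_le[OF f _ B(2), of "(x, t)"] t by simp
  next
    case False
    have xx: "4 \<le> x \<bullet> x"
      using False R(1) power_mono[of 2 "norm x" 2] by (simp add: power2_norm_eq_inner)
    have P: "pk (x - y, t) * \<bar>f y\<bar> \<le> 8 powr k * (1 + x \<bullet> x) powr (- k) / m * \<bar>f y\<bar>" for y
    proof (cases "f y = 0")
      case nz: False
      have "norm y \<le> norm x / 2" using R(2)[OF nz] False by simp
      hence "norm x / 2 \<le> norm (x - y)" using norm_triangle_ineq2[of x y] by linarith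
      hence "(norm x / 2)\<^sup>2 \<le> (norm (x - y))\<^sup>2" by (intro power_mono) auto
      hence "x \<bullet> x / 4 \<le> (x - y) \<bullet> (x - y)" by (simp add: power2_norm_eq_inner power_divide)
      moreover have "(1 + a) / 8 \<le> s + b" if "a / 4 \<le> b" "4 \<le> a" "0 \<le> s" for a b s :: real
        using that by argo
      ultimately have "(1 + x \<bullet> x) / 8 \<le> t\<^sup>2 + (x - y) \<bullet> (x - y)" using xx zero_le_power2[of t] by blast
      hence "(t\<^sup>2 + (x - y) \<bullet> (x - y)) powr (- k) \<le> ((1 + x \<bullet> x) / 8) powr (- k)"
        using k by (intro powr_mono2') (auto intro: add_pos_nonneg)
      also have "\<dots> = 8 powr k * (1 + x \<bullet> x) powr (- k)"
      proof -
        have "q powr (- k) / 8 powr (- k) = 8 powr k * q powr (- k)" for q :: real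
          unfolding powr_minus_divide[of 8 k] by simp
        thus ?thesis by (simp only: powr_divide)
      qed
      finally have "t * (t\<^sup>2 + (x - y) \<bullet> (x - y)) powr (- k) \<le> 1 * (8 powr k * (1 + x \<bullet> x) powr (- k))"
        using t by (intro mult_mono) auto
      thus ?thesis unfolding pk_Pair e m_def[symmetric] using m by (intro mult_right_mono divide_right_mono) auto
    qed simp
    have "\<bar>hconv pk f (x, t)\<bar> \<le> (LINT y|lborel. \<bar>pk ((x, t) - (y, 0)) * f y\<bar>)"
      unfolding hconv_def by (rule integral_abs_bound)
    also have "\<dots> \<le> (LINT y|lborel. 8 powr k * (1 + x \<bullet> x) powr (- k) / m * \<bar>f y\<bar>)"
    proof (rule integral_mono)
      show "integrable lborel (\<lambda>y. \<bar>pk ((x, t) - (y, 0)) * f y\<bar>)"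
        using hconv_integrable[OF pk_continuous(1) _ f, of "(x, t)"] t by simp
      show "integrable lborel (\<lambda>y. 8 powr k * (1 + x \<bullet> x) powr (- k) / m * \<bar>f y\<bar>)"
        using ccs_integrable[OF f] by (intro integrable_mult_right integrable_abs)
      show "\<bar>pk ((x, t) - (y, 0)) * f y\<bar> \<le> 8 powr k * (1 + x \<bullet> x) powr (- k) / m * \<bar>f y\<bar>" for y
        using P[of y] pk_pos[of "(x - y, t)"] t by (simp add: abs_mult)
    qed
    also have "\<dots> = (8 powr k * I / m) * (1 + x \<bullet> x) powr (- k)" by (simp add: I_def)
    also have "\<dots> \<le> C * (1 + x \<bullet> x) powr (- k)" by (rule mult_right_mono[OF C12(2)]) simp
    finally show ?thesis by simp
  qed
  with int show ?thesis by (rule that)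
qed

subsection \<open>Green formula on strips\<close>

definition bdd_on :: "'b set \<Rightarrow> ('b \<Rightarrow> real) \<Rightarrow> bool" where
  "bdd_on S X \<longleftrightarrow> (\<exists>C. \<forall>z\<in>S. \<bar>X z\<bar> \<le> C)"

named_theorems bdd_on_intros

lemma bdd_onI: "(\<And>z. z \<in> S \<Longrightarrow> \<bar>X z\<bar> \<le> C) \<Longrightarrow> bdd_on S X"
  unfolding bdd_on_def by blast

lemma bdd_on_const [bdd_on_intros]: "bdd_on S (\<lambda>z. c)"
  unfolding bdd_on_def by blast

lemma bdd_on_minus [bdd_on_intros]: "bdd_on S X \<Longrightarrow> bdd_on S (\<lambda>z. - X z)"
  unfolding bdd_on_def by simp

lemma bdd_on_add [bdd_on_intros]:
  assumes "bdd_on S X" "bdd_on S Y" shows "bdd_on S (\<lambda>z. X z + Y z)"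
proof -
  obtain A B where "\<And>z. z \<in> S \<Longrightarrow> \<bar>X z\<bar> \<le> A" "\<And>z. z \<in> S \<Longrightarrow> \<bar>Y z\<bar> \<le> B"
    using assms unfolding bdd_on_def by blast
  thus ?thesis by (intro bdd_onI[of _ _ "A + B"]) (use abs_triangle_ineq in \<open>blast intro: add_mono order_trans\<close>)
qed

lemma bdd_on_diff [bdd_on_intros]:
  "bdd_on S X \<Longrightarrow> bdd_on S Y \<Longrightarrow> bdd_on S (\<lambda>z. X z - Y z)"
  using bdd_on_add[of S X "\<lambda>z. - Y z"] bdd_on_minus[of S Y] by simp

lemma bdd_on_mult [bdd_on_intros]:
  assumes "bdd_on S X" "bdd_on S Y" shows "bdd_on S (\<lambda>z. X z * Y z)"
proof -
  obtain A B where "\<And>z. z \<in> S \<Longrightarrow> \<bar>X z\<bar> \<le> A" "\<And>z. z \<in> S \<Longrightarrow> \<bar>Y z\<bar> \<le> B"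
    using assms unfolding bdd_on_def by blast
  thus ?thesis by (intro bdd_onI[of _ _ "A * B"]) (force simp: abs_mult intro!: mult_mono)
qed

lemma bdd_on_power [bdd_on_intros]: "bdd_on S X \<Longrightarrow> bdd_on S (\<lambda>z. X z ^ n)"
  by (induction n) (auto intro: bdd_on_intros)

lemma bdd_on_sum [bdd_on_intros]:
  "(\<And>i. i \<in> A \<Longrightarrow> bdd_on S (X i)) \<Longrightarrow> bdd_on S (\<lambda>z. \<Sum>i\<in>A. X i z)"
  by (induction A rule: infinite_finite_induct) (auto intro: bdd_on_intros)

lemma horizontal_derivative_integral_0:
  fixes u u' :: "'a::euclidean_space \<times> real \<Rightarrow> real"
  assumes t: "0 < t"
    and d: "\<And>z. 0 < snd z \<Longrightarrow> ((\<lambda>s. u (z + s *\<^sub>R (i, 0))) has_real_derivative u' z) (at 0)"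
    and c: "continuous_on halfspace u'"
    and I: "integrable lborel (\<lambda>x. u (x, t))" "integrable lborel (\<lambda>x. u' (x, t))"
  shows "(LINT x|lborel. u' (x, t)) = 0"
proof (rule integral_line_derivative_eq_0[where u = "\<lambda>x. u (x, t)" and v = i])
  show "((\<lambda>s. u (x + s *\<^sub>R i, t)) has_real_derivative u' (x, t)) (at 0)" for x
    using d[of "(x, t)"] t by simp
  show "continuous_on UNIV (\<lambda>x. u' (x, t))"
    by (rule continuous_on_compose2[OF c]) (use t in \<open>auto intro!: continuous_intros\<close>)
qed (use I in auto)

lemma sum_Basis_Times_real:
  fixes f :: "'a::euclidean_space \<times> real \<Rightarrow> 'b::comm_monoid_add"
  shows "(\<Sum>b\<in>Basis. f b) = (\<Sum>i\<in>Basis. f (i, 0)) + f (0, 1)"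
proof -
  have "inj_on (\<lambda>i::'a. (i, 0::real)) Basis" by (rule inj_onI) simp
  moreover have "(\<lambda>i::'a. (i, 0::real)) ` Basis \<inter> {(0, 1)} = {}" by auto
  ultimately show ?thesis
    by (simp add: Basis_prod_def sum.union_disjoint sum.reindex add.commute)
qed

text \<open>Horizontal second derivatives integrate to 0 on each slice, so the Laplacian may be
  replaced by the second t-derivative, and two integrations by parts in t remain. The weight t -
  \<epsilon> vanishes at the bottom and has slope 1, so the bottom slice contributes
  \<open>B\<close> alone and none of its derivatives.\<close>

lemma strip_green:
  fixes B :: "'a::euclidean_space \<times> real \<Rightarrow> real"
  assumes eT: "0 < \<epsilon>" "\<epsilon> \<le> T"
    and d1: "\<And>b z. b \<in> Basis \<Longrightarrow> 0 < snd z \<Longrightarrow> ((\<lambda>s. B (z + s *\<^sub>R b)) has_real_derivative B1 b z) (at 0)"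
    and d2: "\<And>b z. b \<in> Basis \<Longrightarrow> 0 < snd z \<Longrightarrow> ((\<lambda>s. B1 b (z + s *\<^sub>R b)) has_real_derivative B2 b z) (at 0)"
    and c0: "continuous_on halfspace B"
    and c1: "\<And>b. b \<in> Basis \<Longrightarrow> continuous_on halfspace (B1 b)"
    and c2: "\<And>b. b \<in> Basis \<Longrightarrow> continuous_on halfspace (B2 b)"
    and M: "integrable lborel M"
    and b0: "\<And>x t. \<epsilon> \<le> t \<Longrightarrow> t \<le> T \<Longrightarrow> \<bar>B (x, t)\<bar> \<le> M x"
    and b1: "\<And>b x t. b \<in> Basis \<Longrightarrow> \<epsilon> \<le> t \<Longrightarrow> t \<le> T \<Longrightarrow> \<bar>B1 b (x, t)\<bar> \<le> M x"
    and b2: "\<And>b x t. b \<in> Basis \<Longrightarrow> \<epsilon> \<le> t \<Longrightarrow> t \<le> T \<Longrightarrow> \<bar>B2 b (x, t)\<bar> \<le> M x"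
  shows "(LINT t|lborel. (LINT x|lborel. (\<Sum>b\<in>Basis. B2 b (x, t)) * (t - \<epsilon>)) * indicator {\<epsilon>..T} t)
    = (LINT x|lborel. (T - \<epsilon>) * B1 (0, 1) (x, T) - B (x, T) + B (x, \<epsilon>))"
proof -
  define e where "e = ((0, 1) :: 'a \<times> real)"
  have e: "e \<in> Basis" "e = (0, 1)" by (auto simp: e_def Basis_prod_def)
  have M0: "0 \<le> M x" for x using b0[of \<epsilon> x] eT by (auto intro: order_trans[OF abs_ge_zero])
  have int1: "integrable lborel (\<lambda>x. B1 b (x, t))" and int2: "integrable lborel (\<lambda>x. B2 b (x, t))"
    if "b \<in> Basis" "\<epsilon> \<le> t" "t \<le> T" for b t
    using strip_integrable(2)[OF eT(1) c1[OF that(1)] M b1[OF that(1)] that(2,3)]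
      strip_integrable(2)[OF eT(1) c2[OF that(1)] M b2[OF that(1)] that(2,3)] by auto
  define Y where "Y z = (snd z - \<epsilon>) * B1 e z - B z" for z
  define Y' where "Y' z = (snd z - \<epsilon>) * B2 e z" for z
  have dY: "((\<lambda>s. Y (z + s *\<^sub>R (0, 1))) has_real_derivative Y' z) (at 0)" if "0 < snd z" for z
    using d1[OF e(1) that] d2[OF e(1) that] unfolding e(2) Y_def Y'_def
    by (auto intro!: derivative_eq_intros simp: zero_prod_def[symmetric])
  have cY: "continuous_on halfspace Y" "continuous_on halfspace Y'"
    unfolding Y_def Y'_def by (intro continuous_intros c0 c1 c2 e)+
  have bY: "\<bar>Y (x, t)\<bar> \<le> (T + 1) * M x" "\<bar>Y' (x, t)\<bar> \<le> (T + 1) * M x" if t: "\<epsilon> \<le> t" "t \<le> T" for x t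
  proof -
    have "\<bar>(t - \<epsilon>) * B1 e (x, t)\<bar> \<le> T * M x" "\<bar>(t - \<epsilon>) * B2 e (x, t)\<bar> \<le> T * M x"
      unfolding abs_mult using t eT b1[OF e(1) t, of x] b2[OF e(1) t, of x] by (auto intro!: mult_mono)
    thus "\<bar>Y (x, t)\<bar> \<le> (T + 1) * M x" "\<bar>Y' (x, t)\<bar> \<le> (T + 1) * M x"
      using b0[OF t, of x] M0[of x] unfolding Y_def Y'_def by (simp_all add: algebra_simps)
  qed
  note S = strip_integral[OF eT dY cY integrable_mult_right[OF M] bY]
  have E: "(LINT x|lborel. (\<Sum>b\<in>Basis. B2 b (x, t)) * (t - \<epsilon>)) * indicator {\<epsilon>..T} t = (LINT x|lborel. Y' (x, t)) * indicator {\<epsilon>..T} t" for t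
  proof (cases "\<epsilon> \<le> t \<and> t \<le> T")
    case True
    hence t: "\<epsilon> \<le> t" "t \<le> T" by auto
    have z: "(LINT x|lborel. B2 (i, 0) (x, t)) = 0" if "i \<in> Basis" for i
    proof -
      have "(i, 0) \<in> (Basis :: ('a \<times> real) set)" using that by (auto simp: Basis_prod_def)
      from horizontal_derivative_integral_0[OF _ d2[OF this] c2[OF this] int1[OF this t] int2[OF this t]]
      show ?thesis using t eT by simp
    qed
    have "(LINT x|lborel. (\<Sum>b\<in>Basis. B2 b (x, t)) * (t - \<epsilon>)) = (\<Sum>b\<in>Basis. (LINT x|lborel. B2 b (x, t))) * (t - \<epsilon>)"
      using int2[OF _ t] by (simp add: Bochner_Integration.integral_sum)
    also have "\<dots> = (LINT x|lborel. B2 e (x, t)) * (t - \<epsilon>)"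
      unfolding sum_Basis_Times_real using z e by simp
    also have "\<dots> = (LINT x|lborel. Y' (x, t))" by (simp add: Y'_def mult.commute)
    finally show ?thesis by simp
  qed auto
  have "(LINT t|lborel. (LINT x|lborel. (\<Sum>b\<in>Basis. B2 b (x, t)) * (t - \<epsilon>)) * indicator {\<epsilon>..T} t)
    = (LINT x|lborel. Y (x, T)) - (LINT x|lborel. Y (x, \<epsilon>))" unfolding E by (rule S(2))
  also have "\<dots> = (LINT x|lborel. Y (x, T) - Y (x, \<epsilon>))"
    using eT by (intro Bochner_Integration.integral_diff[symmetric] S(3)) auto
  finally show ?thesis by (simp add: Y_def e_def[symmetric] algebra_simps)
qed

text \<open>The constants for first and second derivatives in \<open>pk_bounds\<close> are added so
  that one constant serves both; the leading 1 makes it at least 1.\<close>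

definition poisson_grad_const :: "'a::euclidean_space itself \<Rightarrow> real" where
  "poisson_grad_const _ = (let k = (real DIM('a) + 1) / 2 in 1 + (1 + 2 * k) + (4 * k * (k + 1) + 6 * k))"

lemma poisson_grad_const_ge_1: "1 \<le> poisson_grad_const TYPE('a::euclidean_space)"
  by (simp add: poisson_grad_const_def Let_def)

lemma hconv_grad_bounds:
  fixes f :: "'a::euclidean_space \<Rightarrow> real"
  assumes f: "ccs f" and z: "0 < snd z" and b: "b \<in> Basis" "c \<in> Basis"
  shows "\<bar>hconv (pk1 b) f z\<bar> \<le> poisson_grad_const TYPE('a) / snd z * hconv pk (\<lambda>y. \<bar>f y\<bar>) z"
    and "\<bar>hconv (pk2 b c) f z\<bar> \<le> poisson_grad_const TYPE('a) / (snd z)\<^sup>2 * hconv pk (\<lambda>y. \<bar>f y\<bar>) z"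
proof -
  define k where "k = (real DIM('a) + 1) / 2"
  have k: "0 < k" by (simp add: k_def)
  have K: "1 + 2 * k \<le> poisson_grad_const TYPE('a)" "4 * k * (k + 1) + 6 * k \<le> poisson_grad_const TYPE('a)"
    using k unfolding poisson_grad_const_def Let_def k_def[symmetric] by (simp_all add: add_nonneg_nonneg)
  show "\<bar>hconv (pk1 b) f z\<bar> \<le> poisson_grad_const TYPE('a) / snd z * hconv pk (\<lambda>y. \<bar>f y\<bar>) z"
  proof (rule hconv_le[OF pk_continuous(2) f z])
    fix w :: "'a \<times> real" assume w: "snd w = snd z"
    have "\<bar>pk1 b w\<bar> \<le> (1 + 2 * k) * norm b / snd w * pk w"
      unfolding k_def by (rule pk_bounds(1)) (use w z in simp)
    also have "\<dots> \<le> poisson_grad_const TYPE('a) / snd z * pk w"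
      using w z K b pk_pos[of w] by (intro mult_right_mono) (auto simp: divide_right_mono)
    finally show "\<bar>pk1 b w\<bar> \<le> poisson_grad_const TYPE('a) / snd z * pk w" .
  qed
  show "\<bar>hconv (pk2 b c) f z\<bar> \<le> poisson_grad_const TYPE('a) / (snd z)\<^sup>2 * hconv pk (\<lambda>y. \<bar>f y\<bar>) z"
  proof (rule hconv_le[OF pk_continuous(3) f z])
    fix w :: "'a \<times> real" assume w: "snd w = snd z"
    have "\<bar>pk2 b c w\<bar> \<le> (4 * k * (k + 1) + 6 * k) * norm b * norm c / (snd w)\<^sup>2 * pk w"
      unfolding k_def by (rule pk_bounds(2)) (use w z in simp)
    also have "\<dots> \<le> poisson_grad_const TYPE('a) / (snd z)\<^sup>2 * pk w"
      using w z K b pk_pos[of w] by (intro mult_right_mono) (auto simp: divide_right_mono)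
    finally show "\<bar>pk2 b c w\<bar> \<le> poisson_grad_const TYPE('a) / (snd z)\<^sup>2 * pk w" .
  qed
qed

subsection \<open>The Bellman function\<close>

text \<open>Here g, \<eta>, u stand for the normalised first derivatives of G, H, F, and \<phi> for
  F / G^(q-1). Completing squares in \<eta> and u costs at most 4 q^2 g^2 and 4 g^2; the last term,
  negative for q < 2, costs at most g^2, and one further g^2 is wanted on the left. \<open>K\<close>
  is chosen so that q (q - 1) K = 4 q^2 + 6 pays for exactly these.\<close>

lemma bellman_remainder:
  fixes q K H g \<eta> \<phi> u :: real
  assumes q: "1 < q" "q \<le> 2" and K: "K = (4 * q\<^sup>2 + 6) / (q * (q - 1))"
    and H: "\<bar>H\<bar> \<le> 1" and \<phi>: "0 \<le> \<phi>" "\<phi> \<le> 1"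
  shows "g\<^sup>2 + \<eta>\<^sup>2 + u\<^sup>2 \<le> q * (q - 1) * g\<^sup>2 * (K + H\<^sup>2) + 4 * q * g * H * \<eta> + 2 * \<eta>\<^sup>2 + 2 * u\<^sup>2
     + 4 * (2 - q) * \<phi> * u * g + (2 - q) * (1 - q) * \<phi>\<^sup>2 * g\<^sup>2"
proof -
  have qK: "q * (q - 1) * K = 4 * q\<^sup>2 + 6" using q K by simp
  have H2: "H\<^sup>2 \<le> 1" using H by (simp add: abs_square_le_1)
  have p2: "\<phi>\<^sup>2 \<le> 1" using \<phi> by (simp add: power_le_one)
  have A: "0 \<le> (\<eta> + 2 * q * H * g)\<^sup>2" by simp
  have B: "0 \<le> (u + 2 * (2 - q) * \<phi> * g)\<^sup>2" by simp
  have C: "q\<^sup>2 * H\<^sup>2 * g\<^sup>2 \<le> q\<^sup>2 * g\<^sup>2" using H2 by (intro mult_right_mono) (auto simp: mult_left_le)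
  have r1: "(2 - q)\<^sup>2 \<le> 1" using q by (simp add: abs_square_le_1)
  have "(2 - q)\<^sup>2 * \<phi>\<^sup>2 \<le> 1 * 1" using r1 p2 by (intro mult_mono) auto
  hence D: "(2 - q)\<^sup>2 * \<phi>\<^sup>2 * g\<^sup>2 \<le> 1 * g\<^sup>2" by (intro mult_right_mono) auto
  have "(2 - q) * (q - 1) \<le> 1 * 1" using q by (intro mult_mono) auto
  hence "((2 - q) * (q - 1)) * \<phi>\<^sup>2 \<le> 1 * 1" using p2 q by (intro mult_mono) auto
  hence E: "((2 - q) * (q - 1)) * \<phi>\<^sup>2 * g\<^sup>2 \<le> 1 * g\<^sup>2" by (intro mult_right_mono) auto
  have F: "0 \<le> q * (q - 1) * g\<^sup>2 * H\<^sup>2" using q by simp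
  have "q * (q - 1) * g\<^sup>2 * (K + H\<^sup>2) = (q * (q - 1) * K) * g\<^sup>2 + q * (q - 1) * g\<^sup>2 * H\<^sup>2"
    by (simp add: algebra_simps)
  also have "\<dots> = (4 * q\<^sup>2 + 6) * g\<^sup>2 + q * (q - 1) * g\<^sup>2 * H\<^sup>2" unfolding qK ..
  finally have G: "q * (q - 1) * g\<^sup>2 * (K + H\<^sup>2) = 4 * (q\<^sup>2 * g\<^sup>2) + 6 * g\<^sup>2 + q * (q - 1) * g\<^sup>2 * H\<^sup>2"
    by (simp add: algebra_simps)
  have A': "(\<eta> + 2 * q * H * g)\<^sup>2 = \<eta>\<^sup>2 + 4 * q * g * H * \<eta> + 4 * (q\<^sup>2 * H\<^sup>2 * g\<^sup>2)"
    by (simp add: power2_eq_square algebra_simps)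
  have B': "(u + 2 * (2 - q) * \<phi> * g)\<^sup>2 = u\<^sup>2 + 4 * (2 - q) * \<phi> * u * g + 4 * ((2 - q)\<^sup>2 * \<phi>\<^sup>2 * g\<^sup>2)"
    by (simp add: power2_eq_square algebra_simps)
  have E': "(2 - q) * (1 - q) * \<phi>\<^sup>2 * g\<^sup>2 = - (((2 - q) * (q - 1)) * \<phi>\<^sup>2 * g\<^sup>2)"
    by (simp add: algebra_simps)
  show ?thesis using A B C D E F unfolding A' B' G E' by linarith
qed

text \<open>The contribution of direction b to G^(q-2) |\<nabla>G|^2 + G^q |\<nabla>H|^2 + G^(2-q)
  |\<nabla>F|^2, with G^q factored out: what remains involves only quantities that do not change
  under a common scaling of g by c and f by c^(q-1).\<close>

definition bell_D :: "real \<Rightarrow> ('a::euclidean_space \<Rightarrow> real) \<Rightarrow> ('a \<Rightarrow> real) \<Rightarrow> ('a \<Rightarrow> real) \<Rightarrow> 'a \<times> real \<Rightarrow> 'a \<times> real \<Rightarrow> real" where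
  "bell_D q f g h b z = hconv pk g z powr q * ((hconv (pk1 b) g z / hconv pk g z)\<^sup>2 + (hconv (pk1 b) h z)\<^sup>2
     + (hconv (pk1 b) f z * hconv pk g z powr (1 - q))\<^sup>2)"

definition bell_K :: "real \<Rightarrow> real" where
  "bell_K q = (4 * q\<^sup>2 + 6) / (q * (q - 1))"

text \<open>The positive model case. Nontriviality of \<open>f\<close> and \<open>g\<close> makes
  their extensions strictly positive, so powers and quotients of \<open>G\<close> are smooth along
  lines; \<open>h\<close> stands for a partial derivative of a function with Lipschitz constant
  1.\<close>

locale bellman =
  fixes q :: real and f g h :: "'a::euclidean_space \<Rightarrow> real"
  assumes q: "1 < q" "q \<le> 2"
    and f: "ccs f" "\<And>x. 0 \<le> f x" "\<exists>x. 0 < f x"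
    and g: "ccs g" "\<And>x. 0 \<le> g x" "\<exists>x. 0 < g x"
    and fg: "\<And>x. f x \<le> g x powr (q - 1)"
    and h: "ccs h" "\<And>x. \<bar>h x\<bar> \<le> 1"
begin

definition F where "F = hconv pk f"
definition G where "G = hconv pk g"
definition H where "H = hconv pk h"
definition F1 where "F1 b = hconv (pk1 b) f"
definition G1 where "G1 b = hconv (pk1 b) g"
definition H1 where "H1 b = hconv (pk1 b) h"
definition F2 where "F2 b = hconv (pk2 b b) f"
definition G2 where "G2 b = hconv (pk2 b b) g"
definition H2 where "H2 b = hconv (pk2 b b) h"
text \<open>Scale-free variables: \<open>\<phi>\<close> is F / G^(q-1), \<open>\<gamma>\<close> a
  logarithmic derivative of G, \<open>u\<close> a derivative of F divided by G^(q-1).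
  \<open>P\<close> and \<open>PP\<close> are the first and second derivatives of
  \<open>\<phi>\<close> in direction b, whereas \<open>\<gamma>2\<close> and \<open>u2\<close> are
  normalised second derivatives of G and F and not the derivatives of \<open>\<gamma>\<close> and
  \<open>u\<close>.\<close>

definition \<phi> where "\<phi> z = F z * G z powr (1 - q)"
definition \<gamma> where "\<gamma> b z = G1 b z / G z"
definition u where "u b z = F1 b z * G z powr (1 - q)"
definition \<gamma>2 where "\<gamma>2 b z = G2 b z / G z"
definition u2 where "u2 b z = F2 b z * G z powr (1 - q)"
definition P where "P b z = u b z + (1 - q) * (\<phi> z * \<gamma> b z)"
definition PP where "PP b z = u2 b z + (1 - q) * (u b z * \<gamma> b z) + (1 - q) * (P b z * \<gamma> b z + \<phi> z * (\<gamma>2 b z - (\<gamma> b z)\<^sup>2))"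
definition S where "S z = bell_K q + (H z)\<^sup>2 + (\<phi> z)\<^sup>2"
definition S1 where "S1 b z = 2 * (H z * H1 b z) + 2 * (\<phi> z * P b z)"
definition S2 where "S2 b z = 2 * ((H1 b z)\<^sup>2 + H z * H2 b z) + 2 * ((P b z)\<^sup>2 + \<phi> z * PP b z)"
text \<open>Since G^q \<phi>^2 = F^2 G^(2-q), this is the Bellman function along the extensions;
  \<open>B1\<close> and \<open>B2\<close> are its first and second derivatives in direction b. In
  this factored form each is G^q times a polynomial in the scale-free variables.\<close>

definition B where "B z = G z powr q * S z"
definition B1 where "B1 b z = G z powr q * (q * (\<gamma> b z * S z) + S1 b z)"
definition B2 where "B2 b z = G z powr q * (q * (\<gamma> b z * (q * (\<gamma> b z * S z) + S1 b z))
   + (q * (\<gamma> b z * S1 b z + (\<gamma>2 b z - (\<gamma> b z)\<^sup>2) * S z) + S2 b z))"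

lemma G_pos: "0 < snd z \<Longrightarrow> 0 < G z"
  unfolding G_def using hconv_pos[OF g(1) _ g(2)] g(3) by blast

lemma F_pos: "0 < snd z \<Longrightarrow> 0 < F z"
  unfolding F_def using hconv_pos[OF f(1) _ f(2)] f(3) by blast

text \<open>The condition q \<le> 2 makes the power q - 1 concave, and Jensen's inequality then
  carries the pointwise hypothesis from the boundary into the half-space.\<close>

lemma F_le: assumes z: "0 < snd z" shows "F z \<le> G z powr (q - 1)"
proof -
  obtain x0 where x0: "0 < g x0" using g(3) by blast
  have "ccs (\<lambda>x. g x powr (q - 1))" using ccs_abs_powr[OF g(1), of "q - 1"] g(2) q by simp
  hence "F z \<le> hconv pk (\<lambda>x. g x powr (q - 1)) z" unfolding F_def by (intro hconv_mono f z fg)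
  also have "\<dots> \<le> G z powr (q - 1)"
    unfolding G_def by (rule hconv_powr_concave[OF g(1) z g(2) x0]) (use q in auto)
  finally show ?thesis .
qed

lemma phi_bounds: assumes z: "0 < snd z" shows "0 \<le> \<phi> z" "\<phi> z \<le> 1"
proof -
  have "\<phi> z \<le> G z powr (q - 1) * G z powr (1 - q)"
    unfolding \<phi>_def by (intro mult_right_mono F_le z) simp
  also have "\<dots> = 1" using G_pos[OF z] by (simp add: powr_add[symmetric])
  finally show "\<phi> z \<le> 1" .
  show "0 \<le> \<phi> z" unfolding \<phi>_def using F_pos[OF z] by simp
qed

lemma H_bound: "0 < snd z \<Longrightarrow> \<bar>H z\<bar> \<le> 1"
  unfolding H_def by (rule hconv_abs_le[OF h(1) _ h(2)])

text \<open>For nonnegative data the gradient estimate has the function itself on the right,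
  |\<nabla>G| \<le> C G / t, so division by \<open>G\<close> leaves C / t. For \<open>u\<close> and
  \<open>u2\<close> the factor that remains is \<open>\<phi>\<close>, which is at most 1; for
  \<open>h\<close> the extension of |h| is at most 1.\<close>

lemma derivative_bounds:
  assumes z: "0 < snd z" and b: "b \<in> Basis"
  shows "\<bar>\<gamma> b z\<bar> \<le> poisson_grad_const TYPE('a) / snd z" "\<bar>\<gamma>2 b z\<bar> \<le> poisson_grad_const TYPE('a) / (snd z)\<^sup>2"
    "\<bar>u b z\<bar> \<le> poisson_grad_const TYPE('a) / snd z" "\<bar>u2 b z\<bar> \<le> poisson_grad_const TYPE('a) / (snd z)\<^sup>2"
    "\<bar>H1 b z\<bar> \<le> poisson_grad_const TYPE('a) / snd z" "\<bar>H2 b z\<bar> \<le> poisson_grad_const TYPE('a) / (snd z)\<^sup>2"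
proof -
  have p: "0 < poisson_grad_const TYPE('a)" using poisson_grad_const_ge_1[where 'a='a] by linarith
  have K: "0 \<le> poisson_grad_const TYPE('a) / snd z" "0 \<le> poisson_grad_const TYPE('a) / (snd z)\<^sup>2" using p z by auto
  have Gz: "0 < G z" by (rule G_pos[OF z])
  have ab: "(\<lambda>y. \<bar>f y\<bar>) = f" "(\<lambda>y. \<bar>g y\<bar>) = g" using f g by auto
  note fb = hconv_grad_bounds[OF f(1) z b b, unfolded ab, folded F_def F1_def F2_def]
  note gb = hconv_grad_bounds[OF g(1) z b b, unfolded ab, folded G_def G1_def G2_def]
  note hb = hconv_grad_bounds[OF h(1) z b b, folded H1_def H2_def]
  show "\<bar>\<gamma> b z\<bar> \<le> poisson_grad_const TYPE('a) / snd z" "\<bar>\<gamma>2 b z\<bar> \<le> poisson_grad_const TYPE('a) / (snd z)\<^sup>2"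
    using gb Gz by (simp_all add: \<gamma>_def \<gamma>2_def pos_divide_le_eq)
  have *: "\<bar>X * G z powr (1 - q)\<bar> \<le> C" if "\<bar>X\<bar> \<le> C * F z" "0 \<le> C" for X C
  proof -
    have "\<bar>X * G z powr (1 - q)\<bar> \<le> C * F z * G z powr (1 - q)"
      unfolding abs_mult using that by (auto intro: mult_right_mono)
    also have "\<dots> = C * \<phi> z" by (simp add: \<phi>_def)
    also have "\<dots> \<le> C * 1" using phi_bounds[OF z] that by (intro mult_left_mono) auto
    finally show ?thesis by simp
  qed
  show "\<bar>u b z\<bar> \<le> poisson_grad_const TYPE('a) / snd z" "\<bar>u2 b z\<bar> \<le> poisson_grad_const TYPE('a) / (snd z)\<^sup>2"
    unfolding u_def u2_def by (rule *[OF fb(1) K(1)] *[OF fb(2) K(2)])+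
  have "hconv pk (\<lambda>y. \<bar>h y\<bar>) z \<le> 1" using hconv_abs_le[OF ccs_abs[OF h(1)] z, of 1] h(2) by simp
  hence "C * hconv pk (\<lambda>y. \<bar>h y\<bar>) z \<le> C" if "0 \<le> C" for C using that by (simp add: mult_left_le)
  thus "\<bar>H1 b z\<bar> \<le> poisson_grad_const TYPE('a) / snd z" "\<bar>H2 b z\<bar> \<le> poisson_grad_const TYPE('a) / (snd z)\<^sup>2"
    using hb K by (blast intro: order_trans)+
qed

lemma line_derivs:
  assumes z: "0 < snd z" and b: "b \<in> Basis"
  shows "((\<lambda>s. B (z + s *\<^sub>R b)) has_real_derivative B1 b z) (at 0)"
    and "((\<lambda>s. B1 b (z + s *\<^sub>R b)) has_real_derivative B2 b z) (at 0)"
proof -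
  have Gz: "0 < G z" by (rule G_pos[OF z])
  note d0 = pk_U(1)[OF f(1) z, of b, folded F_def F1_def] pk_U(1)[OF g(1) z, of b, folded G_def G1_def]
    pk_U(1)[OF h(1) z, of b, folded H_def H1_def]
  note d1 = pk_U(2)[OF f(1) z, of b b, folded F1_def F2_def] pk_U(2)[OF g(1) z, of b b, folded G1_def G2_def]
    pk_U(2)[OF h(1) z, of b b, folded H1_def H2_def]
  have z0: "z + 0 *\<^sub>R b = z" by simp
  have dG: "((\<lambda>s. G (z + s *\<^sub>R b) powr e) has_real_derivative e * (G z powr e * \<gamma> b z)) (at 0)" for e
  proof -
    have "((\<lambda>s. G (z + s *\<^sub>R b) powr e) has_real_derivative e * G (z + 0 *\<^sub>R b) powr (e - 1) * G1 b z) (at 0)"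
      using DERIV_fun_powr[OF d0(2), of e] Gz unfolding z0 by simp
    moreover have "G z powr (e - 1) = G z powr e / G z" using Gz by (simp add: powr_diff)
    ultimately show ?thesis unfolding z0 by (simp add: \<gamma>_def mult.assoc)
  qed
  have d\<phi>: "((\<lambda>s. \<phi> (z + s *\<^sub>R b)) has_real_derivative P b z) (at 0)"
    using DERIV_mult'[OF d0(1) dG[of "1 - q"]] unfolding z0 \<phi>_def P_def u_def
    by (simp add: algebra_simps)
  have d\<gamma>: "((\<lambda>s. \<gamma> b (z + s *\<^sub>R b)) has_real_derivative \<gamma>2 b z - (\<gamma> b z)\<^sup>2) (at 0)"
    using DERIV_divide[OF d1(2) d0(2)] Gz unfolding z0 \<gamma>_def \<gamma>2_def
    by (simp add: field_simps power2_eq_square)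
  have du: "((\<lambda>s. u b (z + s *\<^sub>R b)) has_real_derivative u2 b z + (1 - q) * (u b z * \<gamma> b z)) (at 0)"
    using DERIV_mult'[OF d1(1) dG[of "1 - q"]] unfolding z0 u_def u2_def
    by (simp add: algebra_simps)
  have dP: "((\<lambda>s. P b (z + s *\<^sub>R b)) has_real_derivative PP b z) (at 0)"
    using DERIV_add[OF du DERIV_cmult[OF DERIV_mult'[OF d\<phi> d\<gamma>], of "1 - q"]] unfolding z0 P_def PP_def
    by (simp add: algebra_simps)
  have dS: "((\<lambda>s. S (z + s *\<^sub>R b)) has_real_derivative S1 b z) (at 0)"
    using DERIV_add[OF DERIV_add[OF DERIV_const[of "bell_K q"] DERIV_mult'[OF d0(3) d0(3)]] DERIV_mult'[OF d\<phi> d\<phi>]]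
    unfolding z0 S_def S1_def by (simp add: power2_eq_square algebra_simps)
  have dS1: "((\<lambda>s. S1 b (z + s *\<^sub>R b)) has_real_derivative S2 b z) (at 0)"
    using DERIV_add[OF DERIV_cmult[OF DERIV_mult'[OF d0(3) d1(3)], of 2] DERIV_cmult[OF DERIV_mult'[OF d\<phi> dP], of 2]]
    unfolding z0 S1_def S2_def by (simp add: power2_eq_square algebra_simps)
  show "((\<lambda>s. B (z + s *\<^sub>R b)) has_real_derivative B1 b z) (at 0)"
    using DERIV_mult'[OF dG[of q] dS] unfolding z0 B_def B1_def by (simp add: algebra_simps)
  show "((\<lambda>s. B1 b (z + s *\<^sub>R b)) has_real_derivative B2 b z) (at 0)"
    using DERIV_mult'[OF dG[of q] DERIV_add[OF DERIV_cmult[OF DERIV_mult'[OF d\<gamma> dS], of q] dS1]]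
    unfolding z0 B1_def B2_def by (simp add: algebra_simps)
qed

lemma continuities:
  "continuous_on halfspace B" "continuous_on halfspace (B1 b)" "continuous_on halfspace (B2 b)"
  "continuous_on halfspace (\<lambda>z. G z powr q)" "continuous_on halfspace (bell_D q f g h b)"
proof -
  note U0 = hconv_continuous[OF pk_continuous(1)] and U1 = hconv_continuous[OF pk_continuous(2)] and U2 = hconv_continuous[OF pk_continuous(3)]
  have [continuous_intros]: "continuous_on halfspace F" "continuous_on halfspace G" "continuous_on halfspace H"
    "continuous_on halfspace (F1 b)" "continuous_on halfspace (G1 b)" "continuous_on halfspace (H1 b)"
    "continuous_on halfspace (F2 b)" "continuous_on halfspace (G2 b)" "continuous_on halfspace (H2 b)" for b
    unfolding F_def G_def H_def F1_def G1_def H1_def F2_def G2_def H2_def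
    by (rule U0 U1 U2 f g h)+
  have [continuous_intros]: "continuous_on halfspace (\<lambda>z. G z powr e)" for e
    by (intro continuous_on_powr continuous_intros) (use G_pos in fastforce)
  have [continuous_intros]: "continuous_on halfspace (\<gamma> b)" "continuous_on halfspace (\<gamma>2 b)" for b
    unfolding \<gamma>_def \<gamma>2_def by (intro continuous_intros; use G_pos in fastforce)+
  have [continuous_intros]: "continuous_on halfspace \<phi>" "continuous_on halfspace (u b)" "continuous_on halfspace (u2 b)" for b
    unfolding \<phi>_def u_def u2_def by (intro continuous_intros)+
  have [continuous_intros]: "continuous_on halfspace (P b)" for b unfolding P_def by (intro continuous_intros)
  have [continuous_intros]: "continuous_on halfspace (PP b)" for b unfolding PP_def by (intro continuous_intros)
  have [continuous_intros]: "continuous_on halfspace S" "continuous_on halfspace (S1 b)" "continuous_on halfspace (S2 b)" for b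
    unfolding S_def S1_def S2_def by (intro continuous_intros)+
  show "continuous_on halfspace B" "continuous_on halfspace (B1 b)" "continuous_on halfspace (B2 b)"
    unfolding B_def B1_def B2_def by (intro continuous_intros)+
  show "continuous_on halfspace (\<lambda>z. G z powr q)" by (intro continuous_intros)
  have "continuous_on halfspace (\<lambda>z. G z powr q * ((\<gamma> b z)\<^sup>2 + (H1 b z)\<^sup>2 + (u b z)\<^sup>2))"
    by (intro continuous_intros)
  thus "continuous_on halfspace (bell_D q f g h b)"
    by (simp add: bell_D_def[abs_def] \<gamma>_def u_def G_def G1_def H1_def F1_def)
qed

lemma bell_D_eq: "bell_D q f g h b z = G z powr q * ((\<gamma> b z)\<^sup>2 + (H1 b z)\<^sup>2 + (u b z)\<^sup>2)"
  by (simp add: bell_D_def \<gamma>_def u_def G_def G1_def H1_def F1_def)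

text \<open>\<open>B2\<close> is G^q times a quadratic form in the first derivatives plus a part
  linear in the second derivatives. \<open>bellman_remainder\<close> bounds the former from below
  for each b separately; only the latter needs the sum over all directions.\<close>

lemma sum_bell_D_le:
  assumes z: "0 < snd z"
  shows "(\<Sum>b\<in>Basis. bell_D q f g h b z) \<le> (\<Sum>b\<in>Basis. B2 b z)"
proof -
  \<comment> \<open>The part with second derivatives. Its coefficients do not depend on b, so its
    sum over b is a combination of the Laplacians of F, G and H.\<close>
  define L where "L b = (q * S z + 2 * (1 - q) * (\<phi> z)\<^sup>2) * \<gamma>2 b z + 2 * H z * H2 b z + 2 * \<phi> z * u2 b z" for b
  have "(\<Sum>b\<in>Basis. L b) = (q * S z + 2 * (1 - q) * (\<phi> z)\<^sup>2) * ((\<Sum>b\<in>Basis. G2 b z) / G z) + 2 * H z * (\<Sum>b\<in>Basis. H2 b z)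
      + 2 * \<phi> z * ((\<Sum>b\<in>Basis. F2 b z) * G z powr (1 - q))"
    unfolding L_def \<gamma>2_def u2_def by (simp add: sum.distrib sum_distrib_left sum_distrib_right sum_divide_distrib)
  also have "\<dots> = 0" unfolding F2_def G2_def H2_def using hconv_harmonic[OF f(1) z] hconv_harmonic[OF g(1) z] hconv_harmonic[OF h(1) z] by simp
  finally have L0: "(\<Sum>b\<in>Basis. L b) = 0" .
  have "bell_D q f g h b z \<le> B2 b z - G z powr q * L b" for b
  proof -
    define R where "R = q * (q - 1) * (\<gamma> b z)\<^sup>2 * (bell_K q + (H z)\<^sup>2) + 4 * q * \<gamma> b z * H z * H1 b z + 2 * (H1 b z)\<^sup>2 + 2 * (u b z)\<^sup>2
      + 4 * (2 - q) * \<phi> z * u b z * \<gamma> b z + (2 - q) * (1 - q) * (\<phi> z)\<^sup>2 * (\<gamma> b z)\<^sup>2"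
    have "(\<gamma> b z)\<^sup>2 + (H1 b z)\<^sup>2 + (u b z)\<^sup>2 \<le> R"
      unfolding R_def by (rule bellman_remainder) (use q H_bound[OF z] phi_bounds[OF z] in \<open>auto simp: bell_K_def\<close>)
    hence "bell_D q f g h b z \<le> G z powr q * R" unfolding bell_D_eq by (intro mult_left_mono) auto
    also have "G z powr q * R = B2 b z - G z powr q * L b"
      unfolding B2_def R_def L_def S2_def PP_def S1_def P_def S_def
      by (simp add: power2_eq_square algebra_simps)
    finally show ?thesis .
  qed
  hence "(\<Sum>b\<in>Basis. bell_D q f g h b z) \<le> (\<Sum>b\<in>Basis. B2 b z - G z powr q * L b)" by (rule sum_mono)
  also have "\<dots> = (\<Sum>b\<in>Basis. B2 b z)" by (simp add: sum_subtractf sum_distrib_left[symmetric] L0)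
  finally show ?thesis .
qed

lemma G_powr_integral:
  assumes t: "0 < t"
  shows "integrable lborel (\<lambda>x. G (x, t) powr q)" "(LINT x|lborel. G (x, t) powr q) \<le> (LINT x|lborel. g x powr q)"
proof -
  obtain x0 where x0: "0 < g x0" using g(3) by blast
  have cq: "ccs (\<lambda>x. g x powr q)" using ccs_abs_powr[OF g(1), of q] g(2) q by simp
  have le: "G (x, t) powr q \<le> hconv pk (\<lambda>x. g x powr q) (x, t)" for x :: 'a
    unfolding G_def by (rule hconv_powr_convex[OF g(1) _ g(2) x0]) (use t q in auto)
  show i: "integrable lborel (\<lambda>x. G (x, t) powr q)"
  proof (rule Bochner_Integration.integrable_bound[OF hconv_slice_integral(1)[OF cq t]])
    have "continuous_on UNIV (\<lambda>x. G (x, t) powr q)"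
      by (rule continuous_on_compose2[OF continuities(4)]) (use t in \<open>auto intro!: continuous_intros\<close>)
    thus "(\<lambda>x. G (x, t) powr q) \<in> borel_measurable lborel" by (simp add: borel_measurable_continuous_onI)
    show "AE x in lborel. norm (G (x, t) powr q) \<le> norm (hconv pk (\<lambda>x. g x powr q) (x, t))"
      using le by (auto intro: order_trans[OF _ abs_ge_self])
  qed
  have "(LINT x|lborel. G (x, t) powr q) \<le> (LINT x|lborel. hconv pk (\<lambda>x. g x powr q) (x, t))"
    by (rule integral_mono[OF i hconv_slice_integral(1)[OF cq t] le])
  thus "(LINT x|lborel. G (x, t) powr q) \<le> (LINT x|lborel. g x powr q)" using hconv_slice_integral(2)[OF cq t] by simp
qed

text \<open>Of G^q the factor G^(q-1) is bounded, as \<open>G\<close> does not exceed the supremum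
  of g, and the last factor \<open>G\<close> is dominated by its bottom slice.\<close>

lemma G_powr_dominated:
  assumes e: "0 < \<epsilon>"
  obtains M where "integrable lborel M" "\<And>x t. \<epsilon> \<le> t \<Longrightarrow> t \<le> T \<Longrightarrow> G (x, t) powr q \<le> M x"
proof -
  obtain C where C: "0 < C" "\<And>x. \<bar>g x\<bar> \<le> C" using ccs_bounded[OF g(1)] by blast
  show ?thesis
  proof (rule that[of "\<lambda>x. C powr (q - 1) * (T / \<epsilon> * G (x, \<epsilon>))"])
    show "integrable lborel (\<lambda>x. C powr (q - 1) * (T / \<epsilon> * G (x, \<epsilon>)))"
      unfolding G_def by (intro integrable_mult_right hconv_slice_integral(1) g e)
    fix x :: 'a and t assume t: "\<epsilon> \<le> t" "t \<le> T"
    have z: "0 < snd (x, t)" using t e by simp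
    have "G (x, t) powr q = G (x, t) powr (q - 1) * G (x, t)"
      using G_pos[OF z] powr_add[of "G (x, t)" "q - 1" 1] by simp
    also have "\<dots> \<le> C powr (q - 1) * (T / \<epsilon> * G (x, \<epsilon>))"
    proof (rule mult_mono)
      have "\<bar>G (x, t)\<bar> \<le> C" unfolding G_def by (rule hconv_abs_le[OF g(1) z C(2)])
      thus "G (x, t) powr (q - 1) \<le> C powr (q - 1)" using G_pos[OF z] q by (intro powr_mono2) auto
      show "G (x, t) \<le> T / \<epsilon> * G (x, \<epsilon>)" unfolding G_def by (rule hconv_strip[OF g(1,2) e t])
    qed (use G_pos[OF z] in auto)
    finally show "G (x, t) powr q \<le> C powr (q - 1) * (T / \<epsilon> * G (x, \<epsilon>))" .
  qed
qed

text \<open>On a strip every scale-free variable is bounded, so all these functions are G^q times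
  something bounded. Their domination thereby reduces to that of G^q.\<close>

lemma factor_bounds:
  assumes e: "0 < \<epsilon>"
  obtains C where "\<And>b z. b \<in> Basis \<Longrightarrow> \<epsilon> \<le> snd z \<Longrightarrow> snd z \<le> T \<Longrightarrow>
     \<bar>B z\<bar> \<le> C * G z powr q \<and> \<bar>B1 b z\<bar> \<le> C * G z powr q \<and> \<bar>B2 b z\<bar> \<le> C * G z powr q \<and> bell_D q f g h b z \<le> C * G z powr q"
proof -
  define N where "N = {z :: 'a \<times> real. \<epsilon> \<le> snd z \<and> snd z \<le> T}"
  have N: "0 < snd z" if "z \<in> N" for z using that e by (auto simp: N_def)
  have p: "0 < poisson_grad_const TYPE('a)" using poisson_grad_const_ge_1[where 'a='a] by linarith
  have le: "poisson_grad_const TYPE('a) / snd z \<le> poisson_grad_const TYPE('a) / \<epsilon>" "poisson_grad_const TYPE('a) / (snd z)\<^sup>2 \<le> poisson_grad_const TYPE('a) / \<epsilon>\<^sup>2" if "z \<in> N" for z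
    using that e p by (auto simp: N_def intro!: divide_left_mono power_mono mult_pos_pos)
  note db = derivative_bounds[OF N]
  have [bdd_on_intros]: "bdd_on N (\<gamma> b)" "bdd_on N (\<gamma>2 b)" "bdd_on N (u b)" "bdd_on N (u2 b)" "bdd_on N (H1 b)" "bdd_on N (H2 b)"
    if "b \<in> Basis" for b
    by (rule bdd_onI, rule order_trans[OF db(1) le(1)] order_trans[OF db(2) le(2)] order_trans[OF db(3) le(1)]
       order_trans[OF db(4) le(2)] order_trans[OF db(5) le(1)] order_trans[OF db(6) le(2)]; use that in simp)+
  have [bdd_on_intros]: "bdd_on N \<phi>" by (rule bdd_onI[of _ _ 1]) (use phi_bounds N in simp)
  have [bdd_on_intros]: "bdd_on N H" by (rule bdd_onI[of _ _ 1]) (use H_bound N in simp)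
  define X where "X b z = \<bar>S z\<bar> + \<bar>q * (\<gamma> b z * S z) + S1 b z\<bar> + \<bar>q * (\<gamma> b z * (q * (\<gamma> b z * S z) + S1 b z))
   + (q * (\<gamma> b z * S1 b z + (\<gamma>2 b z - (\<gamma> b z)\<^sup>2) * S z) + S2 b z)\<bar> + \<bar>(\<gamma> b z)\<^sup>2 + (H1 b z)\<^sup>2 + (u b z)\<^sup>2\<bar>" for b z
  have ab: "bdd_on N (\<lambda>z. \<bar>Y z\<bar>)" if "bdd_on N Y" for Y using that by (simp add: bdd_on_def)
  have bX: "bdd_on N (X b)" if "b \<in> Basis" for b
    unfolding X_def S1_def S2_def S_def PP_def P_def by (intro bdd_on_intros ab that)
  have "bdd_on N (\<lambda>z. \<Sum>b\<in>Basis. X b z)" by (intro bdd_on_intros bX)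
  then obtain C where C: "\<And>z. z \<in> N \<Longrightarrow> \<bar>\<Sum>b\<in>Basis. X b z\<bar> \<le> C" unfolding bdd_on_def by blast
  show ?thesis
  proof (rule that[of C])
    fix b z :: "'a \<times> real" assume b: "b \<in> Basis" and z: "\<epsilon> \<le> snd z" "snd z \<le> T"
    have X0: "0 \<le> X b z" for b :: "'a \<times> real" by (simp add: X_def)
    have "X b z \<le> (\<Sum>b\<in>Basis. X b z)" by (rule member_le_sum[OF b]) (use X0 in auto)
    hence XC: "X b z \<le> C" using C[of z] z by (simp add: N_def)
    have *: "\<bar>G z powr q * Y\<bar> \<le> C * G z powr q" if "\<bar>Y\<bar> \<le> X b z" for Y
      using that XC mult_right_mono[of "\<bar>Y\<bar>" C "G z powr q"] by (simp add: abs_mult mult.commute)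
    have "\<bar>B z\<bar> \<le> C * G z powr q" unfolding B_def by (rule *) (simp add: X_def)
    moreover have "\<bar>B1 b z\<bar> \<le> C * G z powr q" unfolding B1_def by (rule *) (simp add: X_def)
    moreover have "\<bar>B2 b z\<bar> \<le> C * G z powr q" unfolding B2_def by (rule *) (simp add: X_def)
    moreover have "\<bar>bell_D q f g h b z\<bar> \<le> C * G z powr q" unfolding bell_D_eq by (rule *) (simp add: X_def)
    ultimately show "\<bar>B z\<bar> \<le> C * G z powr q \<and> \<bar>B1 b z\<bar> \<le> C * G z powr q \<and> \<bar>B2 b z\<bar> \<le> C * G z powr q \<and> bell_D q f g h b z \<le> C * G z powr q"
      by auto
  qed
qed

lemma bell_D_nonneg: "0 \<le> bell_D q f g h b z"
  by (simp add: bell_D_def)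

lemma bell_D_dominated:
  assumes e: "0 < \<epsilon>"
  obtains M where "integrable lborel M" "\<And>x t. \<epsilon> \<le> t \<Longrightarrow> t \<le> T \<Longrightarrow> \<bar>\<Sum>b\<in>Basis. bell_D q f g h b (x, t)\<bar> \<le> M x"
proof -
  obtain M :: "'a \<Rightarrow> real" where M: "integrable lborel M" "\<And>x t. \<epsilon> \<le> t \<Longrightarrow> t \<le> T \<Longrightarrow> G (x, t) powr q \<le> M x"
    using G_powr_dominated[OF e] by blast
  obtain C where C: "\<And>b z. b \<in> Basis \<Longrightarrow> \<epsilon> \<le> snd z \<Longrightarrow> snd z \<le> T \<Longrightarrow> bell_D q f g h b z \<le> C * G z powr q"
    using factor_bounds[OF e] by metis
  show ?thesis
  proof (rule that[of "\<lambda>x. real DIM('a \<times> real) * (\<bar>C\<bar> * M x)"])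
    show "integrable lborel (\<lambda>x. real DIM('a \<times> real) * (\<bar>C\<bar> * M x))" using M(1) by simp
    fix x :: 'a and t assume t: "\<epsilon> \<le> t" "t \<le> T"
    have "bell_D q f g h b (x, t) \<le> \<bar>C\<bar> * M x" if "b \<in> Basis" for b
    proof -
      have "bell_D q f g h b (x, t) \<le> C * G (x, t) powr q" using C[OF that, of "(x, t)"] t by simp
      also have "\<dots> \<le> \<bar>C\<bar> * M x" using M(2)[OF t, of x] by (intro mult_mono) auto
      finally show ?thesis .
    qed
    hence "(\<Sum>b\<in>Basis. bell_D q f g h b (x, t)) \<le> real DIM('a \<times> real) * (\<bar>C\<bar> * M x)"
      by (rule sum_bounded_above)
    thus "\<bar>\<Sum>b\<in>Basis. bell_D q f g h b (x, t)\<bar> \<le> real DIM('a \<times> real) * (\<bar>C\<bar> * M x)"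
      by (simp add: sum_nonneg bell_D_nonneg)
  qed
qed

text \<open>\<open>strip_green\<close> for \<open>B\<close>, with \<open>sum_bell_D_le\<close> under
  the integral. At the top - B is dropped because of its sign; the remaining boundary terms are at
  most multiples of G^q, and the convex Jensen inequality with conservation of mass bounds the slice
  integral of G^q by that of g^q at every height. The constant is therefore independent of
  \<epsilon> and T.\<close>

lemma bellman_estimate:
  assumes eT: "0 < \<epsilon>" "\<epsilon> \<le> T"
  shows "(LINT t|lborel. (LINT x|lborel. (\<Sum>b\<in>Basis. bell_D q f g h b (x, t)) * (t - \<epsilon>)) * indicator {\<epsilon>..T} t)
    \<le> (poisson_grad_const TYPE('a) * (2 * bell_K q + 10) + bell_K q + 2) * (LINT x|lborel. g x powr q)"
proof -
  define e where "e = ((0, 1) :: 'a \<times> real)"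
  have e: "e \<in> Basis" by (auto simp: e_def Basis_prod_def)
  have T0: "0 < T" using eT by simp
  define K where "K = bell_K q"
  have K: "0 \<le> K" using q by (simp add: K_def bell_K_def)
  define p where "p = poisson_grad_const TYPE('a)"
  have p: "1 \<le> p" unfolding p_def by (rule poisson_grad_const_ge_1)
  obtain M :: "'a \<Rightarrow> real" where M: "integrable lborel M" "\<And>x t. \<epsilon> \<le> t \<Longrightarrow> t \<le> T \<Longrightarrow> G (x, t) powr q \<le> M x"
    using G_powr_dominated[OF eT(1)] by blast
  obtain C where C: "\<And>b z. b \<in> Basis \<Longrightarrow> \<epsilon> \<le> snd z \<Longrightarrow> snd z \<le> T \<Longrightarrow>
     \<bar>B z\<bar> \<le> C * G z powr q \<and> \<bar>B1 b z\<bar> \<le> C * G z powr q \<and> \<bar>B2 b z\<bar> \<le> C * G z powr q"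
    using factor_bounds[OF eT(1)] by metis
  have MC: "C * G (x, t) powr q \<le> \<bar>C\<bar> * M x" if "\<epsilon> \<le> t" "t \<le> T" for x t
    using M(2)[OF that, of x] by (intro mult_mono) auto
  have iM: "integrable lborel (\<lambda>x. \<bar>C\<bar> * M x)" using M(1) by simp
  have b0: "\<bar>B (x, t)\<bar> \<le> \<bar>C\<bar> * M x" if "\<epsilon> \<le> t" "t \<le> T" for x t
    using C[OF e, of "(x, t)"] MC[OF that, of x] that by simp
  have b1: "\<bar>B1 b (x, t)\<bar> \<le> \<bar>C\<bar> * M x" if "b \<in> Basis" "\<epsilon> \<le> t" "t \<le> T" for b x t
    using C[OF that(1), of "(x, t)"] MC[OF that(2,3), of x] that by simp
  have b2: "\<bar>B2 b (x, t)\<bar> \<le> \<bar>C\<bar> * M x" if "b \<in> Basis" "\<epsilon> \<le> t" "t \<le> T" for b x t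
    using C[OF that(1), of "(x, t)"] MC[OF that(2,3), of x] that by simp
  note green = strip_green[OF eT line_derivs(1) line_derivs(2) continuities(1-3) iM b0 b1 b2]
  define A where "A z = (\<Sum>b\<in>Basis. bell_D q f g h b z) * (snd z - \<epsilon>)" for z
  define A2 where "A2 z = (\<Sum>b\<in>Basis. B2 b z) * (snd z - \<epsilon>)" for z
  have cA: "continuous_on halfspace A" "continuous_on halfspace A2"
    unfolding A_def A2_def by (intro continuous_intros continuities)+
  obtain M1 :: "'a \<Rightarrow> real" where M1: "integrable lborel M1" "\<And>x t. \<epsilon> \<le> t \<Longrightarrow> t \<le> T \<Longrightarrow> \<bar>\<Sum>b\<in>Basis. bell_D q f g h b (x, t)\<bar> \<le> M1 x"
    using bell_D_dominated[OF eT(1)] by blast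
  have bA: "\<bar>A (x, t)\<bar> \<le> M1 x * T" if "\<epsilon> \<le> t" "t \<le> T" for x t
    unfolding A_def abs_mult using M1(2)[OF that, of x] that eT by (intro mult_mono) auto
  have bA2: "\<bar>A2 (x, t)\<bar> \<le> (real DIM('a \<times> real) * (\<bar>C\<bar> * M x)) * T" if "\<epsilon> \<le> t" "t \<le> T" for x t
  proof -
    have "\<bar>\<Sum>b\<in>Basis. B2 b (x, t)\<bar> \<le> (\<Sum>b\<in>Basis. \<bar>B2 b (x, t)\<bar>)" by (rule sum_abs)
    also have "\<dots> \<le> real DIM('a \<times> real) * (\<bar>C\<bar> * M x)" by (rule sum_bounded_above) (rule b2[OF _ that])
    finally show ?thesis unfolding A2_def abs_mult using that eT by (intro mult_mono) auto
  qed
  have iA: "integrable lborel (\<lambda>t. (LINT x|lborel. A (x, t)) * indicator {\<epsilon>..T} t)"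
    "\<And>t. \<epsilon> \<le> t \<Longrightarrow> t \<le> T \<Longrightarrow> integrable lborel (\<lambda>x. A (x, t))"
    using strip_integrable[OF eT(1) cA(1) integrable_mult_left[OF M1(1)] bA] by auto
  have iA2: "integrable lborel (\<lambda>t. (LINT x|lborel. A2 (x, t)) * indicator {\<epsilon>..T} t)"
    "\<And>t. \<epsilon> \<le> t \<Longrightarrow> t \<le> T \<Longrightarrow> integrable lborel (\<lambda>x. A2 (x, t))"
    using strip_integrable[OF eT(1) cA(2) integrable_mult_left[OF integrable_mult_right[OF iM]] bA2] by auto
  have "(LINT t|lborel. (LINT x|lborel. A (x, t)) * indicator {\<epsilon>..T} t) \<le> (LINT t|lborel. (LINT x|lborel. A2 (x, t)) * indicator {\<epsilon>..T} t)"
  proof (rule integral_mono[OF iA(1) iA2(1)])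
    fix t
    show "(LINT x|lborel. A (x, t)) * indicator {\<epsilon>..T} t \<le> (LINT x|lborel. A2 (x, t)) * indicator {\<epsilon>..T} t"
    proof (cases "\<epsilon> \<le> t \<and> t \<le> T")
      case True
      have "(LINT x|lborel. A (x, t)) \<le> (LINT x|lborel. A2 (x, t))"
        by (intro integral_mono iA(2) iA2(2)) (use True eT sum_bell_D_le[of "(_, t)"] in \<open>auto simp: A_def A2_def intro!: mult_right_mono\<close>)
      thus ?thesis using True by simp
    qed auto
  qed
  also have "\<dots> = (LINT x|lborel. (T - \<epsilon>) * B1 (0, 1) (x, T) - B (x, T) + B (x, \<epsilon>))"
    using green by (simp add: A2_def)
  also have "\<dots> \<le> (LINT x|lborel. p * (2 * K + 10) * G (x, T) powr q + (K + 2) * G (x, \<epsilon>) powr q)"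
  proof (rule integral_mono)
    show "integrable lborel (\<lambda>x. p * (2 * K + 10) * G (x, T) powr q + (K + 2) * G (x, \<epsilon>) powr q)"
      using G_powr_integral(1)[OF T0] G_powr_integral(1)[OF eT(1)] by simp
    have "integrable lborel (\<lambda>x. B1 (0, 1) (x, T))"
      using strip_integrable(2)[OF eT(1) continuities(2) iM b1[OF e[unfolded e_def]]] eT by blast
    moreover have "integrable lborel (\<lambda>x. B (x, T))" "integrable lborel (\<lambda>x. B (x, \<epsilon>))"
      using strip_integrable(2)[OF eT(1) continuities(1) iM b0] eT by auto
    ultimately show "integrable lborel (\<lambda>x. (T - \<epsilon>) * B1 (0, 1) (x, T) - B (x, T) + B (x, \<epsilon>))" by simp
    fix x :: 'a
    have zT: "0 < snd (x, T)" and ze: "0 < snd (x, \<epsilon>)" using T0 eT by auto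
    have Sb: "0 \<le> S z" "S z \<le> K + 2" if "0 < snd z" for z :: "'a \<times> real"
    proof -
      have "(H z)\<^sup>2 \<le> 1" "(\<phi> z)\<^sup>2 \<le> 1"
        using H_bound[OF that] phi_bounds[OF that] by (auto simp: abs_square_le_1)
      thus "0 \<le> S z" "S z \<le> K + 2" using K by (auto simp: S_def K_def[symmetric])
    qed
    have "B (x, \<epsilon>) \<le> (K + 2) * G (x, \<epsilon>) powr q"
      unfolding B_def using mult_right_mono[OF Sb(2)[OF ze], of "G (x, \<epsilon>) powr q"] by (simp add: mult.commute)
    moreover have "0 \<le> B (x, T)" unfolding B_def using Sb(1)[OF zT] by simp
    \<comment> \<open>The weight T - \<epsilon> is compensated by the factor 1 / T in each
      normalised derivative. With S \<le> K + 2 and q \<le> 2 the term q \<gamma> S contributes 2 p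
      (K + 2), and \<open>S1\<close> contributes 2 p from H and 4 p from \<open>\<phi>\<close>, in
      total p (2 K + 10).\<close>
    moreover have "(T - \<epsilon>) * B1 (0, 1) (x, T) \<le> p * (2 * K + 10) * G (x, T) powr q"
    proof -
      define z where "z = (x, T)"
      have z: "0 < snd z" "snd z = T" using T0 by (auto simp: z_def)
      have d: "T * \<bar>\<gamma> e z\<bar> \<le> p" "T * \<bar>u e z\<bar> \<le> p" "T * \<bar>H1 e z\<bar> \<le> p"
        using derivative_bounds(1,3,5)[OF z(1) e] T0 unfolding z(2) p_def[symmetric]
        by (simp_all add: pos_le_divide_eq mult.commute)
      have 1: "T * \<bar>q * (\<gamma> e z * S z)\<bar> \<le> 2 * (p * (K + 2))"
      proof -
        have "T * \<bar>q * (\<gamma> e z * S z)\<bar> = q * ((T * \<bar>\<gamma> e z\<bar>) * S z)" using q Sb(1)[OF z(1)] by (simp add: abs_mult)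
        also have "\<dots> \<le> 2 * (p * (K + 2))"
          using q d Sb[OF z(1)] T0 p by (intro mult_mono) auto
        finally show ?thesis .
      qed
      have P: "T * \<bar>P e z\<bar> \<le> 2 * p"
      proof -
        have "\<bar>(1 - q) * (\<phi> z * \<gamma> e z)\<bar> \<le> 1 * (1 * \<bar>\<gamma> e z\<bar>)"
          unfolding abs_mult using q phi_bounds[OF z(1)] by (intro mult_mono) auto
        hence "\<bar>P e z\<bar> \<le> \<bar>u e z\<bar> + \<bar>\<gamma> e z\<bar>" unfolding P_def using abs_triangle_ineq[of "u e z"] by (smt (verit))
        hence "T * \<bar>P e z\<bar> \<le> T * (\<bar>u e z\<bar> + \<bar>\<gamma> e z\<bar>)" using T0 by (intro mult_left_mono) auto
        thus ?thesis using d by (simp add: distrib_left)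
      qed
      have "\<bar>H z * H1 e z\<bar> \<le> 1 * \<bar>H1 e z\<bar>" "\<bar>\<phi> z * P e z\<bar> \<le> 1 * \<bar>P e z\<bar>"
        unfolding abs_mult using H_bound[OF z(1)] phi_bounds[OF z(1)] by (intro mult_right_mono; simp)+
      hence "T * \<bar>H z * H1 e z\<bar> \<le> T * \<bar>H1 e z\<bar>" "T * \<bar>\<phi> z * P e z\<bar> \<le> T * \<bar>P e z\<bar>"
        using T0 by (auto intro: mult_left_mono)
      with d P have 2: "T * \<bar>H z * H1 e z\<bar> \<le> p" "T * \<bar>\<phi> z * P e z\<bar> \<le> 2 * p" by linarith+
      have "\<bar>S1 e z\<bar> \<le> 2 * \<bar>H z * H1 e z\<bar> + 2 * \<bar>\<phi> z * P e z\<bar>"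
        unfolding S1_def by (smt (verit))
      hence "T * \<bar>S1 e z\<bar> \<le> T * (2 * \<bar>H z * H1 e z\<bar> + 2 * \<bar>\<phi> z * P e z\<bar>)"
        using T0 by (intro mult_left_mono) auto
      also have "\<dots> = 2 * (T * \<bar>H z * H1 e z\<bar>) + 2 * (T * \<bar>\<phi> z * P e z\<bar>)" by (simp add: algebra_simps)
      also have "\<dots> \<le> 6 * p" using 2 by linarith
      finally have 3: "T * \<bar>S1 e z\<bar> \<le> 6 * p" .
      define Y where "Y = q * (\<gamma> e z * S z) + S1 e z"
      have "T * \<bar>Y\<bar> \<le> T * (\<bar>q * (\<gamma> e z * S z)\<bar> + \<bar>S1 e z\<bar>)"
        unfolding Y_def using T0 by (intro mult_left_mono abs_triangle_ineq) auto
      also have "\<dots> \<le> 2 * (p * (K + 2)) + 6 * p" using 1 3 by (simp add: distrib_left)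
      also have "\<dots> = p * (2 * K + 10)" by (simp add: algebra_simps)
      finally have TY: "T * \<bar>Y\<bar> \<le> p * (2 * K + 10)" .
      have "(T - \<epsilon>) * Y \<le> (T - \<epsilon>) * \<bar>Y\<bar>" by (rule mult_left_mono[OF abs_ge_self]) (use eT in simp)
      moreover have "(T - \<epsilon>) * \<bar>Y\<bar> \<le> T * \<bar>Y\<bar>" by (rule mult_right_mono) (use eT in simp_all)
      ultimately have "(T - \<epsilon>) * Y \<le> p * (2 * K + 10)" using TY by linarith
      hence "((T - \<epsilon>) * Y) * G z powr q \<le> (p * (2 * K + 10)) * G z powr q" by (intro mult_right_mono) auto
      thus ?thesis unfolding B1_def Y_def e_def[symmetric] z_def[symmetric] by (simp add: mult_ac)
    qed
    ultimately show "(T - \<epsilon>) * B1 (0, 1) (x, T) - B (x, T) + B (x, \<epsilon>) \<le> p * (2 * K + 10) * G (x, T) powr q + (K + 2) * G (x, \<epsilon>) powr q"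
      by linarith
  qed
  also have "\<dots> = p * (2 * K + 10) * (LINT x|lborel. G (x, T) powr q) + (K + 2) * (LINT x|lborel. G (x, \<epsilon>) powr q)"
    using G_powr_integral(1)[OF T0] G_powr_integral(1)[OF eT(1)] by simp
  also have "\<dots> \<le> p * (2 * K + 10) * (LINT x|lborel. g x powr q) + (K + 2) * (LINT x|lborel. g x powr q)"
    using p K by (intro add_mono mult_left_mono G_powr_integral(2) T0 eT) auto
  finally show ?thesis unfolding A_def p_def K_def by (simp add: algebra_simps)
qed

end

subsection \<open>The trilinear form\<close>

definition strip_dom :: "real \<Rightarrow> real \<Rightarrow> ('a::euclidean_space \<times> real \<Rightarrow> real) \<Rightarrow> bool" where
  "strip_dom \<epsilon> T Z \<longleftrightarrow> (\<exists>M. integrable lborel M \<and> (\<forall>x t. \<epsilon> \<le> t \<longrightarrow> t \<le> T \<longrightarrow> \<bar>Z (x, t)\<bar> \<le> M x))"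

abbreviation strip :: "real \<Rightarrow> real \<Rightarrow> ('a::euclidean_space \<times> real) set" where
  "strip \<epsilon> T \<equiv> {z. \<epsilon> \<le> snd z \<and> snd z \<le> T}"

named_theorems strip_dom_intros

lemma strip_dom_add [strip_dom_intros]:
  assumes "strip_dom \<epsilon> T X" "strip_dom \<epsilon> T Y" shows "strip_dom \<epsilon> T (\<lambda>z. X z + Y z)"
proof -
  obtain M N where "integrable lborel M" "\<And>x t. \<epsilon> \<le> t \<Longrightarrow> t \<le> T \<Longrightarrow> \<bar>X (x, t)\<bar> \<le> M x"
    "integrable lborel N" "\<And>x t. \<epsilon> \<le> t \<Longrightarrow> t \<le> T \<Longrightarrow> \<bar>Y (x, t)\<bar> \<le> N x"
    using assms unfolding strip_dom_def by blast
  thus ?thesis unfolding strip_dom_def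
    by (intro exI[of _ "\<lambda>x. M x + N x"] conjI allI impI Bochner_Integration.integrable_add order_trans[OF abs_triangle_ineq] add_mono)
qed

text \<open>In a product one factor supplies the integrable majorant and the other only needs to be
  bounded. Extensions and their derivatives are of both kinds on a strip, so polynomial densities
  are handled by applying the rules repeatedly.\<close>

lemma strip_dom_mult_right [strip_dom_intros]:
  fixes X :: "'a::euclidean_space \<times> real \<Rightarrow> real"
  assumes "strip_dom \<epsilon> T X" "bdd_on (strip \<epsilon> T) Y" shows "strip_dom \<epsilon> T (\<lambda>z. X z * Y z)"
proof -
  obtain M :: "'a \<Rightarrow> real" and C where M: "integrable lborel M" "\<And>x t. \<epsilon> \<le> t \<Longrightarrow> t \<le> T \<Longrightarrow> \<bar>X (x, t)\<bar> \<le> M x"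
    and C: "\<And>z. z \<in> strip \<epsilon> T \<Longrightarrow> \<bar>Y z\<bar> \<le> C"
    using assms unfolding strip_dom_def bdd_on_def by blast
  show ?thesis unfolding strip_dom_def
  proof (intro exI[of _ "\<lambda>x. M x * C"] conjI allI impI)
    show "integrable lborel (\<lambda>x. M x * C)" using M(1) by simp
    fix x t assume t: "\<epsilon> \<le> t" "t \<le> T"
    show "\<bar>X (x, t) * Y (x, t)\<bar> \<le> M x * C" unfolding abs_mult
      by (rule mult_mono[OF M(2)[OF t] C]) (use t order_trans[OF abs_ge_zero M(2)[OF t]] in auto)
  qed
qed

lemma strip_dom_minus [strip_dom_intros]: "strip_dom \<epsilon> T X \<Longrightarrow> strip_dom \<epsilon> T (\<lambda>z. - X z)"
  unfolding strip_dom_def by simp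

lemma strip_dom_diff [strip_dom_intros]:
  "strip_dom \<epsilon> T X \<Longrightarrow> strip_dom \<epsilon> T Y \<Longrightarrow> strip_dom \<epsilon> T (\<lambda>z. X z - Y z)"
  using strip_dom_add[of \<epsilon> T X "\<lambda>z. - Y z"] strip_dom_minus[of \<epsilon> T Y] by simp

lemma strip_dom_cmult [strip_dom_intros]: "strip_dom \<epsilon> T X \<Longrightarrow> strip_dom \<epsilon> T (\<lambda>z. c * X z)"
  using strip_dom_mult_right[OF _ bdd_on_const, of \<epsilon> T X c] by (simp add: mult.commute)

lemma strip_dom_zero: "strip_dom \<epsilon> T (\<lambda>z::'a::euclidean_space \<times> real. 0)"
  unfolding strip_dom_def by (intro exI[of _ "\<lambda>x. 0"]) simp

lemma strip_dom_sum [strip_dom_intros]: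
  "(\<And>i. i \<in> A \<Longrightarrow> strip_dom \<epsilon> T (X i)) \<Longrightarrow> strip_dom \<epsilon> T (\<lambda>z. \<Sum>i\<in>A. X i z)"
  by (induction A rule: infinite_finite_induct) (auto intro: strip_dom_intros strip_dom_zero)

lemma bdd_on_snd [bdd_on_intros]: "bdd_on (strip \<epsilon> T) snd"
  by (rule bdd_onI[of _ _ "\<bar>\<epsilon>\<bar> + \<bar>T\<bar>"]) auto

lemma Basis_halfspace: "(0, 1) \<in> (Basis :: ('a::euclidean_space \<times> real) set)"
  "i \<in> Basis \<Longrightarrow> (i, 0) \<in> (Basis :: ('a::euclidean_space \<times> real) set)"
  by (auto simp: Basis_prod_def)

lemma hconv_strip_dom:
  fixes f :: "'a::euclidean_space \<Rightarrow> real"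
  assumes e: "0 < \<epsilon>" and f: "ccs f" and b: "b \<in> Basis" "c \<in> Basis"
  shows "strip_dom \<epsilon> T (hconv pk f)" "strip_dom \<epsilon> T (hconv (pk1 b) f)" "strip_dom \<epsilon> T (hconv (pk2 b c) f)"
    "bdd_on (strip \<epsilon> T) (hconv pk f)" "bdd_on (strip \<epsilon> T) (hconv (pk1 b) f)" "bdd_on (strip \<epsilon> T) (hconv (pk2 b c) f)"
proof -
  define A where "A z = hconv pk (\<lambda>y. \<bar>f y\<bar>) z" for z
  define K where "K = poisson_grad_const TYPE('a)"
  have K: "0 \<le> K" using poisson_grad_const_ge_1[where 'a='a] unfolding K_def by linarith
  obtain C where C: "0 < C" "\<And>x. \<bar>f x\<bar> \<le> C" using ccs_bounded[OF f] by blast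
  have A0: "0 \<le> A z" if "0 < snd z" for z :: "'a \<times> real" unfolding A_def by (rule hconv_nonneg[OF that]) simp
  have dA: "strip_dom \<epsilon> T A"
    unfolding strip_dom_def
  proof (intro exI[of _ "\<lambda>x. T / \<epsilon> * A (x, \<epsilon>)"] conjI allI impI)
    show "integrable lborel (\<lambda>x. T / \<epsilon> * A (x, \<epsilon>))"
      unfolding A_def by (intro integrable_mult_right hconv_slice_integral(1) ccs_abs f e)
    fix x :: 'a and t assume t: "\<epsilon> \<le> t" "t \<le> T"
    show "\<bar>A (x, t)\<bar> \<le> T / \<epsilon> * A (x, \<epsilon>)"
      using hconv_strip[OF ccs_abs[OF f] _ e t, of x] A0[of "(x, t)"] t e by (simp add: A_def)
  qed
  have bA: "bdd_on (strip \<epsilon> T) A"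
  proof (rule bdd_onI[of _ _ C])
    fix z :: "'a \<times> real" assume "z \<in> strip \<epsilon> T"
    thus "\<bar>A z\<bar> \<le> C" unfolding A_def using e C by (intro hconv_abs_le ccs_abs f) auto
  qed
  have le: "\<bar>hconv pk f z\<bar> \<le> \<bar>1 * A z\<bar>" "\<bar>hconv (pk1 b) f z\<bar> \<le> \<bar>K / \<epsilon> * A z\<bar>" "\<bar>hconv (pk2 b c) f z\<bar> \<le> \<bar>K / \<epsilon>\<^sup>2 * A z\<bar>"
    if "z \<in> strip \<epsilon> T" for z
  proof -
    have z: "0 < snd z" "\<epsilon> \<le> snd z" using that e by auto
    have "\<bar>hconv pk f z\<bar> \<le> 1 * A z" unfolding A_def
    proof (rule hconv_le[OF pk_continuous(1) f z(1)])
      show "\<bar>pk w\<bar> \<le> 1 * pk w" if "snd w = snd z" for w :: "'a \<times> real"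
        using pk_pos[of w] z(1) that by simp
    qed
    thus "\<bar>hconv pk f z\<bar> \<le> \<bar>1 * A z\<bar>" by linarith
    have Kle: "K / snd z \<le> K / \<epsilon>" "K / (snd z)\<^sup>2 \<le> K / \<epsilon>\<^sup>2"
      using z e K by (auto intro!: divide_left_mono power_mono mult_pos_pos)
    have "K / snd z * A z \<le> K / \<epsilon> * A z" "K / (snd z)\<^sup>2 * A z \<le> K / \<epsilon>\<^sup>2 * A z"
      by (rule mult_right_mono[OF Kle(1) A0[OF z(1)]] mult_right_mono[OF Kle(2) A0[OF z(1)]])+
    thus "\<bar>hconv (pk1 b) f z\<bar> \<le> \<bar>K / \<epsilon> * A z\<bar>" "\<bar>hconv (pk2 b c) f z\<bar> \<le> \<bar>K / \<epsilon>\<^sup>2 * A z\<bar>"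
      using hconv_grad_bounds[OF f z(1) b] unfolding A_def[symmetric] K_def[symmetric] by linarith+
  qed
  have *: "strip_dom \<epsilon> T X" if "\<And>z. z \<in> strip \<epsilon> T \<Longrightarrow> \<bar>X z\<bar> \<le> \<bar>D * A z\<bar>" for X D
  proof -
    have "strip_dom \<epsilon> T (\<lambda>z. D * A z)" by (intro strip_dom_intros dA)
    thus ?thesis unfolding strip_dom_def using that by (metis (mono_tags, lifting) mem_Collect_eq order_trans snd_conv)
  qed
  have **: "bdd_on (strip \<epsilon> T) X" if "\<And>z. z \<in> strip \<epsilon> T \<Longrightarrow> \<bar>X z\<bar> \<le> \<bar>D * A z\<bar>" for X D
  proof -
    have "bdd_on (strip \<epsilon> T) (\<lambda>z. D * A z)" by (intro bdd_on_intros bA)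
    thus ?thesis unfolding bdd_on_def using that by (meson order_trans)
  qed
  show "strip_dom \<epsilon> T (hconv pk f)" "strip_dom \<epsilon> T (hconv (pk1 b) f)" "strip_dom \<epsilon> T (hconv (pk2 b c) f)"
    by (rule *[OF le(1)] *[OF le(2)] *[OF le(3)], assumption)+
  show "bdd_on (strip \<epsilon> T) (hconv pk f)" "bdd_on (strip \<epsilon> T) (hconv (pk1 b) f)" "bdd_on (strip \<epsilon> T) (hconv (pk2 b c) f)"
    by (rule **[OF le(1)] **[OF le(2)] **[OF le(3)], assumption)+
qed

lemmas hconv_strip_dom_pk = hconv_strip_dom(1,4)[OF _ _ Basis_halfspace(1) Basis_halfspace(1)]
  and hconv_strip_dom_pk1 = hconv_strip_dom(2,5)[OF _ _ _ Basis_halfspace(1)]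
  and hconv_strip_dom_pk2 = hconv_strip_dom(3,6)

lemma strip_dom_integrable:
  fixes Z :: "'a::euclidean_space \<times> real \<Rightarrow> real"
  assumes "0 < \<epsilon>" "continuous_on halfspace Z" "strip_dom \<epsilon> T Z"
  shows "integrable lborel (\<lambda>t. (LINT x|lborel. Z (x, t)) * indicator {\<epsilon>..T} t)"
    and "\<And>t. \<epsilon> \<le> t \<Longrightarrow> t \<le> T \<Longrightarrow> integrable lborel (\<lambda>x. Z (x, t))"
  using assms strip_integrable[OF assms(1,2)] unfolding strip_dom_def by blast+

text \<open>For h = \<open>\<partial>\<^sub>i \<psi>\<close> the sum over i of the slice integrals
  is b'' (see \<open>integral_A1\<close>). Each of the six products contains two first derivatives,
  and exchanging f and g changes the sign.\<close>

definition trilinear_density :: "'a::euclidean_space \<Rightarrow> ('a \<Rightarrow> real) \<Rightarrow> ('a \<Rightarrow> real) \<Rightarrow> ('a \<Rightarrow> real) \<Rightarrow> 'a \<times> real \<Rightarrow> real" where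
  "trilinear_density i f g h z = 2 * ((hconv (pk1 (0, 1)) f z * hconv (pk1 (i, 0)) g z - hconv (pk1 (0, 1)) g z * hconv (pk1 (i, 0)) f z) * hconv pk h z)
    + 2 * ((hconv pk f z * hconv (pk1 (i, 0)) g z - hconv pk g z * hconv (pk1 (i, 0)) f z) * hconv (pk1 (0, 1)) h z)
    - 2 * ((hconv pk f z * hconv (pk1 (0, 1)) g z - hconv pk g z * hconv (pk1 (0, 1)) f z) * hconv (pk1 (i, 0)) h z)"

text \<open>The weight t - \<epsilon> is the kernel of a twofold integration over t starting at
  \<epsilon>, as in the remainder of Taylor's formula.\<close>

definition trilinear_form :: "real \<Rightarrow> real \<Rightarrow> 'a::euclidean_space \<Rightarrow> ('a \<Rightarrow> real) \<Rightarrow> ('a \<Rightarrow> real) \<Rightarrow> ('a \<Rightarrow> real) \<Rightarrow> real" where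
  "trilinear_form \<epsilon> T i f g h = (LINT t|lborel. (LINT x|lborel. trilinear_density i f g h (x, t) * (t - \<epsilon>)) * indicator {\<epsilon>..T} t)"

lemma trilinear_density_regular:
  fixes f g h :: "'a::euclidean_space \<Rightarrow> real"
  assumes e: "0 < \<epsilon>" and i: "i \<in> Basis" and f: "ccs f" and g: "ccs g" and h: "ccs h"
  shows "continuous_on halfspace (\<lambda>z. trilinear_density i f g h z * (snd z - \<epsilon>))"
    "strip_dom \<epsilon> T (\<lambda>z. trilinear_density i f g h z * (snd z - \<epsilon>))"
proof -
  note U0 = hconv_continuous[OF pk_continuous(1)] and U1 = hconv_continuous[OF pk_continuous(2)]
  show "continuous_on halfspace (\<lambda>z. trilinear_density i f g h z * (snd z - \<epsilon>))"
    unfolding trilinear_density_def by (intro continuous_intros U0 U1 f g h)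
  show "strip_dom \<epsilon> T (\<lambda>z. trilinear_density i f g h z * (snd z - \<epsilon>))"
    unfolding trilinear_density_def
    by (rule strip_dom_diff strip_dom_add strip_dom_cmult e f g h Basis_halfspace i
        hconv_strip_dom_pk hconv_strip_dom_pk1 strip_dom_mult_right bdd_on_intros)+
qed

lemma trilinear_form_integrand_integrable:
  fixes f g h :: "'a::euclidean_space \<Rightarrow> real"
  assumes e: "0 < \<epsilon>" and i: "i \<in> Basis" and f: "ccs f" and g: "ccs g" and h: "ccs h"
  shows "integrable lborel (\<lambda>t. (LINT x|lborel. trilinear_density i f g h (x, t) * (t - \<epsilon>)) * indicator {\<epsilon>..T} t)"
    and "\<epsilon> \<le> t \<Longrightarrow> t \<le> T \<Longrightarrow> integrable lborel (\<lambda>x. trilinear_density i f g h (x, t) * (t - \<epsilon>))"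
  using strip_dom_integrable[OF e trilinear_density_regular[OF assms]] by simp_all

lemma trilinear_form_combine:
  fixes f g h :: "'a::euclidean_space \<Rightarrow> real"
  assumes e: "0 < \<epsilon>" and i: "i \<in> Basis" and c: "ccs f1" "ccs g1" "ccs f2" "ccs g2" "ccs f3" "ccs g3" "ccs h"
    and eq: "\<And>z. 0 < snd z \<Longrightarrow> trilinear_density i f1 g1 h z = trilinear_density i f2 g2 h z - trilinear_density i f3 g3 h z"
  shows "trilinear_form \<epsilon> T i f1 g1 h = trilinear_form \<epsilon> T i f2 g2 h - trilinear_form \<epsilon> T i f3 g3 h"
proof -
  have "(LINT x|lborel. trilinear_density i f1 g1 h (x, t) * (t - \<epsilon>)) * indicator {\<epsilon>..T} t
     = (LINT x|lborel. trilinear_density i f2 g2 h (x, t) * (t - \<epsilon>)) * indicator {\<epsilon>..T} t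
      - (LINT x|lborel. trilinear_density i f3 g3 h (x, t) * (t - \<epsilon>)) * indicator {\<epsilon>..T} t" for t
  proof (cases "\<epsilon> \<le> t \<and> t \<le> T")
    case True
    hence t: "\<epsilon> \<le> t" "t \<le> T" by auto
    have "(LINT x|lborel. trilinear_density i f1 g1 h (x, t) * (t - \<epsilon>)) = (LINT x|lborel. trilinear_density i f2 g2 h (x, t) * (t - \<epsilon>) - trilinear_density i f3 g3 h (x, t) * (t - \<epsilon>))"
      using eq[of "(_, t)"] t e by (simp add: left_diff_distrib)
    also have "\<dots> = (LINT x|lborel. trilinear_density i f2 g2 h (x, t) * (t - \<epsilon>)) - (LINT x|lborel. trilinear_density i f3 g3 h (x, t) * (t - \<epsilon>))"
      by (intro Bochner_Integration.integral_diff trilinear_form_integrand_integrable(2)[OF e i _ _ _ t] c)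
    finally show ?thesis using True by simp
  qed auto
  thus ?thesis unfolding trilinear_form_def
    using trilinear_form_integrand_integrable(1)[OF e i c(3,4,7)] trilinear_form_integrand_integrable(1)[OF e i c(5,6,7)] by simp
qed

lemma trilinear_form_diff_left:
  assumes e: "0 < \<epsilon>" and i: "i \<in> Basis" and c: "ccs f1" "ccs f2" "ccs g" "ccs h"
  shows "trilinear_form \<epsilon> T i (\<lambda>x. f1 x - f2 x) g h = trilinear_form \<epsilon> T i f1 g h - trilinear_form \<epsilon> T i f2 g h"
  by (rule trilinear_form_combine[OF e i])
    (use c in \<open>auto simp: trilinear_density_def hconv_diff[OF pk_continuous(1)] hconv_diff[OF pk_continuous(2)] algebra_simps intro: ccs_diff\<close>)

lemma trilinear_form_diff_right:
  assumes e: "0 < \<epsilon>" and i: "i \<in> Basis" and c: "ccs g1" "ccs g2" "ccs f" "ccs h"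
  shows "trilinear_form \<epsilon> T i f (\<lambda>x. g1 x - g2 x) h = trilinear_form \<epsilon> T i f g1 h - trilinear_form \<epsilon> T i f g2 h"
  by (rule trilinear_form_combine[OF e i])
    (use c in \<open>auto simp: trilinear_density_def hconv_diff[OF pk_continuous(1)] hconv_diff[OF pk_continuous(2)] algebra_simps intro: ccs_diff\<close>)

lemma trilinear_form_swap: "trilinear_form \<epsilon> T i f g h = - trilinear_form \<epsilon> T i g f h"
proof -
  have "trilinear_density i f g h z = - trilinear_density i g f h z" for z by (simp add: trilinear_density_def algebra_simps)
  thus ?thesis unfolding trilinear_form_def by simp
qed

lemma trilinear_form_zero: "trilinear_form \<epsilon> T i (\<lambda>x. 0) g h = 0"
  unfolding trilinear_form_def trilinear_density_def hconv_def by simp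

context bellman
begin

text \<open>In scale-free variables F carries the factor G^(q-1) and G the factor G, so every term
  of the density carries exactly G^q. What is left are products of two normalised derivatives with a
  factor \<open>\<phi>\<close> or \<open>H\<close> of modulus at most 1, and |a b| \<le> (a^2 + b^2)
  / 2 applies. Only the vertical direction and direction i occur; the other terms of the sum are
  nonnegative.\<close>

lemma trilinear_density_le:
  assumes z: "0 < snd z" and i: "i \<in> Basis"
  shows "\<bar>trilinear_density i f g h z\<bar> \<le> 2 * (\<Sum>b\<in>Basis. bell_D q f g h b z)"
proof -
  define e where "e = ((0, 1) :: 'a \<times> real)"
  define j where "j = ((i, 0) :: 'a \<times> real)"
  have ej: "e \<in> Basis" "j \<in> Basis" "e \<noteq> j" using Basis_halfspace i by (auto simp: e_def j_def)
  have Gz: "0 < G z" by (rule G_pos[OF z])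
  define Q where "Q = G z powr q"
  have Q: "0 \<le> Q" by (simp add: Q_def)
  have pw: "G z powr (1 - q) * G z powr (q - 1) = 1" using Gz by (simp add: powr_add[symmetric])
  have Qp: "G z powr (q - 1) * G z = Q" using Gz powr_add[of "G z" "q - 1" 1] by (simp add: Q_def)
  have eF: "F z = \<phi> z * G z powr (q - 1)" "F1 b z = u b z * G z powr (q - 1)" for b
    unfolding \<phi>_def u_def mult.assoc pw by simp_all
  have eG: "G1 b z = \<gamma> b z * G z" for b using Gz by (simp add: \<gamma>_def)
  have sw: "(a * G z powr (q - 1)) * (b * G z) = Q * (a * b)" "(b * G z) * (a * G z powr (q - 1)) = Q * (a * b)"
    "G z * (a * G z powr (q - 1)) = Q * a" for a b
    unfolding Qp[symmetric] by simp_all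
  have N: "trilinear_density i f g h z = Q * (2 * ((u e z * \<gamma> j z - u j z * \<gamma> e z) * H z)
     + 2 * ((\<phi> z * \<gamma> j z - u j z) * H1 e z) - 2 * ((\<phi> z * \<gamma> e z - u e z) * H1 j z))"
    unfolding trilinear_density_def e_def[symmetric] j_def[symmetric] F_def[symmetric] G_def[symmetric] H_def[symmetric]
      F1_def[symmetric] G1_def[symmetric] H1_def[symmetric]
    unfolding eF eG sw by (simp add: algebra_simps)
  have ineq: "\<bar>2 * ((ue * gj - uj * ge) * hh) + 2 * ((p * gj - uj) * he) - 2 * ((p * ge - ue) * hj)\<bar>
     \<le> 2 * ((ge\<^sup>2 + he\<^sup>2 + ue\<^sup>2) + (gj\<^sup>2 + hj\<^sup>2 + uj\<^sup>2))"
    if "\<bar>hh\<bar> \<le> 1" "\<bar>p\<bar> \<le> 1" for ue uj ge gj he hj hh p :: real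
  proof -
    have ag: "\<bar>a * b\<bar> \<le> (a\<^sup>2 + b\<^sup>2) / 2" for a b :: real
      using sum_squares_bound[of "\<bar>a\<bar>" "\<bar>b\<bar>"] by (simp add: abs_mult)
    have s: "\<bar>(a * b) * c\<bar> \<le> (a\<^sup>2 + b\<^sup>2) / 2" if "\<bar>c\<bar> \<le> 1" for a b c :: real
      using mult_mono[OF ag[of a b] that] by (simp add: abs_mult)
    have "\<bar>2 * ((ue * gj - uj * ge) * hh) + 2 * ((p * gj - uj) * he) - 2 * ((p * ge - ue) * hj)\<bar>
      \<le> 2 * (\<bar>(ue * gj) * hh\<bar> + \<bar>(uj * ge) * hh\<bar> + \<bar>(gj * he) * p\<bar> + \<bar>uj * he\<bar> + \<bar>(ge * hj) * p\<bar> + \<bar>ue * hj\<bar>)"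
    proof -
      have "2 * ((ue * gj - uj * ge) * hh) + 2 * ((p * gj - uj) * he) - 2 * ((p * ge - ue) * hj)
        = 2 * ((ue * gj) * hh - (uj * ge) * hh + (gj * he) * p - uj * he - (ge * hj) * p + ue * hj)"
        by (simp add: algebra_simps)
      moreover have "\<bar>2 * (a - b + c - d - e' + k)\<bar> \<le> 2 * (\<bar>a\<bar> + \<bar>b\<bar> + \<bar>c\<bar> + \<bar>d\<bar> + \<bar>e'\<bar> + \<bar>k\<bar>)" for a b c d e' k :: real
        by (smt (verit))
      ultimately show ?thesis by presburger
    qed
    also have "\<dots> \<le> 2 * ((ue\<^sup>2 + gj\<^sup>2) / 2 + (uj\<^sup>2 + ge\<^sup>2) / 2 + (gj\<^sup>2 + he\<^sup>2) / 2 + (uj\<^sup>2 + he\<^sup>2) / 2 + (ge\<^sup>2 + hj\<^sup>2) / 2 + (ue\<^sup>2 + hj\<^sup>2) / 2)"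
      by (intro mult_left_mono add_mono s ag that) simp
    also have "\<dots> = 2 * ((ge\<^sup>2 + he\<^sup>2 + ue\<^sup>2) + (gj\<^sup>2 + hj\<^sup>2 + uj\<^sup>2))" by (simp add: field_simps)
    finally show ?thesis .
  qed
  have "\<bar>trilinear_density i f g h z\<bar> \<le> Q * (2 * (((\<gamma> e z)\<^sup>2 + (H1 e z)\<^sup>2 + (u e z)\<^sup>2) + ((\<gamma> j z)\<^sup>2 + (H1 j z)\<^sup>2 + (u j z)\<^sup>2)))"
    unfolding N abs_mult[of Q] abs_of_nonneg[OF Q] using phi_bounds[OF z] H_bound[OF z]
    by (intro mult_left_mono ineq Q) auto
  also have "\<dots> = 2 * (\<Sum>b\<in>{e, j}. bell_D q f g h b z)"
    using ej(3) by (simp add: bell_D_eq Q_def algebra_simps)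
  also have "\<dots> \<le> 2 * (\<Sum>b\<in>Basis. bell_D q f g h b z)"
    using ej by (intro mult_left_mono sum_mono2 bell_D_nonneg) auto
  finally show ?thesis .
qed

lemma trilinear_form_le:
  assumes eT: "0 < \<epsilon>" "\<epsilon> \<le> T" and i: "i \<in> Basis"
  shows "\<bar>trilinear_form \<epsilon> T i f g h\<bar> \<le> 2 * ((poisson_grad_const TYPE('a) * (2 * bell_K q + 10) + bell_K q + 2) * (LINT x|lborel. g x powr q))"
proof -
  define A where "A z = (\<Sum>b\<in>Basis. bell_D q f g h b z) * (snd z - \<epsilon>)" for z
  have cA: "continuous_on halfspace A"
    unfolding A_def by (intro continuous_intros continuities)
  obtain M :: "'a \<Rightarrow> real" where M: "integrable lborel M" "\<And>x t. \<epsilon> \<le> t \<Longrightarrow> t \<le> T \<Longrightarrow> \<bar>\<Sum>b\<in>Basis. bell_D q f g h b (x, t)\<bar> \<le> M x"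
    using bell_D_dominated[OF eT(1)] by blast
  hence "strip_dom \<epsilon> T (\<lambda>z. \<Sum>b\<in>Basis. bell_D q f g h b z)" unfolding strip_dom_def by blast
  hence dA: "strip_dom \<epsilon> T A" unfolding A_def by (rule strip_dom_mult_right) (intro bdd_on_intros)
  note iA = strip_dom_integrable[OF eT(1) cA dA]
  note iN = trilinear_form_integrand_integrable[OF eT(1) i f(1) g(1) h(1), where T = T]
  have "\<bar>trilinear_form \<epsilon> T i f g h\<bar> \<le> (LINT t|lborel. \<bar>(LINT x|lborel. trilinear_density i f g h (x, t) * (t - \<epsilon>)) * indicator {\<epsilon>..T} t\<bar>)"
    unfolding trilinear_form_def by (rule integral_abs_bound)
  also have "\<dots> \<le> (LINT t|lborel. 2 * ((LINT x|lborel. A (x, t)) * indicator {\<epsilon>..T} t))"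
  proof (rule integral_mono)
    show "integrable lborel (\<lambda>t. \<bar>(LINT x|lborel. trilinear_density i f g h (x, t) * (t - \<epsilon>)) * indicator {\<epsilon>..T} t\<bar>)"
      by (rule integrable_abs[OF iN(1)])
    show "integrable lborel (\<lambda>t. 2 * ((LINT x|lborel. A (x, t)) * indicator {\<epsilon>..T} t))"
      by (rule integrable_mult_right[OF iA(1)])
    fix t
    show "\<bar>(LINT x|lborel. trilinear_density i f g h (x, t) * (t - \<epsilon>)) * indicator {\<epsilon>..T} t\<bar> \<le> 2 * ((LINT x|lborel. A (x, t)) * indicator {\<epsilon>..T} t)"
    proof (cases "\<epsilon> \<le> t \<and> t \<le> T")
      case True
      hence t: "\<epsilon> \<le> t" "t \<le> T" by auto
      have "\<bar>LINT x|lborel. trilinear_density i f g h (x, t) * (t - \<epsilon>)\<bar> \<le> (LINT x|lborel. \<bar>trilinear_density i f g h (x, t) * (t - \<epsilon>)\<bar>)"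
        by (rule integral_abs_bound)
      also have "\<dots> \<le> (LINT x|lborel. 2 * A (x, t))"
      proof (intro integral_mono integrable_abs iN(2) integrable_mult_right iA(2) t)
        fix x
        have "\<bar>trilinear_density i f g h (x, t)\<bar> * \<bar>t - \<epsilon>\<bar> \<le> (2 * (\<Sum>b\<in>Basis. bell_D q f g h b (x, t))) * \<bar>t - \<epsilon>\<bar>"
          by (rule mult_right_mono[OF trilinear_density_le[OF _ i]]) (use t eT in auto)
        thus "\<bar>trilinear_density i f g h (x, t) * (t - \<epsilon>)\<bar> \<le> 2 * A (x, t)" using t by (simp add: A_def abs_mult mult.assoc)
      qed
      finally show ?thesis using True by simp
    qed auto
  qed
  also have "\<dots> = 2 * (LINT t|lborel. (LINT x|lborel. A (x, t)) * indicator {\<epsilon>..T} t)" by simp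
  also have "\<dots> \<le> 2 * ((poisson_grad_const TYPE('a) * (2 * bell_K q + 10) + bell_K q + 2) * (LINT x|lborel. g x powr q))"
    using bellman_estimate[OF eT] unfolding A_def by simp
  finally show ?thesis .
qed

end

section \<open>From positive pairs to arbitrary data\<close>

lemma powr_add_le:
  fixes a b q :: real
  assumes "0 \<le> a" "0 \<le> b" "0 \<le> q"
  shows "(a + b) powr q \<le> 2 powr q * (a powr q + b powr q)"
proof -
  have "(a + b) powr q \<le> (2 * max a b) powr q" using assms by (intro powr_mono2) auto
  also have "\<dots> = 2 powr q * (max a b) powr q" using assms by (simp add: powr_mult)
  also have "(max a b) powr q \<le> a powr q + b powr q" by (simp add: max_def)
  finally show ?thesis by (simp add: mult_left_mono)
qed

text \<open>The decomposition \<open>f = f1 - f2\<close>, \<open>g = g1 - g2\<close> into positive parts is chosen such that the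
  pointwise hypothesis \<open>f \<le> g powr (q - 1)\<close> of the locale \<open>bellman\<close> holds for all four pairs.\<close>

lemma trilinear_form_bound_dual:
  assumes q: "1 < q" "q \<le> 2"
  shows "\<exists>C. \<forall>f g h :: 'a::euclidean_space \<Rightarrow> real. \<forall>\<epsilon> T. \<forall>i\<in>Basis. ccs f \<longrightarrow> ccs g \<longrightarrow> ccs h \<longrightarrow> (\<forall>x. \<bar>h x\<bar> \<le> 1)
    \<longrightarrow> 0 < \<epsilon> \<longrightarrow> \<epsilon> \<le> T \<longrightarrow>
    \<bar>trilinear_form \<epsilon> T i f g h\<bar> \<le> C * ((LINT x|lborel. \<bar>f x\<bar> powr (q / (q - 1))) + (LINT x|lborel. \<bar>g x\<bar> powr q))"
proof -
  define p where "p = q / (q - 1)"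
  have p: "p - 1 = 1 / (q - 1)" "(p - 1) * (q - 1) = 1" "(p - 1) * q = p" "0 < p" "0 < p - 1"
    using q by (auto simp: p_def field_simps)
  \<comment> \<open>Since (p - 1) (q - 1) = 1, this value gives (m |f|^(p-1))^(q-1) = 3/2 |f|, which
    is the upper bound for the two parts of f.\<close>
  define m where "m = (3 / 2 :: real) powr (p - 1)"
  have m: "0 < m" by (simp add: m_def)
  define C0 where "C0 = 2 * (poisson_grad_const TYPE('a) * (2 * bell_K q + 10) + bell_K q + 2)"
  have "0 \<le> bell_K q" using q by (simp add: bell_K_def)
  hence C0: "0 \<le> C0" unfolding C0_def using poisson_grad_const_ge_1[where 'a='a] by (intro mult_nonneg_nonneg add_nonneg_nonneg) auto
  define C1 where "C1 = 2 powr q * ((3 / 2) powr q + m powr q)"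
  have C1: "0 \<le> C1" by (simp add: C1_def)
  show ?thesis
  proof (intro exI[of _ "4 * (C0 * C1)"] allI ballI impI)
    fix f g h :: "'a \<Rightarrow> real" and \<epsilon> T :: real and i :: 'a
    assume i: "i \<in> Basis" and f: "ccs f" and g: "ccs g" and h: "ccs h" "\<forall>x. \<bar>h x\<bar> \<le> 1" and eT: "0 < \<epsilon>" "\<epsilon> \<le> T"
    define R where "R = (LINT x|lborel. \<bar>f x\<bar> powr p) + (LINT x|lborel. \<bar>g x\<bar> powr q)"
    have R: "0 \<le> R" unfolding R_def by (intro add_nonneg_nonneg integral_nonneg_AE AE_I2) auto
    have "\<bar>trilinear_form \<epsilon> T i f g h\<bar> \<le> 4 * (C0 * C1) * R"
    proof (cases "(\<forall>x. f x = 0) \<or> (\<forall>x. g x = 0)")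
      case True
      hence "f = (\<lambda>x. 0) \<or> g = (\<lambda>x. 0)" by auto
      hence "trilinear_form \<epsilon> T i f g h = 0"
      proof
        assume "f = (\<lambda>x. 0)" thus ?thesis by (simp add: trilinear_form_zero)
      next
        assume "g = (\<lambda>x. 0)" thus ?thesis using trilinear_form_swap[of \<epsilon> T i f g h] by (simp add: trilinear_form_zero)
      qed
      thus ?thesis using C0 C1 R by simp
    next
      case False
      then obtain x0 y0 where x0: "f x0 \<noteq> 0" and y0: "g y0 \<noteq> 0" by auto
      \<comment> \<open>For s = 1/2 and s = - 1/2 the parts differ by f and lie between |f| / 2 and
        3/2 |f|. Unlike the usual positive and negative parts, neither can vanish identically when f
        does not, as the locale demands.\<close>
      define fp where "fp s x = \<bar>f x\<bar> + s * f x" for s x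
      define gp where "gp s x = (\<bar>g x\<bar> + s * g x) + m * \<bar>f x\<bar> powr (p - 1)" for s x
      have cF: "ccs (fp s)" for s unfolding fp_def by (intro ccs_add ccs_abs ccs_cmult f)
      have cG: "ccs (gp s)" for s unfolding gp_def by (intro ccs_add ccs_abs ccs_cmult ccs_abs_powr f g p(5))
      have J: "\<bar>trilinear_form \<epsilon> T i (fp s) (gp s') h\<bar> \<le> C0 * C1 * R" if s: "s \<in> {1/2, -1/2}" "s' \<in> {1/2, -1/2}" for s s'
      proof -
        have ab0: "\<bar>y\<bar> / 2 \<le> \<bar>y\<bar> + r * y" "\<bar>y\<bar> + r * y \<le> 3 / 2 * \<bar>y\<bar>" if "r \<in> {1/2, -1/2}" for r y :: real
          using that by (elim insertE emptyE; hypsubst; simp add: abs_if)+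
        have ab: "\<bar>y\<bar> / 2 \<le> \<bar>y\<bar> + s * y" "\<bar>y\<bar> + s * y \<le> 3 / 2 * \<bar>y\<bar>" "\<bar>y\<bar> / 2 \<le> \<bar>y\<bar> + s' * y" "\<bar>y\<bar> + s' * y \<le> 3 / 2 * \<bar>y\<bar>" for y :: real
          by (rule ab0 s)+
        have "0 < q" using q by simp
        note ip = ccs_integrable[OF ccs_abs_powr[OF f p(4)]] ccs_integrable[OF ccs_abs_powr[OF g \<open>0 < q\<close>]]
        have G0: "m * \<bar>f x\<bar> powr (p - 1) \<le> gp s' x" "\<bar>g x\<bar> / 2 \<le> gp s' x" for x
        proof -
          have "0 \<le> \<bar>g x\<bar>" "0 \<le> m * \<bar>f x\<bar> powr (p - 1)" using m by simp_all
          thus "m * \<bar>f x\<bar> powr (p - 1) \<le> gp s' x" "\<bar>g x\<bar> / 2 \<le> gp s' x"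
            using ab(3)[of "g x"] unfolding gp_def by linarith+
        qed
        interpret bellman q "fp s" "gp s'" h
        proof
          show "0 \<le> fp s x" for x using ab(1)[of "f x"] unfolding fp_def by linarith
          show "\<exists>x. 0 < fp s x" using ab(1)[of "f x0"] x0 unfolding fp_def by (intro exI[of _ x0]) linarith
          show "0 \<le> gp s' x" for x using G0(2)[of x] by linarith
          show "\<exists>x. 0 < gp s' x" using G0(2)[of y0] y0 by (intro exI[of _ y0]) linarith
          fix x
          have "fp s x \<le> 3 / 2 * \<bar>f x\<bar>" using ab(2)[of "f x"] unfolding fp_def .
          also have "\<dots> = (m * \<bar>f x\<bar> powr (p - 1)) powr (q - 1)"
            by (simp add: m_def powr_mult powr_powr p(2))
          also have "\<dots> \<le> gp s' x powr (q - 1)" using G0(1)[of x] m q by (intro powr_mono2) auto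
          finally show "fp s x \<le> gp s' x powr (q - 1)" .
        qed (use q cF cG h in auto)
        have "\<bar>trilinear_form \<epsilon> T i (fp s) (gp s') h\<bar> \<le> C0 * (LINT x|lborel. gp s' x powr q)"
          using trilinear_form_le[OF eT i] by (simp only: C0_def mult.assoc)
        also have "(LINT x|lborel. gp s' x powr q) \<le> (LINT x|lborel. C1 * (\<bar>f x\<bar> powr p + \<bar>g x\<bar> powr q))"
        proof (rule integral_mono)
          have cg: "ccs (\<lambda>x. \<bar>gp s' x\<bar> powr q)" using ccs_abs_powr[OF cG] q by simp
          have "(\<lambda>x. \<bar>gp s' x\<bar> powr q) = (\<lambda>x. gp s' x powr q)" using G0(2) by (auto simp: fun_eq_iff intro!: arg_cong2[of _ _ _ _ "(powr)"] abs_of_nonneg order_trans[OF _ G0(2)])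
          thus "integrable lborel (\<lambda>x. gp s' x powr q)" using ccs_integrable[OF cg] by simp
          show "integrable lborel (\<lambda>x. C1 * (\<bar>f x\<bar> powr p + \<bar>g x\<bar> powr q))"
            by (intro integrable_mult_right Bochner_Integration.integrable_add ip)
          fix x
          have "0 \<le> gp s' x" using G0(2)[of x] by linarith
          have "gp s' x powr q \<le> (3 / 2 * \<bar>g x\<bar> + m * \<bar>f x\<bar> powr (p - 1)) powr q"
            using ab(4)[of "g x"] q \<open>0 \<le> gp s' x\<close> unfolding gp_def by (intro powr_mono2) auto
          also have "\<dots> \<le> 2 powr q * ((3 / 2 * \<bar>g x\<bar>) powr q + (m * \<bar>f x\<bar> powr (p - 1)) powr q)"
            using m q by (intro powr_add_le) auto
          also have "\<dots> = 2 powr q * ((3 / 2) powr q * \<bar>g x\<bar> powr q + m powr q * \<bar>f x\<bar> powr p)"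
            unfolding powr_mult powr_powr p(3) ..
          also have "\<dots> \<le> C1 * (\<bar>f x\<bar> powr p + \<bar>g x\<bar> powr q)"
            unfolding C1_def by (simp add: algebra_simps)
          finally show "gp s' x powr q \<le> C1 * (\<bar>f x\<bar> powr p + \<bar>g x\<bar> powr q)" .
        qed
        also have "\<dots> = C1 * R" unfolding R_def integral_mult_right_zero Bochner_Integration.integral_add[OF ip] ..
        finally show ?thesis using C0 by (simp add: mult_left_mono mult.assoc)
      qed
      \<comment> \<open>The summand m |f|^(p-1) of \<open>gp\<close> does not depend on the sign and
        drops out of the difference.\<close>
      have fd: "f = (\<lambda>x. fp (1/2) x - fp (-1/2) x)" "g = (\<lambda>x. gp (1/2) x - gp (-1/2) x)" by (auto simp: fp_def gp_def)
      have "trilinear_form \<epsilon> T i f g h = trilinear_form \<epsilon> T i (fp (1/2)) g h - trilinear_form \<epsilon> T i (fp (-1/2)) g h"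
        using trilinear_form_diff_left[OF eT(1) i cF cF g h(1), of T "1/2" "-1/2"] fd(1) by simp
      moreover have "trilinear_form \<epsilon> T i (fp s) g h = trilinear_form \<epsilon> T i (fp s) (gp (1/2)) h - trilinear_form \<epsilon> T i (fp s) (gp (-1/2)) h" for s
        using trilinear_form_diff_right[OF eT(1) i cG cG cF h(1), of T s "1/2" "-1/2"] fd(2) by simp
      ultimately show ?thesis
        using J[of "1/2" "1/2"] J[of "1/2" "-1/2"] J[of "-1/2" "1/2"] J[of "-1/2" "-1/2"] by simp
    qed
    thus "\<bar>trilinear_form \<epsilon> T i f g h\<bar> \<le> 4 * (C0 * C1) * ((LINT x|lborel. \<bar>f x\<bar> powr (q / (q - 1))) + (LINT x|lborel. \<bar>g x\<bar> powr q))"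
      by (simp add: R_def p_def)
  qed
qed

lemma trilinear_form_bound:
  assumes p: "1 < p"
  shows "\<exists>C. \<forall>f g h :: 'a::euclidean_space \<Rightarrow> real. \<forall>\<epsilon> T. \<forall>i\<in>Basis. ccs f \<longrightarrow> ccs g \<longrightarrow> ccs h \<longrightarrow> (\<forall>x. \<bar>h x\<bar> \<le> 1)
    \<longrightarrow> 0 < \<epsilon> \<longrightarrow> \<epsilon> \<le> T \<longrightarrow>
    \<bar>trilinear_form \<epsilon> T i f g h\<bar> \<le> C * ((LINT x|lborel. \<bar>f x\<bar> powr p) + (LINT x|lborel. \<bar>g x\<bar> powr (p / (p - 1))))"
proof (cases "p \<le> 2")
  case True
  obtain C where C: "\<forall>f g h :: 'a \<Rightarrow> real. \<forall>\<epsilon> T. \<forall>i\<in>Basis. ccs f \<longrightarrow> ccs g \<longrightarrow> ccs h \<longrightarrow> (\<forall>x. \<bar>h x\<bar> \<le> 1)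
    \<longrightarrow> 0 < \<epsilon> \<longrightarrow> \<epsilon> \<le> T \<longrightarrow>
    \<bar>trilinear_form \<epsilon> T i f g h\<bar> \<le> C * ((LINT x|lborel. \<bar>f x\<bar> powr (p / (p - 1))) + (LINT x|lborel. \<bar>g x\<bar> powr p))"
    using trilinear_form_bound_dual[OF p True] by blast
  show ?thesis
  proof (intro exI[of _ C] allI ballI impI)
    fix f g h :: "'a \<Rightarrow> real" and \<epsilon> T :: real and i :: 'a
    assume a: "i \<in> Basis" "ccs f" "ccs g" "ccs h" "\<forall>x. \<bar>h x\<bar> \<le> 1" "0 < \<epsilon>" "\<epsilon> \<le> T"
    have "\<bar>trilinear_form \<epsilon> T i f g h\<bar> = \<bar>trilinear_form \<epsilon> T i g f h\<bar>" using trilinear_form_swap[of \<epsilon> T i f g h] by simp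
    also have "\<dots> \<le> C * ((LINT x|lborel. \<bar>g x\<bar> powr (p / (p - 1))) + (LINT x|lborel. \<bar>f x\<bar> powr p))"
      using C a by blast
    finally show "\<bar>trilinear_form \<epsilon> T i f g h\<bar> \<le> C * ((LINT x|lborel. \<bar>f x\<bar> powr p) + (LINT x|lborel. \<bar>g x\<bar> powr (p / (p - 1))))"
      by (simp only: add.commute)
  qed
next
  case False
  define q where "q = p / (p - 1)"
  have q: "1 < q" "q \<le> 2" "q / (q - 1) = p" using p False by (auto simp: q_def field_simps)
  show ?thesis using trilinear_form_bound_dual[OF q(1,2), where 'a='a] unfolding q(3) q_def[symmetric] .
qed

subsection \<open>The boundary identity\<close>

locale trilinear =
  fixes f g \<psi> :: "'a::euclidean_space \<Rightarrow> real"
  assumes f: "test_function f" and g: "test_function g" and psi: "test_function \<psi>"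
begin

abbreviation e :: "'a \<times> real" where "e \<equiv> (0, 1)"

lemmas cf = test_function_ccs[OF f] and cg = test_function_ccs[OF g] and cp = test_function_ccs[OF psi]

definition h where "h i x = frechet_derivative \<psi> (at x) i"

lemma ch: "ccs (h i)"
  unfolding h_def[abs_def] by (rule test_function_ccs[OF test_function_deriv[OF psi]])

definition V where "V b z = hconv pk f z * hconv (pk1 b) g z - hconv pk g z * hconv (pk1 b) f z"
definition V1 where "V1 b c z = (hconv (pk1 c) f z * hconv (pk1 b) g z + hconv pk f z * hconv (pk2 b c) g z)
   - (hconv (pk1 c) g z * hconv (pk1 b) f z + hconv pk g z * hconv (pk2 b c) f z)"
text \<open>Integrated over a slice, \<open>W\<close> gives b(t), \<open>A\<close> gives b'(t) and
  \<open>A1\<close> gives b''(t). \<open>W1\<close> is the pointwise t-derivative of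
  \<open>W\<close>; it shares with \<open>A\<close> only the slice integral.\<close>

definition W where "W z = V e z * hconv pk \<psi> z"
definition W1 where "W1 z = V1 e e z * hconv pk \<psi> z + V e z * hconv (pk1 e) \<psi> z"
definition A where "A z = (\<Sum>b\<in>Basis. V b z * hconv (pk1 b) \<psi> z)"
definition A1 where "A1 z = (\<Sum>b\<in>Basis. V1 b e z * hconv (pk1 b) \<psi> z + V b z * hconv (pk2 b e) \<psi> z)"

lemma V_deriv:
  assumes z: "0 < snd z"
  shows "((\<lambda>s. V b (z + s *\<^sub>R c)) has_real_derivative V1 b c z) (at 0)"
  using DERIV_diff[OF DERIV_mult'[OF pk_U(1)[OF cf z, of c] pk_U(2)[OF cg z, of b c]]
    DERIV_mult'[OF pk_U(1)[OF cg z, of c] pk_U(2)[OF cf z, of b c]]]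
  unfolding V_def V1_def by (simp add: algebra_simps)

lemma W_deriv:
  assumes z: "0 < snd z"
  shows "((\<lambda>s. W (z + s *\<^sub>R e)) has_real_derivative W1 z) (at 0)"
  using DERIV_mult'[OF V_deriv[OF z, of e e] pk_U(1)[OF cp z, of e]]
  unfolding W_def W1_def by (simp add: algebra_simps zero_prod_def[symmetric])

lemma A_deriv:
  assumes z: "0 < snd z"
  shows "((\<lambda>s. A (z + s *\<^sub>R e)) has_real_derivative A1 z) (at 0)"
  unfolding A_def A1_def
proof (rule DERIV_sum)
  fix b :: "'a \<times> real"
  show "((\<lambda>s. V b (z + s *\<^sub>R e) * hconv (pk1 b) \<psi> (z + s *\<^sub>R e)) has_real_derivative
     V1 b e z * hconv (pk1 b) \<psi> z + V b z * hconv (pk2 b e) \<psi> z) (at 0)"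
    using DERIV_mult'[OF V_deriv[OF z, of b e] pk_U(2)[OF cp z, of b e]]
    by (simp add: algebra_simps zero_prod_def[symmetric])
qed

lemmas hconv_conts = hconv_continuous[OF pk_continuous(1)] hconv_continuous[OF pk_continuous(2)] hconv_continuous[OF pk_continuous(3)]

lemma continuities:
  "continuous_on halfspace (V b)" "continuous_on halfspace (V1 b c)" "continuous_on halfspace W"
  "continuous_on halfspace W1" "continuous_on halfspace A" "continuous_on halfspace A1"
  unfolding V_def V1_def W_def W1_def A_def A1_def
  by (intro continuous_intros hconv_conts cf cg cp)+

lemma V_dom:
  assumes \<epsilon>: "0 < \<epsilon>" and b: "b \<in> Basis"
  shows "strip_dom \<epsilon> T (V b)"
  unfolding V_def
  by (rule strip_dom_diff strip_dom_add \<epsilon> b cf cg hconv_strip_dom_pk hconv_strip_dom_pk1 strip_dom_mult_right)+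

lemma V1_dom:
  assumes \<epsilon>: "0 < \<epsilon>" and b: "b \<in> Basis" "c \<in> Basis"
  shows "strip_dom \<epsilon> T (V1 b c)"
  unfolding V1_def
  by (rule strip_dom_diff strip_dom_add \<epsilon> b cf cg hconv_strip_dom_pk hconv_strip_dom_pk1 hconv_strip_dom_pk2 strip_dom_mult_right)+

lemma doms:
  assumes \<epsilon>: "0 < \<epsilon>"
  shows "strip_dom \<epsilon> T W" "strip_dom \<epsilon> T W1" "strip_dom \<epsilon> T A" "strip_dom \<epsilon> T A1"
  unfolding W_def W1_def A_def A1_def
  by (rule strip_dom_sum strip_dom_add \<epsilon> cp Basis_halfspace(1) V_dom V1_dom hconv_strip_dom_pk hconv_strip_dom_pk1 hconv_strip_dom_pk2 strip_dom_mult_right | assumption)+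

lemma horizontal_0:
  fixes u u' :: "'a \<times> real \<Rightarrow> real"
  assumes t: "0 < t"
    and d: "\<And>z. 0 < snd z \<Longrightarrow> ((\<lambda>s. u (z + s *\<^sub>R (i, 0))) has_real_derivative u' z) (at 0)"
    and c: "continuous_on halfspace u" "continuous_on halfspace u'"
    and dom: "strip_dom t t u" "strip_dom t t u'"
  shows "(LINT x|lborel. u' (x, t)) = 0" "integrable lborel (\<lambda>x. u' (x, t))"
  using horizontal_derivative_integral_0[OF t d c(2)] strip_dom_integrable(2)[OF t c(1) dom(1), of t]
    strip_dom_integrable(2)[OF t c(2) dom(2), of t] by auto

lemma laplace_normal:
  fixes w :: "'a \<Rightarrow> real"
  assumes z: "0 < snd z" and w: "ccs w"
  shows "hconv (pk2 e e) w z = - (\<Sum>i\<in>Basis. hconv (pk2 (i, 0) (i, 0)) w z)"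
  using hconv_harmonic[OF w z] by (simp add: sum_Basis_Times_real)

text \<open>Harmonicity of F and G makes V divergence free, so -
  \<open>\<partial>\<^sub>t V\<^sub>t\<close> is the horizontal divergence of V, and
  \<open>A - W1\<close> becomes the horizontal divergence of V \<Psi>. Horizontal divergences
  integrate to 0 on a slice.\<close>

lemma integral_W1:
  assumes t: "0 < t" shows "(LINT x|lborel. W1 (x, t)) = (LINT x|lborel. A (x, t))"
proof -
  define D where "D i z = V1 (i, 0) (i, 0) z * hconv pk \<psi> z + V (i, 0) z * hconv (pk1 (i, 0)) \<psi> z" for i z
  have D: "(LINT x|lborel. D i (x, t)) = 0" "integrable lborel (\<lambda>x. D i (x, t))" if i: "i \<in> Basis" for i
  proof -
    note ib = Basis_halfspace(2)[OF i]
    have d: "((\<lambda>s. V (i, 0) (z + s *\<^sub>R (i, 0)) * hconv pk \<psi> (z + s *\<^sub>R (i, 0))) has_real_derivative D i z) (at 0)" if z: "0 < snd z" for z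
      using DERIV_mult'[OF V_deriv[OF z, of "(i, 0)" "(i, 0)"] pk_U(1)[OF cp z, of "(i, 0)"]]
      unfolding D_def by (simp add: algebra_simps zero_prod_def[symmetric])
    have c: "continuous_on halfspace (\<lambda>z. V (i, 0) z * hconv pk \<psi> z)" "continuous_on halfspace (D i)"
      unfolding D_def by (intro continuous_intros continuities hconv_conts cp)+
    have dm: "strip_dom t t (\<lambda>z. V (i, 0) z * hconv pk \<psi> z)" "strip_dom t t (D i)"
      unfolding D_def
      by (rule strip_dom_add t ib cp Basis_halfspace(1) V_dom V1_dom hconv_strip_dom_pk hconv_strip_dom_pk1 hconv_strip_dom_pk2 strip_dom_mult_right)+
    show "(LINT x|lborel. D i (x, t)) = 0" "integrable lborel (\<lambda>x. D i (x, t))"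
      by (rule horizontal_0[OF t d c dm]; assumption)+
  qed
  have eq: "A z - W1 z = (\<Sum>i\<in>Basis. D i z)" if z: "0 < snd z" for z
  proof -
    have s: "hconv pk f z * (\<Sum>i\<in>Basis. hconv (pk2 (i, 0) (i, 0)) g z) - hconv pk g z * (\<Sum>i\<in>Basis. hconv (pk2 (i, 0) (i, 0)) f z)
      = (\<Sum>i\<in>Basis. V1 (i, 0) (i, 0) z)"
    proof -
      have "V1 (i, 0) (i, 0) z = hconv pk f z * hconv (pk2 (i, 0) (i, 0)) g z - hconv pk g z * hconv (pk2 (i, 0) (i, 0)) f z" for i
        by (simp add: V1_def)
      thus ?thesis by (simp add: sum_subtractf sum_distrib_left)
    qed
    have "V1 e e z = - (\<Sum>i\<in>Basis. V1 (i, 0) (i, 0) z)"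
      unfolding s[symmetric] unfolding V1_def laplace_normal[OF z cf] laplace_normal[OF z cg] by (simp add: algebra_simps)
    thus ?thesis
      unfolding A_def W1_def D_def sum_Basis_Times_real by (simp add: sum.distrib sum_distrib_right)
  qed
  have iA: "integrable lborel (\<lambda>x. A (x, t))" and iW: "integrable lborel (\<lambda>x. W1 (x, t))"
    using strip_dom_integrable(2)[OF t continuities(5) doms(3)[OF t], of t t] strip_dom_integrable(2)[OF t continuities(4) doms(2)[OF t], of t t] by auto
  have "(LINT x|lborel. A (x, t)) - (LINT x|lborel. W1 (x, t)) = (LINT x|lborel. A (x, t) - W1 (x, t))"
    by (rule Bochner_Integration.integral_diff[OF iA iW, symmetric])
  also have "\<dots> = (LINT x|lborel. (\<Sum>i\<in>Basis. D i (x, t)))" using eq t by simp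
  also have "\<dots> = (\<Sum>i\<in>Basis. (LINT x|lborel. D i (x, t)))" by (rule Bochner_Integration.integral_sum) (rule D(2))
  also have "\<dots> = 0" by (simp add: D(1))
  finally show ?thesis by simp
qed

text \<open>Second derivatives of \<Psi> with at least one horizontal direction become first
  derivatives of the extension of a bounded function; this is how the Lipschitz hypothesis on \<psi>
  enters.\<close>

lemma hconv_h:
  assumes z: "0 < snd z"
  shows "hconv pk (h i) z = hconv (pk1 (i, 0)) \<psi> z" "hconv (pk1 e) (h i) z = hconv (pk2 (i, 0) e) \<psi> z"
    "hconv (pk1 (i, 0)) (h i) z = hconv (pk2 (i, 0) (i, 0)) \<psi> z"
proof -
  have he: "h i = (\<lambda>x. frechet_derivative \<psi> (at x) i)" by (simp add: h_def fun_eq_iff)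
  show "hconv pk (h i) z = hconv (pk1 (i, 0)) \<psi> z"
    unfolding he by (rule hconv_deriv_swap[OF pk_continuous(1) psi z pk_continuous(2) pk_line_deriv(1), symmetric])
  show "hconv (pk1 (i, 0)) (h i) z = hconv (pk2 (i, 0) (i, 0)) \<psi> z"
    unfolding he by (rule hconv_deriv_swap[OF pk_continuous(2) psi z pk_continuous(3) pk_line_deriv(2), symmetric])
  have "hconv (pk2 e (i, 0)) \<psi> z = hconv (pk1 e) (h i) z"
    unfolding he by (rule hconv_deriv_swap[OF pk_continuous(2) psi z pk_continuous(3) pk_line_deriv(2)])
  moreover have "pk2 e (i, 0) = pk2 (i, 0) e" by (simp add: fun_eq_iff pk2_commute)
  ultimately show "hconv (pk1 e) (h i) z = hconv (pk2 (i, 0) e) \<psi> z" by simp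
qed

text \<open>The difference is the sum over i of the i-derivatives of \<open>V\<^sub>t
  \<partial>\<^sub>i \<Psi> - V\<^sub>i \<partial>\<^sub>t \<Psi>\<close>. The divergence of V
  eliminates \<open>\<partial>\<^sub>t V\<^sub>t\<close>, harmonicity of \<Psi> eliminates its
  second t-derivative, and the mixed second derivatives of F and G cancel by antisymmetry, so that
  only products with two first derivatives survive.\<close>

lemma integral_A1:
  assumes t: "0 < t" shows "(LINT x|lborel. A1 (x, t)) = (\<Sum>i\<in>Basis. LINT x|lborel. trilinear_density i f g (h i) (x, t))"
proof -
  define D where "D i z = (V1 e (i, 0) z * hconv (pk1 (i, 0)) \<psi> z + V e z * hconv (pk2 (i, 0) (i, 0)) \<psi> z)
     - (V1 (i, 0) (i, 0) z * hconv (pk1 e) \<psi> z + V (i, 0) z * hconv (pk2 e (i, 0)) \<psi> z)" for i z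
  have D: "(LINT x|lborel. D i (x, t)) = 0" "integrable lborel (\<lambda>x. D i (x, t))" if i: "i \<in> Basis" for i
  proof -
    note ib = Basis_halfspace(2)[OF i]
    have d: "((\<lambda>s. V e (z + s *\<^sub>R (i, 0)) * hconv (pk1 (i, 0)) \<psi> (z + s *\<^sub>R (i, 0)) - V (i, 0) (z + s *\<^sub>R (i, 0)) * hconv (pk1 e) \<psi> (z + s *\<^sub>R (i, 0)))
       has_real_derivative D i z) (at 0)" if z: "0 < snd z" for z
      using DERIV_diff[OF DERIV_mult'[OF V_deriv[OF z, of e "(i, 0)"] pk_U(2)[OF cp z, of "(i, 0)" "(i, 0)"]]
         DERIV_mult'[OF V_deriv[OF z, of "(i, 0)" "(i, 0)"] pk_U(2)[OF cp z, of e "(i, 0)"]]]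
      unfolding D_def by (simp add: algebra_simps zero_prod_def[symmetric])
    have c: "continuous_on halfspace (\<lambda>z. V e z * hconv (pk1 (i, 0)) \<psi> z - V (i, 0) z * hconv (pk1 e) \<psi> z)" "continuous_on halfspace (D i)"
      unfolding D_def by (intro continuous_intros continuities hconv_conts cp)+
    have dm: "strip_dom t t (\<lambda>z. V e z * hconv (pk1 (i, 0)) \<psi> z - V (i, 0) z * hconv (pk1 e) \<psi> z)" "strip_dom t t (D i)"
      unfolding D_def
      by (rule strip_dom_diff strip_dom_add t ib cp Basis_halfspace(1) V_dom V1_dom hconv_strip_dom_pk hconv_strip_dom_pk1 hconv_strip_dom_pk2 strip_dom_mult_right)+
    show "(LINT x|lborel. D i (x, t)) = 0" "integrable lborel (\<lambda>x. D i (x, t))"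
      by (rule horizontal_0[OF t d c dm]; assumption)+
  qed
  have eq: "A1 z - (\<Sum>i\<in>Basis. trilinear_density i f g (h i) z) = (\<Sum>i\<in>Basis. D i z)" if z: "0 < snd z" for z
  proof -
    have s: "hconv pk f z * (\<Sum>i\<in>Basis. hconv (pk2 (i, 0) (i, 0)) g z) - hconv pk g z * (\<Sum>i\<in>Basis. hconv (pk2 (i, 0) (i, 0)) f z)
      = (\<Sum>i\<in>Basis. V1 (i, 0) (i, 0) z)"
    proof -
      have "V1 (i, 0) (i, 0) z = hconv pk f z * hconv (pk2 (i, 0) (i, 0)) g z - hconv pk g z * hconv (pk2 (i, 0) (i, 0)) f z" for i
        by (simp add: V1_def)
      thus ?thesis by (simp add: sum_subtractf sum_distrib_left)
    qed
    have Vee: "V1 e e z = - (\<Sum>i\<in>Basis. V1 (i, 0) (i, 0) z)"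
      unfolding s[symmetric] unfolding V1_def laplace_normal[OF z cf] laplace_normal[OF z cg] by (simp add: algebra_simps)
    have c: "pk2 e (i, 0) = pk2 (i, 0) e" for i :: 'a by (simp add: fun_eq_iff pk2_commute)
    have "A1 z - (\<Sum>i\<in>Basis. trilinear_density i f g (h i) z) = (\<Sum>i\<in>Basis. V1 (i, 0) e z * hconv (pk1 (i, 0)) \<psi> z + V (i, 0) z * hconv (pk2 (i, 0) e) \<psi> z
        - V1 (i, 0) (i, 0) z * hconv (pk1 e) \<psi> z - V e z * hconv (pk2 (i, 0) (i, 0)) \<psi> z - trilinear_density i f g (h i) z)"
      unfolding A1_def sum_Basis_Times_real Vee laplace_normal[OF z cp]
      by (simp add: sum.distrib sum_subtractf sum_distrib_left sum_distrib_right algebra_simps sum_negf)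
    also have "\<dots> = (\<Sum>i\<in>Basis. D i z)"
      by (intro sum.cong refl) (simp add: D_def trilinear_density_def hconv_h[OF z] V_def V1_def c algebra_simps)
    finally show ?thesis .
  qed
  have iN: "integrable lborel (\<lambda>x. trilinear_density i f g (h i) (x, t))" if i: "i \<in> Basis" for i
  proof (rule strip_dom_integrable(2)[OF t])
    show "continuous_on halfspace (trilinear_density i f g (h i))"
      unfolding trilinear_density_def by (intro continuous_intros hconv_conts cf cg ch)
    show "strip_dom t t (trilinear_density i f g (h i))" unfolding trilinear_density_def
      by (rule strip_dom_diff strip_dom_add strip_dom_cmult t cf cg ch Basis_halfspace i
        hconv_strip_dom_pk hconv_strip_dom_pk1 strip_dom_mult_right)+
  qed auto
  have iA: "integrable lborel (\<lambda>x. A1 (x, t))"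
    using strip_dom_integrable(2)[OF t continuities(6) doms(4)[OF t], of t t] by auto
  have "(LINT x|lborel. A1 (x, t)) - (\<Sum>i\<in>Basis. LINT x|lborel. trilinear_density i f g (h i) (x, t))
     = (LINT x|lborel. A1 (x, t) - (\<Sum>i\<in>Basis. trilinear_density i f g (h i) (x, t)))"
    using iA iN by (simp add: Bochner_Integration.integral_sum)
  also have "\<dots> = (LINT x|lborel. (\<Sum>i\<in>Basis. D i (x, t)))" using eq t by simp
  also have "\<dots> = (\<Sum>i\<in>Basis. (LINT x|lborel. D i (x, t)))" by (rule Bochner_Integration.integral_sum) (rule D(2))
  also have "\<dots> = 0" by (simp add: D(1))
  finally show ?thesis by simp
qed

lemma strip_dom_joint:
  assumes "strip_dom \<epsilon> T X" "strip_dom \<epsilon> T Y"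
  obtains M :: "'a \<Rightarrow> real" where "integrable lborel M" "\<And>x t. \<epsilon> \<le> t \<Longrightarrow> t \<le> T \<Longrightarrow> \<bar>X (x, t)\<bar> \<le> M x"
    "\<And>x t. \<epsilon> \<le> t \<Longrightarrow> t \<le> T \<Longrightarrow> \<bar>Y (x, t)\<bar> \<le> M x"
proof -
  obtain M N :: "'a \<Rightarrow> real" where M: "integrable lborel M" "\<And>x t. \<epsilon> \<le> t \<Longrightarrow> t \<le> T \<Longrightarrow> \<bar>X (x, t)\<bar> \<le> M x"
    and N: "integrable lborel N" "\<And>x t. \<epsilon> \<le> t \<Longrightarrow> t \<le> T \<Longrightarrow> \<bar>Y (x, t)\<bar> \<le> N x"
    using assms unfolding strip_dom_def by blast
  show ?thesis
    by (rule that[of "\<lambda>x. \<bar>M x\<bar> + \<bar>N x\<bar>"])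
      (use M N in \<open>auto intro: order_trans[OF M(2)] order_trans[OF N(2)] add_increasing add_increasing2\<close>)
qed

text \<open>Taylor's formula with integral remainder, b(\<epsilon>) = b(T) - (T - \<epsilon>) b'(T)
  + \<integral> (t - \<epsilon>) b''(t) dt over the strip. It comes from integrating the
  t-derivative A + (t - \<epsilon>) A1 of (t - \<epsilon>) A, the lower boundary term of which
  vanishes.\<close>

lemma boundary_identity:
  assumes eT: "0 < \<epsilon>" "\<epsilon> \<le> T"
  shows "(LINT x|lborel. W (x, \<epsilon>)) = (LINT x|lborel. W (x, T)) - (T - \<epsilon>) * (LINT x|lborel. A (x, T))
    + (\<Sum>i\<in>Basis. trilinear_form \<epsilon> T i f g (h i))"
proof -
  define Y where "Y z = (snd z - \<epsilon>) * A z" for z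
  define Y' where "Y' z = A z + (snd z - \<epsilon>) * A1 z" for z
  define Z where "Z z = (snd z - \<epsilon>) * A1 z" for z
  have dY: "((\<lambda>s. Y (z + s *\<^sub>R e)) has_real_derivative Y' z) (at 0)" if z: "0 < snd z" for z
  proof -
    have "((\<lambda>s. snd (z + s *\<^sub>R e) - \<epsilon>) has_real_derivative 1) (at 0)" by (auto intro!: derivative_eq_intros)
    from DERIV_mult'[OF this A_deriv[OF z]] show ?thesis
      unfolding Y_def Y'_def by (simp add: algebra_simps zero_prod_def[symmetric])
  qed
  have c: "continuous_on halfspace Y" "continuous_on halfspace Y'" "continuous_on halfspace Z"
    unfolding Y_def Y'_def Z_def by (intro continuous_intros continuities)+
  have sb: "bdd_on (strip \<epsilon> T) (\<lambda>z::'a \<times> real. snd z - \<epsilon>)" by (intro bdd_on_intros)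
  have dZ: "strip_dom \<epsilon> T Z" and dYd: "strip_dom \<epsilon> T Y"
    using strip_dom_mult_right[OF doms(4)[OF eT(1)] sb] strip_dom_mult_right[OF doms(3)[OF eT(1)] sb]
    by (simp_all add: Z_def[abs_def] Y_def[abs_def] mult.commute)
  have dY'd: "strip_dom \<epsilon> T Y'"
    using strip_dom_add[OF doms(3)[OF eT(1)] dZ] by (simp add: Y'_def[abs_def] Z_def)
  obtain M :: "'a \<Rightarrow> real" where M: "integrable lborel M" "\<And>x t. \<epsilon> \<le> t \<Longrightarrow> t \<le> T \<Longrightarrow> \<bar>Y (x, t)\<bar> \<le> M x"
    "\<And>x t. \<epsilon> \<le> t \<Longrightarrow> t \<le> T \<Longrightarrow> \<bar>Y' (x, t)\<bar> \<le> M x"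
    using strip_dom_joint[OF dYd dY'd] by blast
  note SY = strip_integral[OF eT dY c(1,2) M]
  obtain M' :: "'a \<Rightarrow> real" where M': "integrable lborel M'" "\<And>x t. \<epsilon> \<le> t \<Longrightarrow> t \<le> T \<Longrightarrow> \<bar>W (x, t)\<bar> \<le> M' x"
    "\<And>x t. \<epsilon> \<le> t \<Longrightarrow> t \<le> T \<Longrightarrow> \<bar>W1 (x, t)\<bar> \<le> M' x"
    using strip_dom_joint[OF doms(1,2)[OF eT(1)]] by blast
  note SW = strip_integral[OF eT W_deriv continuities(3,4) M']
  note IA = strip_dom_integrable[OF eT(1) continuities(5) doms(3)[OF eT(1)], where T = T]
  note IZ = strip_dom_integrable[OF eT(1) c(3) dZ]
  have 1: "(LINT t|lborel. (LINT x|lborel. A (x, t)) * indicator {\<epsilon>..T} t) = (LINT x|lborel. W (x, T)) - (LINT x|lborel. W (x, \<epsilon>))"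
  proof -
    have "(LINT x|lborel. A (x, t)) * indicator {\<epsilon>..T} t = (LINT x|lborel. W1 (x, t)) * indicator {\<epsilon>..T} t" for t
      using integral_W1[of t] eT by (auto simp: indicator_def)
    thus ?thesis using SW(2) by (simp only:)
  qed
  have 2: "(LINT t|lborel. (LINT x|lborel. Z (x, t)) * indicator {\<epsilon>..T} t) = (\<Sum>i\<in>Basis. trilinear_form \<epsilon> T i f g (h i))"
  proof -
    have E: "(LINT x|lborel. Z (x, t)) * indicator {\<epsilon>..T} t = (\<Sum>i\<in>Basis. (LINT x|lborel. trilinear_density i f g (h i) (x, t) * (t - \<epsilon>)) * indicator {\<epsilon>..T} t)" for t
    proof (cases "\<epsilon> \<le> t \<and> t \<le> T")
      case True
      hence "0 < t" using eT by simp
      have "(LINT x|lborel. Z (x, t)) = (t - \<epsilon>) * (LINT x|lborel. A1 (x, t))" by (simp add: Z_def)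
      thus ?thesis using True integral_A1[OF \<open>0 < t\<close>] by (simp add: sum_distrib_left mult.commute)
    qed auto
    show ?thesis unfolding trilinear_form_def E
      by (rule Bochner_Integration.integral_sum) (rule trilinear_form_integrand_integrable(1)[OF eT(1) _ cf cg ch])
  qed
  have "(T - \<epsilon>) * (LINT x|lborel. A (x, T)) = (LINT x|lborel. Y (x, T)) - (LINT x|lborel. Y (x, \<epsilon>))"
    by (simp add: Y_def)
  also have "\<dots> = (LINT t|lborel. (LINT x|lborel. Y' (x, t)) * indicator {\<epsilon>..T} t)" by (rule SY(2)[symmetric])
  also have "\<dots> = (LINT t|lborel. (LINT x|lborel. A (x, t)) * indicator {\<epsilon>..T} t + (LINT x|lborel. Z (x, t)) * indicator {\<epsilon>..T} t)"
  proof (intro Bochner_Integration.integral_cong refl)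
    fix t
    show "(LINT x|lborel. Y' (x, t)) * indicator {\<epsilon>..T} t = (LINT x|lborel. A (x, t)) * indicator {\<epsilon>..T} t + (LINT x|lborel. Z (x, t)) * indicator {\<epsilon>..T} t"
    proof (cases "\<epsilon> \<le> t \<and> t \<le> T")
      case True
      hence "(LINT x|lborel. Y' (x, t)) = (LINT x|lborel. A (x, t)) + (LINT x|lborel. Z (x, t))"
        unfolding Y'_def Z_def[symmetric] by (intro Bochner_Integration.integral_add IA(2) IZ(2)) auto
      thus ?thesis by (simp add: distrib_right)
    qed auto
  qed
  also have "\<dots> = (LINT t|lborel. (LINT x|lborel. A (x, t)) * indicator {\<epsilon>..T} t) + (LINT t|lborel. (LINT x|lborel. Z (x, t)) * indicator {\<epsilon>..T} t)"
    by (rule Bochner_Integration.integral_add[OF IA(1) IZ(1)])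
  finally show ?thesis unfolding 1 2 by simp
qed

text \<open>At height T kernel gradients are at most a constant times T^(-n-1) \<le> T^(-2), so the
  gradients of all extensions are uniformly of that size, while the slices of the extensions of |f|
  and |g| keep their total mass. This makes b(T) of order T^(-2) and T b'(T) of order T^(-3), better
  than the stated rate.\<close>

lemma decay:
  obtains C where "\<And>T. 1 \<le> T \<Longrightarrow> \<bar>LINT x|lborel. W (x, T)\<bar> \<le> C / T" "\<And>T. 1 \<le> T \<Longrightarrow> \<bar>T * (LINT x|lborel. A (x, T))\<bar> \<le> C / T"
proof -
  define k where "k = (real DIM('a) + 1) / 2"
  define m where "m = poisson_mass TYPE('a)"
  have m: "0 < m" unfolding m_def by (rule poisson_mass_pos)
  define I where "I u = (LINT y|lborel. \<bar>u y\<bar>)" for u :: "'a \<Rightarrow> real"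
  have I: "0 \<le> I u" for u by (simp add: I_def)
  define c where "c = (1 + 2 * k) / m"
  have c: "0 \<le> c" using m by (simp add: c_def k_def)
  have gradb: "\<bar>hconv (pk1 b) u (x, T)\<bar> \<le> c / T\<^sup>2 * I u" if "1 \<le> T" "ccs u" "b \<in> Basis" for b u x T
    unfolding I_def
  proof (rule hconv_le_sup[OF pk_continuous(2) that(2)])
    show "0 < snd (x, T)" using that by simp
    fix w :: "'a \<times> real" assume w: "snd w = snd (x, T)"
    have "\<bar>pk1 b w\<bar> \<le> (1 + 2 * k) * norm b * (snd w) powr (- real DIM('a) - 1) / m"
      unfolding k_def m_def by (rule pk_bounds(4)) (use w that in simp)
    also have "\<dots> = c * T powr (- real DIM('a) - 1)" using w that(3) by (simp add: c_def)
    also have "\<dots> \<le> c * T powr (- 2)"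
    proof (intro mult_left_mono powr_mono c)
      have "1 \<le> DIM('a)" by (simp add: Suc_leI)
      thus "- real DIM('a) - 1 \<le> - 2" by simp
    qed (use that in simp)
    also have "T powr (- 2) = 1 / T\<^sup>2" using that by (simp add: powr_minus_divide powr_numeral)
    finally show "\<bar>pk1 b w\<bar> \<le> c / T\<^sup>2" by simp
  qed
  obtain P where P: "0 < P" "\<And>x. \<bar>\<psi> x\<bar> \<le> P" using ccs_bounded[OF cp] by blast
  define F where "F = hconv pk (\<lambda>y. \<bar>f y\<bar>)"
  define G where "G = hconv pk (\<lambda>y. \<bar>g y\<bar>)"
  have FG: "\<bar>hconv pk f z\<bar> \<le> F z" "\<bar>hconv pk g z\<bar> \<le> G z" "0 \<le> F z" "0 \<le> G z" if z: "0 < snd z" for z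
  proof -
    have "\<bar>hconv pk u z\<bar> \<le> 1 * hconv pk (\<lambda>y. \<bar>u y\<bar>) z" if u: "ccs u" for u
    proof (rule hconv_le[OF pk_continuous(1) u z])
      show "\<bar>pk w\<bar> \<le> 1 * pk w" if "snd w = snd z" for w :: "'a \<times> real" using pk_pos[of w] z that by simp
    qed
    from this[OF cf] this[OF cg] show "\<bar>hconv pk f z\<bar> \<le> F z" "\<bar>hconv pk g z\<bar> \<le> G z" by (simp_all add: F_def G_def)
    show "0 \<le> F z" "0 \<le> G z" unfolding F_def G_def by (rule hconv_nonneg[OF z]; simp)+
  qed
  have Vb: "\<bar>V b (x, T)\<bar> \<le> c / T\<^sup>2 * (I g * F (x, T) + I f * G (x, T))" if T: "1 \<le> T" and b: "b \<in> Basis" for b x T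
  proof -
    have z: "0 < snd (x, T)" using T by simp
    have "\<bar>V b (x, T)\<bar> \<le> \<bar>hconv pk f (x, T)\<bar> * \<bar>hconv (pk1 b) g (x, T)\<bar> + \<bar>hconv pk g (x, T)\<bar> * \<bar>hconv (pk1 b) f (x, T)\<bar>"
      unfolding V_def abs_mult[symmetric] by (rule abs_triangle_ineq4)
    also have "\<dots> \<le> F (x, T) * (c / T\<^sup>2 * I g) + G (x, T) * (c / T\<^sup>2 * I f)"
      by (intro add_mono mult_mono FG[OF z] gradb T b cf cg abs_ge_zero)
    finally show ?thesis by (simp add: algebra_simps)
  qed
  have int: "integrable lborel (\<lambda>x. I g * F (x, T) + I f * G (x, T))"
    "(LINT x|lborel. I g * F (x, T) + I f * G (x, T)) = 2 * (I f * I g)" if "0 < T" for T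
  proof -
    note SF = hconv_slice_integral[OF ccs_abs[OF cf] that] and SG = hconv_slice_integral[OF ccs_abs[OF cg] that]
    show "integrable lborel (\<lambda>x. I g * F (x, T) + I f * G (x, T))"
      unfolding F_def G_def using SF(1) SG(1) by simp
    show "(LINT x|lborel. I g * F (x, T) + I f * G (x, T)) = 2 * (I f * I g)"
      unfolding F_def G_def using SF SG by (simp add: I_def)
  qed
  have bound: "\<bar>LINT x|lborel. X (x, T)\<bar> \<le> D * (2 * (I f * I g))"
    if T: "0 < T" and X: "continuous_on halfspace X" "strip_dom T T X" and le: "\<And>x. \<bar>X (x, T)\<bar> \<le> D * (I g * F (x, T) + I f * G (x, T))" for X D T
  proof -
    have iX: "integrable lborel (\<lambda>x. X (x, T))" using strip_dom_integrable(2)[OF T X, of T] by simp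
    have "\<bar>LINT x|lborel. X (x, T)\<bar> \<le> (LINT x|lborel. \<bar>X (x, T)\<bar>)" by (rule integral_abs_bound)
    also have "\<dots> \<le> (LINT x|lborel. D * (I g * F (x, T) + I f * G (x, T)))"
      by (intro integral_mono integrable_abs iX integrable_mult_right int(1) T le)
    also have "\<dots> = D * (2 * (I f * I g))" unfolding integral_mult_right_zero int(2)[OF T] ..
    finally show ?thesis .
  qed
  define N where "N = real DIM('a \<times> real)"
  have N: "0 \<le> N" by (simp add: N_def)
  define C where "C = (c * P + N * (c * (c * I \<psi>))) * (2 * (I f * I g))"
  have Cn: "c * P * (2 * (I f * I g)) \<le> C" "N * (c * (c * I \<psi>)) * (2 * (I f * I g)) \<le> C" "0 \<le> C"
    using c P I N unfolding C_def by (auto simp: distrib_right intro!: mult_nonneg_nonneg add_nonneg_nonneg)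
  show ?thesis
  proof (rule that[of C])
    fix T :: real assume T: "1 \<le> T"
    hence T0: "0 < T" by simp
    have T2: "1 / T\<^sup>2 \<le> 1 / T" using T by (auto intro!: divide_left_mono simp: power2_eq_square)
    have Q: "0 \<le> I g * F (x, T) + I f * G (x, T)" for x
      using FG(3,4)[of "(x, T)"] I T0 by (intro add_nonneg_nonneg mult_nonneg_nonneg) auto
    have "\<bar>LINT x|lborel. W (x, T)\<bar> \<le> c / T\<^sup>2 * P * (2 * (I f * I g))"
    proof (rule bound[OF T0 continuities(3) doms(1)[OF T0]])
      fix x
      have "\<bar>W (x, T)\<bar> \<le> c / T\<^sup>2 * (I g * F (x, T) + I f * G (x, T)) * P"
        unfolding W_def abs_mult by (intro mult_mono Vb T Basis_halfspace hconv_abs_le cp P) (use T0 c Q in auto)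
      thus "\<bar>W (x, T)\<bar> \<le> c / T\<^sup>2 * P * (I g * F (x, T) + I f * G (x, T))" by (simp only: mult_ac)
    qed
    also have "\<dots> = (c * P * (2 * (I f * I g))) * (1 / T\<^sup>2)" by simp
    also have "\<dots> \<le> C * (1 / T)" by (intro mult_mono Cn T2) auto
    finally show "\<bar>LINT x|lborel. W (x, T)\<bar> \<le> C / T" by simp
    have "\<bar>LINT x|lborel. A (x, T)\<bar> \<le> N * (c / T\<^sup>2 * (c / T\<^sup>2 * I \<psi>)) * (2 * (I f * I g))"
    proof (rule bound[OF T0 continuities(5) doms(3)[OF T0]])
      fix x
      have "\<bar>A (x, T)\<bar> \<le> (\<Sum>b\<in>Basis. \<bar>V b (x, T) * hconv (pk1 b) \<psi> (x, T)\<bar>)" unfolding A_def by (rule sum_abs)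
      also have "\<dots> \<le> N * (c / T\<^sup>2 * (I g * F (x, T) + I f * G (x, T)) * (c / T\<^sup>2 * I \<psi>))"
        unfolding N_def
      proof (rule sum_bounded_above)
        fix b :: "'a \<times> real" assume b: "b \<in> Basis"
        show "\<bar>V b (x, T) * hconv (pk1 b) \<psi> (x, T)\<bar> \<le> c / T\<^sup>2 * (I g * F (x, T) + I f * G (x, T)) * (c / T\<^sup>2 * I \<psi>)"
          unfolding abs_mult by (intro mult_mono Vb T b gradb cp) (use c Q in auto)
      qed
      finally show "\<bar>A (x, T)\<bar> \<le> N * (c / T\<^sup>2 * (c / T\<^sup>2 * I \<psi>)) * (I g * F (x, T) + I f * G (x, T))" by (simp only: mult_ac)
    qed
    hence "T * \<bar>LINT x|lborel. A (x, T)\<bar> \<le> T * (N * (c / T\<^sup>2 * (c / T\<^sup>2 * I \<psi>)) * (2 * (I f * I g)))"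
      using T0 by (intro mult_left_mono) auto
    also have "\<dots> = (N * (c * (c * I \<psi>)) * (2 * (I f * I g))) * (1 / T * (1 / T\<^sup>2))"
      using T0 by (simp add: field_simps power2_eq_square)
    also have "\<dots> \<le> C * (1 / T * 1)"
      using T by (intro mult_mono Cn) (auto simp: power2_eq_square divide_le_eq mult_ge1_I)
    finally show "\<bar>T * (LINT x|lborel. A (x, T))\<bar> \<le> C / T" using T0 by (simp add: abs_mult)
  qed
qed

text \<open>The bound \<open>B\<close> is uniform in T, so \<open>boundary_identity\<close> can be
  read in the limit T to infinity, where the two terms at the top vanish and the n directions
  contribute \<open>B\<close> each.\<close>

lemma W_bound:
  assumes \<epsilon>: "0 < \<epsilon>" and B: "\<And>T i. \<epsilon> \<le> T \<Longrightarrow> i \<in> Basis \<Longrightarrow> \<bar>trilinear_form \<epsilon> T i f g (h i)\<bar> \<le> B"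
  shows "\<bar>LINT x|lborel. W (x, \<epsilon>)\<bar> \<le> real DIM('a) * B"
proof -
  obtain C where C: "\<And>T. 1 \<le> T \<Longrightarrow> \<bar>LINT x|lborel. W (x, T)\<bar> \<le> C / T" "\<And>T. 1 \<le> T \<Longrightarrow> \<bar>T * (LINT x|lborel. A (x, T))\<bar> \<le> C / T"
    using decay by blast
  have le: "\<bar>LINT x|lborel. W (x, \<epsilon>)\<bar> \<le> real DIM('a) * B + 2 * C / T" if T: "max 1 \<epsilon> \<le> T" for T
  proof -
    have T': "1 \<le> T" "\<epsilon> \<le> T" using T by auto
    have "\<bar>(T - \<epsilon>) * (LINT x|lborel. A (x, T))\<bar> \<le> \<bar>T * (LINT x|lborel. A (x, T))\<bar>"
      unfolding abs_mult using T' \<epsilon> by (intro mult_right_mono) auto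
    moreover have "\<bar>\<Sum>i\<in>Basis. trilinear_form \<epsilon> T i f g (h i)\<bar> \<le> real DIM('a) * B"
      by (rule order_trans[OF sum_abs sum_bounded_above]) (rule B[OF T'(2)])
    moreover have "\<bar>w - t + s\<bar> \<le> d + 2 * c" if "\<bar>t\<bar> \<le> u" "\<bar>s\<bar> \<le> d" "\<bar>w\<bar> \<le> c" "u \<le> c" for w t s u c d :: real
      using that by linarith
    ultimately have "\<bar>LINT x|lborel. W (x, \<epsilon>)\<bar> \<le> real DIM('a) * B + 2 * (C / T)"
      unfolding boundary_identity[OF \<epsilon> T'(2)] using C(1)[OF T'(1)] C(2)[OF T'(1)] by blast
    thus ?thesis by simp
  qed
  have "((\<lambda>T. real DIM('a) * B + 2 * C / T) \<longlongrightarrow> real DIM('a) * B + 0) at_top"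
    by (intro tendsto_intros real_tendsto_divide_at_top[OF tendsto_const filterlim_ident])
  moreover have "eventually (\<lambda>T. \<bar>LINT x|lborel. W (x, \<epsilon>)\<bar> \<le> real DIM('a) * B + 2 * C / T) at_top"
    using eventually_ge_at_top[of "max 1 \<epsilon>"] by eventually_elim (rule le)
  ultimately have "\<bar>LINT x|lborel. W (x, \<epsilon>)\<bar> \<le> real DIM('a) * B + 0"
    by (intro tendsto_lowerbound) auto
  thus ?thesis by simp
qed

end

subsection \<open>The bilinear estimate\<close>

text \<open>\<open>W_bound\<close> along heights tending to 0. For t \<le> 1 the extensions have an
  integrable majorant and their normal derivatives are bounded, so the integrals of \<open>W\<close>
  converge to - c times the form; the sign disappears in the absolute value.\<close>

lemma (in trilinear) boundary_form_bound:
  assumes c: "0 < c" "\<And>(u :: 'a \<Rightarrow> real) x X. test_function u \<Longrightarrow> (\<And>i. 0 < X i) \<Longrightarrow> X \<longlonglongrightarrow> 0 \<Longrightarrow>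
      (\<lambda>i. hconv (pk1 (0, 1)) u (x, X i)) \<longlonglongrightarrow> - c * half_laplacian u x"
    "\<And>u :: 'a \<Rightarrow> real. test_function u \<Longrightarrow> \<exists>B. \<forall>x t. 0 < t \<longrightarrow> \<bar>hconv (pk1 (0, 1)) u (x, t)\<bar> \<le> B"
    and B: "\<And>\<epsilon> T i. 0 < \<epsilon> \<Longrightarrow> \<epsilon> \<le> T \<Longrightarrow> i \<in> Basis \<Longrightarrow> \<bar>trilinear_form \<epsilon> T i f g (h i)\<bar> \<le> B"
  shows "c * \<bar>LINT x|lborel. (f x * half_laplacian g x - half_laplacian f x * g x) * \<psi> x\<bar> \<le> real DIM('a) * B"
proof -
  define X where "X i = inverse (real (Suc i))" for i
  have X: "0 < X i" "X i \<le> 1" "X \<longlonglongrightarrow> 0" for i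
    using LIMSEQ_inverse_real_of_nat by (auto simp: X_def[abs_def] inverse_le_1_iff)
  obtain Bf Bg where Bf: "\<And>x t. 0 < t \<Longrightarrow> \<bar>hconv (pk1 e) f (x, t)\<bar> \<le> Bf" and Bg: "\<And>x t. 0 < t \<Longrightarrow> \<bar>hconv (pk1 e) g (x, t)\<bar> \<le> Bg"
    using c(3)[OF f] c(3)[OF g] by blast
  obtain Mf where Mf: "integrable lborel Mf" "\<And>x t. 0 < t \<Longrightarrow> t \<le> 1 \<Longrightarrow> \<bar>hconv pk f (x, t)\<bar> \<le> Mf x"
    using hconv_boundary_dominated[OF cf] by blast
  obtain Mg where Mg: "integrable lborel Mg" "\<And>x t. 0 < t \<Longrightarrow> t \<le> 1 \<Longrightarrow> \<bar>hconv pk g (x, t)\<bar> \<le> Mg x"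
    using hconv_boundary_dominated[OF cg] by blast
  obtain P where P: "0 < P" "\<And>x. \<bar>\<psi> x\<bar> \<le> P" using ccs_bounded[OF cp] by blast
  have B0: "0 \<le> Bf" "0 \<le> Bg" using order_trans[OF abs_ge_zero Bf[OF X(1)]] order_trans[OF abs_ge_zero Bg[OF X(1)]] by auto
  have [measurable]: "f \<in> borel_measurable borel" "g \<in> borel_measurable borel" "\<psi> \<in> borel_measurable borel"
    by (rule ccs_measurable cf cg cp)+
  have [measurable]: "half_laplacian f \<in> borel_measurable borel" "half_laplacian g \<in> borel_measurable borel"
    using half_laplacian_continuous[OF f] half_laplacian_continuous[OF g] by (auto intro: borel_measurable_continuous_onI)
  have "(\<lambda>i. LINT x|lborel. W (x, X i)) \<longlonglongrightarrow>
      (LINT x|lborel. (f x * (- c * half_laplacian g x) - g x * (- c * half_laplacian f x)) * \<psi> x)"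
  proof (rule integral_dominated_convergence[where w = "\<lambda>x. (Mf x * Bg + Mg x * Bf) * P"])
    show "(\<lambda>x. W (x, X i)) \<in> borel_measurable lborel" for i
    proof -
      have "continuous_on UNIV (\<lambda>x. W (x, X i))"
        by (rule continuous_on_compose2[OF continuities(3)]) (use X in \<open>auto intro!: continuous_intros\<close>)
      thus ?thesis by (simp add: borel_measurable_continuous_onI)
    qed
    show "integrable lborel (\<lambda>x. (Mf x * Bg + Mg x * Bf) * P)" using Mf Mg by simp
    show "AE x in lborel. (\<lambda>i. W (x, X i)) \<longlonglongrightarrow> (f x * (- c * half_laplacian g x) - g x * (- c * half_laplacian f x)) * \<psi> x"
      unfolding W_def V_def
      by (intro AE_I2 tendsto_intros hconv_boundary_limit cf cg cp c(2) f g X)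
    show "AE x in lborel. norm (W (x, X i)) \<le> (Mf x * Bg + Mg x * Bf) * P" for i
    proof (rule AE_I2)
      fix x :: 'a
      have z: "0 < snd (x, X i)" using X by simp
      have "\<bar>V e (x, X i)\<bar> \<le> \<bar>hconv pk f (x, X i)\<bar> * \<bar>hconv (pk1 e) g (x, X i)\<bar> + \<bar>hconv pk g (x, X i)\<bar> * \<bar>hconv (pk1 e) f (x, X i)\<bar>"
        unfolding V_def abs_mult[symmetric] by (rule abs_triangle_ineq4)
      also have "\<dots> \<le> Mf x * Bg + Mg x * Bf"
        by (intro add_mono mult_mono Mf Mg Bf Bg X abs_ge_zero order_trans[OF abs_ge_zero Mf(2)[OF X(1,2)]]
            order_trans[OF abs_ge_zero Mg(2)[OF X(1,2)]])
      finally have V: "\<bar>V e (x, X i)\<bar> \<le> Mf x * Bg + Mg x * Bf" .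
      have "\<bar>W (x, X i)\<bar> \<le> (Mf x * Bg + Mg x * Bf) * P"
        unfolding W_def abs_mult
        by (rule mult_mono[OF V hconv_abs_le[OF cp z P(2)]]) (use order_trans[OF abs_ge_zero V] in auto)
      thus "norm (W (x, X i)) \<le> (Mf x * Bg + Mg x * Bf) * P" by simp
    qed
  qed measurable
  moreover have "(LINT x|lborel. (f x * (- c * half_laplacian g x) - g x * (- c * half_laplacian f x)) * \<psi> x)
     = - c * (LINT x|lborel. (f x * half_laplacian g x - half_laplacian f x * g x) * \<psi> x)"
    unfolding integral_mult_right_zero[symmetric]
    by (intro Bochner_Integration.integral_cong refl) (simp add: algebra_simps)
  ultimately have L: "(\<lambda>i. \<bar>LINT x|lborel. W (x, X i)\<bar>) \<longlonglongrightarrow>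
      \<bar>- c * (LINT x|lborel. (f x * half_laplacian g x - half_laplacian f x * g x) * \<psi> x)\<bar>"
    by (intro tendsto_rabs) simp
  have "\<bar>- c * (LINT x|lborel. (f x * half_laplacian g x - half_laplacian f x * g x) * \<psi> x)\<bar> \<le> real DIM('a) * B"
    by (rule LIMSEQ_le_const2[OF L]) (use W_bound[OF X(1) B[OF X(1)]] in blast)
  thus ?thesis using c(1) by (simp add: abs_mult)
qed

lemma form_bound_unit:
  assumes p: "1 < p"
  shows "\<exists>C\<ge>0. \<forall>f g \<psi> :: 'a::euclidean_space \<Rightarrow> real. test_function f \<longrightarrow> test_function g \<longrightarrow> test_function \<psi> \<longrightarrow>
     (\<forall>x y. \<bar>\<psi> x - \<psi> y\<bar> \<le> norm (x - y)) \<longrightarrow>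
     \<bar>LINT x|lborel. (f x * half_laplacian g x - half_laplacian f x * g x) * \<psi> x\<bar>
       \<le> C * ((LINT x|lborel. \<bar>f x\<bar> powr p) + (LINT x|lborel. \<bar>g x\<bar> powr (p / (p - 1))))"
proof -
  obtain C where C: "\<And>(f :: 'a \<Rightarrow> real) g h \<epsilon> T i. i \<in> Basis \<Longrightarrow> ccs f \<Longrightarrow> ccs g \<Longrightarrow> ccs h \<Longrightarrow> (\<And>x. \<bar>h x\<bar> \<le> 1)
    \<Longrightarrow> 0 < \<epsilon> \<Longrightarrow> \<epsilon> \<le> T \<Longrightarrow>
    \<bar>trilinear_form \<epsilon> T i f g h\<bar> \<le> C * ((LINT x|lborel. \<bar>f x\<bar> powr p) + (LINT x|lborel. \<bar>g x\<bar> powr (p / (p - 1))))"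
    using trilinear_form_bound[OF p, where 'a='a] by blast
  obtain c where c: "0 < c" "\<And>(u :: 'a \<Rightarrow> real) x X. test_function u \<Longrightarrow> (\<And>i. 0 < X i) \<Longrightarrow> X \<longlonglongrightarrow> 0 \<Longrightarrow>
      (\<lambda>i. hconv (pk1 (0, 1)) u (x, X i)) \<longlonglongrightarrow> - c * half_laplacian u x"
    "\<And>u :: 'a \<Rightarrow> real. test_function u \<Longrightarrow> \<exists>B. \<forall>x t. 0 < t \<longrightarrow> \<bar>hconv (pk1 (0, 1)) u (x, t)\<bar> \<le> B"
    using hconv_normal_derivative_boundary[where 'a='a] by blast
  show ?thesis
  proof (intro exI[of _ "real DIM('a) * \<bar>C\<bar> / c"] conjI allI impI)
    show "0 \<le> real DIM('a) * \<bar>C\<bar> / c" using c(1) by simp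
    fix f g \<psi> :: "'a \<Rightarrow> real"
    assume t: "test_function f" "test_function g" "test_function \<psi>" and L: "\<forall>x y. \<bar>\<psi> x - \<psi> y\<bar> \<le> norm (x - y)"
    interpret trilinear f g \<psi> by unfold_locales (rule t)+
    define R where "R = (LINT x|lborel. \<bar>f x\<bar> powr p) + (LINT x|lborel. \<bar>g x\<bar> powr (p / (p - 1)))"
    have R: "0 \<le> R" unfolding R_def by (intro add_nonneg_nonneg integral_nonneg_AE AE_I2) auto
    \<comment> \<open>The partial derivative is a limit of difference quotients, and the Lipschitz
      condition bounds each of them by 1; at s = 0 the quotient is 0 by the convention for
      division.\<close>
    have h1: "\<bar>h i x\<bar> \<le> 1" if i: "i \<in> Basis" for i x
    proof -
      have "((\<lambda>s. (\<psi> (x + s *\<^sub>R i) - \<psi> x) / s) \<longlongrightarrow> h i x) (at 0)"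
        using test_function_line_deriv[OF t(3), of x i] unfolding has_field_derivative_iff h_def by simp
      hence "((\<lambda>s. \<bar>(\<psi> (x + s *\<^sub>R i) - \<psi> x) / s\<bar>) \<longlongrightarrow> \<bar>h i x\<bar>) (at 0)" by (rule tendsto_rabs)
      moreover have "\<bar>(\<psi> (x + s *\<^sub>R i) - \<psi> x) / s\<bar> \<le> 1" for s
      proof -
        have "\<bar>\<psi> (x + s *\<^sub>R i) - \<psi> x\<bar> \<le> \<bar>s\<bar>" using L[rule_format, of "x + s *\<^sub>R i" x] i by simp
        thus ?thesis by (cases "s = 0") (simp_all add: divide_le_eq)
      qed
      ultimately show ?thesis by (intro tendsto_upperbound[of _ "\<bar>h i x\<bar>" "at (0::real)"]) auto
    qed
    have "c * \<bar>LINT x|lborel. (f x * half_laplacian g x - half_laplacian f x * g x) * \<psi> x\<bar> \<le> real DIM('a) * (\<bar>C\<bar> * R)"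
    proof (rule boundary_form_bound[OF c])
      fix \<epsilon> T :: real and i :: 'a assume a: "0 < \<epsilon>" "\<epsilon> \<le> T" "i \<in> Basis"
      have "\<bar>trilinear_form \<epsilon> T i f g (h i)\<bar> \<le> C * R" unfolding R_def by (rule C[OF a(3) cf cg ch h1[OF a(3)] a(1,2)])
      also have "\<dots> \<le> \<bar>C\<bar> * R" using R by (intro mult_right_mono) auto
      finally show "\<bar>trilinear_form \<epsilon> T i f g (h i)\<bar> \<le> \<bar>C\<bar> * R" .
    qed
    hence "\<bar>LINT x|lborel. (f x * half_laplacian g x - half_laplacian f x * g x) * \<psi> x\<bar> \<le> real DIM('a) * (\<bar>C\<bar> * R) / c"
      using c(1) by (simp add: pos_le_divide_eq mult.commute)
    thus "\<bar>LINT x|lborel. (f x * half_laplacian g x - half_laplacian f x * g x) * \<psi> x\<bar>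
       \<le> real DIM('a) * \<bar>C\<bar> / c * ((LINT x|lborel. \<bar>f x\<bar> powr p) + (LINT x|lborel. \<bar>g x\<bar> powr (p / (p - 1))))"
      by (simp add: R_def)
  qed
qed

section \<open>Normalisation by the Lipschitz seminorm and the norms\<close>

text \<open>A supremum of reals is only informative for a set that is bounded above. A crude
  Lipschitz constant, the sum of bounds for the partial derivatives, shows this; afterwards the
  seminorm itself is a Lipschitz constant. Nonnegativity uses a pair of distinct points, which a
  nonempty basis provides.\<close>

lemma test_function_lipschitz:
  fixes \<psi> :: "'a::euclidean_space \<Rightarrow> real"
  assumes t: "test_function \<psi>"
  shows "\<bar>\<psi> x - \<psi> y\<bar> \<le> lipschitz_seminorm \<psi> * norm (x - y)" "0 \<le> lipschitz_seminorm \<psi>"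
proof -
  have "\<exists>B. \<forall>x. \<bar>frechet_derivative \<psi> (at x) b\<bar> \<le> B" for b
    using ccs_bounded[OF test_function_ccs[OF test_function_deriv[OF t, of b]]] by metis
  then obtain B where B: "\<And>b x. \<bar>frechet_derivative \<psi> (at x) b\<bar> \<le> B b" by metis
  define K where "K = (\<Sum>b\<in>Basis. B b)"
  have D: "(\<psi> has_derivative frechet_derivative \<psi> (at x)) (at x)" for x
    using frechet_derivative_works[THEN iffD1, OF test_functionD(3)[OF t]] .
  have le: "\<bar>frechet_derivative \<psi> (at x) v\<bar> \<le> K * norm v" for x v
  proof -
    interpret linear "frechet_derivative \<psi> (at x)" by (rule linear_frechet_derivative[OF test_functionD(3)[OF t]])
    have "frechet_derivative \<psi> (at x) v = frechet_derivative \<psi> (at x) (\<Sum>b\<in>Basis. (v \<bullet> b) *\<^sub>R b)"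
      by (simp add: euclidean_representation)
    also have "\<dots> = (\<Sum>b\<in>Basis. (v \<bullet> b) * frechet_derivative \<psi> (at x) b)" by (simp add: sum scale)
    finally have "\<bar>frechet_derivative \<psi> (at x) v\<bar> \<le> (\<Sum>b\<in>Basis. \<bar>(v \<bullet> b) * frechet_derivative \<psi> (at x) b\<bar>)"
      using sum_abs by metis
    also have "\<dots> \<le> (\<Sum>b\<in>Basis. norm v * B b)"
      unfolding abs_mult by (intro sum_mono mult_mono B Basis_le_norm) auto
    finally show ?thesis by (simp add: K_def sum_distrib_left mult.commute)
  qed
  have lip: "\<bar>\<psi> x - \<psi> y\<bar> \<le> K * norm (x - y)" for x y
  proof -
    have "norm (\<psi> x - \<psi> y) \<le> K * norm (x - y)"
      by (rule differentiable_bound[of UNIV \<psi> "\<lambda>x. frechet_derivative \<psi> (at x)"])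
        (auto intro!: D onorm_le simp: le)
    thus ?thesis by simp
  qed
  have bdd: "bdd_above ((\<lambda>(x, y). \<bar>\<psi> x - \<psi> y\<bar> / dist x y) ` {(x, y). x \<noteq> y})"
  proof (rule bdd_aboveI2[of _ _ K])
    fix p :: "'a \<times> 'a" assume "p \<in> {(x, y). x \<noteq> y}"
    then obtain x y where "p = (x, y)" "x \<noteq> y" by auto
    thus "(case p of (x, y) \<Rightarrow> \<bar>\<psi> x - \<psi> y\<bar> / dist x y) \<le> K"
      using lip[of x y] by (simp add: dist_norm pos_divide_le_eq)
  qed
  have le_sup: "\<bar>\<psi> x - \<psi> y\<bar> / dist x y \<le> lipschitz_seminorm \<psi>" if "x \<noteq> y" for x y
    unfolding lipschitz_seminorm_def using cSUP_upper[OF _ bdd, of "(x, y)"] that by simp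
  show "\<bar>\<psi> x - \<psi> y\<bar> \<le> lipschitz_seminorm \<psi> * norm (x - y)"
    using le_sup[of x y] by (cases "x = y") (simp_all add: dist_norm pos_divide_le_eq)
  obtain b :: 'a where "b \<in> Basis" using nonempty_Basis by blast
  hence "b \<noteq> 0" by auto
  have "0 \<le> \<bar>\<psi> b - \<psi> 0\<bar> / dist b 0" by simp
  also have "\<dots> \<le> lipschitz_seminorm \<psi>" by (rule le_sup[OF \<open>b \<noteq> 0\<close>])
  finally show "0 \<le> lipschitz_seminorm \<psi>" .
qed

lemma Lp_norm_nonneg: "0 \<le> Lp_norm p f"
  by (simp add: Lp_norm_def)

lemma Lp_integral_scaled_le_1:
  fixes f :: "'a::euclidean_space \<Rightarrow> real"
  assumes p: "0 < p" and a: "Lp_norm p f < a"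
  shows "(LINT x|lborel. \<bar>f x / a\<bar> powr p) \<le> 1"
proof -
  have a0: "0 < a" using a Lp_norm_nonneg[of p f] by linarith
  have I: "0 \<le> (LINT x|lborel. \<bar>f x\<bar> powr p)" by (intro integral_nonneg_AE AE_I2) auto
  have "Lp_norm p f powr p = (LINT x|lborel. \<bar>f x\<bar> powr p)"
    unfolding Lp_norm_def using p I by (simp add: powr_powr)
  hence le: "(LINT x|lborel. \<bar>f x\<bar> powr p) \<le> a powr p"
    using powr_mono2[of p "Lp_norm p f" a] p a Lp_norm_nonneg[of p f] by simp
  have "(LINT x|lborel. \<bar>f x / a\<bar> powr p) = (LINT x|lborel. \<bar>f x\<bar> powr p) / a powr p"
    using a0 by (simp add: powr_divide)
  also have "\<dots> \<le> 1" using le a0 by (simp add: divide_le_eq)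
  finally show ?thesis .
qed

text \<open>Lets d tend to 0 from the right. Dividing by norm + d instead of the norm removes the
  case distinction for vanishing norms.\<close>

lemma le_of_shifted_product:
  fixes T a b c K :: real
  assumes "\<And>d. 0 < d \<Longrightarrow> T \<le> K * (a + d) * (b + d) * (c + d)"
  shows "T \<le> K * a * b * c"
proof -
  have "((\<lambda>d. K * (a + d) * (b + d) * (c + d)) \<longlongrightarrow> K * (a + 0) * (b + 0) * (c + 0)) (at_right 0)"
    by (intro tendsto_intros)
  moreover have "eventually (\<lambda>d. T \<le> K * (a + d) * (b + d) * (c + d)) (at_right 0)"
    using eventually_at_right_less by (rule eventually_mono) (rule assms)
  ultimately show ?thesis using tendsto_lowerbound[of _ "K * (a + 0) * (b + 0) * (c + 0)" "at_right (0::real)" T] by simp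
qed

text \<open>Both sides of the claim are homogeneous in each function. Dividing \<psi>, f and g by
  numbers slightly larger than their seminorm and norms makes \<psi> 1-Lipschitz and both power
  integrals at most 1, so the additive bound becomes C (1 + 1), whence 2 C.\<close>

lemma form_bound:
  assumes p: "1 < p"
  shows "\<exists>C. \<forall>f g \<psi> :: 'a::euclidean_space \<Rightarrow> real. test_function f \<longrightarrow> test_function g \<longrightarrow> test_function \<psi> \<longrightarrow>
     (LINT x|lborel. (f x * half_laplacian g x - half_laplacian f x * g x) * \<psi> x)
       \<le> C * lipschitz_seminorm \<psi> * Lp_norm p f * Lp_norm (p / (p - 1)) g"
proof -
  define q where "q = p / (p - 1)"
  have q: "0 < q" using p by (simp add: q_def)
  obtain C where C0: "0 \<le> C" and C: "\<And>f g \<psi> :: 'a \<Rightarrow> real. test_function f \<Longrightarrow> test_function g \<Longrightarrow> test_function \<psi> \<Longrightarrow>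
     (\<And>x y. \<bar>\<psi> x - \<psi> y\<bar> \<le> norm (x - y)) \<Longrightarrow>
     \<bar>LINT x|lborel. (f x * half_laplacian g x - half_laplacian f x * g x) * \<psi> x\<bar>
       \<le> C * ((LINT x|lborel. \<bar>f x\<bar> powr p) + (LINT x|lborel. \<bar>g x\<bar> powr q))"
    using form_bound_unit[OF p, where 'a='a] unfolding q_def[symmetric] by blast
  show ?thesis
  proof (intro exI[of _ "2 * C"] allI impI)
    fix f g \<psi> :: "'a \<Rightarrow> real" assume t: "test_function f" "test_function g" "test_function \<psi>"
    let ?T = "LINT x|lborel. (f x * half_laplacian g x - half_laplacian f x * g x) * \<psi> x"
    have "?T \<le> 2 * C * lipschitz_seminorm \<psi> * Lp_norm p f * Lp_norm q g"
    proof (rule le_of_shifted_product)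
      fix d :: real assume d: "0 < d"
      define l where "l = lipschitz_seminorm \<psi> + d"
      define a where "a = Lp_norm p f + d"
      define b where "b = Lp_norm q g + d"
      have l: "0 < l" and a: "0 < a" "Lp_norm p f < a" and b: "0 < b" "Lp_norm q g < b"
        using d test_function_lipschitz(2)[OF t(3)] Lp_norm_nonneg[of p f] Lp_norm_nonneg[of q g]
        by (auto simp: l_def a_def b_def)
      define f' where "f' x = (1 / a) * f x" for x
      define g' where "g' x = (1 / b) * g x" for x
      define \<psi>' where "\<psi>' x = (1 / l) * \<psi> x" for x
      have t': "test_function f'" "test_function g'" "test_function \<psi>'"
        unfolding f'_def g'_def \<psi>'_def by (intro test_function_cmult t)+
      have "\<bar>LINT x|lborel. (f' x * half_laplacian g' x - half_laplacian f' x * g' x) * \<psi>' x\<bar>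
         \<le> C * ((LINT x|lborel. \<bar>f' x\<bar> powr p) + (LINT x|lborel. \<bar>g' x\<bar> powr q))"
      proof (rule C[OF t'])
        fix x y
        have "\<bar>\<psi> x - \<psi> y\<bar> \<le> lipschitz_seminorm \<psi> * norm (x - y)" by (rule test_function_lipschitz(1)[OF t(3)])
        also have "\<dots> \<le> l * norm (x - y)" using d by (intro mult_right_mono) (auto simp: l_def)
        finally have "\<bar>\<psi> x - \<psi> y\<bar> / l \<le> norm (x - y)" using l by (simp add: pos_divide_le_eq mult.commute)
        moreover have "\<psi>' x - \<psi>' y = (\<psi> x - \<psi> y) / l" by (simp add: \<psi>'_def diff_divide_distrib)
        ultimately show "\<bar>\<psi>' x - \<psi>' y\<bar> \<le> norm (x - y)" using l by simp
      qed
      also have "\<dots> \<le> C * (1 + 1)"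
        using Lp_integral_scaled_le_1[OF _ a(2)] Lp_integral_scaled_le_1[OF q b(2)] p C0
        by (intro mult_left_mono add_mono) (auto simp: f'_def g'_def)
      also have "(LINT x|lborel. (f' x * half_laplacian g' x - half_laplacian f' x * g' x) * \<psi>' x) = (1 / (a * b * l)) * ?T"
        unfolding integral_mult_right_zero[symmetric]
      proof (intro Bochner_Integration.integral_cong refl)
        fix x
        have hl: "half_laplacian f' x = (1 / a) * half_laplacian f x" "half_laplacian g' x = (1 / b) * half_laplacian g x"
          unfolding f'_def[abs_def] g'_def[abs_def] by (rule half_laplacian_cmult)+
        show "(f' x * half_laplacian g' x - half_laplacian f' x * g' x) * \<psi>' x
          = 1 / (a * b * l) * ((f x * half_laplacian g x - half_laplacian f x * g x) * \<psi> x)"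
          unfolding hl unfolding f'_def g'_def \<psi>'_def using a b l by (simp add: field_simps)
      qed
      finally have "\<bar>?T\<bar> / (a * b * l) \<le> 2 * C" using a b l by (simp add: abs_mult)
      hence "\<bar>?T\<bar> \<le> 2 * C * (a * b * l)" using a b l by (simp add: pos_divide_le_eq)
      moreover have "2 * C * (a * b * l) = 2 * C * l * a * b" by simp
      ultimately show "?T \<le> 2 * C * (lipschitz_seminorm \<psi> + d) * (Lp_norm p f + d) * (Lp_norm q g + d)"
        unfolding l_def a_def b_def by linarith
    qed
    thus "?T \<le> 2 * C * lipschitz_seminorm \<psi> * Lp_norm p f * Lp_norm (p / (p - 1)) g" unfolding q_def .
  qed
qed

subsection \<open>Duality\<close>

lemma Holder_inequality_Lp:
  fixes w g :: "'a::euclidean_space \<Rightarrow> real"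
  assumes p: "1 < p" and w: "in_Lp p w" and g: "in_Lp (p / (p - 1)) g"
  shows "(LINT x|lborel. w x * g x) \<le> Lp_norm p w * Lp_norm (p / (p - 1)) g"
proof -
  define q where "q = p / (p - 1)"
  have q: "1 < q" "1 / p + 1 / q = 1" using p by (auto simp: q_def field_simps)
  have [measurable]: "w \<in> borel_measurable borel" "g \<in> borel_measurable borel" using w g by (auto simp: in_Lp_def)
  have i: "integrable lborel (\<lambda>x. \<bar>w x\<bar> powr p)" "integrable lborel (\<lambda>x. \<bar>g x\<bar> powr q)"
    using w g by (auto simp: in_Lp_def q_def)
  have young: "\<bar>s * t\<bar> \<le> \<bar>s\<bar> powr p / p + \<bar>t\<bar> powr q / q" for s t :: real
    using Youngs_inequality[of p q "\<bar>s\<bar>" "\<bar>t\<bar>"] p q by (simp add: abs_mult)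
  have iwg: "integrable lborel (\<lambda>x. w x * g x)"
  proof (rule Bochner_Integration.integrable_bound[where f = "\<lambda>x. \<bar>w x\<bar> powr p / p + \<bar>g x\<bar> powr q / q"])
    show "integrable lborel (\<lambda>x. \<bar>w x\<bar> powr p / p + \<bar>g x\<bar> powr q / q)" using i by simp
    show "AE x in lborel. norm (w x * g x) \<le> norm (\<bar>w x\<bar> powr p / p + \<bar>g x\<bar> powr q / q)"
      using young by (auto intro: order_trans[OF _ abs_ge_self])
  qed measurable
  \<comment> \<open>\<open>le_of_shifted_product\<close> expects three shifted factors; the second 1
    fills the place of the third one and becomes 1 + d.\<close>
  have "(LINT x|lborel. w x * g x) \<le> 1 * 1 * Lp_norm p w * Lp_norm q g"
  proof (rule le_of_shifted_product)
    fix d :: real assume d: "0 < d"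
    define a where "a = Lp_norm p w + d"
    define b where "b = Lp_norm q g + d"
    have a: "0 < a" "Lp_norm p w < a" and b: "0 < b" "Lp_norm q g < b"
      using d Lp_norm_nonneg[of p w] Lp_norm_nonneg[of q g] by (auto simp: a_def b_def)
    have ia: "integrable lborel (\<lambda>x. \<bar>w x / a\<bar> powr p)" "integrable lborel (\<lambda>x. \<bar>g x / b\<bar> powr q)"
      using i a b by (simp_all add: powr_divide)
    have "(LINT x|lborel. w x * g x) / (a * b) = (LINT x|lborel. (w x / a) * (g x / b))" by simp
    also have "\<dots> \<le> (LINT x|lborel. \<bar>w x / a\<bar> powr p / p + \<bar>g x / b\<bar> powr q / q)"
    proof (rule integral_mono)
      show "integrable lborel (\<lambda>x. (w x / a) * (g x / b))" using iwg by simp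
      show "integrable lborel (\<lambda>x. \<bar>w x / a\<bar> powr p / p + \<bar>g x / b\<bar> powr q / q)" using ia by simp
      show "(w x / a) * (g x / b) \<le> \<bar>w x / a\<bar> powr p / p + \<bar>g x / b\<bar> powr q / q" for x
        by (rule order_trans[OF abs_ge_self young])
    qed
    also have "\<dots> = (LINT x|lborel. \<bar>w x / a\<bar> powr p) / p + (LINT x|lborel. \<bar>g x / b\<bar> powr q) / q"
      using ia by simp
    also have "\<dots> \<le> 1 / p + 1 / q"
      using p q Lp_integral_scaled_le_1[OF _ a(2)] Lp_integral_scaled_le_1[OF _ b(2)]
      by (intro add_mono divide_right_mono) auto
    finally have "(LINT x|lborel. w x * g x) / (a * b) \<le> 1" using q by simp
    hence "(LINT x|lborel. w x * g x) \<le> a * b" using a b by (simp add: pos_divide_le_eq)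
    also have "\<dots> \<le> (1 + d) * (a * b)" using a b d by (simp add: mult_right_mono)
    finally show "(LINT x|lborel. w x * g x) \<le> 1 * (1 + d) * (Lp_norm p w + d) * (Lp_norm q g + d)"
      by (simp add: a_def b_def mult.assoc)
  qed
  thus ?thesis by (simp add: q_def)
qed

text \<open>The standard bump on the ball of radius \<open>R\<close>; the factor exp 1 normalises
  its value at the origin to 1, so that the cutoffs tend to 1 pointwise as \<open>R\<close>
  grows.\<close>

definition cutoff :: "real \<Rightarrow> 'a::euclidean_space \<Rightarrow> real" where
  "cutoff R x = exp 1 * flat_exp 0 (1 - (x \<bullet> x) / R\<^sup>2)"

lemma cutoff:
  fixes x :: "'a::euclidean_space"
  assumes R: "0 < R"
  shows "test_function (cutoff R :: 'a \<Rightarrow> real)" "0 \<le> cutoff R x" "cutoff R x \<le> 1" "R \<le> norm x \<Longrightarrow> cutoff R x = 0"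
    "cutoff R (0 :: 'a) = 1"
proof -
  show 0: "cutoff R x = 0" if "R \<le> norm x" for x :: 'a
  proof -
    have "R\<^sup>2 \<le> x \<bullet> x" using power_mono[OF that, of 2] R by (simp add: power2_norm_eq_inner)
    thus ?thesis using R by (simp add: cutoff_def flat_exp_def)
  qed
  have poly: "C_diff m (\<lambda>x::'a. 1 - (x \<bullet> x) / R\<^sup>2)" for m
  proof -
    have "real_polynomial_function (\<lambda>x::'a. 1 - (1 / R\<^sup>2) * (\<Sum>b\<in>Basis. (x \<bullet> b) * (x \<bullet> b)))"
      by (intro real_polynomial_function_diff real_polynomial_function.intros real_polynomial_function_sum
          bounded_linear_inner_left finite_Basis)
    thus ?thesis using C_diff_polynomial by (simp add: euclidean_inner[symmetric])
  qed
  have "C_diff m (cutoff R :: 'a \<Rightarrow> real)" for m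
    unfolding cutoff_def[abs_def] by (intro C_diff_mult C_diff_const C_diff_flat_exp poly)
  moreover have "bounded {x :: 'a. cutoff R x \<noteq> 0}"
    using 0 by (intro boundedI[of _ R]) (force simp: not_le[symmetric])
  ultimately show "test_function (cutoff R :: 'a \<Rightarrow> real)" by (simp add: test_function_def compact_closure)
  show "0 \<le> cutoff R x" by (simp add: cutoff_def flat_exp_def)
  show "cutoff R x \<le> 1"
  proof (cases "0 < 1 - (x \<bullet> x) / R\<^sup>2")
    case True
    have "1 \<le> inverse (1 - (x \<bullet> x) / R\<^sup>2)" using True R by (simp add: one_le_inverse_iff)
    thus ?thesis using True by (simp add: cutoff_def flat_exp_def flip: exp_add)
  qed (simp add: cutoff_def flat_exp_def)
  show "cutoff R (0 :: 'a) = 1" by (simp add: cutoff_def flat_exp_def flip: exp_add)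
qed

lemma cutoff_tendsto: "(\<lambda>k. cutoff (real (Suc k)) x) \<longlonglongrightarrow> 1"
proof -
  have "(\<lambda>k. (x \<bullet> x) * (inverse (real (Suc k)) * inverse (real (Suc k)))) \<longlonglongrightarrow> (x \<bullet> x) * (0 * 0)"
    by (intro tendsto_intros LIMSEQ_inverse_real_of_nat)
  hence "(\<lambda>k. 1 - (x \<bullet> x) / (real (Suc k))\<^sup>2) \<longlonglongrightarrow> 1 - 0"
    by (intro tendsto_intros) (simp add: power2_eq_square divide_inverse)
  moreover have "isCont (flat_exp 0) 1" using DERIV_flat_exp DERIV_isCont by blast
  ultimately have "(\<lambda>k. flat_exp 0 (1 - (x \<bullet> x) / (real (Suc k))\<^sup>2)) \<longlonglongrightarrow> flat_exp 0 1"
    by (intro isCont_tendsto_compose[of _ "flat_exp 0"]) simp_all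
  hence "(\<lambda>k. exp 1 * flat_exp 0 (1 - (x \<bullet> x) / (real (Suc k))\<^sup>2)) \<longlonglongrightarrow> exp 1 * flat_exp 0 1"
    by (intro tendsto_intros)
  thus ?thesis by (simp add: cutoff_def flat_exp_def flip: exp_add)
qed

text \<open>The extremal function for the pairing is the signed power of \<open>w\<close>, which is
  continuous but in general not smooth. It is approximated uniformly on the ball by polynomials,
  which become test functions after multiplication by the cutoff. As \<open>w\<close> is not yet
  known to lie in Lp, the cutoff also keeps the integral \<open>I\<close> finite, so that the
  resulting I \<le> A I^(1/q) can be divided by I^(1/q).\<close>

lemma cutoff_Lp_bound:
  fixes w :: "'a::euclidean_space \<Rightarrow> real"
  assumes p: "1 < p" and w: "continuous_on UNIV w" and A0: "0 \<le> A" and R: "0 < R"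
    and A: "\<And>g. test_function g \<Longrightarrow> (LINT x|lborel. w x * g x) \<le> A * Lp_norm (p / (p - 1)) g"
  shows "(LINT x|lborel. cutoff R x * \<bar>w x\<bar> powr p) \<le> A powr p"
proof -
  define q where "q = p / (p - 1)"
  have q: "1 < q" "(p - 1) * q = p" "1 - 1 / q = 1 / p" using p by (auto simp: q_def field_simps)
  \<comment> \<open>The signed power: w v = |w|^p and |v|^q = |w|^p, the equality case of Hoelder's
    inequality.\<close>
  define v where "v x = max (w x) 0 powr (p - 1) - max (- w x) 0 powr (p - 1)" for x
  have vc: "continuous_on UNIV v"
    unfolding v_def using p by (intro continuous_intros continuous_on_powr' w) auto
  have wv: "w x * v x = \<bar>w x\<bar> powr p" for x
    using p powr_add[of "\<bar>w x\<bar>" 1 "p - 1"] by (auto simp: v_def max_def abs_if)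
  have vq: "\<bar>v x\<bar> powr q = \<bar>w x\<bar> powr p" for x
    using p by (auto simp: v_def max_def abs_if powr_powr q(2))
  define K where "K = cball (0::'a) R"
  define \<eta> where "\<eta> = (cutoff R :: 'a \<Rightarrow> real)"
  note eta = cutoff(1)[OF R, where 'a='a, folded \<eta>_def] cutoff(2-4)[OF R, where 'a='a, folded \<eta>_def]
  note ec = test_function_ccs[OF eta(1)]
  have etac: "continuous_on UNIV \<eta>" using ec by (simp add: ccs_def)
  have etaK: "\<eta> x = 0" if "x \<notin> K" for x using eta(4)[of x] that by (simp add: K_def)
  have "\<exists>s. real_polynomial_function s \<and> (\<forall>x\<in>K. \<bar>v x - s x\<bar> < inverse (real (Suc k)))" for k
  proof -
    have "compact K" "continuous_on K v" "0 < inverse (real (Suc k))"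
      using vc by (auto simp: K_def intro: continuous_on_subset)
    from Stone_Weierstrass_real_polynomial_function[OF this] show ?thesis by metis
  qed
  then obtain s where s: "\<And>k. real_polynomial_function (s k)" "\<And>k x. x \<in> K \<Longrightarrow> \<bar>v x - s k x\<bar> < inverse (real (Suc k))" by metis
  define g where "g k x = \<eta> x * s k x" for k x
  have tg: "test_function (g k)" for k
    unfolding g_def using test_function_mult_left[OF C_diff_polynomial[OF s(1)] eta(1)] by (simp add: mult.commute)
  have gl: "(\<lambda>k. g k x) \<longlonglongrightarrow> \<eta> x * v x" for x
  proof (cases "x \<in> K")
    case True
    have "(\<lambda>k. v x - s k x) \<longlonglongrightarrow> 0"
      by (rule Lim_null_comparison[OF _ LIMSEQ_inverse_real_of_nat]) (use s(2)[OF True] in \<open>auto intro!: always_eventually less_imp_le\<close>)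
    hence "(\<lambda>k. v x - (v x - s k x)) \<longlonglongrightarrow> v x - 0" by (intro tendsto_intros)
    thus ?thesis unfolding g_def by (intro tendsto_intros) simp
  qed (simp add: g_def etaK)
  have gb: "\<bar>g k x\<bar> \<le> \<eta> x * (\<bar>v x\<bar> + 1)" for k x
  proof (cases "x \<in> K")
    case True
    have "inverse (real (Suc k)) \<le> 1" by (simp add: inverse_le_1_iff)
    hence "\<bar>s k x\<bar> \<le> \<bar>v x\<bar> + 1" using s(2)[OF True, of k] by linarith
    thus ?thesis unfolding g_def abs_mult using eta(2)[of x] by (simp add: mult_left_mono)
  qed (simp add: g_def etaK)
  have [measurable]: "w \<in> borel_measurable borel" "v \<in> borel_measurable borel" "\<eta> \<in> borel_measurable borel" "g k \<in> borel_measurable borel" for k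
    using w vc ccs_measurable[OF ec] ccs_measurable[OF test_function_ccs[OF tg]] by (auto intro: borel_measurable_continuous_onI)
  have cdom: "ccs (\<lambda>x. \<eta> x * (\<bar>v x\<bar> + 1))" by (intro ccs_mult ec continuous_intros vc)
  have "(\<lambda>k. LINT x|lborel. w x * g k x) \<longlonglongrightarrow> (LINT x|lborel. w x * (\<eta> x * v x))"
  proof (rule integral_dominated_convergence[where w = "\<lambda>x. \<eta> x * (\<bar>v x\<bar> + 1) * \<bar>w x\<bar>"])
    show "integrable lborel (\<lambda>x. \<eta> x * (\<bar>v x\<bar> + 1) * \<bar>w x\<bar>)"
      by (intro ccs_mult_integrable cdom continuous_intros w)
    show "AE x in lborel. (\<lambda>k. w x * g k x) \<longlonglongrightarrow> w x * (\<eta> x * v x)"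
      by (intro AE_I2 tendsto_intros gl)
    show "AE x in lborel. norm (w x * g k x) \<le> \<eta> x * (\<bar>v x\<bar> + 1) * \<bar>w x\<bar>" for k
      using gb[of k] by (auto simp: abs_mult mult.commute intro!: AE_I2 mult_left_mono)
  qed measurable
  moreover have "(\<lambda>k. LINT x|lborel. \<bar>g k x\<bar> powr q) \<longlonglongrightarrow> (LINT x|lborel. \<bar>\<eta> x * v x\<bar> powr q)"
  proof (rule integral_dominated_convergence[where w = "\<lambda>x. \<bar>\<eta> x * (\<bar>v x\<bar> + 1)\<bar> powr q"])
    show "integrable lborel (\<lambda>x. \<bar>\<eta> x * (\<bar>v x\<bar> + 1)\<bar> powr q)"
      by (intro ccs_integrable ccs_abs_powr cdom) (use q in simp)
    show "AE x in lborel. (\<lambda>k. \<bar>g k x\<bar> powr q) \<longlonglongrightarrow> \<bar>\<eta> x * v x\<bar> powr q"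
      using q by (intro AE_I2 tendsto_powr' tendsto_rabs gl tendsto_const) auto
    show "AE x in lborel. norm (\<bar>g k x\<bar> powr q) \<le> \<bar>\<eta> x * (\<bar>v x\<bar> + 1)\<bar> powr q" for k
      using q by (auto intro!: AE_I2 powr_mono2 order_trans[OF gb abs_ge_self])
  qed measurable
  hence "(\<lambda>k. A * Lp_norm q (g k)) \<longlonglongrightarrow> A * (LINT x|lborel. \<bar>\<eta> x * v x\<bar> powr q) powr (1 / q)"
    unfolding Lp_norm_def using q by (intro tendsto_intros tendsto_powr') (auto intro: integral_nonneg_AE)
  ultimately have "(LINT x|lborel. w x * (\<eta> x * v x)) \<le> A * (LINT x|lborel. \<bar>\<eta> x * v x\<bar> powr q) powr (1 / q)"
    by (rule LIMSEQ_le) (use A[OF tg] in \<open>auto simp: q_def\<close>)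
  moreover define I where "I = (LINT x|lborel. \<eta> x * \<bar>w x\<bar> powr p)"
  have iI: "integrable lborel (\<lambda>x. \<eta> x * \<bar>w x\<bar> powr p)"
    using p by (intro ccs_mult_integrable ec continuous_intros continuous_on_powr' w) auto
  have "(LINT x|lborel. w x * (\<eta> x * v x)) = I"
    unfolding I_def wv[symmetric] by (simp add: mult_ac)
  moreover have "(LINT x|lborel. \<bar>\<eta> x * v x\<bar> powr q) \<le> I"
    unfolding I_def
  proof (rule integral_mono)
    show "integrable lborel (\<lambda>x. \<bar>\<eta> x * v x\<bar> powr q)"
      by (intro ccs_integrable ccs_abs_powr ccs_mult ec vc) (use q in simp)
    fix x
    \<comment> \<open>From 0 \<le> \<eta> \<le> 1 and q > 1; this lets the same integral
      \<open>I\<close> appear on both sides.\<close>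
    have "\<eta> x powr q \<le> \<eta> x"
      using eta(2,3)[of x] q powr_mono'[of 1 q "\<eta> x"] by simp
    hence "\<eta> x powr q * \<bar>v x\<bar> powr q \<le> \<eta> x * \<bar>v x\<bar> powr q" by (rule mult_right_mono) simp
    thus "\<bar>\<eta> x * v x\<bar> powr q \<le> \<eta> x * \<bar>w x\<bar> powr p"
      using eta(2)[of x] by (simp add: abs_mult powr_mult vq)
  qed (rule iI)
  hence "(LINT x|lborel. \<bar>\<eta> x * v x\<bar> powr q) powr (1 / q) \<le> I powr (1 / q)"
    using q by (intro powr_mono2) (auto intro: integral_nonneg_AE)
  ultimately have IA: "I \<le> A * I powr (1 / q)" using A0 by (meson mult_left_mono order_trans)
  have I0: "0 \<le> I" unfolding I_def using eta(2) by (intro integral_nonneg_AE AE_I2) auto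
  have "I \<le> A powr p"
  \<comment> \<open>For \<open>I\<close> > 0 the identity 1/p + 1/q = 1 allows cancelling I^(1/q),
    leaving I^(1/p) \<le> A.\<close>
  proof (cases "I = 0")
    case False
    hence Ip: "0 < I" using I0 by simp
    have "I powr (1 / p) * I powr (1 / q) = I"
      using Ip q(3) by (simp add: powr_add[symmetric]) (simp add: q(3)[symmetric])
    hence "I powr (1 / p) * I powr (1 / q) \<le> A * I powr (1 / q)" using IA by simp
    hence "I powr (1 / p) \<le> A" using Ip by simp
    hence "(I powr (1 / p)) powr p \<le> A powr p" using p by (intro powr_mono2) auto
    thus ?thesis using Ip p by (simp add: powr_powr)
  qed simp
  thus ?thesis by (simp add: I_def \<eta>_def)
qed

text \<open>The bound for cutoffs is uniform in the radius, so Fatou's lemma passes it to the full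
  integral. Membership in Lp has to come out as well, since \<open>Lp_norm\<close> of a function
  with divergent integral would be 0 and the norm bound empty.\<close>

lemma Lp_duality:
  fixes w :: "'a::euclidean_space \<Rightarrow> real"
  assumes p: "1 < p" and w: "continuous_on UNIV w"
    and A: "\<And>g. test_function g \<Longrightarrow> (LINT x|lborel. w x * g x) \<le> A * Lp_norm (p / (p - 1)) g"
  shows "in_Lp p w" "Lp_norm p w \<le> A"
proof -
  define q where "q = p / (p - 1)"
  have q: "0 < q" using p by (simp add: q_def)
  have [measurable]: "w \<in> borel_measurable borel" using w by (simp add: borel_measurable_continuous_onI)
  \<comment> \<open>Testing with a bump and with its negative bounds the modulus of one and the same
    pairing by \<open>A\<close> times a positive norm, which forces the sign of
    \<open>A\<close>.\<close>
  have A0: "0 \<le> A"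
  proof -
    define b where "b = (cutoff 1 :: 'a \<Rightarrow> real)"
    have t: "test_function b" "test_function (\<lambda>x. (-1) * b x)"
      unfolding b_def by (intro test_function_cmult cutoff zero_less_one)+
    have "0 < (LINT x|lborel. \<bar>b x\<bar> powr q)"
      by (rule ccs_integral_pos[OF ccs_abs_powr[OF test_function_ccs[OF t(1)] q], of 0]) (simp_all add: b_def cutoff)
    hence n: "0 < Lp_norm q b" by (simp add: Lp_norm_def)
    have "(LINT x|lborel. w x * b x) \<le> A * Lp_norm q b" using A[OF t(1)] by (simp add: q_def)
    moreover have "- (LINT x|lborel. w x * b x) \<le> A * Lp_norm q b"
      using A[OF t(2)] by (simp add: q_def Lp_norm_def)
    ultimately have "0 \<le> A * Lp_norm q b" by linarith
    thus ?thesis using n by (simp add: zero_le_mult_iff)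
  qed
  have iI: "integrable lborel (\<lambda>x. cutoff (real (Suc k)) x * \<bar>w x\<bar> powr p)" for k
    using p by (intro ccs_mult_integrable test_function_ccs cutoff continuous_intros continuous_on_powr' w) auto
  \<comment> \<open>Nonnegative integrals in the extended reals, because finiteness is part of what
    is being proved at this point.\<close>
  have nn: "(\<integral>\<^sup>+x. ennreal (\<bar>w x\<bar> powr p) \<partial>lborel) \<le> ennreal (A powr p)"
  proof -
    have "(\<integral>\<^sup>+x. ennreal (\<bar>w x\<bar> powr p) \<partial>lborel)
       = (\<integral>\<^sup>+x. liminf (\<lambda>k. ennreal (cutoff (real (Suc k)) x * \<bar>w x\<bar> powr p)) \<partial>lborel)"
    proof (rule nn_integral_cong)
      fix x
      have "(\<lambda>k. cutoff (real (Suc k)) x * \<bar>w x\<bar> powr p) \<longlonglongrightarrow> 1 * \<bar>w x\<bar> powr p"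
        by (intro tendsto_intros cutoff_tendsto)
      hence "(\<lambda>k. ennreal (cutoff (real (Suc k)) x * \<bar>w x\<bar> powr p)) \<longlonglongrightarrow> ennreal (\<bar>w x\<bar> powr p)"
        by (intro tendsto_ennrealI) simp
      thus "ennreal (\<bar>w x\<bar> powr p) = liminf (\<lambda>k. ennreal (cutoff (real (Suc k)) x * \<bar>w x\<bar> powr p))"
        by (intro lim_imp_Liminf[symmetric]) auto
    qed
    also have "\<dots> \<le> liminf (\<lambda>k. \<integral>\<^sup>+x. ennreal (cutoff (real (Suc k)) x * \<bar>w x\<bar> powr p) \<partial>lborel)"
      using iI by (intro nn_integral_liminf) auto
    also have "\<dots> \<le> liminf (\<lambda>k::nat. ennreal (A powr p))"
    proof (intro Liminf_mono always_eventually allI)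
      fix k
      have "(\<integral>\<^sup>+x. ennreal (cutoff (real (Suc k)) x * \<bar>w x\<bar> powr p) \<partial>lborel) = ennreal (LINT x|lborel. cutoff (real (Suc k)) x * \<bar>w x\<bar> powr p)"
        by (rule nn_integral_eq_integral[OF iI]) (simp add: cutoff)
      also have "\<dots> \<le> ennreal (A powr p)"
        by (intro ennreal_leI cutoff_Lp_bound[OF p w A0 _ A]) auto
      finally show "(\<integral>\<^sup>+x. ennreal (cutoff (real (Suc k)) x * \<bar>w x\<bar> powr p) \<partial>lborel) \<le> ennreal (A powr p)" .
    qed
    also have "\<dots> = ennreal (A powr p)" by (simp add: Liminf_const)
    finally show ?thesis .
  qed
  have int: "integrable lborel (\<lambda>x. \<bar>w x\<bar> powr p)"
    by (rule integrableI_nonneg) (use nn in \<open>auto intro: le_less_trans\<close>)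
  thus "in_Lp p w" by (simp add: in_Lp_def)
  have "ennreal (LINT x|lborel. \<bar>w x\<bar> powr p) \<le> ennreal (A powr p)"
    using nn nn_integral_eq_integral[OF int] by simp
  hence "(LINT x|lborel. \<bar>w x\<bar> powr p) \<le> A powr p" by simp
  hence "Lp_norm p w \<le> (A powr p) powr (1 / p)"
    unfolding Lp_norm_def using p by (intro powr_mono2) (auto intro: integral_nonneg_AE)
  thus "Lp_norm p w \<le> A" using A0 p by (simp add: powr_powr)
qed

text \<open>Self-adjointness of the half-Laplacian for the pair \<phi> f and g moves the operator
  from g onto \<phi> f, and the remaining terms are those of the commutator.\<close>

lemma commutator_pairing:
  fixes f g \<phi> :: "'a::euclidean_space \<Rightarrow> real"
  assumes t: "test_function f" "test_function g" "test_function \<phi>"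
  shows "(LINT x|lborel. (f x * half_laplacian g x - half_laplacian f x * g x) * \<phi> x)
    = (LINT x|lborel. half_laplacian_commutator \<phi> f x * g x)"
proof -
  have tf: "test_function (\<lambda>x. \<phi> x * f x)" by (intro test_function_mult t)
  note c = test_function_ccs[OF t(1)] test_function_ccs[OF t(2)] test_function_ccs[OF t(3)] test_function_ccs[OF tf]
  have c0: "continuous_on UNIV f" "continuous_on UNIV \<phi>" using c by (auto simp: ccs_def)
  note hc = half_laplacian_continuous[OF t(1)] half_laplacian_continuous[OF t(2)] half_laplacian_continuous[OF tf]
  have i1: "integrable lborel (\<lambda>x. half_laplacian (\<lambda>x. \<phi> x * f x) x * g x)"
    using ccs_mult_integrable[OF c(2) hc(3)] by (simp add: mult.commute)
  have i2: "integrable lborel (\<lambda>x. half_laplacian f x * g x * \<phi> x)"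
    using ccs_mult_integrable[OF c(2) continuous_on_mult[OF hc(1) c0(2)]] by (simp add: mult_ac)
  have i3: "integrable lborel (\<lambda>x. (\<phi> x * f x) * half_laplacian g x)"
    by (rule ccs_mult_integrable[OF c(4) hc(2)])
  have "(LINT x|lborel. (f x * half_laplacian g x - half_laplacian f x * g x) * \<phi> x)
     = (LINT x|lborel. (\<phi> x * f x) * half_laplacian g x - half_laplacian f x * g x * \<phi> x)"
    by (intro Bochner_Integration.integral_cong refl) (simp add: algebra_simps)
  also have "\<dots> = (LINT x|lborel. (\<phi> x * f x) * half_laplacian g x) - (LINT x|lborel. half_laplacian f x * g x * \<phi> x)"
    by (rule Bochner_Integration.integral_diff[OF i3 i2])
  also have "(LINT x|lborel. (\<phi> x * f x) * half_laplacian g x) = (LINT x|lborel. half_laplacian (\<lambda>x. \<phi> x * f x) x * g x)"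
    by (rule half_laplacian_selfadjoint[OF tf t(2), symmetric])
  also have "\<dots> - (LINT x|lborel. half_laplacian f x * g x * \<phi> x)
     = (LINT x|lborel. half_laplacian (\<lambda>x. \<phi> x * f x) x * g x - half_laplacian f x * g x * \<phi> x)"
    by (rule Bochner_Integration.integral_diff[OF i1 i2, symmetric])
  also have "\<dots> = (LINT x|lborel. half_laplacian_commutator \<phi> f x * g x)"
    by (intro Bochner_Integration.integral_cong refl) (simp add: half_laplacian_commutator_def algebra_simps)
  finally show ?thesis .
qed

lemma commutator_continuous:
  fixes f \<phi> :: "'a::euclidean_space \<Rightarrow> real"
  assumes t: "test_function f" "test_function \<phi>"
  shows "continuous_on UNIV (half_laplacian_commutator \<phi> f)"
  unfolding half_laplacian_commutator_def[abs_def]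
  by (intro continuous_intros half_laplacian_continuous test_function_mult t test_functionD(2))

theorem theorem5:
  fixes p :: real
  assumes "1 < p"
  shows "(\<exists>C. \<forall>f \<phi> :: 'a::euclidean_space \<Rightarrow> real. test_function f \<longrightarrow> test_function \<phi> \<longrightarrow>
            in_Lp p (half_laplacian_commutator \<phi> f) \<and>
            Lp_norm p (half_laplacian_commutator \<phi> f) \<le> C * lipschitz_seminorm \<phi> * Lp_norm p f)
       \<and> (\<forall>C. (\<forall>f \<phi> :: 'a \<Rightarrow> real. test_function f \<longrightarrow> test_function \<phi> \<longrightarrow>
            in_Lp p (half_laplacian_commutator \<phi> f) \<and>
            Lp_norm p (half_laplacian_commutator \<phi> f) \<le> C * lipschitz_seminorm \<phi> * Lp_norm p f)
         \<longleftrightarrow>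
         (\<forall>f g \<phi> :: 'a \<Rightarrow> real. test_function f \<longrightarrow> test_function g \<longrightarrow> test_function \<phi> \<longrightarrow>
            (LINT x|lborel. (f x * half_laplacian g x - half_laplacian f x * g x) * \<phi> x)
              \<le> C * lipschitz_seminorm \<phi> * Lp_norm p f * Lp_norm (p / (p - 1)) g))"
    (is "(\<exists>C. ?norm C) \<and> (\<forall>C. ?norm C \<longleftrightarrow> ?form C)")
proof -
  \<comment> \<open>The same constant works in both directions: Hoelder's inequality, for which the
    \<open>in_Lp\<close> clause is needed, leads from the norm bound to the form, and
    \<open>Lp_duality\<close> leads back with A = C times the seminorm of \<phi> times the norm of
    f. A constant for the form then serves for both.\<close>
  have iff: "?norm C \<longleftrightarrow> ?form C" for C
  proof
    assume N: "?norm C"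
    show "?form C"
    proof (intro allI impI)
      fix f g \<phi> :: "'a \<Rightarrow> real" assume t: "test_function f" "test_function g" "test_function \<phi>"
      have q: "0 < p / (p - 1)" using assms by simp
      have g: "in_Lp (p / (p - 1)) g"
        using ccs_integrable[OF ccs_abs_powr[OF test_function_ccs[OF t(2)] q]] ccs_measurable[OF test_function_ccs[OF t(2)]]
        by (simp add: in_Lp_def)
      have "(LINT x|lborel. half_laplacian_commutator \<phi> f x * g x)
         \<le> Lp_norm p (half_laplacian_commutator \<phi> f) * Lp_norm (p / (p - 1)) g"
        using N t by (intro Holder_inequality_Lp[OF assms _ g]) blast
      also have "\<dots> \<le> C * lipschitz_seminorm \<phi> * Lp_norm p f * Lp_norm (p / (p - 1)) g"
        using N t by (intro mult_right_mono Lp_norm_nonneg) blast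
      finally show "(LINT x|lborel. (f x * half_laplacian g x - half_laplacian f x * g x) * \<phi> x)
              \<le> C * lipschitz_seminorm \<phi> * Lp_norm p f * Lp_norm (p / (p - 1)) g"
        unfolding commutator_pairing[OF t] .
    qed
  next
    assume F: "?form C"
    show "?norm C"
    proof (intro allI impI)
      fix f \<phi> :: "'a \<Rightarrow> real" assume t: "test_function f" "test_function \<phi>"
      have "(LINT x|lborel. half_laplacian_commutator \<phi> f x * g x) \<le> C * lipschitz_seminorm \<phi> * Lp_norm p f * Lp_norm (p / (p - 1)) g"
        if g: "test_function g" for g
        using F[rule_format, OF t(1) g t(2)] unfolding commutator_pairing[OF t(1) g t(2)] .
      from Lp_duality[OF assms commutator_continuous[OF t] this]
      show "in_Lp p (half_laplacian_commutator \<phi> f) \<and>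
            Lp_norm p (half_laplacian_commutator \<phi> f) \<le> C * lipschitz_seminorm \<phi> * Lp_norm p f" by blast
    qed
  qed
  with form_bound[OF assms, where 'a='a] show ?thesis by blast
qed

end
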